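(* Let $\Gamma$ be the union of all iso-surfaces (i.e. of all iso-elements) computed from a set $\mathcal{G}=\{G_1,\ldots,G_N\}$ of labeled cuboid graphs on a cuboid partition, as described in the context, and for an iso-element $Z\subset\Gamma$ let $\Gamma(Z)$ be the component of $\Gamma$ with respect to $Z$, consisting of $Z$ and of all iso-elements of $\Gamma$ which are disperse connected to $Z$. Then an iso-surface component is connected. Furthermore, for any two distinct iso-elements $Z_1$ and $Z_2$ of $\Gamma$ it holds that either $\Gamma(Z_1)=\Gamma(Z_2)$ or $\Gamma(Z_1)\cap\Gamma(Z_2)=\emptyset$ in the sense of the convention of iso-elements disjointness. Consequently, the components of $\Gamma$ are uniquely determined.
   Context: **Labeled cuboid graphs.** A cuboid is $C=[a_1,b_1]\times[a_2,b_2]\times[a_3,b_3]\subset\mathbb{R}^3$. A labeled cuboid graph $G(V,E,\mathcal{F})$ consists of the 8 vertices $V$ and 12 edges $E$ of a cuboid (the cuboid of $G$) and $\mathcal{F}:V\to[0,1]$. Two nodes are incident if they are the end points of an edge. Fix an iso-level $c\in(0,1)$. A node $P$ is disperse if $\mathcal{F}(P)>c$ and continuous if $\mathcal{F}(P)\le c$; $D(G)$ is the number of disperse nodes. $G$ (or a face, or an edge) is disperse (continuous) if all its nodes are. On an edge with end points $x_0,x_1$ such that $\mathcal{F}(x_0)\le c<\mathcal{F}(x_1)$, the iso-point is the point $x_0+(x_1-x_0)\frac{c-\mathcal{F}(x_0)}{\mathcal{F}(x_1)-\mathcal{F}(x_0)}$; these are all iso-points of $G$. An iso-node is a node that is an iso-point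 (label $c$ and incident to a disperse node). An L-face is a face with two disperse and two continuous nodes, the disperse ones not incident; it is trivial if both its continuous nodes are iso-nodes, otherwise non-trivial. $L(G)$ is the set of L-faces. A singular face has three disperse nodes and one iso-node. A regular face is one that is not an L-face, disperse, continuous or singular. Two faces of a cuboid are parallel if they have no common node. Two graphs are face-neighbors if the intersection of their cuboids is a face of both. **Singular / isolated iso-paths; regular graphs.** A $T_1$-subgraph of $G$: a node with label $c$ together with its three incident nodes, all disperse. A $T_2$-subgraph: a subgraph with seven nodes, two of which are incident and have label $c$ while the other five are disperse. $G$ is an $F_1$-graph if there is $\tilde V\subset V$, $|\tilde V|=4$, with each $P\in\tilde V$ incident to exactly two nodes of $V\setminus\tilde V$, $\mathcal{F}=c$ on $\tilde V$ and $\mathcal{F}>c$ on $V\setminus\tilde V$. $G_1$ is an $F_2$-graph if it has a face-neighbor $G_2$ such that all four common nodes have label $c$ (in both) and all other nodes of $G_1$ and of $G_2$ are disperse. $G$ is singular iso-path free if it has no $T_1$- or $T_2$-subgraph, and isolated iso-path free if it is not an $F_1$- or $F_2$-graph. $G$ is regular if it is neither disperse nor continuous, and is singular iso-path free and isolated iso-path free. **Partition and labeling.** $\Omega\subset\mathbb{R}^3$ is a polygonal domain, $\overline\Omega=\bigcup_{i=1}^N C_i$ a partition into cuboids (two cuboids share a face, or an edge, or a vertex, or are disjoint). $G_i$ is a labeled cuboid graph with cuboid $C_i$ and common iso-level $c\in(0,1)$; all $G_i$ are singular iso-path free and isolated iso-path free. They arise from one labeling of the cuboid vertices by the removal step, performed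 separately in each cuboid: if the graph is not an $F_1$- or $F_2$-graph, the label-$c$ node of every $T_1$-subgraph, and then both label-$c$ nodes of a $T_2$-subgraph (if any), are relabeled $1$; if the graph is an $F_1$- or $F_2$-graph, its four label-$c$ nodes are relabeled $1$. The iso-surfaces are assumed not to touch $\partial\Omega$. **$S$-subgraphs.** $S_1$-subgraph: a disperse node and its three incident nodes, all continuous. $S_2$-subgraph: two incident disperse nodes and the four further nodes incident to them, all continuous. $S_3$-subgraph: a node with label $<c$ and its three incident nodes, all disperse. An $S_i$-rule at an $S_i$-subgraph $H$ records the closed polygon through the iso-points on the edges of $H$ (a triangle for $i=1,3$; for $i=2$ the quadrilateral through the four cyclically ordered iso-points, consecutive ones on a common face), and then relabels: for $i=1,2$ the disperse nodes of $H$ get label $0$; for $i=3$ the continuous node of $H$ gets label $1$. The $S_i^n$-rule is the successive application of the $S_i$-rule at $n$ distinct $S_i$-subgraphs. Table of $S^n$-rules for regular $G$ with $L(G)\ne\emptyset$: $D=2$: $S_1$. $D=3$: $S_1$ if $|L(G)|=1$, $S_1^2$ if $|L(G)|=3$. $D=4$: if $|L(G)|=2$, $S_1$ for non-parallel and $S_2$ for parallel L-faces; $S_1^3$ if $|L(G)|=6$. $D=5$: $S_3$ if $|L(G)|=1$, $S_1$ if $|L(G)|=3$. $D=6$: $S_3$. **Iso-paths and iso-elements.** $C$-rules: on each regular face join the two iso-points of the face. Inner iso-paths of a regular $G$: (1) if $L(G)\neq\emptyset$, apply the $S^n$-rule from the table, recording $n$ polygons; the resulting graph has one further iso-path, formed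 by the segments given by the $C$-rules; (2) if $L(G)=\emptyset$, $D(G)=2$ and $G$ has an $S_1$-subgraph (resp. $D(G)=6$ and $G$ has an $S_3$-subgraph), apply the $S_1$-rule (resp. $S_3$-rule) once and then the $C$-rules to the resulting graph; (3) otherwise the $C$-rules applied to $G$ give the iso-path. Non-regular graphs have no iso-path. Outer iso-path of $G$: a simple closed polygon with iso-points as vertices, lying on a single non-trivial L-face of $G$, which equals $\bigcup_k J_k\cap M$, where $M$ is the common face of the cuboids of $G$ and of its face-neighbor $G'$ at this L-face and $\{J_k\}$ are the inner iso-paths of $G$ and $G'$. An iso-path $[P_1,\ldots,P_n]$ is an inner or outer iso-path; its edges are iso-lines. The corresponding iso-element is the union of the filled triangles spanned by $P_c=\frac1n\sum P_i$ and the edges of the iso-path. **Connectedness.** An iso-path $\omega$ of $G$ with iso-lines $l_1,\ldots,l_n$ ($3\le n\le 6$) is called connected if every $l_i$ lies on an iso-path $\omega_i$ of $G_i$, where $G_1,\ldots,G_n$ are labeled cuboid graphs with the same iso-level $c$ and $\omega\ne\omega_i$ for all $i=1,\ldots,n$. An iso-surface (a surface obtained by joining iso-elements) is called connected if each of its iso-paths which does not have an edge that lies on the boundary of $\Omega$ is connected; that is, it has no holes except, possibly, at $\partial\Omega$. **System of graphs.** System of cuboids at an edge: for a cuboid $C_1$ and an edge $e$ of $C_1$, let $C_2,C_3,C_4$ be distinct cuboids such that $C_1,\ldots,C_4$ have the edge $e$ in common and, if $C_i\cap C_j\nsubseteq e$ for $i\ne j$, then $C_i$ and $C_j$ have a common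 face; then $C_1,\ldots,C_4$ are the system of cuboids with common edge $e$. System of cuboids of a cuboid $C$ with vertices $P_1,\ldots,P_8$ and edges $e_1,\ldots,e_{12}$: let $\mathcal{C}_i=\{C_{ij}: j=1,\ldots,4\}$ be the system of cuboids with respect to $e_i$, $i=1,\ldots,12$, where $C=C_{i1}$ for all $i$, and such that for all $x\in\{P_1,\ldots,P_8\}$ there exists a neighborhood $U\subset\mathbb{R}^3$ of $x$ with $U\subset\bigcup_{i=1}^{12}\bigcup_{j=1}^4 C_{ij}$ and any two distinct cuboids in the set $\{C_{ij}: i=1,\ldots,12,\ j=1,\ldots,4\}$ have a common edge or a common face. Then the $C_{ij}$ are the system of cuboids of $C$. If $G_{ij}$ are labeled cuboid graphs with cuboids $C_{ij}$ and common iso-level $c$, singular iso-path free and isolated iso-path free, with $G=G_{i1}$ for all $i$, then the $G_{ij}$ are the system of (labeled cuboid) graphs of $G$; their number is stated to be $19$. **Disperse connectedness.** Correspondence of nodes and iso-lines: the iso-line on a regular face corresponds to the disperse node or nodes of that face. On a non-trivial L-face, the iso-line joining the two iso-points on the face edges at a node $Q$ corresponds to $Q$, where $Q$ is a disperse node or a continuous node that is not an iso-node. A disperse node corresponds to an iso-line $l$ with respect to an iso-path $\omega$ if $l$ is an edge of $\omega$ and $l$ corresponds to that node (on a trivial L-face: the disperse node of the face that is disperse in the $S$-subgraph, or in the remaining graph, from which $\omega$ is obtained). A disperse path in the system of graphs of $G$ is a simple, non-closed path of the form $\bigcup_{m=1}^r l_m$ with $r\ge2$, each $l_m$ being a disperse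 edge of some graph in the system. Let $G$ be regular, $l$ an iso-line of $G$, $\omega_1$ an iso-path of $G$, and $\omega_2\ne\omega_1$ an iso-path in the system of graphs of $G$ with $l=\omega_1\cap\omega_2$. They are disperse connected with respect to the common edge $l$ if one of the following holds: (1) $\omega_1$ and $\omega_2$ are the only iso-paths in the system of graphs of $G$ such that $l=\omega_1\cap\omega_2$; (2) $\omega_1$ is an inner iso-path of $G$, $\omega_2$ is an inner iso-path of one labeled cuboid graph in the system, and either (a) at least one of the disperse nodes corresponding to $l$ is the same for $l$ with respect to $\omega_1$ and $\omega_2$, or (b) there exist two distinct disperse nodes $P_1$ and $P_2$ in the system such that $P_1$ is a node of $G$ (while $P_2$ need not be), $P_1$ and $P_2$ correspond to $l$ with respect to $\omega_1$ and $\omega_2$, respectively, and there exists a disperse path in the system which connects $P_1$ and $P_2$. Two distinct iso-elements $Z_1,Z_2$ in the system of graphs of $G$ are neighbored with respect to the iso-line $l=Z_1\cap Z_2$ of $G$ if their corresponding iso-paths are disperse connected with respect to $l$. Iso-elements $Z,\tilde Z$ of $\Gamma$ are disperse connected if there are $r\ge1$ and iso-elements $Z_0,\ldots,Z_r$ of $\Gamma$ with $Z_0=Z$, $Z_r=\tilde Z$ and all pairs $(Z_{i-1},Z_i)$, $i=1,\ldots,r$, neighbored with respect to their common iso-line. **Convention of iso-elements disjointness.** Let $Z_1,Z_2$ be two distinct iso-elements in the system of graphs of a regular $G$ which have an iso-line $l=Z_1\cap Z_2$ of $G$ in common but are not neighbored with respect to $l$. Then, concerning their connectivity, $Z_1$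 and $Z_2$ are considered as disjoint: given points $P_1\in Z_1$, $P_2\in Z_2$, one regards no path in $Z_1\cup Z_2$ as joining $P_1$ and $P_2$. Accordingly, that two different components have empty intersection means that the intersection contains no iso-element; it may contain discrete points or line segments.
   Formalization: In a T2-subgraph the eighth node must not be incident to the two label-c nodes; the system of graphs is all graphs sharing an edge with G (covering and pairwise-contact conditions dropped); l = ω1∩ω2 means l is a common edge; iso-paths of different graphs count as distinct. *)

theory Defs
  imports "HOL-Analysis.Analysis"
begin

section \<open>Labeled cuboid graphs\<close>

type_synonym point = "real ^ 3"

definition is_cuboid :: "point set \<Rightarrow> bool" where
  "is_cuboid C \<longleftrightarrow> (\<exists>a b. (\<forall>i. a $ i < b $ i) \<and> C = cbox a b)"

text \<open>The labels matter at the eight nodes of the cuboid only.\<close>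

record lcg =
  cuboid :: "point set"
  label :: "point \<Rightarrow> real"

definition nodes :: "point set \<Rightarrow> point set" where
  "nodes C = {P. P extreme_point_of C}"

definition incident :: "point set \<Rightarrow> point \<Rightarrow> point \<Rightarrow> bool" where
  "incident C P Q \<longleftrightarrow> closed_segment P Q edge_of C"

definition disperse :: "real \<Rightarrow> lcg \<Rightarrow> point \<Rightarrow> bool" where
  "disperse c G P \<longleftrightarrow> P \<in> nodes (cuboid G) \<and> label G P > c"

definition continuous_node :: "real \<Rightarrow> lcg \<Rightarrow> point \<Rightarrow> bool" where
  "continuous_node c G P \<longleftrightarrow> P \<in> nodes (cuboid G) \<and> label G P \<le> c"

definition disperse_nodes :: "real \<Rightarrow> lcg \<Rightarrow> point set" where
  "disperse_nodes c G = {P. disperse c G P}"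

definition num_disperse :: "real \<Rightarrow> lcg \<Rightarrow> nat" where
  "num_disperse c G = card (disperse_nodes c G)"

definition disperse_graph :: "real \<Rightarrow> lcg \<Rightarrow> bool" where
  "disperse_graph c G \<longleftrightarrow> (\<forall>P\<in>nodes (cuboid G). disperse c G P)"

definition continuous_graph :: "real \<Rightarrow> lcg \<Rightarrow> bool" where
  "continuous_graph c G \<longleftrightarrow> (\<forall>P\<in>nodes (cuboid G). continuous_node c G P)"

definition iso_node :: "real \<Rightarrow> lcg \<Rightarrow> point \<Rightarrow> bool" where
  "iso_node c G P \<longleftrightarrow> P \<in> nodes (cuboid G) \<and> label G P = c \<and>
     (\<exists>Q. incident (cuboid G) P Q \<and> disperse c G Q)"

definition iso_point :: "real \<Rightarrow> lcg \<Rightarrow> point \<Rightarrow> point \<Rightarrow> point" where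
  "iso_point c G x0 x1 =
     x0 + ((c - label G x0) / (label G x1 - label G x0)) *\<^sub>R (x1 - x0)"

definition iso_points :: "real \<Rightarrow> lcg \<Rightarrow> point set" where
  "iso_points c G = {iso_point c G x0 x1 | x0 x1.
     incident (cuboid G) x0 x1 \<and> continuous_node c G x0 \<and> disperse c G x1}"

definition face_iso_points :: "real \<Rightarrow> lcg \<Rightarrow> point set \<Rightarrow> point set" where
  "face_iso_points c G M = {iso_point c G x0 x1 | x0 x1. x0 \<in> M \<and> x1 \<in> M \<and>
     incident (cuboid G) x0 x1 \<and> continuous_node c G x0 \<and> disperse c G x1}"

definition L_faces :: "real \<Rightarrow> lcg \<Rightarrow> point set set" where
  "L_faces c G = {M. M facet_of cuboid G \<and>
     card {P\<in>M. disperse c G P} = 2 \<and> card {P\<in>M. continuous_node c G P} = 2 \<and>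
     (\<forall>P\<in>M. \<forall>Q\<in>M. disperse c G P \<and> disperse c G Q \<longrightarrow> \<not> incident (cuboid G) P Q)}"

definition trivial_L_face :: "real \<Rightarrow> lcg \<Rightarrow> point set \<Rightarrow> bool" where
  "trivial_L_face c G M \<longleftrightarrow> M \<in> L_faces c G \<and>
     (\<forall>P\<in>M. continuous_node c G P \<longrightarrow> iso_node c G P)"

definition nontrivial_L_face :: "real \<Rightarrow> lcg \<Rightarrow> point set \<Rightarrow> bool" where
  "nontrivial_L_face c G M \<longleftrightarrow> M \<in> L_faces c G \<and> \<not> trivial_L_face c G M"

definition singular_face :: "real \<Rightarrow> lcg \<Rightarrow> point set \<Rightarrow> bool" where
  "singular_face c G M \<longleftrightarrow> M facet_of cuboid G \<and>
     card {P\<in>M. disperse c G P} = 3 \<and> card {P\<in>M. iso_node c G P} = 1"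

definition regular_face :: "real \<Rightarrow> lcg \<Rightarrow> point set \<Rightarrow> bool" where
  "regular_face c G M \<longleftrightarrow> M facet_of cuboid G \<and> M \<notin> L_faces c G \<and>
     \<not> (\<forall>P\<in>M \<inter> nodes (cuboid G). disperse c G P) \<and>
     \<not> (\<forall>P\<in>M \<inter> nodes (cuboid G). continuous_node c G P) \<and>
     \<not> singular_face c G M"

definition parallel_faces :: "lcg \<Rightarrow> point set \<Rightarrow> point set \<Rightarrow> bool" where
  "parallel_faces G M M' \<longleftrightarrow> M \<inter> M' \<inter> nodes (cuboid G) = {}"

definition face_neighbors :: "lcg \<Rightarrow> lcg \<Rightarrow> bool" where
  "face_neighbors G G' \<longleftrightarrow>
     (cuboid G \<inter> cuboid G') facet_of cuboid G \<and> (cuboid G \<inter> cuboid G') facet_of cuboid G'"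


section \<open>Singular and isolated iso-paths, regular graphs\<close>

definition T1_node :: "real \<Rightarrow> lcg \<Rightarrow> point \<Rightarrow> bool" where
  "T1_node c G P \<longleftrightarrow> P \<in> nodes (cuboid G) \<and> label G P = c \<and>
     (\<forall>Q. incident (cuboid G) P Q \<longrightarrow> disperse c G Q)"

text \<open>
  \<open>P\<close>, \<open>Q\<close> are the two nodes with label \<open>c\<close> of a \<open>T\<^sub>2\<close>-subgraph with node set \<open>W\<close>. As for
  \<open>T\<^sub>1\<close>-subgraphs, the subgraph contains all nodes incident to its label-\<open>c\<close> nodes, so the
  eighth node is incident to neither \<open>P\<close> nor \<open>Q\<close> (otherwise relabeling \<open>P\<close> and \<open>Q\<close> would move
  iso-points on edges that are shared with other cuboids).
\<close>

definition T2_pair :: "real \<Rightarrow> lcg \<Rightarrow> point \<Rightarrow> point \<Rightarrow> bool" where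
  "T2_pair c G P Q \<longleftrightarrow> incident (cuboid G) P Q \<and> label G P = c \<and> label G Q = c \<and>
     (\<exists>W \<subseteq> nodes (cuboid G). card W = 7 \<and> P \<in> W \<and> Q \<in> W \<and>
        (\<forall>X. incident (cuboid G) P X \<or> incident (cuboid G) Q X \<longrightarrow> X \<in> W) \<and>
        (\<forall>X\<in>W - {P, Q}. disperse c G X))"

definition F1_graph :: "real \<Rightarrow> lcg \<Rightarrow> bool" where
  "F1_graph c G \<longleftrightarrow> (\<exists>V' \<subseteq> nodes (cuboid G). card V' = 4 \<and>
     (\<forall>P\<in>V'. card {Q \<in> nodes (cuboid G) - V'. incident (cuboid G) P Q} = 2) \<and>
     (\<forall>P\<in>V'. label G P = c) \<and> (\<forall>P\<in>nodes (cuboid G) - V'. label G P > c))"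

text \<open>The face-neighbor is taken from the given set \<open>\<G>\<close> of graphs.\<close>

definition F2_graph :: "real \<Rightarrow> lcg set \<Rightarrow> lcg \<Rightarrow> bool" where
  "F2_graph c \<G> G \<longleftrightarrow> (\<exists>G'\<in>\<G>. face_neighbors G G' \<and>
     (let K = nodes (cuboid G) \<inter> nodes (cuboid G') in
        (\<forall>P\<in>K. label G P = c \<and> label G' P = c) \<and>
        (\<forall>P\<in>nodes (cuboid G) - K. disperse c G P) \<and>
        (\<forall>P\<in>nodes (cuboid G') - K. disperse c G' P)))"

definition singular_free :: "real \<Rightarrow> lcg \<Rightarrow> bool" where
  "singular_free c G \<longleftrightarrow> (\<nexists>P. T1_node c G P) \<and> (\<nexists>P Q. T2_pair c G P Q)"

definition isolated_free :: "real \<Rightarrow> lcg set \<Rightarrow> lcg \<Rightarrow> bool" where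
  "isolated_free c \<G> G \<longleftrightarrow> \<not> F1_graph c G \<and> \<not> F2_graph c \<G> G"

definition regular_graph :: "real \<Rightarrow> lcg set \<Rightarrow> lcg \<Rightarrow> bool" where
  "regular_graph c \<G> G \<longleftrightarrow> \<not> disperse_graph c G \<and> \<not> continuous_graph c G \<and>
     singular_free c G \<and> isolated_free c \<G> G"


section \<open>Partition and removal step\<close>

definition polygonal_domain :: "point set \<Rightarrow> bool" where
  "polygonal_domain \<Omega> \<longleftrightarrow> open \<Omega> \<and> connected \<Omega> \<and> bounded \<Omega> \<and> \<Omega> \<noteq> {} \<and>
     (\<exists>\<P>. finite \<P> \<and> (\<forall>P\<in>\<P>. polytope P \<and> aff_dim P = 2) \<and> frontier \<Omega> = \<Union>\<P>)"

definition cuboid_partition :: "point set \<Rightarrow> nat \<Rightarrow> (nat \<Rightarrow> point set) \<Rightarrow> bool" where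
  "cuboid_partition \<Omega> N C \<longleftrightarrow>
     (\<forall>i\<in>{1..N}. is_cuboid (C i)) \<and> closure \<Omega> = (\<Union>i\<in>{1..N}. C i) \<and>
     (\<forall>i\<in>{1..N}. \<forall>j\<in>{1..N}. i \<noteq> j \<longrightarrow>
        C i \<inter> C j = {} \<or>
        (C i \<inter> C j) facet_of C i \<and> (C i \<inter> C j) facet_of C j \<or>
        (C i \<inter> C j) edge_of C i \<and> (C i \<inter> C j) edge_of C j \<or>
        (\<exists>P \<in> nodes (C i) \<inter> nodes (C j). C i \<inter> C j = {P}))"

text \<open>
  \<open>G'\<close> results from \<open>G \<in> \<G>\<close> by the removal step. If \<open>G\<close> is an \<open>F\<^sub>1\<close>- or \<open>F\<^sub>2\<close>-graph, its
  label-\<open>c\<close> nodes are exactly the four nodes to be relabeled.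
\<close>

definition removal_step :: "real \<Rightarrow> lcg set \<Rightarrow> lcg \<Rightarrow> lcg \<Rightarrow> bool" where
  "removal_step c \<G> G G' \<longleftrightarrow>
     (if F1_graph c G \<or> F2_graph c \<G> G
      then G' = G\<lparr>label := \<lambda>P. if P \<in> nodes (cuboid G) \<and> label G P = c then 1 else label G P\<rparr>
      else (let H = G\<lparr>label := \<lambda>P. if T1_node c G P then 1 else label G P\<rparr> in
        (if \<exists>P Q. T2_pair c H P Q
         then \<exists>P Q. T2_pair c H P Q \<and> G' = H\<lparr>label := (label H)(P := 1, Q := 1)\<rparr>
         else G' = H)))"


section \<open>Inner iso-paths\<close>

text \<open>
  An iso-line is represented by the set of its two end points, so that \<open>convex hull l\<close> is the
  segment itself; a closed polygon is represented by the set of its edges.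
\<close>

type_synonym iso_line = "point set"
type_synonym polygon = "iso_line set"

definition polygon_points :: "polygon \<Rightarrow> point set" where
  "polygon_points w = (\<Union>l\<in>w. convex hull l)"

text \<open>
  An \<open>S\<^sub>i\<close>-subgraph is given by the set \<open>A\<close> of those nodes which the \<open>S\<^sub>i\<close>-rule relabels; its nodes
  are those of \<open>A\<close> and the nodes incident to \<open>A\<close>.
\<close>

definition S_subgraph :: "real \<Rightarrow> nat \<Rightarrow> lcg \<Rightarrow> point set \<Rightarrow> bool" where
  "S_subgraph c i G A \<longleftrightarrow>
     i = 1 \<and> (\<exists>P. A = {P} \<and> disperse c G P \<and>
        (\<forall>Q. incident (cuboid G) P Q \<longrightarrow> continuous_node c G Q)) \<or>
     i = 2 \<and> (\<exists>P P'. A = {P, P'} \<and> incident (cuboid G) P P' \<and> disperse c G P \<and> disperse c G P' \<and>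
        (\<forall>Q. Q \<notin> A \<and> (incident (cuboid G) P Q \<or> incident (cuboid G) P' Q) \<longrightarrow>
             continuous_node c G Q)) \<or>
     i = 3 \<and> (\<exists>P. A = {P} \<and> P \<in> nodes (cuboid G) \<and> label G P < c \<and>
        (\<forall>Q. incident (cuboid G) P Q \<longrightarrow> disperse c G Q))"

definition S_iso_points :: "real \<Rightarrow> lcg \<Rightarrow> point set \<Rightarrow> point set" where
  "S_iso_points c G A = {iso_point c G x0 x1 | x0 x1. (x0 \<in> A \<or> x1 \<in> A) \<and>
     incident (cuboid G) x0 x1 \<and> continuous_node c G x0 \<and> disperse c G x1}"

text \<open>For \<open>i = 1, 3\<close> any two of the three iso-points lie on a common face of the cuboid.\<close>

definition S_polygon :: "real \<Rightarrow> lcg \<Rightarrow> point set \<Rightarrow> polygon" where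
  "S_polygon c G A = {{x, y} | x y. x \<noteq> y \<and> x \<in> S_iso_points c G A \<and> y \<in> S_iso_points c G A \<and>
     (\<exists>M. M facet_of cuboid G \<and> x \<in> M \<and> y \<in> M)}"

definition S_disperse :: "real \<Rightarrow> lcg \<Rightarrow> point set \<Rightarrow> point set" where
  "S_disperse c G A = {P. disperse c G P \<and> (P \<in> A \<or> (\<exists>Q\<in>A. incident (cuboid G) Q P))}"

definition S_relabel :: "nat \<Rightarrow> lcg \<Rightarrow> point set \<Rightarrow> lcg" where
  "S_relabel i G A = G\<lparr>label := \<lambda>P. if P \<in> A then (if i = 3 then 1 else 0) else label G P\<rparr>"

text \<open>
  \<open>S_rule c i n G R G'\<close>: the \<open>S\<^sub>i\<^sup>n\<close>-rule leads from \<open>G\<close> to \<open>G'\<close> and records \<open>R\<close>, which consists of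
  the polygons, each with the set of disperse nodes of the \<open>S\<^sub>i\<close>-subgraph it comes from. The
  subgraphs are distinct since the relabeled set is no longer an \<open>S\<^sub>i\<close>-subgraph.
\<close>

inductive S_rule ::
  "real \<Rightarrow> nat \<Rightarrow> nat \<Rightarrow> lcg \<Rightarrow> (polygon \<times> point set) set \<Rightarrow> lcg \<Rightarrow> bool" for c i where
  S_rule_0: "S_rule c i 0 G {} G"
| S_rule_Suc: "S_subgraph c i G A \<Longrightarrow> S_rule c i n (S_relabel i G A) R G' \<Longrightarrow>
    S_rule c i (Suc n) G (insert (S_polygon c G A, S_disperse c G A) R) G'"

definition S_table :: "real \<Rightarrow> lcg \<Rightarrow> nat \<Rightarrow> nat \<Rightarrow> bool" where
  "S_table c G i n \<longleftrightarrow> (let D = num_disperse c G; L = L_faces c G;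
      par = (\<exists>M\<in>L. \<exists>M'\<in>L. parallel_faces G M M') in
     D = 2 \<and> i = 1 \<and> n = 1 \<or>
     D = 3 \<and> card L = 1 \<and> i = 1 \<and> n = 1 \<or>
     D = 3 \<and> card L = 3 \<and> i = 1 \<and> n = 2 \<or>
     D = 4 \<and> card L = 2 \<and> \<not> par \<and> i = 1 \<and> n = 1 \<or>
     D = 4 \<and> card L = 2 \<and> par \<and> i = 2 \<and> n = 1 \<or>
     D = 4 \<and> card L = 6 \<and> i = 1 \<and> n = 3 \<or>
     D = 5 \<and> card L = 1 \<and> i = 3 \<and> n = 1 \<or>
     D = 5 \<and> card L = 3 \<and> i = 1 \<and> n = 1 \<or>
     D = 6 \<and> i = 3 \<and> n = 1)"

text \<open>The rule \<open>S\<^sub>i\<^sup>n\<close> to be applied to \<open>G\<close> before the \<open>C\<close>-rules; \<open>n = 0\<close> means no rule.\<close>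

definition applicable_rule :: "real \<Rightarrow> lcg \<Rightarrow> nat \<Rightarrow> nat \<Rightarrow> bool" where
  "applicable_rule c G i n \<longleftrightarrow>
     (if L_faces c G \<noteq> {} then S_table c G i n
      else if num_disperse c G = 2 \<and> (\<exists>A. S_subgraph c 1 G A) then i = 1 \<and> n = 1
      else if num_disperse c G = 6 \<and> (\<exists>A. S_subgraph c 3 G A) then i = 3 \<and> n = 1
      else n = 0)"

text \<open>On a regular face the set of iso-points consists of the end points of its iso-line.\<close>

definition C_polygon :: "real \<Rightarrow> lcg \<Rightarrow> polygon" where
  "C_polygon c G = {face_iso_points c G M | M. regular_face c G M}"

text \<open>
  \<open>K\<close> is the set of disperse nodes of the \<open>S\<close>-subgraph, or of the remaining graph, from which
  the inner iso-path \<open>w\<close> of \<open>G\<close> is obtained.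
\<close>

definition inner_iso_path_from ::
  "real \<Rightarrow> lcg set \<Rightarrow> lcg \<Rightarrow> polygon \<Rightarrow> point set \<Rightarrow> bool" where
  "inner_iso_path_from c \<G> G w K \<longleftrightarrow> regular_graph c \<G> G \<and>
     (\<exists>i n R G'. applicable_rule c G i n \<and> S_rule c i n G R G' \<and>
        ((w, K) \<in> R \<or> w = C_polygon c G' \<and> K = disperse_nodes c G'))"

definition inner_iso_path :: "real \<Rightarrow> lcg set \<Rightarrow> lcg \<Rightarrow> polygon \<Rightarrow> bool" where
  "inner_iso_path c \<G> G w \<longleftrightarrow> (\<exists>K. inner_iso_path_from c \<G> G w K)"


section \<open>Outer iso-paths, iso-paths and iso-elements\<close>

text \<open>The last conjunct says that the closed polygon does not intersect itself.\<close>

definition simple_closed_polygon :: "polygon \<Rightarrow> bool" where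
  "simple_closed_polygon w \<longleftrightarrow>
     (\<exists>ps. distinct ps \<and> length ps \<ge> 3 \<and>
        w = {{ps ! i, ps ! (Suc i mod length ps)} | i. i < length ps}) \<and>
     (\<forall>l\<in>w. \<forall>l'\<in>w. l \<noteq> l' \<longrightarrow> convex hull l \<inter> convex hull l' = l \<inter> l')"

definition outer_iso_path :: "real \<Rightarrow> lcg set \<Rightarrow> lcg \<Rightarrow> point set \<Rightarrow> polygon \<Rightarrow> bool" where
  "outer_iso_path c \<G> G M w \<longleftrightarrow> regular_graph c \<G> G \<and> nontrivial_L_face c G M \<and>
     simple_closed_polygon w \<and> \<Union>w \<subseteq> iso_points c G \<and>
     (\<exists>G'\<in>\<G>. face_neighbors G G' \<and> M = cuboid G \<inter> cuboid G' \<and>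
        polygon_points w =
          (\<Union>J\<in>{J. inner_iso_path c \<G> G J \<or> inner_iso_path c \<G> G' J}. polygon_points J) \<inter> M)"

text \<open>
  An iso-path is a polygon together with the cell which carries it: the cuboid for an inner
  iso-path, the L-face for an outer one. So inner iso-paths of different graphs are different
  iso-paths, even in the degenerate case of two face-neighbors having the same triangle in
  their common face as an iso-path; an outer iso-path on the common L-face of two
  face-neighbors is one and the same for both of them.
\<close>

type_synonym iso_path = "point set \<times> polygon"

definition inner_path_of :: "real \<Rightarrow> lcg set \<Rightarrow> lcg \<Rightarrow> iso_path \<Rightarrow> bool" where
  "inner_path_of c \<G> G p \<longleftrightarrow> fst p = cuboid G \<and> inner_iso_path c \<G> G (snd p)"

definition iso_path_of :: "real \<Rightarrow> lcg set \<Rightarrow> lcg \<Rightarrow> iso_path \<Rightarrow> bool" where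
  "iso_path_of c \<G> G p \<longleftrightarrow> inner_path_of c \<G> G p \<or> outer_iso_path c \<G> G (fst p) (snd p)"

definition iso_element :: "iso_path \<Rightarrow> point set" where
  "iso_element p = (let V = \<Union>(snd p); Pc = (1 / real (card V)) *\<^sub>R (\<Sum>P\<in>V. P) in
     \<Union>l\<in>snd p. convex hull (insert Pc l))"

text \<open>The set of the iso-elements of \<open>\<Gamma>\<close>, whose union is \<open>\<Gamma>\<close>.\<close>

definition iso_elements :: "real \<Rightarrow> lcg set \<Rightarrow> point set set" where
  "iso_elements c \<G> = {iso_element p | p G. G \<in> \<G> \<and> iso_path_of c \<G> G p}"


section \<open>Connectedness\<close>

text \<open>
  A surface is given by the set \<open>S\<close> of the iso-elements it is joined of. Since a connected
  surface has no holes, the iso-paths adjacent to \<open>p\<close> have to belong to the surface, too.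
\<close>

definition iso_path_connected :: "real \<Rightarrow> lcg set \<Rightarrow> point set set \<Rightarrow> iso_path \<Rightarrow> bool" where
  "iso_path_connected c \<G> S p \<longleftrightarrow> 3 \<le> card (snd p) \<and> card (snd p) \<le> 6 \<and>
     (\<forall>l\<in>snd p. \<exists>G\<in>\<G>. \<exists>q. iso_path_of c \<G> G q \<and> iso_element q \<in> S \<and> q \<noteq> p \<and>
        convex hull l \<subseteq> polygon_points (snd q))"

definition iso_surface_connected ::
  "real \<Rightarrow> lcg set \<Rightarrow> point set \<Rightarrow> point set set \<Rightarrow> bool" where
  "iso_surface_connected c \<G> \<Omega> S \<longleftrightarrow>
     (\<forall>G\<in>\<G>. \<forall>p. iso_path_of c \<G> G p \<and> iso_element p \<in> S \<and>
        \<not> (\<exists>l\<in>snd p. convex hull l \<subseteq> frontier \<Omega>) \<longrightarrow> iso_path_connected c \<G> S p)"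


section \<open>Disperse connectedness\<close>

text \<open>
  For \<open>e\<close> in the interior of the domain there are four graphs at \<open>e\<close>, and the system of a
  graph consists of 19 graphs if its cuboid lies in the interior of the domain: of the graph
  itself, 6 face-neighbors and 12 graphs which have only an edge in common with it.
\<close>

definition edge_system :: "lcg set \<Rightarrow> point set \<Rightarrow> lcg set" where
  "edge_system \<G> e = {G\<in>\<G>. e edge_of cuboid G}"

definition graph_system :: "lcg set \<Rightarrow> lcg \<Rightarrow> lcg set" where
  "graph_system \<G> G = (\<Union>e\<in>{e. e edge_of cuboid G}. edge_system \<G> e)"

text \<open>
  The disperse node \<open>P\<close> corresponds to the iso-line \<open>l\<close> with respect to the inner iso-path \<open>p\<close>
  of \<open>G\<close>.
\<close>

definition corresponds ::
  "real \<Rightarrow> lcg set \<Rightarrow> lcg \<Rightarrow> iso_path \<Rightarrow> iso_line \<Rightarrow> point \<Rightarrow> bool" where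
  "corresponds c \<G> G p l P \<longleftrightarrow> inner_path_of c \<G> G p \<and> l \<in> snd p \<and> disperse c G P \<and>
     (\<exists>M. P \<in> M \<and>
        (regular_face c G M \<and> l = face_iso_points c G M \<or>
         nontrivial_L_face c G M \<and>
           l = {iso_point c G Q P | Q. Q \<in> M \<and> incident (cuboid G) Q P} \<or>
         trivial_L_face c G M \<and> l = face_iso_points c G M \<and>
           (\<exists>K. inner_iso_path_from c \<G> G (snd p) K \<and> P \<in> K)))"

definition disperse_path :: "real \<Rightarrow> lcg set \<Rightarrow> point \<Rightarrow> point \<Rightarrow> bool" where
  "disperse_path c \<H> P1 P2 \<longleftrightarrow>
     (\<exists>ps. distinct ps \<and> length ps \<ge> 3 \<and> hd ps = P1 \<and> last ps = P2 \<and>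
        (\<forall>m. Suc m < length ps \<longrightarrow>
           (\<exists>H\<in>\<H>. incident (cuboid H) (ps ! m) (ps ! Suc m) \<and>
              disperse c H (ps ! m) \<and> disperse c H (ps ! Suc m))))"

text \<open>
  Here \<open>p1\<close> is an iso-path of \<open>G\<close> and \<open>p2\<close> an iso-path in the system of graphs of \<open>G\<close> having
  the edge \<open>l\<close> in common.
\<close>

definition disperse_connected_paths ::
  "real \<Rightarrow> lcg set \<Rightarrow> lcg \<Rightarrow> iso_path \<Rightarrow> iso_path \<Rightarrow> iso_line \<Rightarrow> bool" where
  "disperse_connected_paths c \<G> G p1 p2 l \<longleftrightarrow>
     regular_graph c \<G> G \<and> iso_path_of c \<G> G p1 \<and>
     (\<exists>G2\<in>graph_system \<G> G. iso_path_of c \<G> G2 p2) \<and> p2 \<noteq> p1 \<and> l \<in> snd p1 \<and> l \<in> snd p2 \<and>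
     ((\<forall>H\<in>graph_system \<G> G. \<forall>q. iso_path_of c \<G> H q \<and> l \<in> snd q \<longrightarrow> q = p1 \<or> q = p2) \<or>
      (\<exists>G2\<in>graph_system \<G> G. inner_path_of c \<G> G p1 \<and> inner_path_of c \<G> G2 p2 \<and>
         ((\<exists>P. corresponds c \<G> G p1 l P \<and> corresponds c \<G> G2 p2 l P) \<or>
          (\<exists>P1 P2. P1 \<noteq> P2 \<and> corresponds c \<G> G p1 l P1 \<and> corresponds c \<G> G2 p2 l P2 \<and>
             disperse_path c (graph_system \<G> G) P1 P2))))"

text \<open>
  Being neighbored is a property of the unordered pair of iso-elements, whereas the two
  iso-paths play different roles in the preceding definition.
\<close>

definition neighbored :: "real \<Rightarrow> lcg set \<Rightarrow> point set \<Rightarrow> point set \<Rightarrow> bool" where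
  "neighbored c \<G> Z1 Z2 \<longleftrightarrow> Z1 \<noteq> Z2 \<and>
     (\<exists>G\<in>\<G>. \<exists>p1 p2 l. {Z1, Z2} = {iso_element p1, iso_element p2} \<and>
        disperse_connected_paths c \<G> G p1 p2 l)"

definition disperse_connected :: "real \<Rightarrow> lcg set \<Rightarrow> point set \<Rightarrow> point set \<Rightarrow> bool" where
  "disperse_connected c \<G> Z Z' \<longleftrightarrow> (\<exists>r\<ge>1. \<exists>Y :: nat \<Rightarrow> point set.
     Y 0 = Z \<and> Y r = Z' \<and> (\<forall>i\<le>r. Y i \<in> iso_elements c \<G>) \<and>
     (\<forall>i\<in>{1..r}. neighbored c \<G> (Y (i - 1)) (Y i)))"

text \<open>
  The component of \<open>\<Gamma>\<close> with respect to \<open>Z\<close>, as a set of iso-elements. By the convention of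
  iso-elements disjointness two components are disjoint if they have no iso-element in
  common, i.e. if these sets are disjoint, whether or not the iso-elements touch in space.
\<close>

definition component :: "real \<Rightarrow> lcg set \<Rightarrow> point set \<Rightarrow> point set set" where
  "component c \<G> Z = insert Z {Z'\<in>iso_elements c \<G>. disperse_connected c \<G> Z Z'}"

end

theory Submission imports Defs "HOL-Analysis.Analysis" begin

text \<open>
  The vertices of a cuboid are indexed by three bits, so that a labeled cuboid graph becomes one of
  256 patterns of disperse nodes together with the set of its label-\<open>c\<close> nodes. Every rule of the
  construction removes components of such a pattern: each inner iso-path is the polygon of the C-rules
  for a pattern in which all but one component (of the disperse nodes or, for the two complementary
  patterns, of the continuous ones) have been relabeled. A line on a regular or trivial L-face is
  continued in the face-neighbor, unless a node of that face has been removed there; then the line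
  either is an edge of the cuboid and one walks around that edge, the removed nodes providing the
  disperse path, or it joins two diagonal label-\<open>c\<close> nodes and belongs to two iso-paths of the same graph.
  On a non-trivial L-face each of the two graphs carries either the lines at the disperse or those at
  the continuous nodes; if they disagree, the union of both sets is the outer iso-path, and in any case
  every line lies in exactly two iso-paths.
\<close>

text \<open>Being neighbored is a property of unordered pairs, so components are the classes of an
  equivalence relation and their being equal or disjoint is formal. The content is connectedness:
  along every line of an iso-path there is a second, disperse connected iso-path. The obstacle is
  the removal step. It acts in each cuboid separately, so a node may keep label c in one graph and
  be disperse in the next. The key is \<open>removed_incident\<close>: all nodes incident to a
  removed node are disperse in that graph. Hence on a non-trivial L-face the two labelings differ at
  one continuous corner at most, and there only as c against a larger label. The exclusions have
  separate tasks: T1- and T2-freeness keep faces from being singular all around a node or an edge,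
  which gives at least three lines per path; F1-freeness helps to keep two paths of one graph apart.
  An outer iso-path is given as a point set only. Its edges are recovered because the segments
  involved are exposed in the hull of the iso-points of the face. Since iso-elements miss the
  frontier, every line lies in the open domain, and a face that carries a line has a cuboid on its
  other side.\<close>

datatype ix = Ix bool bool bool

section \<open>Faces, edges and vertices of a box\<close>

definition side :: "point \<Rightarrow> point \<Rightarrow> 3 \<Rightarrow> bool \<Rightarrow> real" where
  "side a b k s = (if s then b $ k else a $ k)"

text \<open>Every non-empty face of a box has this form, and the size of \<open>I\<close> is its
  codimension.\<close>

definition box_face :: "point \<Rightarrow> point \<Rightarrow> 3 set \<Rightarrow> (3 \<Rightarrow> bool) \<Rightarrow> point set" where
  "box_face a b I s = {x \<in> cbox a b. \<forall>k\<in>I. x $ k = side a b k (s k)}"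

definition bface :: "point \<Rightarrow> point \<Rightarrow> 3 \<Rightarrow> bool \<Rightarrow> point set" where
  "bface a b k s = {x \<in> cbox a b. x $ k = side a b k s}"

lemma cbox_vec: "x \<in> cbox a (b :: point) \<longleftrightarrow> (\<forall>k. a $ k \<le> x $ k \<and> x $ k \<le> b $ k)"
  by (auto simp: mem_box_cart)

text \<open>Faces of a polyhedron are exposed, and a linear functional is maximized on a box
  coordinate by coordinate: a non-zero coefficient pins its coordinate to the side given by the
  sign, a zero coefficient leaves it free.\<close>

lemma face_is_box_face:
  assumes "F face_of cbox a b" "F \<noteq> {}"
  shows "\<exists>I s. F = box_face a b I s"
proof -
  from assms(1) have "F exposed_face_of cbox a b"
    using exposed_face_of_polyhedron polyhedron_interval by blast
  then obtain n \<beta> where n: "cbox a b \<subseteq> {x. n \<bullet> x \<le> \<beta>}" "F = cbox a b \<inter> {x. n \<bullet> x = \<beta>}"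
    unfolding exposed_face_of_def by blast
  define s where "s k = (n $ k > 0)" for k
  \<comment> \<open>\<open>m\<close> is a corner at which the functional is maximal; the defect of
    any other point is a sum of non-negative terms, one per coordinate, and vanishes only
    termwise.\<close>
  define m :: point where "m = (\<chi> k. side a b k (s k))"
  obtain x0 where x0: "x0 \<in> cbox a b" "n \<bullet> x0 = \<beta>" using assms(2) n by blast
  have m: "m \<in> cbox a b" using x0(1) unfolding cbox_vec
    by (auto simp: m_def side_def) (meson order_trans)+
  have diff: "n \<bullet> m - n \<bullet> x = (\<Sum>k\<in>UNIV. n $ k * (m $ k - x $ k))" for x
    by (simp add: inner_vec_def sum_subtractf algebra_simps)
  have term_ge: "n $ k * (m $ k - x $ k) \<ge> 0" if "x \<in> cbox a b" for x k
    using that unfolding cbox_vec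
    by (cases "n $ k > 0") (auto simp: m_def s_def side_def zero_le_mult_iff)
  have "n \<bullet> m - n \<bullet> x0 \<ge> 0" unfolding diff by (intro sum_nonneg) (use term_ge x0 in auto)
  moreover have "n \<bullet> m \<le> \<beta>" using n m by auto
  ultimately have nm: "n \<bullet> m = \<beta>" using x0 by linarith
  have "n \<bullet> x = \<beta> \<longleftrightarrow> (\<forall>k\<in>{k. n $ k \<noteq> 0}. x $ k = side a b k (s k))" if x: "x \<in> cbox a b" for x
  proof -
    have "n \<bullet> x = \<beta> \<longleftrightarrow> (\<Sum>k\<in>UNIV. n $ k * (m $ k - x $ k)) = 0" using diff[of x] nm by linarith
    also have "\<dots> \<longleftrightarrow> (\<forall>k\<in>UNIV. n $ k * (m $ k - x $ k) = 0)"
      by (rule sum_nonneg_eq_0_iff) (use term_ge x in auto)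
    also have "\<dots> \<longleftrightarrow> (\<forall>k\<in>{k. n $ k \<noteq> 0}. x $ k = side a b k (s k))" by (auto simp: m_def)
    finally show ?thesis .
  qed
  then have "F = box_face a b {k. n $ k \<noteq> 0} s" unfolding n(2) box_face_def by blast
  then show ?thesis by blast
qed

lemma bface_face_of: "bface a b k s face_of cbox a b"
proof (cases s)
  case True
  have "cbox a b \<inter> {x. axis k 1 \<bullet> x = b $ k} face_of cbox a b"
    by (rule face_of_Int_supporting_hyperplane_le) (auto simp: cbox_vec inner_axis' )
  then show ?thesis using True by (simp add: bface_def side_def inner_axis' Int_def)
next
  case False
  have "cbox a b \<inter> {x. axis k 1 \<bullet> x = a $ k} face_of cbox a b"
    by (rule face_of_Int_supporting_hyperplane_ge) (auto simp: cbox_vec inner_axis' )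
  then show ?thesis using False by (simp add: bface_def side_def inner_axis' Int_def)
qed

lemma box_face_face_of: "box_face a b I s face_of cbox a b"
  using finite[of I]
proof (induction rule: finite_induct)
  case empty
  have "box_face a b {} s = cbox a b" by (auto simp: box_face_def)
  then show ?case by (simp add: face_of_refl)
next
  case (insert k I)
  have "box_face a b (insert k I) s = bface a b k (s k) \<inter> box_face a b I s"
    by (auto simp: box_face_def bface_def)
  then show ?case using insert bface_face_of face_of_Int by metis
qed

fun co :: "3 \<Rightarrow> ix \<Rightarrow> bool" where
  "co k (Ix x y z) = (if k = 1 then x else if k = 2 then y else z)"

fun nb :: "ix \<Rightarrow> ix list" where
  "nb (Ix x y z) = [Ix (\<not> x) y z, Ix x (\<not> y) z, Ix x y (\<not> z)]"

definition adj :: "ix \<Rightarrow> ix \<Rightarrow> bool" where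
  "adj \<sigma> \<tau> \<longleftrightarrow> \<tau> \<in> set (nb \<sigma>)"

definition V :: "point \<Rightarrow> point \<Rightarrow> ix \<Rightarrow> point" where
  "V a b \<sigma> = (\<chi> k. side a b k (co k \<sigma>))"

lemma adj_sym: "adj \<sigma> \<tau> \<longleftrightarrow> adj \<tau> \<sigma>"
  by (cases \<sigma>; cases \<tau>) (auto simp: adj_def)

lemma adj_irrefl[simp]: "\<not> adj \<sigma> \<sigma>"
  by (cases \<sigma>) (auto simp: adj_def)

lemma ix_eq_iff: "\<sigma> = \<tau> \<longleftrightarrow> (\<forall>k. co k \<sigma> = co k \<tau>)"
  by (cases \<sigma>; cases \<tau>) (auto simp: forall_3)

lemma ex_3: "(\<exists>k::3. P k) \<longleftrightarrow> P 1 \<or> P 2 \<or> P 3"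
  using forall_3[of "\<lambda>k. \<not> P k"] by auto

lemma adj_iff: "adj \<sigma> \<tau> \<longleftrightarrow> (\<exists>k. co k \<sigma> \<noteq> co k \<tau> \<and> (\<forall>j. j \<noteq> k \<longrightarrow> co j \<sigma> = co j \<tau>))"
  by (cases \<sigma>; cases \<tau>) (auto simp: adj_def forall_3 ex_3)

lemma ix_of_fun: "\<exists>\<sigma>. \<forall>k. co k \<sigma> = f k"
  by (rule exI[of _ "Ix (f 1) (f 2) (f 3)"]) (auto simp: forall_3)

lemma V_nth[simp]: "V a b \<sigma> $ k = side a b k (co k \<sigma>)"
  by (simp add: V_def)

locale cub =
  fixes a b :: point
  assumes ab: "\<And>k. a $ k < b $ k"
begin

lemma side_le: "a $ k \<le> side a b k s" "side a b k s \<le> b $ k"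
  using ab[of k] by (auto simp: side_def)

lemma side_eq[simp]: "side a b k s = side a b k t \<longleftrightarrow> s = t"
  using ab[of k] by (auto simp: side_def)

lemma V_in[simp]: "V a b \<sigma> \<in> cbox a b"
  by (simp add: cbox_vec side_le)

lemma V_eq[simp]: "V a b \<sigma> = V a b \<tau> \<longleftrightarrow> \<sigma> = \<tau>"
  by (simp add: vec_eq_iff ix_eq_iff)

lemma V_bface[simp]: "V a b \<sigma> \<in> bface a b k s \<longleftrightarrow> co k \<sigma> = s"
  by (simp add: bface_def)

lemma box_face_UNIV: "box_face a b UNIV (\<lambda>k. co k \<sigma>) = {V a b \<sigma>}"
  by (auto simp: box_face_def vec_eq_iff side_le cbox_vec)

lemma box_face_strict:
  assumes "k \<notin> I" shows "box_face a b (insert k I) s \<subset> box_face a b I s"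
proof -
  obtain \<sigma> where "\<forall>j. co j \<sigma> = (if j = k then \<not> s k else s j)"
    using ix_of_fun[of "\<lambda>j. if j = k then \<not> s k else s j"] by blast
  then have "V a b \<sigma> \<in> box_face a b I s" "V a b \<sigma> \<notin> box_face a b (insert k I) s"
    using assms by (auto simp: box_face_def)
  moreover have "box_face a b (insert k I) s \<subseteq> box_face a b I s" by (auto simp: box_face_def)
  ultimately show ?thesis by blast
qed

lemma aff_dim_box_face_strict:
  assumes "k \<notin> I" shows "aff_dim (box_face a b (insert k I) s) < aff_dim (box_face a b I s)"
proof (rule face_of_aff_dim_lt)
  show "convex (box_face a b I s)"
    using face_of_imp_convex[OF box_face_face_of] by blast
  show "box_face a b (insert k I) s face_of box_face a b I s"
    using face_of_subset[OF box_face_face_of[of a b "insert k I" s], of "box_face a b I s"]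
    by (auto simp: box_face_def)
  show "box_face a b (insert k I) s \<noteq> box_face a b I s" using box_face_strict[OF assms] by blast
qed

lemma aff_dim_cbox: "aff_dim (cbox a b) = 3"
proof -
  have "(\<chi> k. (a $ k + b $ k) / 2) \<in> box a b" using ab by (auto simp: mem_box_cart field_simps)
  then have "interior (cbox a b) \<noteq> {}" by (auto simp: interior_cbox)
  then show ?thesis by (simp add: aff_dim_nonempty_interior)
qed

lemma other_axes: "\<exists>i j. i \<noteq> k \<and> j \<noteq> k \<and> i \<noteq> j \<and> UNIV = {i, j, k :: 3}"
proof -
  have "UNIV = {1, 2, 3 :: 3}" using UNIV_3 .
  moreover have "k = 1 \<or> k = 2 \<or> k = 3" by (rule exhaust_3)
  ultimately show ?thesis
    by (elim disjE) (rule exI[of _ 2], rule exI[of _ 3], force,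
      rule exI[of _ 1], rule exI[of _ 3], force, rule exI[of _ 1], rule exI[of _ 2], force)
qed

text \<open>Along a chain of faces from the box to a vertex the dimension falls strictly in three
  steps from 3 to 0, so every step lowers it by exactly one.\<close>

lemma aff_dim_chain:
  assumes "UNIV = {i, j, k :: 3}" "i \<noteq> j" "j \<noteq> k" "i \<noteq> k"
  shows "aff_dim (box_face a b {k} s) = 2" "aff_dim (box_face a b {j, k} s) = 1"
    "aff_dim (box_face a b UNIV s) = 0"
proof -
  have 0: "box_face a b {} s = cbox a b" by (simp add: box_face_def)
  obtain \<sigma> where "\<forall>k. co k \<sigma> = s k" using ix_of_fun[of s] by blast
  then have "s = (\<lambda>k. co k \<sigma>)" by auto
  then have 3: "aff_dim (box_face a b UNIV s) = 0" using box_face_UNIV[of \<sigma>] by simp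
  have "aff_dim (box_face a b {k} s) < 3"
    using aff_dim_box_face_strict[of k "{}" s] 0 aff_dim_cbox by simp
  moreover have "aff_dim (box_face a b {j, k} s) < aff_dim (box_face a b {k} s)"
    using aff_dim_box_face_strict[of j "{k}" s] assms by simp
  moreover have "aff_dim (box_face a b UNIV s) < aff_dim (box_face a b {j, k} s)"
    using aff_dim_box_face_strict[of i "{j,k}" s] assms by simp
  ultimately show "aff_dim (box_face a b {k} s) = 2" "aff_dim (box_face a b {j, k} s) = 1"
    "aff_dim (box_face a b UNIV s) = 0" using 3 by auto
qed

lemma box_face_single: "box_face a b {k} s = bface a b k (s k)"
  by (auto simp: box_face_def bface_def)

text \<open>In the third case \<open>i\<close> is the axis that stays free, the direction of the
  edge.\<close>

lemma index_cases:
  fixes I :: "3 set"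
  obtains "I = {}" | k where "I = {k}" | i j k where "UNIV = {i, j, k}" "i \<noteq> j" "j \<noteq> k" "i \<noteq> k" "I = {j, k}"
    | "I = UNIV"
proof -
  note r = that
  have U: "UNIV = {1, 2, 3 :: 3}" by (rule UNIV_3)
  have "\<exists>p q r. I = (if p then {1} else {}) \<union> (if q then {2} else {}) \<union> (if r then {3} else {})"
  proof (intro exI set_eqI)
    fix x
    show "x \<in> I \<longleftrightarrow> x \<in> (if 1 \<in> I then {1} else {}) \<union> (if 2 \<in> I then {2} else {}) \<union> (if 3 \<in> I then {3} else {})"
      using exhaust_3[of x] by auto
  qed
  then obtain p q r where pqr: "I = (if p then {1} else {}) \<union> (if q then {2} else {}) \<union> (if r then {3} else {})"
    by blast
  have "I = {} \<or> I = {1} \<or> I = {2} \<or> I = {3} \<or> I = {1,2} \<or> I = {1,3} \<or> I = {2,3} \<or> I = {1,2,3}"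
    unfolding pqr by (cases p; cases q; cases r) (simp_all add: insert_commute)
  moreover have p: "UNIV = {3, 1, 2 :: 3}" "UNIV = {2, 1, 3 :: 3}"
    using U by (metis insert_commute)+
  moreover have thesis if h: "I = {1, 2}" by (rule r(3)[OF p(1) _ _ _ h]) simp_all
  moreover have thesis if h: "I = {1, 3}" by (rule r(3)[OF p(2) _ _ _ h]) simp_all
  moreover have thesis if h: "I = {2, 3}" by (rule r(3)[OF U _ _ _ h]) simp_all
  moreover have thesis if h: "I = {1, 2, 3}" by (rule r(4)) (simp only: U h)
  ultimately show thesis using r(1,2) by blast
qed

lemma facet_iff: "M facet_of cbox a b \<longleftrightarrow> (\<exists>k s. M = bface a b k s)"
proof
  assume M: "M facet_of cbox a b"
  then obtain I s where F: "M = box_face a b I s"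
    using face_is_box_face[of M a b] by (auto simp: facet_of_def)
  have d: "aff_dim M = 2" using M aff_dim_cbox by (auto simp: facet_of_def)
  show "\<exists>k s. M = bface a b k s"
  proof (cases I rule: index_cases)
    case 1 then show ?thesis using F d aff_dim_cbox by (simp add: box_face_def)
  next
    case (2 k) then show ?thesis using F box_face_single by auto
  next
    case (3 i j k) then show ?thesis using F d aff_dim_chain(2)[of i j k s] by simp
  next
    case 4
    obtain i j k where "UNIV = {i, j, k :: 3}" "i \<noteq> j" "j \<noteq> k" "i \<noteq> k" using other_axes[of 1] by metis
    then show ?thesis using F d 4 aff_dim_chain(3)[of i j k s] by simp
  qed
next
  assume "\<exists>k s. M = bface a b k s"
  then obtain k s where M: "M = bface a b k s" by blast
  obtain i j where u: "i \<noteq> k" "j \<noteq> k" "i \<noteq> j" "UNIV = {i, j, k}" using other_axes[of k] by blast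
  have "aff_dim M = 2" using aff_dim_chain(1)[of i j k "\<lambda>_. s"] u M box_face_single[of k "\<lambda>_. s"] by simp
  then show "M facet_of cbox a b" using M bface_face_of[of a b k s] aff_dim_cbox
    by (auto simp: facet_of_def)
qed

lemma nodes_eq: "nodes (cbox a b) = range (V a b)"
proof -
  have "P extreme_point_of cbox a b \<longleftrightarrow> P \<in> range (V a b)" for P
  proof
    assume "P extreme_point_of cbox a b"
    then have f: "{P} face_of cbox a b" by (simp add: face_of_singleton)
    then obtain I s where F: "{P} = box_face a b I s" using face_is_box_face[OF f] by blast
    obtain \<sigma> where "\<forall>k. co k \<sigma> = s k" using ix_of_fun[of s] by blast
    then have "V a b \<sigma> \<in> box_face a b I s" by (simp add: box_face_def)
    then have "P = V a b \<sigma>" unfolding F[symmetric] by simp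
    then show "P \<in> range (V a b)" by blast
  next
    assume "P \<in> range (V a b)"
    then obtain \<sigma> where P: "P = V a b \<sigma>" by blast
    then show "P extreme_point_of cbox a b"
      using box_face_face_of[of a b UNIV "\<lambda>k. co k \<sigma>"] box_face_UNIV[of \<sigma>] by (simp add: face_of_singleton)
  qed
  then show ?thesis unfolding nodes_def by blast
qed

lemma segment_V:
  assumes "co k \<sigma> \<noteq> co k \<tau>" "\<And>j. j \<noteq> k \<Longrightarrow> co j \<sigma> = co j \<tau>"
  shows "closed_segment (V a b \<sigma>) (V a b \<tau>) = box_face a b (- {k}) (\<lambda>j. co j \<sigma>)"
proof -
  have "x \<in> closed_segment (V a b \<sigma>) (V a b \<tau>) \<longleftrightarrow> x \<in> box_face a b (- {k}) (\<lambda>j. co j \<sigma>)" for x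
  proof
    assume "x \<in> closed_segment (V a b \<sigma>) (V a b \<tau>)"
    then have "x \<in> cbox a b" using convex_box(1)[of a b] closed_segment_subset[of "V a b \<sigma>" "cbox a b" "V a b \<tau>"] by auto
    moreover obtain u where u: "x = (1 - u) *\<^sub>R V a b \<sigma> + u *\<^sub>R V a b \<tau>"
      using \<open>x \<in> closed_segment _ _\<close> by (auto simp: in_segment)
    have "x $ j = side a b j (co j \<sigma>)" if "j \<noteq> k" for j
      unfolding u using assms(2)[OF that] by (simp add: algebra_simps)
    ultimately show "x \<in> box_face a b (- {k}) (\<lambda>j. co j \<sigma>)" by (auto simp: box_face_def)
  next
    assume x: "x \<in> box_face a b (- {k}) (\<lambda>j. co j \<sigma>)"
    define p where "p = side a b k (co k \<sigma>)"
    define q where "q = side a b k (co k \<tau>)"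
    have pq: "p \<noteq> q" using assms(1) by (simp add: p_def q_def)
    define u where "u = (x $ k - p) / (q - p)"
    have "(p = a $ k \<and> q = b $ k) \<or> (p = b $ k \<and> q = a $ k)"
      using assms(1) by (auto simp: p_def q_def side_def)
    moreover have "a $ k \<le> x $ k" "x $ k \<le> b $ k" using x by (auto simp: box_face_def cbox_vec)
    ultimately have u: "0 \<le> u" "u \<le> 1" using ab[of k] by (auto simp: u_def divide_simps)
    have "u * (q - p) = x $ k - p" using pq by (simp add: u_def)
    then have k: "x $ k = (1 - u) * p + u * q" by (simp add: algebra_simps)
    have "x $ j = ((1 - u) *\<^sub>R V a b \<sigma> + u *\<^sub>R V a b \<tau>) $ j" for j
    proof (cases "j = k")
      case True then show ?thesis using k by (simp add: p_def q_def)
    next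
      case False then show ?thesis using x assms(2)[OF False] by (simp add: box_face_def algebra_simps)
    qed
    then have "x = (1 - u) *\<^sub>R V a b \<sigma> + u *\<^sub>R V a b \<tau>" by (simp add: vec_eq_iff)
    then show "x \<in> closed_segment (V a b \<sigma>) (V a b \<tau>)" using u by (auto simp: in_segment)
  qed
  then show ?thesis by blast
qed

lemma edge_iff: "e edge_of cbox a b \<longleftrightarrow> (\<exists>\<sigma> \<tau>. adj \<sigma> \<tau> \<and> e = closed_segment (V a b \<sigma>) (V a b \<tau>))"
proof
  assume e: "e edge_of cbox a b"
  then obtain I s where F: "e = box_face a b I s"
    using face_is_box_face[of e a b] by (fastforce simp: edge_of_def)
  have d: "aff_dim e = 1" using e by (auto simp: edge_of_def)
  show "\<exists>\<sigma> \<tau>. adj \<sigma> \<tau> \<and> e = closed_segment (V a b \<sigma>) (V a b \<tau>)"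
  proof (cases I rule: index_cases)
    case 1 then show ?thesis using F d aff_dim_cbox by (simp add: box_face_def)
  next
    case (2 k)
    obtain i j where "i \<noteq> k" "j \<noteq> k" "i \<noteq> j" "UNIV = {i, j, k}" using other_axes[of k] by blast
    then show ?thesis using F d 2 aff_dim_chain(1)[of i j k s] by simp
  next
    case (3 i j k)
    obtain \<sigma> where s: "\<forall>k. co k \<sigma> = s k" using ix_of_fun[of s] by blast
    obtain \<tau> where t: "\<forall>k. co k \<tau> = (s(i := \<not> s i)) k" using ix_of_fun[of "s(i := \<not> s i)"] by blast
    have I: "I = - {i}" using 3 by auto
    have "closed_segment (V a b \<sigma>) (V a b \<tau>) = box_face a b (- {i}) (\<lambda>j. co j \<sigma>)"
      by (rule segment_V) (use s t in auto)
    then have "closed_segment (V a b \<sigma>) (V a b \<tau>) = e" using F I s by simp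
    moreover have "adj \<sigma> \<tau>" unfolding adj_iff using s t by auto
    ultimately show ?thesis by blast
  next
    case 4
    obtain i j k where "UNIV = {i, j, k :: 3}" "i \<noteq> j" "j \<noteq> k" "i \<noteq> k" using other_axes[of 1] by metis
    then show ?thesis using F d 4 aff_dim_chain(3)[of i j k s] by simp
  qed
next
  assume "\<exists>\<sigma> \<tau>. adj \<sigma> \<tau> \<and> e = closed_segment (V a b \<sigma>) (V a b \<tau>)"
  then obtain \<sigma> \<tau> where st: "adj \<sigma> \<tau>" "e = closed_segment (V a b \<sigma>) (V a b \<tau>)" by blast
  then obtain k where k: "co k \<sigma> \<noteq> co k \<tau>" "\<forall>j. j \<noteq> k \<longrightarrow> co j \<sigma> = co j \<tau>" by (auto simp: adj_iff)
  then have e: "e = box_face a b (- {k}) (\<lambda>j. co j \<sigma>)" using segment_V st by simp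
  obtain i j where u: "i \<noteq> k" "j \<noteq> k" "i \<noteq> j" "UNIV = {i, j, k}" using other_axes[of k] by blast
  then have "- {k} = {i, j}" by auto
  moreover have "aff_dim (box_face a b {i, j} (\<lambda>j. co j \<sigma>)) = 1"
    by (rule aff_dim_chain(2)[of k i j]) (use u in auto)
  ultimately show "e edge_of cbox a b" unfolding edge_of_def using e box_face_face_of by simp
qed

lemma incident_iff: "incident (cbox a b) P Q \<longleftrightarrow> (\<exists>\<sigma> \<tau>. P = V a b \<sigma> \<and> Q = V a b \<tau> \<and> adj \<sigma> \<tau>)"
proof
  assume "incident (cbox a b) P Q"
  then obtain \<sigma> \<tau> where st: "adj \<sigma> \<tau>" "closed_segment P Q = closed_segment (V a b \<sigma>) (V a b \<tau>)"
    unfolding incident_def edge_iff by blast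
  then have "{P, Q} = {V a b \<sigma>, V a b \<tau>}" by simp
  then have "P = V a b \<sigma> \<and> Q = V a b \<tau> \<or> P = V a b \<tau> \<and> Q = V a b \<sigma>" by (auto simp: doubleton_eq_iff)
  then show "\<exists>\<sigma> \<tau>. P = V a b \<sigma> \<and> Q = V a b \<tau> \<and> adj \<sigma> \<tau>"
    using st(1) adj_sym[of \<sigma> \<tau>] by blast
next
  assume "\<exists>\<sigma> \<tau>. P = V a b \<sigma> \<and> Q = V a b \<tau> \<and> adj \<sigma> \<tau>"
  then show "incident (cbox a b) P Q" unfolding incident_def edge_iff by blast
qed

lemma incident_V[simp]: "incident (cbox a b) (V a b \<sigma>) (V a b \<tau>) \<longleftrightarrow> adj \<sigma> \<tau>"
  unfolding incident_iff using V_eq by metis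

end

text \<open>The corners of one face, addressed by the two remaining bits in the order of the axes.
  Two cuboids on opposite sides of a face address its corners by the same bits, which is what makes
  labels on both sides comparable.\<close>

fun cn :: "3 \<Rightarrow> bool \<Rightarrow> bool \<Rightarrow> bool \<Rightarrow> ix" where
  "cn k s u v = (if k = 1 then Ix s u v else if k = 2 then Ix u s v else Ix u v s)"

section \<open>Patterns of disperse nodes and their exhaustive check\<close>

definition allix :: "ix list" where
  "allix = [Ix True True True, Ix True True False, Ix True False True, Ix True False False,
    Ix False True True, Ix False True False, Ix False False True, Ix False False False]"

text \<open>Parallel faces stand next to each other; \<open>apar\<close> relies on this
  order.\<close>

definition fcs :: "(bool \<Rightarrow> bool \<Rightarrow> ix) list" where
  "fcs = [Ix True, Ix False, \<lambda>u. Ix u True, \<lambda>u. Ix u False, \<lambda>u v. Ix u v True, \<lambda>u v. Ix u v False]"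

definition aL :: "(ix \<Rightarrow> bool) \<Rightarrow> (bool \<Rightarrow> bool \<Rightarrow> ix) \<Rightarrow> bool" where
  "aL d f \<longleftrightarrow> d (f False False) = d (f True True) \<and> d (f False True) = d (f True False) \<and>
     d (f False False) \<noteq> d (f False True)"

definition aD :: "(ix \<Rightarrow> bool) \<Rightarrow> nat" where "aD d = length (filter d allix)"
definition nL :: "(ix \<Rightarrow> bool) \<Rightarrow> nat" where "nL d = length (filter (aL d) fcs)"
definition apar :: "(ix \<Rightarrow> bool) \<Rightarrow> bool" where
  "apar d \<longleftrightarrow> aL d (fcs ! 0) \<and> aL d (fcs ! 1) \<or> aL d (fcs ! 2) \<and> aL d (fcs ! 3) \<or> aL d (fcs ! 4) \<and> aL d (fcs ! 5)"

definition isol :: "(ix \<Rightarrow> bool) \<Rightarrow> ix \<Rightarrow> bool" where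
  "isol d \<sigma> \<longleftrightarrow> list_all (\<lambda>\<rho>. \<not> d \<rho>) (nb \<sigma>)"

text \<open>The center of an S3-subgraph if its label is below c, of a T1-subgraph if its label is
  c.\<close>

definition coiso :: "(ix \<Rightarrow> bool) \<Rightarrow> ix \<Rightarrow> bool" where
  "coiso d \<sigma> \<longleftrightarrow> \<not> d \<sigma> \<and> list_all d (nb \<sigma>)"

definition iso :: "(ix \<Rightarrow> bool) \<Rightarrow> ix \<Rightarrow> bool" where
  "iso d \<sigma> \<longleftrightarrow> d \<sigma> \<and> list_all (\<lambda>\<rho>. \<not> d \<rho>) (nb \<sigma>)"

text \<open>The patterns of the S3-rule, in which every path cuts off continuous nodes instead of
  disperse ones. On mixed patterns \<open>ckT\<close> confirms that they are exactly the S3-rows of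
  the table.\<close>

definition ctype :: "(ix \<Rightarrow> bool) \<Rightarrow> bool" where
  "ctype d \<longleftrightarrow> aD d = 6 \<and> list_ex (coiso d) allix \<or> aD d = 5 \<and> nL d = 1"

definition s2type :: "(ix \<Rightarrow> bool) \<Rightarrow> bool" where
  "s2type d \<longleftrightarrow> aD d = 4 \<and> nL d = 2 \<and> apar d"

text \<open>The disperse set that remains when everything except the part belonging to \<sigma> has
  been relabeled; the C-rules applied to it draw the path of \<sigma>. The two type flags are
  arguments so that the check computes them once per pattern.\<close>

definition res0 :: "bool \<Rightarrow> bool \<Rightarrow> (ix \<Rightarrow> bool) \<Rightarrow> ix \<Rightarrow> ix \<Rightarrow> bool" where
  "res0 ct st d \<sigma> \<tau> \<longleftrightarrow>
    (if ct then (if coiso d \<sigma> then \<tau> \<noteq> \<sigma> else d \<tau> \<or> coiso d \<tau>)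
     else if st then d \<tau> \<and> (\<tau> = \<sigma> \<or> \<tau> \<in> set (nb \<sigma>))
     else if iso d \<sigma> then \<tau> = \<sigma> else d \<tau> \<and> \<not> iso d \<tau>)"

definition res :: "(ix \<Rightarrow> bool) \<Rightarrow> ix \<Rightarrow> ix \<Rightarrow> bool" where
  "res d = res0 (ctype d) (s2type d) d"

text \<open>The nodes that own a path: by \<open>inner_fwd\<close> and \<open>inner_bwd\<close> the
  inner iso-paths of a regular graph are the polygons of \<open>res d \<sigma>\<close> for these
  \<sigma>.\<close>

definition src :: "(ix \<Rightarrow> bool) \<Rightarrow> ix \<Rightarrow> bool" where
  "src d \<sigma> \<longleftrightarrow> (if ctype d then \<not> d \<sigma> else d \<sigma>)"

definition mixed :: "(ix \<Rightarrow> bool) \<Rightarrow> bool" where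
  "mixed d \<longleftrightarrow> list_ex d allix \<and> \<not> list_all d allix"

text \<open>A pattern as a datum of eight entries. The evaluation needs patterns that are normalized
  once and can be compared, which functions on \<open>ix\<close> are not.\<close>

datatype tb = Tb bool bool bool bool bool bool bool bool

fun tbat :: "tb \<Rightarrow> ix \<Rightarrow> bool" where
  "tbat (Tb a b c e f g h i) (Ix x y z) =
     (if x then (if y then (if z then a else b) else (if z then c else e))
      else (if y then (if z then f else g) else (if z then h else i)))"

fun ofl :: "bool list \<Rightarrow> tb" where
  "ofl [a, b, c, e, f, g, h, i] = Tb a b c e f g h i"
| "ofl _ = Tb True True True True True True True True"

definition tab :: "(ix \<Rightarrow> bool) \<Rightarrow> tb" where "tab d = ofl (map d allix)"

lemma tbat_tab[simp]: "tbat (tab d) = d"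
proof
  fix \<sigma> show "tbat (tab d) \<sigma> = d \<sigma>"
    by (cases \<sigma>) (simp add: tab_def allix_def)
qed

text \<open>Written with \<open>if\<close>, so that the evaluation skips the conclusion when the
  premise fails.\<close>

definition imp :: "bool \<Rightarrow> bool \<Rightarrow> bool" where "imp p q \<longleftrightarrow> (if p then q else True)"

definition edges :: "(ix \<times> ix) list" where
  "edges = [(\<rho>, \<tau>). \<rho> \<leftarrow> allix, \<tau> \<leftarrow> nb \<rho>]"

text \<open>The continuous ends of the crossing edges of \<open>r\<close>, the only nodes at which
  an iso-point of its polygon can sit.\<close>

definition bnd :: "tb \<Rightarrow> ix \<Rightarrow> bool" where
  "bnd r \<rho> \<longleftrightarrow> \<not> tbat r \<rho> \<and> list_ex (tbat r) (nb \<rho>)"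

definition facecount :: "tb \<Rightarrow> (bool \<Rightarrow> bool \<Rightarrow> ix) \<Rightarrow> nat" where
  "facecount r f = length (filter (tbat r) [f True True, f True False, f False True, f False False])"

text \<open>The requirements on a single residual pattern \<open>r\<close> of \<open>t\<close>: it
  creates no crossing edges, relabels in one direction, keeps \<sigma>, has no L-face, keeps at most
  one of the two corners concerned on an L-face of \<open>t\<close>, and is constant or unchanged on
  all other faces. The last conjunct prepares the bound of three lines in \<open>pp_card\<close>:
  one or two disperse corners make a face regular whatever the labels are, three may make it
  singular.\<close>

definition ck1 :: "bool \<Rightarrow> tb \<Rightarrow> ix \<Rightarrow> tb \<Rightarrow> bool" where
  "ck1 ct t \<sigma> r \<longleftrightarrow>
     list_all (\<lambda>(\<rho>, \<tau>). imp (\<not> tbat r \<rho>) (imp (tbat r \<tau>) (\<not> tbat t \<rho> \<and> tbat t \<tau>))) edges \<and>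
     list_all (\<lambda>\<tau>. if ct then imp (tbat t \<tau>) (tbat r \<tau>) else imp (tbat r \<tau>) (tbat t \<tau>)) allix \<and>
     (if ct then \<not> tbat r \<sigma> else tbat r \<sigma>) \<and>
     list_all (\<lambda>f. \<not> aL (tbat r) f \<and>
        (if aL (tbat t) f then (if ct then facecount r f \<ge> 3 else facecount r f \<le> 1)
         else facecount r f = 0 \<or> facecount r f = 4 \<or>
           tbat r (f True True) = tbat t (f True True) \<and> tbat r (f True False) = tbat t (f True False) \<and>
           tbat r (f False True) = tbat t (f False True) \<and> tbat r (f False False) = tbat t (f False False))) fcs \<and>
     (3 \<le> length (filter (\<lambda>f. facecount r f = 1 \<or> facecount r f = 2) fcs) \<or>
      aD (tbat r) = 7 \<or>
      aD (tbat r) = 6 \<and> list_ex (\<lambda>(\<rho>, \<tau>). \<not> tbat r \<rho> \<and> \<not> tbat r \<tau>) edges)"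

text \<open>A node kept by two residual patterns forces them to be equal. If two different ones had
  the same boundary nodes, then label c at all of these nodes would produce an F1-graph or a
  T1-subgraph; this separates the paths of one graph in \<open>paths_distinct\<close>.\<close>

definition ck2 :: "bool \<Rightarrow> tb \<Rightarrow> tb \<Rightarrow> (ix \<times> tb) \<Rightarrow> bool" where
  "ck2 ct t r rp \<longleftrightarrow> (case rp of (\<tau>, r') \<Rightarrow>
     (if tbat r \<tau> \<noteq> ct then r' = r
      else imp (\<not> ct \<and> list_all (\<lambda>\<rho>. bnd r \<rho> = bnd r' \<rho>) allix)
        (aD (tbat t) = 4 \<and> list_all (\<lambda>\<rho>. imp (\<not> tbat t \<rho>) (bnd r \<rho> \<and> length (filter (tbat t) (nb \<rho>)) = 2)) allix \<or>
         list_ex (\<lambda>\<rho>. bnd r \<rho> \<and> coiso (tbat t) \<rho>) allix)))"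

definition ckr :: "bool \<Rightarrow> tb \<Rightarrow> (ix \<times> tb) list \<Rightarrow> bool" where
  "ckr ct t rs \<longleftrightarrow> list_all (\<lambda>(\<sigma>, r). ck1 ct t \<sigma> r \<and> list_all (ck2 ct t r) rs) rs"

definition ck :: "bool \<Rightarrow> bool \<Rightarrow> tb \<Rightarrow> bool" where
  "ck ct st t \<longleftrightarrow> ckr ct t (map (\<lambda>\<sigma>. (\<sigma>, tab (res0 ct st (tbat t) \<sigma>))) (filter (\<lambda>\<sigma>. tbat t \<sigma> \<noteq> ct) allix))"

definition ckall :: "tb \<Rightarrow> bool" where
  "ckall t \<longleftrightarrow> imp (mixed (tbat t)) (ck (ctype (tbat t)) (s2type (tbat t)) t)"

definition alltb :: "tb list" where
  "alltb = (let B = [True, False] in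
     map (\<lambda>(a, b, c, e, f, g, h, i). Tb a b c e f g h i)
       (List.product B (List.product B (List.product B (List.product B
         (List.product B (List.product B (List.product B B))))))))"

text \<open>The rows of the table with the S1-rule, applied \<open>n\<close> times, joined with the
  single S1-rule for graphs without L-faces; \<open>rows3\<close> does the same for S3.\<close>

definition rows1 :: "(ix \<Rightarrow> bool) \<Rightarrow> nat \<Rightarrow> bool" where
  "rows1 d n \<longleftrightarrow> (let D = aD d; L = nL d in
     (if L = 0 then D = 2 \<and> list_ex (iso d) allix \<and> n = 1 else
     D = 2 \<and> n = 1 \<or> D = 3 \<and> L = 1 \<and> n = 1 \<or> D = 3 \<and> L = 3 \<and> n = 2 \<or>
     D = 4 \<and> L = 2 \<and> \<not> apar d \<and> n = 1 \<or> D = 4 \<and> L = 6 \<and> n = 3 \<or> D = 5 \<and> L = 3 \<and> n = 1))"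

definition rows3 :: "(ix \<Rightarrow> bool) \<Rightarrow> bool" where
  "rows3 d \<longleftrightarrow> (let D = aD d; L = nL d in
     if L = 0 then D = 6 \<and> list_ex (coiso d) allix else D = 5 \<and> L = 1 \<or> D = 6)"

text \<open>Agreement of the rule table with \<open>res\<close>. An S1-row removes all isolated
  disperse nodes if others remain, and all but one if every disperse node is isolated. In an S2- or
  S3-row, relabeling any one admissible subgraph leaves the residual pattern of a node outside the
  relabeled set. In the remaining case there is no L-face and nothing is relabeled.\<close>

definition ckT1 :: "bool \<Rightarrow> bool \<Rightarrow> nat \<Rightarrow> tb \<Rightarrow> (ix \<times> tb) list \<Rightarrow> bool" where
  "ckT1 ct st k t rs \<longleftrightarrow>
    (if rows1 (tbat t) 1 \<or> rows1 (tbat t) 2 \<or> rows1 (tbat t) 3 then \<not> ct \<and> \<not> st \<and>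
       list_all (\<lambda>n. imp (rows1 (tbat t) n) (k = n \<and> n < aD (tbat t) \<or> k = Suc n \<and> aD (tbat t) = Suc n)) [1, 2, 3]
     else if rows3 (tbat t) then ct \<and> list_ex (coiso (tbat t)) allix \<and>
       list_all (\<lambda>\<rho>. imp (coiso (tbat t) \<rho>)
         (list_ex (\<lambda>(\<tau>, r). \<tau> \<noteq> \<rho> \<and> list_all (\<lambda>\<xi>. tbat r \<xi> \<longleftrightarrow> tbat t \<xi> \<or> \<xi> = \<rho>) allix) rs)) allix
     else \<not> ct \<and>
       (if st then list_all (\<lambda>\<rho>. imp (tbat t \<rho>) (list_ex (tbat t) (nb \<rho>))) allix \<and>
         list_all (\<lambda>(\<rho>, \<tau>). imp (tbat t \<rho> \<and> tbat t \<tau>)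
          (list_all (\<lambda>\<xi>. \<xi> = \<tau> \<or> \<not> tbat t \<xi>) (nb \<rho>) \<and>
           list_ex (\<lambda>(\<sigma>, r). \<sigma> \<noteq> \<rho> \<and> \<sigma> \<noteq> \<tau> \<and> list_all (\<lambda>\<xi>. tbat r \<xi> \<longleftrightarrow> tbat t \<xi> \<and> \<xi> \<noteq> \<rho> \<and> \<xi> \<noteq> \<tau>) allix) rs)) edges
        else nL (tbat t) = 0 \<and> list_all (\<lambda>(\<sigma>, r). r = t) rs))"

definition ckT :: "tb \<Rightarrow> bool" where
  "ckT t \<longleftrightarrow> (if mixed (tbat t) then ckT1 (ctype (tbat t)) (s2type (tbat t)) (length (filter (iso (tbat t)) allix)) t
     (map (\<lambda>\<sigma>. (\<sigma>, tab (res0 (ctype (tbat t)) (s2type (tbat t)) (tbat t) \<sigma>))) (filter (\<lambda>\<sigma>. tbat t \<sigma> \<noteq> ctype (tbat t)) allix))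
    else nL (tbat t) = 0)"

lemma ckT_all: "list_all ckT alltb"
  by code_simp

fun shares_face :: "ix \<Rightarrow> ix \<Rightarrow> ix \<Rightarrow> ix \<Rightarrow> bool" where
  "shares_face (Ix x y z) (Ix x1 y1 z1) (Ix x2 y2 z2) (Ix x3 y3 z3) \<longleftrightarrow>
    x = x1 \<and> x = x2 \<and> x = x3 \<or> y = y1 \<and> y = y2 \<and> y = y3 \<or> z = z1 \<and> z = z2 \<and> z = z3"

definition crosses :: "tb \<Rightarrow> (ix \<times> ix) list" where
  "crosses r = filter (\<lambda>(\<rho>, \<tau>). \<not> tbat r \<rho> \<and> tbat r \<tau>) edges"

text \<open>\<open>S_polygon\<close> joins iso-points that share a facet, and an iso-point sitting
  at a node lies on more facets than its edge does. In the patterns of S-subgraphs this makes no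
  difference: as soon as the continuous ends share a face, the crossing edges do.\<close>

definition samef :: "tb \<Rightarrow> bool" where
  "samef r \<longleftrightarrow> list_all (\<lambda>f. \<not> aL (tbat r) f) fcs \<and> list_all (\<lambda>(\<rho>, \<tau>). list_all (\<lambda>(\<rho>', \<tau>').
     imp (shares_face \<rho> \<rho>' \<rho> \<rho>') (shares_face \<rho> \<tau> \<rho>' \<tau>')) (crosses r)) (crosses r)"

lemma samef_all:
  "list_all (\<lambda>\<sigma>. samef (tab (\<lambda>\<tau>. \<tau> = \<sigma>)) \<and> samef (tab (\<lambda>\<tau>. \<tau> \<noteq> \<sigma>)) \<and>
     list_all (\<lambda>\<rho>. samef (tab (\<lambda>\<tau>. \<tau> = \<sigma> \<or> \<tau> = \<rho>))) (nb \<sigma>)) allix"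
  by code_simp

text \<open>Two nodes lie away from a given edge in this sense; a T2-subgraph omits one of
  them.\<close>

definition t2far :: "ix \<Rightarrow> ix \<Rightarrow> ix \<Rightarrow> bool" where
  "t2far \<sigma> \<tau> \<xi> \<longleftrightarrow> \<xi> \<noteq> \<sigma> \<and> \<xi> \<noteq> \<tau> \<and> \<xi> \<notin> set (nb \<sigma>) \<and> \<xi> \<notin> set (nb \<tau>)"

lemma t2far_all: "list_all (\<lambda>(\<sigma>, \<tau>). list_all (\<lambda>\<xi>. imp (t2far \<sigma> \<tau> \<xi>)
    (list_ex (\<lambda>\<eta>. \<eta> \<noteq> \<xi> \<and> t2far \<sigma> \<tau> \<eta> \<and> list_all (\<lambda>\<rho>. imp (t2far \<sigma> \<tau> \<rho>) (\<rho> = \<xi> \<or> \<rho> = \<eta>)) allix) allix)) allix) edges"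
  by code_simp

lemma ckall_all: "list_all ckall alltb"
  by code_simp


section \<open>The checked facts as logical statements\<close>

declare cn.simps[simp del] nb.simps[simp del]

lemma imp_iff[simp]: "imp p q \<longleftrightarrow> (p \<longrightarrow> q)" by (simp add: imp_def)

lemma in_allix[simp]: "\<sigma> \<in> set allix" by (cases \<sigma>) (auto simp: allix_def)

lemma list_all_allix[simp]: "list_all P allix \<longleftrightarrow> (\<forall>\<sigma>. P \<sigma>)"
  using in_allix by (auto simp: list_all_iff)

lemma list_ex_allix[simp]: "list_ex P allix \<longleftrightarrow> (\<exists>\<sigma>. P \<sigma>)"
  using in_allix by (auto simp: list_ex_iff)

lemma list_all_nb[simp]: "list_all P (nb \<sigma>) \<longleftrightarrow> (\<forall>\<rho>. adj \<sigma> \<rho> \<longrightarrow> P \<rho>)"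
  by (auto simp: list_all_iff adj_def)

lemma list_ex_nb[simp]: "list_ex P (nb \<sigma>) \<longleftrightarrow> (\<exists>\<rho>. adj \<sigma> \<rho> \<and> P \<rho>)"
  by (auto simp: list_ex_iff adj_def)

lemma set_edges: "set edges = {(\<rho>, \<tau>). adj \<rho> \<tau>}"
  unfolding edges_def adj_def using in_allix by auto

lemma list_all_edges[simp]: "list_all (\<lambda>(\<rho>, \<tau>). P \<rho> \<tau>) edges \<longleftrightarrow> (\<forall>\<rho> \<tau>. adj \<rho> \<tau> \<longrightarrow> P \<rho> \<tau>)"
  by (auto simp: list_all_iff set_edges)

lemma list_ex_edges[simp]: "list_ex (\<lambda>(\<rho>, \<tau>). P \<rho> \<tau>) edges \<longleftrightarrow> (\<exists>\<rho> \<tau>. adj \<rho> \<tau> \<and> P \<rho> \<tau>)"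
  by (auto simp: list_ex_iff set_edges)

definition faxes :: "(3 \<times> bool) list" where
  "faxes = [(1, True), (1, False), (2, True), (2, False), (3, True), (3, False)]"

lemma fcs_eq: "fcs = map (\<lambda>(k, s). cn k s) faxes"
  by (simp add: fcs_def faxes_def fun_eq_iff cn.simps)

lemma in_faxes[simp]: "(k, s) \<in> set faxes"
  using exhaust_3[of k] by (cases s) (auto simp: faxes_def)

lemma distinct_faxes: "distinct faxes" by (simp add: faxes_def)

lemma set_fcs: "set fcs = {cn k s | k s. True}"
  unfolding fcs_eq by (force simp: image_iff)

lemma list_all_fcs[simp]: "list_all P fcs \<longleftrightarrow> (\<forall>k s. P (cn k s))"
  by (auto simp: list_all_iff set_fcs)

lemma in_alltb: "t \<in> set alltb"
proof (cases t)
  case (Tb a b c e f g h i)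
  have "(\<lambda>(a, b, c, e, f, g, h, i). Tb a b c e f g h i) (a, b, c, e, f, g, h, i) \<in> set alltb"
    unfolding alltb_def Let_def set_map
    by (rule imageI) (unfold set_product mem_Sigma_iff list.set, blast)
  then show ?thesis using Tb by simp
qed

lemma ckall: "ckall t" using ckall_all in_alltb by (auto simp: list_all_iff)

definition fcount :: "(ix \<Rightarrow> bool) \<Rightarrow> (bool \<Rightarrow> bool \<Rightarrow> ix) \<Rightarrow> nat" where
  "fcount d f = of_bool (d (f True True)) + of_bool (d (f True False)) + of_bool (d (f False True)) + of_bool (d (f False False))"

lemma fcount_le1: "fcount e f \<le> 1 \<Longrightarrow> e (f u v) \<Longrightarrow> e (f u' v') \<Longrightarrow> u = u' \<and> v = v'"
  by (cases u; cases v; cases u'; cases v') (simp_all add: fcount_def)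

lemma fcount_ge3: "3 \<le> fcount e f \<Longrightarrow> \<not> e (f u v) \<Longrightarrow> \<not> e (f u' v') \<Longrightarrow> u = u' \<and> v = v'"
  using of_bool_less_eq_one[of "e (f True True)", where 'a=nat] of_bool_less_eq_one[of "e (f True False)", where 'a=nat]
    of_bool_less_eq_one[of "e (f False True)", where 'a=nat] of_bool_less_eq_one[of "e (f False False)", where 'a=nat]
  by (cases u; cases v; cases u'; cases v') (simp_all add: fcount_def)

lemma facecount_eq: "facecount t f = fcount (tbat t) f"
  by (simp add: facecount_def fcount_def)

lemma mixed_iff: "mixed d \<longleftrightarrow> (\<exists>\<sigma>. d \<sigma>) \<and> (\<exists>\<sigma>. \<not> d \<sigma>)"
  by (simp add: mixed_def)

lemma ck1_face:
  assumes "ck1 ct t \<sigma> r" "f = cn k s"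
  shows "if aL (tbat t) f then (if ct then facecount r f \<ge> 3 else facecount r f \<le> 1)
         else facecount r f = 0 \<or> facecount r f = 4 \<or>
           tbat r (f True True) = tbat t (f True True) \<and> tbat r (f True False) = tbat t (f True False) \<and>
           tbat r (f False True) = tbat t (f False True) \<and> tbat r (f False False) = tbat t (f False False)"
proof -
  have "f \<in> set fcs" using assms(2) by (auto simp: set_fcs)
  then show ?thesis using assms(1) unfolding ck1_def list_all_iff[of _ fcs] by blast
qed

lemma ck_res:
  assumes "mixed d" "src d \<sigma>"
  shows ck1_res: "ck1 (ctype d) (tab d) \<sigma> (tab (res d \<sigma>))"
    and ck2_res: "src d \<tau> \<Longrightarrow> ck2 (ctype d) (tab d) (tab (res d \<sigma>)) (\<tau>, tab (res d \<tau>))"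
proof -
  define rs where "rs = map (\<lambda>\<sigma>. (\<sigma>, tab (res d \<sigma>))) (filter (\<lambda>\<sigma>. d \<sigma> \<noteq> ctype d) allix)"
  have "ckr (ctype d) (tab d) rs"
    using ckall[of "tab d"] assms(1) by (simp add: ckall_def ck_def rs_def res_def)
  then have *: "ck1 (ctype d) (tab d) \<sigma> r \<and> (\<forall>p\<in>set rs. ck2 (ctype d) (tab d) r p)" if "(\<sigma>, r) \<in> set rs" for \<sigma> r
    using that by (auto simp: ckr_def list_all_iff)
  have rs: "(\<sigma>, tab (res d \<sigma>)) \<in> set rs" if "src d \<sigma>" for \<sigma>
    using that by (auto simp: rs_def src_def split: if_splits)
  show "ck1 (ctype d) (tab d) \<sigma> (tab (res d \<sigma>))" using * rs assms(2) by blast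
  show "ck2 (ctype d) (tab d) (tab (res d \<sigma>)) (\<tau>, tab (res d \<tau>))" if "src d \<tau>"
    using * rs assms(2) that by blast
qed

lemma shares_face_iff: "shares_face \<rho> \<tau> \<rho>' \<tau>' \<longleftrightarrow> (\<exists>k. co k \<tau> = co k \<rho> \<and> co k \<rho>' = co k \<rho> \<and> co k \<tau>' = co k \<rho>)"
  by (cases \<rho>; cases \<tau>; cases \<rho>'; cases \<tau>') (auto simp: ex_3)

lemma samefD:
  assumes "samef (tab d)"
  shows "\<not> aL d (cn k s)"
    "adj \<rho> \<tau> \<Longrightarrow> \<not> d \<rho> \<Longrightarrow> d \<tau> \<Longrightarrow> adj \<rho>' \<tau>' \<Longrightarrow> \<not> d \<rho>' \<Longrightarrow> d \<tau>' \<Longrightarrow> co j \<rho> = co j \<rho>' \<Longrightarrow>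
      \<exists>k. co k \<tau> = co k \<rho> \<and> co k \<rho>' = co k \<rho> \<and> co k \<tau>' = co k \<rho>"
proof -
  show "\<not> aL d (cn k s)" using assms by (simp add: samef_def)
  assume h: "adj \<rho> \<tau>" "\<not> d \<rho>" "d \<tau>" "adj \<rho>' \<tau>'" "\<not> d \<rho>'" "d \<tau>'" "co j \<rho> = co j \<rho>'"
  have "(\<rho>, \<tau>) \<in> set (crosses (tab d))" "(\<rho>', \<tau>') \<in> set (crosses (tab d))"
    using h by (auto simp: crosses_def set_edges)
  moreover have "shares_face \<rho> \<rho>' \<rho> \<rho>'" using h(7) unfolding shares_face_iff by auto
  ultimately have "shares_face \<rho> \<tau> \<rho>' \<tau>'" using assms by (force simp: samef_def list_all_iff)
  then show "\<exists>k. co k \<tau> = co k \<rho> \<and> co k \<rho>' = co k \<rho> \<and> co k \<tau>' = co k \<rho>" unfolding shares_face_iff .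
qed

lemma samef_instances:
  "samef (tab (\<lambda>\<tau>. \<tau> = \<sigma>))" "samef (tab (\<lambda>\<tau>. \<tau> \<noteq> \<sigma>))"
  "adj \<sigma> \<rho> \<Longrightarrow> samef (tab (\<lambda>\<tau>. \<tau> = \<sigma> \<or> \<tau> = \<rho>))"
  using samef_all by auto

lemma t2far_two:
  assumes "adj \<sigma> \<tau>" "t2far \<sigma> \<tau> \<xi>"
  obtains \<eta> where "\<eta> \<noteq> \<xi>" "t2far \<sigma> \<tau> \<eta>" "\<And>\<rho>. t2far \<sigma> \<tau> \<rho> \<Longrightarrow> \<rho> = \<xi> \<or> \<rho> = \<eta>"
  using t2far_all assms by auto blast

lemma tab_eq: "tab d = tab d' \<longleftrightarrow> d = d'" by (metis tbat_tab)

lemma ckT: "ckT t" using ckT_all in_alltb by (auto simp: list_all_iff)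

definition keys :: "(ix \<Rightarrow> bool) \<Rightarrow> (ix \<times> tb) list" where
  "keys d = map (\<lambda>\<sigma>. (\<sigma>, tab (res d \<sigma>))) (filter (\<lambda>\<sigma>. d \<sigma> \<noteq> ctype d) allix)"

lemma in_keys: "(\<sigma>, r) \<in> set (keys d) \<longleftrightarrow> src d \<sigma> \<and> r = tab (res d \<sigma>)"
  by (auto simp: keys_def src_def)

lemma ckT1_keys: "mixed d \<Longrightarrow> ckT1 (ctype d) (s2type d) (length (filter (iso d) allix)) (tab d) (keys d)"
  using ckT[of "tab d"] by (simp add: ckT_def keys_def res_def)

lemma not_mixed_no_L: "\<not> mixed d \<Longrightarrow> nL d = 0"
  using ckT[of "tab d"] by (simp add: ckT_def)

lemma list_ex_keys: "list_ex (\<lambda>(\<sigma>, r). P \<sigma> r) (keys d) \<longleftrightarrow> (\<exists>\<sigma>. src d \<sigma> \<and> P \<sigma> (tab (res d \<sigma>)))"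
  by (auto simp: list_ex_iff in_keys)

lemma list_all_keys: "list_all (\<lambda>(\<sigma>, r). P \<sigma> r) (keys d) \<longleftrightarrow> (\<forall>\<sigma>. src d \<sigma> \<longrightarrow> P \<sigma> (tab (res d \<sigma>)))"
  by (auto simp: list_all_iff in_keys)

lemma rows1_n: "rows1 d n \<Longrightarrow> n = 1 \<or> n = 2 \<or> n = 3"
  by (auto simp: rows1_def Let_def split: if_splits)

lemma rows1_facts:
  assumes "mixed d" "rows1 d n"
  shows "\<not> ctype d" "\<not> s2type d"
    "length (filter (iso d) allix) = n \<and> n < aD d \<or> length (filter (iso d) allix) = Suc n \<and> aD d = Suc n"
proof -
  have c: "rows1 d 1 \<or> rows1 d 2 \<or> rows1 d 3" using assms(2) rows1_n by blast
  let ?P = "\<lambda>n. imp (rows1 d n) (length (filter (iso d) allix) = n \<and> n < aD d \<or> length (filter (iso d) allix) = Suc n \<and> aD d = Suc n)"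
  have *: "\<not> ctype d \<and> \<not> s2type d \<and> list_all ?P [1, 2, 3]"
    using ckT1_keys[OF assms(1)] unfolding ckT1_def tbat_tab if_P[OF c] .
  then have "?P n" using rows1_n[OF assms(2)] unfolding list_all_iff by fastforce
  then show "\<not> ctype d" "\<not> s2type d"
    "length (filter (iso d) allix) = n \<and> n < aD d \<or> length (filter (iso d) allix) = Suc n \<and> aD d = Suc n"
    using * assms(2) unfolding imp_iff by blast+
qed

lemma rows3_not_1: "rows3 d \<Longrightarrow> \<not> rows1 d n"
  by (cases "nL d = 0") (auto simp: rows1_def rows3_def Let_def)

lemma s2type_not: "s2type d \<Longrightarrow> \<not> rows1 d n" "s2type d \<Longrightarrow> \<not> rows3 d"
  by (auto simp: rows1_def rows3_def s2type_def Let_def)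

lemma rows3_facts:
  assumes "mixed d" "rows3 d"
  shows "ctype d" "\<exists>\<rho>. coiso d \<rho>"
    "coiso d \<rho> \<Longrightarrow> \<exists>\<tau>. src d \<tau> \<and> \<tau> \<noteq> \<rho> \<and> (\<forall>\<xi>. res d \<tau> \<xi> \<longleftrightarrow> d \<xi> \<or> \<xi> = \<rho>)"
  using ckT1_keys[OF assms(1)] assms(2) rows3_not_1[OF assms(2)] unfolding ckT1_def tbat_tab list_ex_keys
  by (simp_all)

lemma s2type_facts:
  assumes "mixed d" "s2type d"
  shows "\<not> ctype d" "d \<rho> \<Longrightarrow> \<exists>\<tau>. adj \<rho> \<tau> \<and> d \<tau>"
    "adj \<rho> \<tau> \<Longrightarrow> d \<rho> \<Longrightarrow> d \<tau> \<Longrightarrow> adj \<rho> \<xi> \<Longrightarrow> \<xi> = \<tau> \<or> \<not> d \<xi>"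
    "adj \<rho> \<tau> \<Longrightarrow> d \<rho> \<Longrightarrow> d \<tau> \<Longrightarrow> \<exists>\<sigma>. src d \<sigma> \<and> \<sigma> \<noteq> \<rho> \<and> \<sigma> \<noteq> \<tau> \<and> (\<forall>\<xi>. res d \<sigma> \<xi> \<longleftrightarrow> d \<xi> \<and> \<xi> \<noteq> \<rho> \<and> \<xi> \<noteq> \<tau>)"
  using ckT1_keys[OF assms(1)] assms(2) s2type_not[OF assms(2)] unfolding ckT1_def tbat_tab list_ex_keys
  by (simp_all)

lemma plain_facts:
  assumes "mixed d" "\<And>n. \<not> rows1 d n" "\<not> rows3 d" "\<not> s2type d"
  shows "\<not> ctype d" "nL d = 0" "src d \<sigma> \<Longrightarrow> res d \<sigma> = d"
  using ckT1_keys[OF assms(1)] assms(2-4) unfolding ckT1_def tbat_tab list_all_keys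
  by (simp_all add: tab_eq)

context
  fixes d :: "ix \<Rightarrow> bool" and \<sigma> :: ix
  assumes mx: "mixed d" and sr: "src d \<sigma>"
begin

lemma res_cross: "adj \<rho> \<tau> \<Longrightarrow> \<not> res d \<sigma> \<rho> \<Longrightarrow> res d \<sigma> \<tau> \<Longrightarrow> \<not> d \<rho> \<and> d \<tau>"
  using ck1_res[OF mx sr] by (simp add: ck1_def)

lemma res_mono: "ctype d \<Longrightarrow> d \<tau> \<Longrightarrow> res d \<sigma> \<tau>" "\<not> ctype d \<Longrightarrow> res d \<sigma> \<tau> \<Longrightarrow> d \<tau>"
  using ck1_res[OF mx sr] by (auto simp: ck1_def)

lemma res_self: "res d \<sigma> \<sigma> \<longleftrightarrow> \<not> ctype d"
  using ck1_res[OF mx sr] by (simp add: ck1_def split: if_splits)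

lemma res_no_L: "\<not> aL (res d \<sigma>) (cn k s)"
  using ck1_res[OF mx sr] by (simp add: ck1_def)

lemma res_L:
  assumes "aL d (cn k s)" "res d \<sigma> (cn k s u v) \<noteq> ctype d" "res d \<sigma> (cn k s u' v') \<noteq> ctype d"
  shows "u = u' \<and> v = v'"
proof -
  have *: "if ctype d then 3 \<le> fcount (res d \<sigma>) (cn k s) else fcount (res d \<sigma>) (cn k s) \<le> 1"
    using ck1_face[OF ck1_res[OF mx sr] refl, of k s] assms(1)
    unfolding facecount_eq tbat_tab by (simp only: if_True)
  show ?thesis
  proof (cases "ctype d")
    case True
    then show ?thesis using * assms(2,3) fcount_ge3[of "res d \<sigma>" "cn k s" u v u' v'] by simp
  next
    case False
    then show ?thesis using * assms(2,3) fcount_le1[of "res d \<sigma>" "cn k s" u v u' v'] by simp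
  qed
qed

lemma res_not_L:
  assumes "\<not> aL d (cn k s)"
  shows "(\<forall>u v. res d \<sigma> (cn k s u v)) \<or> (\<forall>u v. \<not> res d \<sigma> (cn k s u v)) \<or>
    (\<forall>u v. res d \<sigma> (cn k s u v) = d (cn k s u v))"
proof -
  define p where "p u v = res d \<sigma> (cn k s u v)" for u v
  have *: "fcount (res d \<sigma>) (cn k s) = 0 \<or> fcount (res d \<sigma>) (cn k s) = 4 \<or>
     p True True = d (cn k s True True) \<and> p True False = d (cn k s True False) \<and>
     p False True = d (cn k s False True) \<and> p False False = d (cn k s False False)"
    using ck1_face[OF ck1_res[OF mx sr] refl, of k s] assms(1)
    unfolding facecount_eq p_def tbat_tab by (simp only: if_False)
  have "fcount (res d \<sigma>) (cn k s) = of_bool (p True True) + of_bool (p True False) + of_bool (p False True) + of_bool (p False False)"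
    by (simp add: fcount_def p_def)
  with * have "(\<forall>u v. p u v) \<or> (\<forall>u v. \<not> p u v) \<or> (\<forall>u v. p u v = d (cn k s u v))"
    unfolding all_bool_eq by (cases "p True True"; cases "p True False"; cases "p False True"; cases "p False False") simp_all
  then show ?thesis by (simp add: p_def)
qed

lemma res_faces:
  "3 \<le> length (filter (\<lambda>f. fcount (res d \<sigma>) f = 1 \<or> fcount (res d \<sigma>) f = 2) fcs) \<or>
      aD (res d \<sigma>) = 7 \<or>
      aD (res d \<sigma>) = 6 \<and> (\<exists>\<rho> \<tau>. adj \<rho> \<tau> \<and> \<not> res d \<sigma> \<rho> \<and> \<not> res d \<sigma> \<tau>)"
  using ck1_res[OF mx sr] by (simp add: ck1_def facecount_eq)

lemma res_unique: "src d \<tau> \<Longrightarrow> res d \<sigma> \<tau> \<noteq> ctype d \<Longrightarrow> res d \<tau> = res d \<sigma>"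
  using ck2_res[OF mx sr, of \<tau>] by (simp add: ck2_def) (metis tbat_tab)

lemma res_bnd:
  assumes "src d \<tau>" "res d \<sigma> \<tau> = ctype d" "\<not> ctype d"
    "\<And>\<rho>. (\<not> res d \<sigma> \<rho> \<and> (\<exists>\<tau>'. adj \<rho> \<tau>' \<and> res d \<sigma> \<tau>')) = (\<not> res d \<tau> \<rho> \<and> (\<exists>\<tau>'. adj \<rho> \<tau>' \<and> res d \<tau> \<tau>'))"
  shows "aD d = 4 \<and> (\<forall>\<rho>. \<not> d \<rho> \<longrightarrow> (\<not> res d \<sigma> \<rho> \<and> (\<exists>\<tau>'. adj \<rho> \<tau>' \<and> res d \<sigma> \<tau>')) \<and> length (filter d (nb \<rho>)) = 2) \<or>
    (\<exists>\<rho>. \<not> res d \<sigma> \<rho> \<and> (\<exists>\<tau>'. adj \<rho> \<tau>' \<and> res d \<sigma> \<tau>') \<and> coiso d \<rho>)"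
proof -
  have 1: "bnd (tab (res d \<sigma>)) \<rho> = (\<not> res d \<sigma> \<rho> \<and> (\<exists>\<tau>'. adj \<rho> \<tau>' \<and> res d \<sigma> \<tau>'))" for \<rho>
    by (simp add: bnd_def)
  have 2: "bnd (tab (res d \<tau>)) \<rho> = (\<not> res d \<tau> \<rho> \<and> (\<exists>\<tau>'. adj \<rho> \<tau>' \<and> res d \<tau> \<tau>'))" for \<rho>
    by (simp add: bnd_def)
  have "list_all (\<lambda>\<rho>. bnd (tab (res d \<sigma>)) \<rho> = bnd (tab (res d \<tau>)) \<rho>) allix"
    unfolding list_all_allix 1 2 using assms(4) by blast
  moreover have "\<not> tbat (tab (res d \<sigma>)) \<tau> \<noteq> ctype d" using assms(2) by simp
  ultimately have "aD (tbat (tab d)) = 4 \<and> list_all (\<lambda>\<rho>. imp (\<not> tbat (tab d) \<rho>) (bnd (tab (res d \<sigma>)) \<rho> \<and> length (filter (tbat (tab d)) (nb \<rho>)) = 2)) allix \<or>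
         list_ex (\<lambda>\<rho>. bnd (tab (res d \<sigma>)) \<rho> \<and> coiso (tbat (tab d)) \<rho>) allix"
    using ck2_res[OF mx sr assms(1)] assms(3) unfolding ck2_def imp_iff by (simp only: prod.case if_False) blast
  then show ?thesis unfolding tbat_tab list_all_allix list_ex_allix imp_iff 1 by blast
qed

end

section \<open>Corners of a face and the translation of graphs into patterns\<close>

lemma co_cn[simp]: "co k (cn k s u v) = s"
  using exhaust_3[of k] by (auto simp: cn.simps)

lemma co_iff_cn: "co k \<sigma> = s \<longleftrightarrow> (\<exists>u v. \<sigma> = cn k s u v)"
proof
  assume "co k \<sigma> = s"
  moreover obtain x y z where "\<sigma> = Ix x y z" by (cases \<sigma>)
  ultimately show "\<exists>u v. \<sigma> = cn k s u v" using exhaust_3[of k] by (auto simp: cn.simps split: if_splits)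
qed auto

lemma cn_eq[simp]: "cn k s u v = cn k s' u' v' \<longleftrightarrow> s = s' \<and> u = u' \<and> v = v'"
  using exhaust_3[of k] by (auto simp: cn.simps)

lemma adj_cn[simp]: "adj (cn k s u v) (cn k s u' v') \<longleftrightarrow> (u = u') \<noteq> (v = v')"
  using exhaust_3[of k] by (auto simp: cn.simps adj_def nb.simps)

lemma fcount_card: "card {\<sigma>. co k \<sigma> = s \<and> d \<sigma>} = fcount d (cn k s)"
proof -
  define S where "S u v = (if d (cn k s u v) then {cn k s u v} else {})" for u v
  have "{\<sigma>. co k \<sigma> = s \<and> d \<sigma>} = S True True \<union> S True False \<union> S False True \<union> S False False" (is "?A = ?B")
  proof (rule set_eqI)
    fix \<sigma>
    have "\<sigma> \<in> ?A \<longleftrightarrow> (\<exists>u v. \<sigma> = cn k s u v \<and> d (cn k s u v))" by (auto simp: co_iff_cn)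
    also have "\<dots> \<longleftrightarrow> (\<exists>u v. \<sigma> \<in> S u v)" by (auto simp: S_def)
    finally show "\<sigma> \<in> ?A \<longleftrightarrow> \<sigma> \<in> ?B" by (simp add: ex_bool_eq disj_ac)
  qed
  then show ?thesis
    by (cases "d (cn k s True True)"; cases "d (cn k s True False)"; cases "d (cn k s False True)"; cases "d (cn k s False False)")
      (simp_all add: S_def fcount_def del: Collect_empty_eq card_eq_0_iff)
qed

text \<open>The predicate \<open>z\<close> marks the nodes with label c. It matters for faces with
  three disperse corners only, which are singular if the fourth corner is an iso-node.\<close>

definition areg :: "(ix \<Rightarrow> bool) \<Rightarrow> (ix \<Rightarrow> bool) \<Rightarrow> (bool \<Rightarrow> bool \<Rightarrow> ix) \<Rightarrow> bool" where
  "areg d z f \<longleftrightarrow> \<not> aL d f \<and> (\<exists>u v. d (f u v)) \<and> (\<exists>u v. \<not> d (f u v)) \<and>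
     \<not> (fcount d f = 3 \<and> (\<exists>u v. \<not> d (f u v) \<and> z (f u v)))"

lemma distinct_allix: "distinct allix" by (simp add: allix_def)

lemma card_aD: "card {\<sigma>. d \<sigma>} = aD d"
proof -
  have "{\<sigma>. d \<sigma>} = set (filter d allix)" by auto
  then show ?thesis unfolding aD_def using distinct_card[OF distinct_filter[OF distinct_allix]] by metis
qed

locale cubc = cub +
  fixes c :: real
  assumes c01: "0 < c" "c < 1"
begin

definition Gr :: "(point \<Rightarrow> real) \<Rightarrow> lcg" where "Gr t = \<lparr>cuboid = cbox a b, label = t\<rparr>"
definition dd :: "(point \<Rightarrow> real) \<Rightarrow> ix \<Rightarrow> bool" where "dd t \<sigma> \<longleftrightarrow> c < t (V a b \<sigma>)"
definition zz :: "(point \<Rightarrow> real) \<Rightarrow> ix \<Rightarrow> bool" where "zz t \<sigma> \<longleftrightarrow> t (V a b \<sigma>) = c"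
definition ip :: "(point \<Rightarrow> real) \<Rightarrow> ix \<Rightarrow> ix \<Rightarrow> point" where
  "ip t \<rho> \<tau> = iso_point c (Gr t) (V a b \<rho>) (V a b \<tau>)"
text \<open>The pattern \<open>d\<close> selects the crossing edges while the iso-points come from
  \<open>t\<close>, and \<open>d\<close> may differ from the pattern of \<open>t\<close>. So lines
  of a relabeled graph can be written with the labels before the relabeling.\<close>

definition line :: "(point \<Rightarrow> real) \<Rightarrow> (ix \<Rightarrow> bool) \<Rightarrow> 3 \<Rightarrow> bool \<Rightarrow> point set" where
  "line t d k s = {ip t \<rho> \<tau> | \<rho> \<tau>. co k \<rho> = s \<and> co k \<tau> = s \<and> adj \<rho> \<tau> \<and> \<not> d \<rho> \<and> d \<tau>}"

lemma Gr_simps[simp]: "cuboid (Gr t) = cbox a b" "label (Gr t) = t" by (simp_all add: Gr_def)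

lemma V_nodes[simp]: "V a b \<sigma> \<in> nodes (cbox a b)" by (simp add: nodes_eq)

lemma disperse_V[simp]: "disperse c (Gr t) (V a b \<sigma>) \<longleftrightarrow> dd t \<sigma>" by (simp add: disperse_def dd_def)
lemma continuous_V[simp]: "continuous_node c (Gr t) (V a b \<sigma>) \<longleftrightarrow> \<not> dd t \<sigma>"
  by (auto simp: continuous_node_def dd_def)

lemma disperse_iff: "disperse c (Gr t) P \<longleftrightarrow> (\<exists>\<sigma>. P = V a b \<sigma> \<and> dd t \<sigma>)"
  by (auto simp: disperse_def nodes_eq dd_def)
lemma continuous_iff: "continuous_node c (Gr t) P \<longleftrightarrow> (\<exists>\<sigma>. P = V a b \<sigma> \<and> \<not> dd t \<sigma>)"
  by (auto simp: continuous_node_def nodes_eq dd_def)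

lemma disperse_nodes_eq: "disperse_nodes c (Gr t) = V a b ` {\<sigma>. dd t \<sigma>}"
  by (auto simp: disperse_nodes_def disperse_iff)

lemma inj_V: "inj_on (V a b) A" by (simp add: inj_on_def)

lemma num_disperse_eq: "num_disperse c (Gr t) = aD (dd t)"
  by (simp add: num_disperse_def disperse_nodes_eq card_image inj_V card_aD)

lemma bface_inj[simp]: "bface a b k s = bface a b k' s' \<longleftrightarrow> k = k' \<and> s = s'"
proof
  assume e: "bface a b k s = bface a b k' s'"
  have *: "co k' \<sigma> = s'" if "co k \<sigma> = s" for \<sigma>
    using that V_bface[of \<sigma> k s] V_bface[of \<sigma> k' s'] unfolding e by simp
  show "k = k' \<and> s = s'"
  proof (rule ccontr)
    assume n: "\<not> (k = k' \<and> s = s')"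
    \<comment> \<open>A corner of the first face that avoids the second one unless the two faces are
      the same.\<close>
    obtain \<sigma> where "\<forall>j. co j \<sigma> = (if j = k then s else \<not> s')" using ix_of_fun[of "\<lambda>j. if j = k then s else \<not> s'"] by blast
    then show False using *[of \<sigma>] n by (auto split: if_splits)
  qed
qed simp

lemma bface_disperse: "{P \<in> bface a b k s. disperse c (Gr t) P} = V a b ` {\<sigma>. co k \<sigma> = s \<and> dd t \<sigma>}"
  by (auto simp: disperse_iff)
lemma bface_continuous: "{P \<in> bface a b k s. continuous_node c (Gr t) P} = V a b ` {\<sigma>. co k \<sigma> = s \<and> \<not> dd t \<sigma>}"
  by (auto simp: continuous_iff)

lemma L_face_iff: "bface a b k s \<in> L_faces c (Gr t) \<longleftrightarrow> aL (dd t) (cn k s)"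
proof -
  define p where "p u v = dd t (cn k s u v)" for u v
  have inc: "(\<forall>P\<in>bface a b k s. \<forall>Q\<in>bface a b k s. disperse c (Gr t) P \<and> disperse c (Gr t) Q \<longrightarrow>
      \<not> incident (cbox a b) P Q) \<longleftrightarrow> (\<forall>\<rho> \<tau>. co k \<rho> = s \<and> co k \<tau> = s \<and> dd t \<rho> \<and> dd t \<tau> \<longrightarrow> \<not> adj \<rho> \<tau>)"
    (is "?l = ?r")
  proof
    assume l: ?l
    show ?r
    proof (intro allI impI)
      fix \<rho> \<tau> assume "co k \<rho> = s \<and> co k \<tau> = s \<and> dd t \<rho> \<and> dd t \<tau>"
      then show "\<not> adj \<rho> \<tau>" using l[rule_format, of "V a b \<rho>" "V a b \<tau>"] by simp
    qed
  next
    assume r: ?r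
    show ?l
    proof (intro ballI impI)
      fix P Q assume h: "P \<in> bface a b k s" "Q \<in> bface a b k s" "disperse c (Gr t) P \<and> disperse c (Gr t) Q"
      then obtain \<rho> \<tau> where "P = V a b \<rho>" "Q = V a b \<tau>" "dd t \<rho>" "dd t \<tau>" unfolding disperse_iff by blast
      then show "\<not> incident (cbox a b) P Q" using r[rule_format, of \<rho> \<tau>] h by simp
    qed
  qed
  have fac: "bface a b k s facet_of cbox a b" unfolding facet_iff by (intro exI) (rule refl)
  have "bface a b k s \<in> L_faces c (Gr t) \<longleftrightarrow> fcount (dd t) (cn k s) = 2 \<and> fcount (\<lambda>\<sigma>. \<not> dd t \<sigma>) (cn k s) = 2 \<and>
      (\<forall>\<rho> \<tau>. co k \<rho> = s \<and> co k \<tau> = s \<and> dd t \<rho> \<and> dd t \<tau> \<longrightarrow> \<not> adj \<rho> \<tau>)"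
    unfolding L_faces_def mem_Collect_eq bface_disperse bface_continuous
    unfolding Gr_simps inc by (simp only: card_image[OF inj_V] fcount_card fac simp_thms)
  also have "(\<forall>\<rho> \<tau>. co k \<rho> = s \<and> co k \<tau> = s \<and> dd t \<rho> \<and> dd t \<tau> \<longrightarrow> \<not> adj \<rho> \<tau>) \<longleftrightarrow>
     (\<forall>u v u' v'. p u v \<and> p u' v' \<longrightarrow> (u = u') = (v = v'))"
    (is "?l = ?r")
  proof
    assume l: ?l
    show ?r unfolding p_def
    proof (intro allI impI)
      fix u v u' v' assume "dd t (cn k s u v) \<and> dd t (cn k s u' v')"
      then show "(u = u') = (v = v')" using l[rule_format, of "cn k s u v" "cn k s u' v'"] by simp
    qed
  next
    assume r: ?r
    show ?l
    proof (intro allI impI)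
      fix \<rho> \<tau> assume h: "co k \<rho> = s \<and> co k \<tau> = s \<and> dd t \<rho> \<and> dd t \<tau>"
      obtain u v where "\<rho> = cn k s u v" using h co_iff_cn[of k \<rho> s] by auto
      moreover obtain u' v' where "\<tau> = cn k s u' v'" using h co_iff_cn[of k \<tau> s] by auto
      ultimately show "\<not> adj \<rho> \<tau>" using r[rule_format, of u v u' v'] h by (simp add: p_def)
    qed
  qed
  also have "fcount (dd t) (cn k s) = 2 \<and> fcount (\<lambda>\<sigma>. \<not> dd t \<sigma>) (cn k s) = 2 \<and> \<dots> \<longleftrightarrow> aL (dd t) (cn k s)"
    unfolding fcount_def aL_def p_def[symmetric]
    by (cases "p True True"; cases "p True False"; cases "p False True"; cases "p False False") (simp_all add: all_bool_eq)
  finally show ?thesis .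
qed

lemma L_faces_eq: "L_faces c (Gr t) = {bface a b k s | k s. aL (dd t) (cn k s)}"
proof (intro equalityI subsetI)
  fix M assume M: "M \<in> L_faces c (Gr t)"
  then have "M facet_of cbox a b" by (simp add: L_faces_def)
  then obtain k s where "M = bface a b k s" using facet_iff by blast
  then show "M \<in> {bface a b k s | k s. aL (dd t) (cn k s)}" using M L_face_iff by blast
qed (use L_face_iff in blast)

lemma L_faces_image: "L_faces c (Gr t) = (\<lambda>(k, s). bface a b k s) ` set (filter (\<lambda>(k, s). aL (dd t) (cn k s)) faxes)"
  unfolding L_faces_eq by (auto simp: image_iff)

lemma card_L: "card (L_faces c (Gr t)) = nL (dd t)"
proof -
  have "inj_on (\<lambda>(k, s). bface a b k s) A" for A by (auto simp: inj_on_def)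
  then have "card (L_faces c (Gr t)) = card (set (filter (\<lambda>(k, s). aL (dd t) (cn k s)) faxes))"
    unfolding L_faces_image by (rule card_image)
  also have "\<dots> = length (filter (\<lambda>(k, s). aL (dd t) (cn k s)) faxes)"
    by (rule distinct_card) (simp add: distinct_faxes)
  also have "\<dots> = nL (dd t)"
    by (simp add: nL_def fcs_eq filter_map comp_def case_prod_unfold)
  finally show ?thesis .
qed

lemma L_empty: "L_faces c (Gr t) = {} \<longleftrightarrow> nL (dd t) = 0"
proof -
  have "finite (L_faces c (Gr t))" unfolding L_faces_image by simp
  then show ?thesis using card_0_eq[of "L_faces c (Gr t)"] unfolding card_L by blast
qed

lemma parallel_iff: "parallel_faces (Gr t) (bface a b k s) (bface a b k' s') \<longleftrightarrow> k = k' \<and> s' = (\<not> s)"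
proof
  assume p: "parallel_faces (Gr t) (bface a b k s) (bface a b k' s')"
  then have n: "\<not> (co k \<sigma> = s \<and> co k' \<sigma> = s')" for \<sigma>
    using V_nodes[of \<sigma>] V_bface[of \<sigma>] unfolding parallel_faces_def Gr_simps by blast
  show "k = k' \<and> s' = (\<not> s)"
  proof (cases "k = k'")
    case True then show ?thesis using n[of "cn k s True True"] by (cases "s = s'") auto
  next
    case False
    obtain \<sigma> where "\<forall>j. co j \<sigma> = (if j = k then s else s')" using ix_of_fun[of "\<lambda>j. if j = k then s else s'"] by blast
    then show ?thesis using n[of \<sigma>] False by auto
  qed
qed (auto simp: parallel_faces_def bface_def)

lemma apar_iff: "apar d \<longleftrightarrow> (\<exists>k. aL d (cn k True) \<and> aL d (cn k False))"
  unfolding apar_def fcs_eq faxes_def ex_3 by simp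

lemma par_iff: "(\<exists>M\<in>L_faces c (Gr t). \<exists>M'\<in>L_faces c (Gr t). parallel_faces (Gr t) M M') \<longleftrightarrow> apar (dd t)"
proof -
  have "(\<exists>M\<in>L_faces c (Gr t). \<exists>M'\<in>L_faces c (Gr t). parallel_faces (Gr t) M M') \<longleftrightarrow>
    (\<exists>k s k' s'. aL (dd t) (cn k s) \<and> aL (dd t) (cn k' s') \<and> k = k' \<and> s' = (\<not> s))"
    unfolding L_faces_eq using parallel_iff by blast
  also have "\<dots> \<longleftrightarrow> apar (dd t)" unfolding apar_iff by (metis (full_types))
  finally show ?thesis .
qed

lemma iso_node_V: "iso_node c (Gr t) (V a b \<sigma>) \<longleftrightarrow> zz t \<sigma> \<and> (\<exists>\<tau>. adj \<sigma> \<tau> \<and> dd t \<tau>)"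
  unfolding iso_node_def by (auto simp: zz_def incident_iff disperse_iff)

lemma fcount_3: "fcount d f = 3 \<longleftrightarrow> (\<exists>u v. \<not> d (f u v) \<and> (\<forall>u' v'. (u', v') \<noteq> (u, v) \<longrightarrow> d (f u' v')))"
  unfolding fcount_def ex_bool_eq all_bool_eq
  by (cases "d (f True True)"; cases "d (f True False)"; cases "d (f False True)"; cases "d (f False False)") simp_all

lemma zz_not_dd: "zz t \<sigma> \<Longrightarrow> \<not> dd t \<sigma>" by (simp add: zz_def dd_def)

text \<open>The one continuous corner of such a face has disperse neighbors within the face, so
  being an iso-node reduces to having label c.\<close>

lemma singular_iff: "singular_face c (Gr t) (bface a b k s) \<longleftrightarrow>
    fcount (dd t) (cn k s) = 3 \<and> (\<exists>u v. \<not> dd t (cn k s u v) \<and> zz t (cn k s u v))"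
proof (cases "fcount (dd t) (cn k s) = 3")
  case True
  then obtain u v where uv: "\<not> dd t (cn k s u v)" "\<And>u' v'. (u', v') \<noteq> (u, v) \<Longrightarrow> dd t (cn k s u' v')"
    unfolding fcount_3 by blast
  have "iso_node c (Gr t) P \<and> P \<in> bface a b k s \<longleftrightarrow> P = V a b (cn k s u v) \<and> zz t (cn k s u v)" for P
  proof
    assume P: "iso_node c (Gr t) P \<and> P \<in> bface a b k s"
    then obtain \<sigma> where \<sigma>: "P = V a b \<sigma>" by (auto simp: iso_node_def nodes_eq)
    then obtain u' v' where "\<sigma> = cn k s u' v'" using P co_iff_cn by auto
    then show "P = V a b (cn k s u v) \<and> zz t (cn k s u v)"
      using P \<sigma> uv(2)[of u' v'] zz_not_dd[of t \<sigma>] by (cases "(u', v') = (u, v)") (auto simp: iso_node_V)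
  next
    assume "P = V a b (cn k s u v) \<and> zz t (cn k s u v)"
    moreover have "adj (cn k s u v) (cn k s (\<not> u) v)" "dd t (cn k s (\<not> u) v)" using uv(2)[of "\<not> u" v] by auto
    ultimately show "iso_node c (Gr t) P \<and> P \<in> bface a b k s" using iso_node_V V_bface co_cn by metis
  qed
  then have "{P \<in> bface a b k s. iso_node c (Gr t) P} = (if zz t (cn k s u v) then {V a b (cn k s u v)} else {})"
    by auto
  then have "card {P \<in> bface a b k s. iso_node c (Gr t) P} = 1 \<longleftrightarrow> zz t (cn k s u v)" by auto
  moreover have "card {P \<in> bface a b k s. disperse c (Gr t) P} = 3"
    unfolding bface_disperse using True by (simp add: card_image inj_V fcount_card)
  moreover have "(\<exists>u v. \<not> dd t (cn k s u v) \<and> zz t (cn k s u v)) \<longleftrightarrow> zz t (cn k s u v)"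
    using uv by (metis prod.inject)
  ultimately show ?thesis using True by (auto simp: singular_face_def facet_iff)
next
  case False
  then show ?thesis unfolding singular_face_def bface_disperse by (simp add: card_image inj_V fcount_card)
qed

lemma bface_nodes: "bface a b k s \<inter> nodes (cbox a b) = {V a b (cn k s u v) | u v. True}"
proof (intro equalityI subsetI)
  fix P assume P: "P \<in> bface a b k s \<inter> nodes (cbox a b)"
  then obtain \<sigma> where "P = V a b \<sigma>" by (auto simp: nodes_eq)
  then show "P \<in> {V a b (cn k s u v) | u v. True}" using P co_iff_cn[of k \<sigma> s] by auto
qed auto

lemma regular_face_iff: "regular_face c (Gr t) (bface a b k s) \<longleftrightarrow> areg (dd t) (zz t) (cn k s)"
proof -
  have 1: "(\<forall>P\<in>bface a b k s \<inter> nodes (cuboid (Gr t)). disperse c (Gr t) P) \<longleftrightarrow> (\<forall>u v. dd t (cn k s u v))"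
    unfolding Gr_simps bface_nodes by fastforce
  have 2: "(\<forall>P\<in>bface a b k s \<inter> nodes (cuboid (Gr t)). continuous_node c (Gr t) P) \<longleftrightarrow> (\<forall>u v. \<not> dd t (cn k s u v))"
    unfolding Gr_simps bface_nodes by fastforce
  have 3: "bface a b k s facet_of cuboid (Gr t)" unfolding Gr_simps facet_iff by blast
  show ?thesis unfolding regular_face_def 1 2 singular_iff L_face_iff areg_def using 3 by blast
qed

lemma face_iso_points_eq: "face_iso_points c (Gr t) (bface a b k s) = line t (dd t) k s"
  unfolding face_iso_points_def line_def ip_def by (fastforce simp: incident_iff)

lemma C_polygon_eq: "C_polygon c (Gr t) = {line t (dd t) k s | k s. areg (dd t) (zz t) (cn k s)}"
proof -
  have *: "regular_face c (Gr t) M \<longleftrightarrow> (\<exists>k s. M = bface a b k s \<and> areg (dd t) (zz t) (cn k s))" for M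
  proof
    assume r: "regular_face c (Gr t) M"
    then obtain k s where "M = bface a b k s" using facet_iff by (auto simp: regular_face_def)
    then show "\<exists>k s. M = bface a b k s \<and> areg (dd t) (zz t) (cn k s)" using r regular_face_iff by blast
  qed (use regular_face_iff in blast)
  show ?thesis
  proof (intro equalityI subsetI)
    fix l assume "l \<in> C_polygon c (Gr t)"
    then obtain M where "l = face_iso_points c (Gr t) M" "regular_face c (Gr t) M" unfolding C_polygon_def by blast
    moreover from this(2) obtain k s where "M = bface a b k s" "areg (dd t) (zz t) (cn k s)" using * by blast
    ultimately show "l \<in> {line t (dd t) k s | k s. areg (dd t) (zz t) (cn k s)}" using face_iso_points_eq by blast
  next
    fix l assume "l \<in> {line t (dd t) k s | k s. areg (dd t) (zz t) (cn k s)}"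
    then obtain k s where "l = line t (dd t) k s" "areg (dd t) (zz t) (cn k s)" by blast
    then show "l \<in> C_polygon c (Gr t)" unfolding C_polygon_def
      using face_iso_points_eq[symmetric] regular_face_iff by blast
  qed
qed

end

section \<open>Iso-points, iso-lines and the polygon of a pattern\<close>

lemma side_nth: "(V a b \<rho> + l *\<^sub>R (V a b \<tau> - V a b \<rho>)) $ k =
    side a b k (co k \<rho>) + l * (side a b k (co k \<tau>) - side a b k (co k \<rho>))"
  by simp

definition cross :: "(ix \<Rightarrow> bool) \<Rightarrow> ix \<Rightarrow> ix \<Rightarrow> bool" where
  "cross d \<rho> \<tau> \<longleftrightarrow> adj \<rho> \<tau> \<and> \<not> d \<rho> \<and> d \<tau>"

lemma fcount_cases:
  assumes "\<not> aL d f" "\<exists>u v. d (f u v)" "\<exists>u v. \<not> d (f u v)"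
  obtains (one) u v where "d (f u v)" "\<not> d (f (\<not> u) v)" "\<not> d (f u (\<not> v))" "\<not> d (f (\<not> u) (\<not> v))"
  | (three) u v where "\<not> d (f u v)" "d (f (\<not> u) v)" "d (f u (\<not> v))" "d (f (\<not> u) (\<not> v))"
  | (two1) u where "\<And>v. d (f u v)" "\<And>v. \<not> d (f (\<not> u) v)"
  | (two2) v where "\<And>u. d (f u v)" "\<And>u. \<not> d (f u (\<not> v))"
proof -
  define p where "p u v = d (f u v)" for u v
  have "\<not> (p False False = p True True \<and> p False True = p True False \<and> p False False \<noteq> p False True)"
    "\<exists>u v. p u v" "\<exists>u v. \<not> p u v" using assms by (auto simp: aL_def p_def)
  then have "(\<exists>u v. p u v \<and> \<not> p (\<not> u) v \<and> \<not> p u (\<not> v) \<and> \<not> p (\<not> u) (\<not> v)) \<or>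
     (\<exists>u v. \<not> p u v \<and> p (\<not> u) v \<and> p u (\<not> v) \<and> p (\<not> u) (\<not> v)) \<or>
     (\<exists>u. \<forall>v. p u v \<and> \<not> p (\<not> u) v) \<or> (\<exists>v. \<forall>u. p u v \<and> \<not> p u (\<not> v))"
    unfolding ex_bool_eq all_bool_eq
    by (cases "p True True"; cases "p True False"; cases "p False True"; cases "p False False") simp_all
  then show thesis using that unfolding p_def by blast
qed

context cubc begin

definition lam :: "(point \<Rightarrow> real) \<Rightarrow> ix \<Rightarrow> ix \<Rightarrow> real" where
  "lam t \<rho> \<tau> = (c - t (V a b \<rho>)) / (t (V a b \<tau>) - t (V a b \<rho>))"

lemma ip_lam: "ip t \<rho> \<tau> = V a b \<rho> + lam t \<rho> \<tau> *\<^sub>R (V a b \<tau> - V a b \<rho>)"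
  by (simp add: ip_def iso_point_def lam_def)

lemma lam_bounds:
  assumes "\<not> dd t \<rho>" "dd t \<tau>"
  shows "0 \<le> lam t \<rho> \<tau>" "lam t \<rho> \<tau> < 1" "lam t \<rho> \<tau> = 0 \<longleftrightarrow> zz t \<rho>"
  using assms by (auto simp: lam_def dd_def zz_def divide_simps)

lemma ip_segment:
  assumes "\<not> dd t \<rho>" "dd t \<tau>"
  shows "ip t \<rho> \<tau> \<in> closed_segment (V a b \<rho>) (V a b \<tau>)"
  unfolding in_segment using lam_bounds[OF assms]
  by (intro exI[of _ "lam t \<rho> \<tau>"]) (simp add: ip_lam algebra_simps)

lemma ip_in: "\<not> dd t \<rho> \<Longrightarrow> dd t \<tau> \<Longrightarrow> ip t \<rho> \<tau> \<in> cbox a b"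
  using ip_segment closed_segment_subset[of "V a b \<rho>" "cbox a b" "V a b \<tau>"] by auto

lemma ip_nth: "ip t \<rho> \<tau> $ k = side a b k (co k \<rho>) + lam t \<rho> \<tau> * (side a b k (co k \<tau>) - side a b k (co k \<rho>))"
  unfolding ip_lam side_nth ..

text \<open>An edge lies in a facet or has at most one end on it. The iso-point never reaches the
  disperse end, so in the latter case it is on the facet only by sitting at the continuous
  end.\<close>

lemma ip_bface:
  assumes "\<not> dd t \<rho>" "dd t \<tau>"
  shows "ip t \<rho> \<tau> \<in> bface a b k s \<longleftrightarrow> co k \<rho> = s \<and> (co k \<tau> = s \<or> zz t \<rho>)"
proof -
  have "ip t \<rho> \<tau> \<in> bface a b k s \<longleftrightarrow> ip t \<rho> \<tau> $ k = side a b k s"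
    using ip_in[OF assms] by (simp add: bface_def)
  also have "\<dots> \<longleftrightarrow> co k \<rho> = s \<and> (co k \<tau> = s \<or> zz t \<rho>)"
  proof (cases "co k \<tau> = co k \<rho>")
    case True then show ?thesis by (simp add: ip_nth) (metis side_eq)
  next
    case False
    define p q l where "p = side a b k (co k \<rho>)" "q = side a b k (co k \<tau>)" "l = lam t \<rho> \<tau>"
    have pq: "p \<noteq> q" using False by (simp add: p_q_l_def)
    have l: "0 \<le> l" "l < 1" "l = 0 \<longleftrightarrow> zz t \<rho>" using lam_bounds[OF assms] by (simp_all add: p_q_l_def)
    have s: "s = co k \<rho> \<or> s = co k \<tau>" using False by auto
    have "p + l * (q - p) = p \<longleftrightarrow> zz t \<rho>" using pq l by simp
    moreover have "p + l * (q - p) \<noteq> q"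
    proof
      assume "p + l * (q - p) = q"
      then have "(1 - l) * (q - p) = 0" by (simp add: algebra_simps)
      then show False using pq l by simp
    qed
    ultimately show ?thesis using s False unfolding ip_nth by (auto simp: p_q_l_def)
  qed
  finally show ?thesis .
qed

text \<open>An iso-point is recognized by the facets through it: a node lies on three, an inner
  point of an edge only on the two that contain the edge.\<close>

lemma ip_eq:
  assumes "cross (dd t) \<rho> \<tau>" "cross (dd t) \<rho>' \<tau>'"
  shows "ip t \<rho> \<tau> = ip t \<rho>' \<tau>' \<longleftrightarrow> \<rho> = \<rho>' \<and> (\<tau> = \<tau>' \<or> zz t \<rho>)"
proof
  assume e: "ip t \<rho> \<tau> = ip t \<rho>' \<tau>'"
  have b: "(co k \<rho> = s \<and> (co k \<tau> = s \<or> zz t \<rho>)) = (co k \<rho>' = s \<and> (co k \<tau>' = s \<or> zz t \<rho>'))" for k s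
    using ip_bface[of t \<rho> \<tau> k s] ip_bface[of t \<rho>' \<tau>' k s] e assms by (simp add: cross_def)
  show "\<rho> = \<rho>' \<and> (\<tau> = \<tau>' \<or> zz t \<rho>)"
  proof (cases "zz t \<rho> \<or> zz t \<rho>'")
    case True
    then have "\<rho> = \<rho>'" unfolding ix_eq_iff using b by blast
    then show ?thesis using True by auto
  next
    case False
    obtain k where k: "co k \<rho> \<noteq> co k \<tau>" "\<And>j. j \<noteq> k \<Longrightarrow> co j \<rho> = co j \<tau>"
      using assms(1) unfolding cross_def adj_iff by blast
    have j: "co j \<rho>' = co j \<rho> \<and> co j \<tau>' = co j \<rho>" if "j \<noteq> k" for j
      using b[of j "co j \<rho>"] k(2)[OF that] False by auto
    have kk: "co k \<rho>' \<noteq> co k \<tau>'"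
    proof
      assume "co k \<rho>' = co k \<tau>'"
      then have "\<rho>' = \<tau>'" unfolding ix_eq_iff using j by metis
      then show False using assms(2) by (simp add: cross_def)
    qed
    have "\<rho>' = \<rho>"
    proof (rule ccontr)
      assume "\<rho>' \<noteq> \<rho>"
      then have "co k \<rho>' \<noteq> co k \<rho>" using j unfolding ix_eq_iff by metis
      then have "co k \<rho>' = co k \<tau>" using k(1) by auto
      then have "\<rho>' = \<tau>" unfolding ix_eq_iff using j k(2) by metis
      then show False using assms by (simp add: cross_def)
    qed
    moreover have "\<tau>' = \<tau>"
    proof -
      have "co k \<tau>' = co k \<tau>" using kk k(1) \<open>\<rho>' = \<rho>\<close> by auto
      then show ?thesis unfolding ix_eq_iff using j k(2) by metis
    qed
    ultimately show ?thesis by simp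
  qed
next
  assume "\<rho> = \<rho>' \<and> (\<tau> = \<tau>' \<or> zz t \<rho>)"
  then show "ip t \<rho> \<tau> = ip t \<rho>' \<tau>'" by (auto simp: ip_lam lam_def zz_def)
qed

text \<open>The polygon obtained from the disperse set \<open>d\<close>, where the crossing edges of \<open>d\<close> carry the labels \<open>t\<close>.\<close>

definition pp :: "(point \<Rightarrow> real) \<Rightarrow> (ix \<Rightarrow> bool) \<Rightarrow> polygon" where
  "pp t d = {line t d k s | k s. areg d (zz t) (cn k s)}"

lemma line_cross: "line t d k s = {ip t \<rho> \<tau> | \<rho> \<tau>. co k \<rho> = s \<and> co k \<tau> = s \<and> cross d \<rho> \<tau>}"
  unfolding line_def cross_def by blast

lemma areg_cong:
  assumes "\<And>\<rho> \<tau>. cross d \<rho> \<tau> \<Longrightarrow> z \<rho> = z' \<rho>"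
  shows "areg d z (cn k s) = areg d z' (cn k s)"
proof (cases "fcount d (cn k s) = 3")
  case True
  then obtain u v where uv: "\<not> d (cn k s u v)" "\<forall>u' v'. (u', v') \<noteq> (u, v) \<longrightarrow> d (cn k s u' v')" unfolding fcount_3 by blast
  then have "cross d (cn k s u v) (cn k s (\<not> u) v)" by (simp add: cross_def)
  then have "z (cn k s u v) = z' (cn k s u v)" by (rule assms)
  moreover have "(\<exists>u' v'. \<not> d (cn k s u' v') \<and> y (cn k s u' v')) \<longleftrightarrow> y (cn k s u v)" for y
    using uv by (metis prod.inject)
  ultimately show ?thesis unfolding areg_def by simp
qed (simp add: areg_def)

text \<open>Only labels at the ends of crossing edges enter a polygon. This allows all polygons of a
  graph to be computed with its own labels, although the rules produce them after
  relabeling.\<close>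

lemma pp_cong:
  assumes "\<And>\<rho> \<tau>. cross d \<rho> \<tau> \<Longrightarrow> t (V a b \<rho>) = t' (V a b \<rho>) \<and> t (V a b \<tau>) = t' (V a b \<tau>)"
  shows "pp t d = pp t' d"
proof -
  have "line t d k s = line t' d k s" for k s
  proof -
    have "ip t \<rho> \<tau> = ip t' \<rho> \<tau>" if "cross d \<rho> \<tau>" for \<rho> \<tau>
      using assms[OF that] by (simp add: ip_lam lam_def)
    then show ?thesis unfolding line_cross by (intro Collect_cong) metis
  qed
  moreover have "areg d (zz t) (cn k s) = areg d (zz t') (cn k s)" for k s
    by (rule areg_cong) (use assms in \<open>auto simp: zz_def\<close>)
  ultimately show ?thesis unfolding pp_def by simp
qed

lemma C_polygon_pp: "C_polygon c (Gr t) = pp t (dd t)"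
  unfolding C_polygon_eq pp_def ..

text \<open>The two iso-points differ because they have different continuous ends or, if three
  corners are disperse, a common one that has no label c since the face is not singular.\<close>

lemma line_two:
  assumes "areg d (zz t) (cn k s)" "\<And>\<rho> \<tau>. cross d \<rho> \<tau> \<Longrightarrow> cross (dd t) \<rho> \<tau>"
  obtains \<rho> \<tau> \<rho>' \<tau>' where "cross d \<rho> \<tau>" "cross d \<rho>' \<tau>'" "co k \<rho> = s" "co k \<tau> = s" "co k \<rho>' = s" "co k \<tau>' = s"
    "line t d k s = {ip t \<rho> \<tau>, ip t \<rho>' \<tau>'}" "ip t \<rho> \<tau> \<noteq> ip t \<rho>' \<tau>'"
    "\<And>\<rho>2 \<tau>2. cross d \<rho>2 \<tau>2 \<Longrightarrow> co k \<rho>2 = s \<Longrightarrow> co k \<tau>2 = s \<Longrightarrow> \<rho>2 = \<rho> \<and> \<tau>2 = \<tau> \<or> \<rho>2 = \<rho>' \<and> \<tau>2 = \<tau>'"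
proof -
  note r = that
  have main: thesis if C: "cross d \<rho> \<tau>" "cross d \<rho>' \<tau>'" "co k \<rho> = s" "co k \<tau> = s" "co k \<rho>' = s" "co k \<tau>' = s"
      "\<rho> = \<rho>' \<Longrightarrow> \<tau> \<noteq> \<tau>' \<and> \<not> zz t \<rho>"
      "\<And>u v u' v'. (u = u') \<noteq> (v = v') \<Longrightarrow> \<not> d (cn k s u v) \<Longrightarrow> d (cn k s u' v') \<Longrightarrow> 
          cn k s u v = \<rho> \<and> cn k s u' v' = \<tau> \<or> cn k s u v = \<rho>' \<and> cn k s u' v' = \<tau>'" for \<rho> \<tau> \<rho>' \<tau>'
  proof -
    have only: "\<rho>2 = \<rho> \<and> \<tau>2 = \<tau> \<or> \<rho>2 = \<rho>' \<and> \<tau>2 = \<tau>'" if X: "cross d \<rho>2 \<tau>2" "co k \<rho>2 = s" "co k \<tau>2 = s" for \<rho>2 \<tau>2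
    proof -
      obtain u v where 1: "\<rho>2 = cn k s u v" using co_iff_cn[THEN iffD1, OF X(2)] by blast
      obtain u' v' where 2: "\<tau>2 = cn k s u' v'" using co_iff_cn[THEN iffD1, OF X(3)] by blast
      show ?thesis using C(8)[of u u' v v'] X(1) unfolding 1 2 cross_def by simp
    qed
    have L1: "line t d k s = {ip t \<rho> \<tau>, ip t \<rho>' \<tau>'}" unfolding line_cross using only C by blast
    have L2: "ip t \<rho> \<tau> \<noteq> ip t \<rho>' \<tau>'" using ip_eq[OF assms(2)[OF C(1)] assms(2)[OF C(2)]] C(7) by blast
    show thesis by (rule r[OF C(1-6) L1 L2 only])
  qed
  have A: "\<not> aL d (cn k s)" "\<exists>u v. d (cn k s u v)" "\<exists>u v. \<not> d (cn k s u v)"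
    and sing: "\<not> (fcount d (cn k s) = 3 \<and> (\<exists>u v. \<not> d (cn k s u v) \<and> zz t (cn k s u v)))"
    using assms(1) unfolding areg_def by auto
  show thesis
    using A
  proof (cases rule: fcount_cases)
    case (one u v)
    have 8: "cn k s p q = cn k s (\<not> u) v \<and> cn k s p' q' = cn k s u v \<or> cn k s p q = cn k s u (\<not> v) \<and> cn k s p' q' = cn k s u v"
      if "(p = p') \<noteq> (q = q')" "\<not> d (cn k s p q)" "d (cn k s p' q')" for p q p' q'
      using that one by (cases u; cases v; cases p; cases q; cases p'; cases q') simp_all
    show thesis by (rule main[OF _ _ _ _ _ _ _ 8]) (use one in \<open>simp_all add: cross_def\<close>)
  next
    case (three u v)
    then have "fcount d (cn k s) = 3" unfolding fcount_def by (cases u; cases v) simp_all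
    then have z: "\<not> zz t (cn k s u v)" using sing three by blast
    have 8: "cn k s p q = cn k s u v \<and> cn k s p' q' = cn k s (\<not> u) v \<or> cn k s p q = cn k s u v \<and> cn k s p' q' = cn k s u (\<not> v)"
      if "(p = p') \<noteq> (q = q')" "\<not> d (cn k s p q)" "d (cn k s p' q')" for p q p' q'
      using that three by (cases u; cases v; cases p; cases q; cases p'; cases q') simp_all
    show thesis by (rule main[OF _ _ _ _ _ _ _ 8]) (use three z in \<open>simp_all add: cross_def\<close>)
  next
    case (two1 u)
    have 8: "cn k s p q = cn k s (\<not> u) True \<and> cn k s p' q' = cn k s u True \<or> cn k s p q = cn k s (\<not> u) False \<and> cn k s p' q' = cn k s u False"
      if "(p = p') \<noteq> (q = q')" "\<not> d (cn k s p q)" "d (cn k s p' q')" for p q p' q'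
      using that two1[of True] two1[of False] by (cases u; cases p; cases q; cases p'; cases q') simp_all
    show thesis by (rule main[OF _ _ _ _ _ _ _ 8]) (use two1 in \<open>simp_all add: cross_def\<close>)
  next
    case (two2 v)
    have 8: "cn k s p q = cn k s True (\<not> v) \<and> cn k s p' q' = cn k s True v \<or> cn k s p q = cn k s False (\<not> v) \<and> cn k s p' q' = cn k s False v"
      if "(p = p') \<noteq> (q = q')" "\<not> d (cn k s p q)" "d (cn k s p' q')" for p q p' q'
      using that two2[of True] two2[of False] by (cases v; cases p; cases q; cases p'; cases q') simp_all
    show thesis by (rule main[OF _ _ _ _ _ _ _ 8]) (use two2 in \<open>simp_all add: cross_def\<close>)
  qed
qed

end

context cubc begin

lemma line_two_ex:
  assumes "areg d (zz t) (cn k s)" "\<forall>\<rho> \<tau>. cross d \<rho> \<tau> \<longrightarrow> cross (dd t) \<rho> \<tau>"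
  shows "\<exists>\<rho> \<tau> \<rho>' \<tau>'. cross d \<rho> \<tau> \<and> cross d \<rho>' \<tau>' \<and> co k \<rho> = s \<and> co k \<tau> = s \<and> co k \<rho>' = s \<and> co k \<tau>' = s \<and>
    line t d k s = {ip t \<rho> \<tau>, ip t \<rho>' \<tau>'} \<and> ip t \<rho> \<tau> \<noteq> ip t \<rho>' \<tau>' \<and>
    (\<forall>\<rho>2 \<tau>2. cross d \<rho>2 \<tau>2 \<longrightarrow> co k \<rho>2 = s \<longrightarrow> co k \<tau>2 = s \<longrightarrow> \<rho>2 = \<rho> \<and> \<tau>2 = \<tau> \<or> \<rho>2 = \<rho>' \<and> \<tau>2 = \<tau>')"
proof (rule line_two[OF assms(1) assms(2)[rule_format]])
  fix \<rho> \<tau> \<rho>' \<tau>'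
  assume h: "cross d \<rho> \<tau>" "cross d \<rho>' \<tau>'" "co k \<rho> = s" "co k \<tau> = s" "co k \<rho>' = s" "co k \<tau>' = s"
    "line t d k s = {ip t \<rho> \<tau>, ip t \<rho>' \<tau>'}" "ip t \<rho> \<tau> \<noteq> ip t \<rho>' \<tau>'"
    "\<And>\<rho>2 \<tau>2. cross d \<rho>2 \<tau>2 \<Longrightarrow> co k \<rho>2 = s \<Longrightarrow> co k \<tau>2 = s \<Longrightarrow> \<rho>2 = \<rho> \<and> \<tau>2 = \<tau> \<or> \<rho>2 = \<rho>' \<and> \<tau>2 = \<tau>'"
  show ?thesis
    by (rule exI[of _ \<rho>], rule exI[of _ \<tau>], rule exI[of _ \<rho>'], rule exI[of _ \<tau>'])
      (intro conjI allI impI h; assumption)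
qed

section \<open>The S-rules in terms of patterns\<close>

definition rl :: "ix set \<Rightarrow> real \<Rightarrow> (point \<Rightarrow> real) \<Rightarrow> point \<Rightarrow> real" where
  "rl B v t = (\<lambda>P. if P \<in> V a b ` B then v else t P)"

lemma rl_V[simp]: "rl B v t (V a b \<sigma>) = (if \<sigma> \<in> B then v else t (V a b \<sigma>))"
  by (auto simp: rl_def)

lemma dd_rl0: "dd (rl B 0 t) = (\<lambda>\<sigma>. dd t \<sigma> \<and> \<sigma> \<notin> B)"
  using c01 by (auto simp: dd_def fun_eq_iff)

lemma dd_rl1: "dd (rl B 1 t) = (\<lambda>\<sigma>. dd t \<sigma> \<or> \<sigma> \<in> B)"
  using c01 by (auto simp: dd_def fun_eq_iff)

lemma S_relabel_Gr: "S_relabel i (Gr t) (V a b ` B) = Gr (rl B (if i = 3 then 1 else 0) t)"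
  by (simp add: S_relabel_def Gr_def rl_def fun_eq_iff)

lemma S1_iff: "S_subgraph c 1 (Gr t) A \<longleftrightarrow> (\<exists>\<sigma>. A = V a b ` {\<sigma>} \<and> iso (dd t) \<sigma>)"
proof
  assume "S_subgraph c 1 (Gr t) A"
  then obtain P where P: "A = {P}" "disperse c (Gr t) P" "\<And>Q. incident (cbox a b) P Q \<Longrightarrow> continuous_node c (Gr t) Q"
    by (auto simp: S_subgraph_def)
  then obtain \<sigma> where "P = V a b \<sigma>" "dd t \<sigma>" unfolding disperse_iff by blast
  moreover from this P(3)[of "V a b _"] have "\<And>\<tau>. adj \<sigma> \<tau> \<Longrightarrow> \<not> dd t \<tau>" by simp
  ultimately show "\<exists>\<sigma>. A = V a b ` {\<sigma>} \<and> iso (dd t) \<sigma>" using P(1) by (intro exI[of _ \<sigma>]) (simp add: iso_def)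
next
  assume "\<exists>\<sigma>. A = V a b ` {\<sigma>} \<and> iso (dd t) \<sigma>"
  then obtain \<sigma> where s: "A = {V a b \<sigma>}" "dd t \<sigma>" "\<And>\<tau>. adj \<sigma> \<tau> \<Longrightarrow> \<not> dd t \<tau>" by (auto simp: iso_def)
  have "continuous_node c (Gr t) Q" if "incident (cbox a b) (V a b \<sigma>) Q" for Q
    using that s(3) unfolding incident_iff by auto
  then show "S_subgraph c 1 (Gr t) A" unfolding S_subgraph_def using s by auto
qed

text \<open>An S3-subgraph needs a label below c, the pattern records only that it is at most c. The
  hypothesis, which is T1-freeness, closes the gap.\<close>

lemma S3_iff:
  assumes "\<And>\<sigma>. zz t \<sigma> \<Longrightarrow> \<not> coiso (dd t) \<sigma>"
  shows "S_subgraph c 3 (Gr t) A \<longleftrightarrow> (\<exists>\<sigma>. A = V a b ` {\<sigma>} \<and> coiso (dd t) \<sigma>)"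
proof
  assume "S_subgraph c 3 (Gr t) A"
  then obtain P where P: "A = {P}" "P \<in> nodes (cbox a b)" "t P < c" "\<And>Q. incident (cbox a b) P Q \<Longrightarrow> disperse c (Gr t) Q"
    by (auto simp: S_subgraph_def)
  then obtain \<sigma> where \<sigma>: "P = V a b \<sigma>" unfolding nodes_eq by blast
  have "\<And>\<tau>. adj \<sigma> \<tau> \<Longrightarrow> dd t \<tau>" using P(4)[of "V a b _"] unfolding \<sigma> by simp
  then have "coiso (dd t) \<sigma>" using P(3) \<sigma> by (simp add: coiso_def dd_def)
  then show "\<exists>\<sigma>. A = V a b ` {\<sigma>} \<and> coiso (dd t) \<sigma>" using P(1) \<sigma> by auto
next
  assume "\<exists>\<sigma>. A = V a b ` {\<sigma>} \<and> coiso (dd t) \<sigma>"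
  then obtain \<sigma> where s: "A = {V a b \<sigma>}" "coiso (dd t) \<sigma>" by auto
  then have s': "\<not> dd t \<sigma>" "\<And>\<tau>. adj \<sigma> \<tau> \<Longrightarrow> dd t \<tau>" by (auto simp: coiso_def)
  have "t (V a b \<sigma>) \<noteq> c" using assms[of \<sigma>] s by (auto simp: zz_def)
  then have "t (V a b \<sigma>) < c" using s'(1) by (simp add: dd_def)
  moreover have "disperse c (Gr t) Q" if "incident (cbox a b) (V a b \<sigma>) Q" for Q
    using that s' unfolding incident_iff by auto
  ultimately show "S_subgraph c 3 (Gr t) A" unfolding S_subgraph_def using s by auto
qed

lemma S2_iff: "S_subgraph c 2 (Gr t) A \<longleftrightarrow> (\<exists>\<sigma> \<tau>. A = V a b ` {\<sigma>, \<tau>} \<and> adj \<sigma> \<tau> \<and> dd t \<sigma> \<and> dd t \<tau> \<and>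
    (\<forall>\<rho>. \<rho> \<noteq> \<sigma> \<and> \<rho> \<noteq> \<tau> \<and> (adj \<sigma> \<rho> \<or> adj \<tau> \<rho>) \<longrightarrow> \<not> dd t \<rho>))"
proof
  assume "S_subgraph c 2 (Gr t) A"
  then obtain P P' where P: "A = {P, P'}" "incident (cbox a b) P P'" "disperse c (Gr t) P" "disperse c (Gr t) P'"
    "\<And>Q. Q \<notin> A \<Longrightarrow> incident (cbox a b) P Q \<or> incident (cbox a b) P' Q \<Longrightarrow> continuous_node c (Gr t) Q"
    by (auto simp: S_subgraph_def)
  then obtain \<sigma> \<tau> where s: "P = V a b \<sigma>" "P' = V a b \<tau>" "dd t \<sigma>" "dd t \<tau>" unfolding disperse_iff by blast
  have "\<not> dd t \<rho>" if "\<rho> \<noteq> \<sigma>" "\<rho> \<noteq> \<tau>" "adj \<sigma> \<rho> \<or> adj \<tau> \<rho>" for \<rho>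
    using P(5)[of "V a b \<rho>"] that unfolding s P(1) by simp
  then show "\<exists>\<sigma> \<tau>. A = V a b ` {\<sigma>, \<tau>} \<and> adj \<sigma> \<tau> \<and> dd t \<sigma> \<and> dd t \<tau> \<and>
    (\<forall>\<rho>. \<rho> \<noteq> \<sigma> \<and> \<rho> \<noteq> \<tau> \<and> (adj \<sigma> \<rho> \<or> adj \<tau> \<rho>) \<longrightarrow> \<not> dd t \<rho>)"
    using P(1,2) s by (intro exI[of _ \<sigma>] exI[of _ \<tau>]) simp
next
  assume "\<exists>\<sigma> \<tau>. A = V a b ` {\<sigma>, \<tau>} \<and> adj \<sigma> \<tau> \<and> dd t \<sigma> \<and> dd t \<tau> \<and>
    (\<forall>\<rho>. \<rho> \<noteq> \<sigma> \<and> \<rho> \<noteq> \<tau> \<and> (adj \<sigma> \<rho> \<or> adj \<tau> \<rho>) \<longrightarrow> \<not> dd t \<rho>)"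
  then obtain \<sigma> \<tau> where s: "A = {V a b \<sigma>, V a b \<tau>}" "adj \<sigma> \<tau>" "dd t \<sigma>" "dd t \<tau>"
    "\<And>\<rho>. \<rho> \<noteq> \<sigma> \<Longrightarrow> \<rho> \<noteq> \<tau> \<Longrightarrow> adj \<sigma> \<rho> \<or> adj \<tau> \<rho> \<Longrightarrow> \<not> dd t \<rho>" by auto
  have "continuous_node c (Gr t) Q" if X: "Q \<notin> A" "incident (cbox a b) (V a b \<sigma>) Q \<or> incident (cbox a b) (V a b \<tau>) Q" for Q
  proof -
    obtain \<rho> where "Q = V a b \<rho>" using X(2) unfolding incident_iff by blast
    then show ?thesis using s(5)[of \<rho>] X s(1) by auto
  qed
  then have "(2::nat) = 2 \<and> (\<exists>P P'. A = {P, P'} \<and> incident (cuboid (Gr t)) P P' \<and> disperse c (Gr t) P \<and> disperse c (Gr t) P' \<and>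
      (\<forall>Q. Q \<notin> A \<and> (incident (cuboid (Gr t)) P Q \<or> incident (cuboid (Gr t)) P' Q) \<longrightarrow> continuous_node c (Gr t) Q))"
    using s(1-4) by (intro conjI refl exI[of _ "V a b \<sigma>"] exI[of _ "V a b \<tau>"]) auto
  then show "S_subgraph c 2 (Gr t) A" unfolding S_subgraph_def by blast
qed

lemma S_iso_points_eq: "S_iso_points c (Gr t) (V a b ` B) = {ip t \<rho> \<tau> | \<rho> \<tau>. cross (dd t) \<rho> \<tau> \<and> (\<rho> \<in> B \<or> \<tau> \<in> B)}"
  (is "?L = ?R")
proof (intro equalityI subsetI)
  fix x assume "x \<in> ?L"
  then obtain x0 x1 where x: "x = iso_point c (Gr t) x0 x1" "x0 \<in> V a b ` B \<or> x1 \<in> V a b ` B"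
     "incident (cbox a b) x0 x1" "continuous_node c (Gr t) x0" "disperse c (Gr t) x1"
    unfolding S_iso_points_def by auto
  then obtain \<rho> \<tau> where r: "x0 = V a b \<rho>" "x1 = V a b \<tau>" "adj \<rho> \<tau>" unfolding incident_iff by blast
  then have "cross (dd t) \<rho> \<tau>" "\<rho> \<in> B \<or> \<tau> \<in> B" using x by (auto simp: cross_def)
  then show "x \<in> ?R" using x(1) r unfolding ip_def by blast
next
  fix x assume "x \<in> ?R"
  then obtain \<rho> \<tau> where "x = ip t \<rho> \<tau>" "adj \<rho> \<tau>" "\<not> dd t \<rho>" "dd t \<tau>" "\<rho> \<in> B \<or> \<tau> \<in> B" unfolding cross_def by blast
  then show "x \<in> ?L" unfolding S_iso_points_def ip_def
    by (intro CollectI exI[of _ "V a b \<rho>"] exI[of _ "V a b \<tau>"]) auto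
qed

text \<open>A facet shared by two iso-points contains both continuous ends; by \<open>samef\<close>
  the two edges then lie on one face. That face is regular for \<open>d\<close>, and the pair is its
  line. Conversely the two ends of a line share the face of the line.\<close>

lemma S_polygon_pp:
  assumes sf: "samef (tab d)"
    and cr: "\<And>\<rho> \<tau>. cross d \<rho> \<tau> \<longleftrightarrow> cross (dd t) \<rho> \<tau> \<and> (\<rho> \<in> B \<or> \<tau> \<in> B)"
  shows "S_polygon c (Gr t) (V a b ` B) = pp t d"
proof -
  have pts: "S_iso_points c (Gr t) (V a b ` B) = {ip t \<rho> \<tau> | \<rho> \<tau>. cross d \<rho> \<tau>}"
    unfolding S_iso_points_eq cr ..
  have crd: "cross (dd t) \<rho> \<tau>" if "cross d \<rho> \<tau>" for \<rho> \<tau> using that cr by blast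
  then have crd': "\<forall>\<rho> \<tau>. cross d \<rho> \<tau> \<longrightarrow> cross (dd t) \<rho> \<tau>" by blast
  show ?thesis
  proof (intro equalityI subsetI)
    fix l assume "l \<in> S_polygon c (Gr t) (V a b ` B)"
    then obtain x y M where l: "l = {x, y}" "x \<noteq> y" "x \<in> S_iso_points c (Gr t) (V a b ` B)" "y \<in> S_iso_points c (Gr t) (V a b ` B)"
        "M facet_of cbox a b" "x \<in> M" "y \<in> M" unfolding S_polygon_def by auto
    obtain \<rho> \<tau> where x: "x = ip t \<rho> \<tau>" "cross d \<rho> \<tau>" using l(3) unfolding pts by blast
    obtain \<rho>' \<tau>' where y: "y = ip t \<rho>' \<tau>'" "cross d \<rho>' \<tau>'" using l(4) unfolding pts by blast
    obtain j s where M: "M = bface a b j s" using l(5) facet_iff by blast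
    have "co j \<rho> = co j \<rho>'"
      using l(6,7) crd[OF x(2)] crd[OF y(2)] unfolding x y M cross_def by (simp add: ip_bface)
    then obtain k where k: "co k \<tau> = co k \<rho>" "co k \<rho>' = co k \<rho>" "co k \<tau>' = co k \<rho>"
      using samefD(2)[OF sf, of \<rho> \<tau> \<rho>' \<tau>' j] x(2) y(2) unfolding cross_def by blast
    define s' where "s' = co k \<rho>"
    have cs: "co k \<rho> = s'" "co k \<tau> = s'" "co k \<rho>' = s'" "co k \<tau>' = s'" using k by (simp_all add: s'_def)
    have areg: "areg d (zz t) (cn k s')" unfolding areg_def
    proof (intro conjI notI)
      show "aL d (cn k s') \<Longrightarrow> False" using samefD(1)[OF sf] by blast
      obtain u v where "\<rho> = cn k s' u v" using co_iff_cn[THEN iffD1, OF cs(1)] by blast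
      then show "\<exists>u v. \<not> d (cn k s' u v)" using x(2) by (auto simp: cross_def)
      obtain u v where "\<tau> = cn k s' u v" using co_iff_cn[THEN iffD1, OF cs(2)] by blast
      then show "\<exists>u v. d (cn k s' u v)" using x(2) by (auto simp: cross_def)
      \<comment> \<open>With three disperse corners both continuous ends are the fourth one; if it
        has label c, the two iso-points coincide with it, although they are different.\<close>
      assume h: "fcount d (cn k s') = 3 \<and> (\<exists>u v. \<not> d (cn k s' u v) \<and> zz t (cn k s' u v))"
      then obtain u v where uv: "\<not> d (cn k s' u v)" "\<And>u' v'. (u', v') \<noteq> (u, v) \<Longrightarrow> d (cn k s' u' v')" unfolding fcount_3 by blast
      have only: "\<xi> = cn k s' u v" if X: "co k \<xi> = s'" "\<not> d \<xi>" for \<xi>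
      proof -
        obtain u' v' where "\<xi> = cn k s' u' v'" using co_iff_cn[THEN iffD1, OF X(1)] by blast
        then show ?thesis using uv(2)[of u' v'] X by auto
      qed
      have "\<rho> = cn k s' u v" "\<rho>' = cn k s' u v"
        using only[OF cs(1)] only[OF cs(3)] x(2) y(2) unfolding cross_def by blast+
      moreover obtain u2 v2 where "\<not> d (cn k s' u2 v2)" "zz t (cn k s' u2 v2)" using h by blast
      then have "zz t (cn k s' u v)" using only[OF co_cn] by metis
      ultimately show False using l(2) unfolding x y using ip_eq[OF crd[OF x(2)] crd[OF y(2)]] by simp
    qed
    obtain \<rho>1 \<tau>1 \<rho>2 \<tau>2 where L1: "line t d k s' = {ip t \<rho>1 \<tau>1, ip t \<rho>2 \<tau>2}"
      and L2: "\<forall>\<rho>3 \<tau>3. cross d \<rho>3 \<tau>3 \<longrightarrow> co k \<rho>3 = s' \<longrightarrow> co k \<tau>3 = s' \<longrightarrow> \<rho>3 = \<rho>1 \<and> \<tau>3 = \<tau>1 \<or> \<rho>3 = \<rho>2 \<and> \<tau>3 = \<tau>2"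
      using line_two_ex[OF areg crd'] by (elim exE conjE)
    have "{x, y} = line t d k s'"
      using L2[rule_format, OF x(2) cs(1,2)] L2[rule_format, OF y(2) cs(3,4)] l(2) unfolding L1 x(1) y(1) by auto
    then show "l \<in> pp t d" unfolding pp_def l(1) using areg by blast
  next
    fix l assume "l \<in> pp t d"
    then obtain k s where l: "l = line t d k s" "areg d (zz t) (cn k s)" unfolding pp_def by blast
    obtain \<rho> \<tau> \<rho>' \<tau>' where L: "cross d \<rho> \<tau>" "cross d \<rho>' \<tau>'" "co k \<rho> = s" "co k \<tau> = s" "co k \<rho>' = s" "co k \<tau>' = s"
      "line t d k s = {ip t \<rho> \<tau>, ip t \<rho>' \<tau>'}" "ip t \<rho> \<tau> \<noteq> ip t \<rho>' \<tau>'"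
      using line_two_ex[OF l(2) crd'] by (elim exE conjE)
    have "ip t \<rho> \<tau> \<in> bface a b k s" "ip t \<rho>' \<tau>' \<in> bface a b k s"
      using L crd[OF L(1)] crd[OF L(2)] by (simp_all add: ip_bface cross_def)
    moreover have "bface a b k s facet_of cbox a b" using facet_iff by blast
    ultimately show "l \<in> S_polygon c (Gr t) (V a b ` B)"
      unfolding S_polygon_def pts l(1) L(7) using L(1,2,8) unfolding Gr_simps by blast
  qed
qed

lemma S_disperse_closed:
  assumes "\<And>\<sigma>. \<sigma> \<in> B \<Longrightarrow> dd t \<sigma>" "\<And>\<sigma> \<tau>. \<sigma> \<in> B \<Longrightarrow> adj \<sigma> \<tau> \<Longrightarrow> dd t \<tau> \<Longrightarrow> \<tau> \<in> B"
  shows "S_disperse c (Gr t) (V a b ` B) = V a b ` B"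
proof (intro equalityI subsetI)
  fix P assume "P \<in> S_disperse c (Gr t) (V a b ` B)"
  then have P: "disperse c (Gr t) P" "P \<in> V a b ` B \<or> (\<exists>Q\<in>V a b ` B. incident (cbox a b) Q P)"
    by (auto simp: S_disperse_def)
  then obtain \<tau> where "P = V a b \<tau>" "dd t \<tau>" unfolding disperse_iff by blast
  then show "P \<in> V a b ` B" using P(2) assms(2) by auto
next
  fix P assume "P \<in> V a b ` B"
  then show "P \<in> S_disperse c (Gr t) (V a b ` B)" using assms(1) by (auto simp: S_disperse_def)
qed

end

lemma finite_ix[simp]: "finite (B :: ix set)"
  by (rule finite_subset[of _ "set allix"]) auto

lemma card_iso: "card {\<sigma>. iso d \<sigma>} = length (filter (iso d) allix)"
  using card_aD[of "iso d"] by (simp add: aD_def)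

lemma res_iso:
  assumes "\<not> ctype d" "\<not> s2type d"
  shows "iso d \<sigma> \<Longrightarrow> res d \<sigma> = (\<lambda>\<tau>. \<tau> = \<sigma>)" "\<not> iso d \<sigma> \<Longrightarrow> res d \<sigma> = (\<lambda>\<tau>. d \<tau> \<and> \<not> iso d \<tau>)"
  using assms by (auto simp: res_def res0_def)

lemma iso_d: "iso d \<sigma> \<Longrightarrow> d \<sigma>" by (simp add: iso_def)

lemma iso_adj: "iso d \<sigma> \<Longrightarrow> adj \<sigma> \<tau> \<Longrightarrow> \<not> d \<tau>" by (simp add: iso_def)

context cubc begin

lemma singular_free_T1: "singular_free c (Gr t) \<Longrightarrow> zz t \<sigma> \<Longrightarrow> \<not> coiso (dd t) \<sigma>"
proof
  assume h: "singular_free c (Gr t)" "zz t \<sigma>" "coiso (dd t) \<sigma>"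
  have "disperse c (Gr t) Q" if "incident (cbox a b) (V a b \<sigma>) Q" for Q
    using that h(3) unfolding incident_iff by (auto simp: coiso_def)
  then have "T1_node c (Gr t) (V a b \<sigma>)" using h(2) by (simp add: T1_node_def zz_def)
  then show False using h(1) by (auto simp: singular_free_def)
qed

lemma S_polygon_iso:
  assumes "iso (dd t) \<sigma>"
  shows "S_polygon c (Gr t) (V a b ` {\<sigma>}) = pp t (\<lambda>\<tau>. \<tau> = \<sigma>)"
proof (rule S_polygon_pp[OF samef_instances(1)])
  fix \<rho> \<tau>
  show "cross (\<lambda>\<tau>. \<tau> = \<sigma>) \<rho> \<tau> \<longleftrightarrow> cross (dd t) \<rho> \<tau> \<and> (\<rho> \<in> {\<sigma>} \<or> \<tau> \<in> {\<sigma>})"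
    using iso_d[OF assms] iso_adj[OF assms, of \<rho>] adj_sym[of \<rho> \<sigma>] by (auto simp: cross_def)
qed

lemma S_polygon_coiso:
  assumes "coiso (dd t) \<sigma>"
  shows "S_polygon c (Gr t) (V a b ` {\<sigma>}) = pp t (\<lambda>\<tau>. \<tau> \<noteq> \<sigma>)"
proof (rule S_polygon_pp[OF samef_instances(2)])
  fix \<rho> \<tau>
  show "cross (\<lambda>\<tau>. \<tau> \<noteq> \<sigma>) \<rho> \<tau> \<longleftrightarrow> cross (dd t) \<rho> \<tau> \<and> (\<rho> \<in> {\<sigma>} \<or> \<tau> \<in> {\<sigma>})"
    using assms by (auto simp: cross_def coiso_def)
qed

lemma S_polygon_pair:
  assumes "adj \<sigma> \<tau>" "dd t \<sigma>" "dd t \<tau>" "\<And>\<rho>. \<rho> \<noteq> \<sigma> \<Longrightarrow> \<rho> \<noteq> \<tau> \<Longrightarrow> adj \<sigma> \<rho> \<or> adj \<tau> \<rho> \<Longrightarrow> \<not> dd t \<rho>"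
  shows "S_polygon c (Gr t) (V a b ` {\<sigma>, \<tau>}) = pp t (\<lambda>\<xi>. \<xi> = \<sigma> \<or> \<xi> = \<tau>)"
proof (rule S_polygon_pp[OF samef_instances(3)[OF assms(1)]])
  fix \<rho> \<xi>
  show "cross (\<lambda>\<xi>. \<xi> = \<sigma> \<or> \<xi> = \<tau>) \<rho> \<xi> \<longleftrightarrow> cross (dd t) \<rho> \<xi> \<and> (\<rho> \<in> {\<sigma>, \<tau>} \<or> \<xi> \<in> {\<sigma>, \<tau>})"
    using assms(2,3) assms(4)[of \<rho>] adj_sym[of \<rho> \<xi>] by (auto simp: cross_def)
qed

lemma pp_rl:
  assumes "\<And>\<rho> \<tau>. cross d \<rho> \<tau> \<Longrightarrow> \<rho> \<notin> B \<and> \<tau> \<notin> B"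
  shows "pp (rl B v t) d = pp t d"
  by (rule pp_cong) (use assms in auto)

lemma rl_rl: "rl B v (rl {\<sigma>} v t) = rl (insert \<sigma> B) v t"
  by (auto simp: rl_def fun_eq_iff)

lemma iso_rl: "iso (dd t) \<sigma> \<Longrightarrow> iso (dd (rl {\<sigma>} 0 t)) \<tau> \<longleftrightarrow> \<tau> \<noteq> \<sigma> \<and> iso (dd t) \<tau>"
  using iso_adj[of "dd t" \<sigma> \<tau>] adj_sym[of \<sigma> \<tau>] unfolding dd_rl0 by (auto simp: iso_def)

lemma pp_iso_rl:
  assumes "iso (dd t) \<sigma>" "iso (dd t) \<tau>" "\<tau> \<noteq> \<sigma>"
  shows "pp (rl {\<sigma>} 0 t) (\<lambda>\<xi>. \<xi> = \<tau>) = pp t (\<lambda>\<xi>. \<xi> = \<tau>)"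
proof (rule pp_rl)
  fix \<rho> \<xi> assume "cross (\<lambda>\<xi>. \<xi> = \<tau>) \<rho> \<xi>"
  then have h: "adj \<rho> \<tau>" "\<xi> = \<tau>" by (auto simp: cross_def)
  then have "\<not> dd t \<rho>" using iso_adj[OF assms(2), of \<rho>] adj_sym[of \<rho> \<tau>] by blast
  then show "\<rho> \<notin> {\<sigma>} \<and> \<xi> \<notin> {\<sigma>}" using iso_d[OF assms(1)] assms(3) h by auto
qed

lemma S_disperse_iso: "iso (dd t) \<sigma> \<Longrightarrow> S_disperse c (Gr t) (V a b ` {\<sigma>}) = {V a b \<sigma>}"
  using S_disperse_closed[of "{\<sigma>}" t] iso_d[of "dd t" \<sigma>] iso_adj[of "dd t" \<sigma>] by simp

text \<open>Isolated disperse nodes are pairwise not incident, so relabeling one changes neither the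
  others nor their triangles. The order of the applications is immaterial, and the rule amounts to
  the choice of a set \<open>B\<close> of isolated nodes.\<close>

lemma S1_rule_fwd:
  assumes "S_rule c i n H R H'" "i = 1" "H = Gr t"
  shows "\<exists>B. B \<subseteq> {\<sigma>. iso (dd t) \<sigma>} \<and> card B = n \<and> H' = Gr (rl B 0 t) \<and>
    R = (\<lambda>\<sigma>. (pp t (\<lambda>\<tau>. \<tau> = \<sigma>), {V a b \<sigma>})) ` B"
  using assms
proof (induction arbitrary: t rule: S_rule.induct)
  case (S_rule_0 G)
  have "rl {} 0 t = t" by (simp add: rl_def)
  then show ?case using S_rule_0 by (intro exI[of _ "{}"]) simp
next
  case (S_rule_Suc G A n R G')
  obtain \<sigma> where s: "A = V a b ` {\<sigma>}" "iso (dd t) \<sigma>" using S_rule_Suc.hyps(1) S_rule_Suc.prems S1_iff by blast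
  have G1: "S_relabel i G A = Gr (rl {\<sigma>} 0 t)" unfolding s(1) S_rule_Suc.prems S_relabel_Gr by simp
  obtain B where B: "B \<subseteq> {\<tau>. iso (dd (rl {\<sigma>} 0 t)) \<tau>}" "card B = n" "G' = Gr (rl B 0 (rl {\<sigma>} 0 t))"
    "R = (\<lambda>\<tau>. (pp (rl {\<sigma>} 0 t) (\<lambda>\<xi>. \<xi> = \<tau>), {V a b \<tau>})) ` B"
    using S_rule_Suc.IH[OF S_rule_Suc.prems(1) G1] by blast
  have B1: "\<And>\<tau>. \<tau> \<in> B \<Longrightarrow> \<tau> \<noteq> \<sigma> \<and> iso (dd t) \<tau>" using B(1) iso_rl[OF s(2)] by blast
  have "R = (\<lambda>\<tau>. (pp t (\<lambda>\<xi>. \<xi> = \<tau>), {V a b \<tau>})) ` B"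
    unfolding B(4) by (rule image_cong) (use B1 pp_iso_rl[OF s(2)] in auto)
  moreover have "(S_polygon c G A, S_disperse c G A) = (pp t (\<lambda>\<xi>. \<xi> = \<sigma>), {V a b \<sigma>})"
    unfolding S_rule_Suc.prems s(1) S_polygon_iso[OF s(2)] S_disperse_iso[OF s(2)] ..
  ultimately show ?case using B B1 s(2) unfolding rl_rl
    by (intro exI[of _ "insert \<sigma> B"]) (auto simp: card_insert_if)
qed

lemma S1_rule_bwd:
  assumes "B \<subseteq> {\<sigma>. iso (dd t) \<sigma>}"
  shows "S_rule c 1 (card B) (Gr t) ((\<lambda>\<sigma>. (pp t (\<lambda>\<tau>. \<tau> = \<sigma>), {V a b \<sigma>})) ` B) (Gr (rl B 0 t))"
  using finite_ix[of B] assms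
proof (induction B arbitrary: t rule: finite_induct)
  case empty
  have "rl {} 0 t = t" by (simp add: rl_def)
  then show ?case by (simp add: S_rule_0)
next
  case (insert \<sigma> B)
  have s: "iso (dd t) \<sigma>" using insert by blast
  have "B \<subseteq> {\<tau>. iso (dd (rl {\<sigma>} 0 t)) \<tau>}" using insert iso_rl[OF s] by blast
  then have *: "S_rule c 1 (card B) (Gr (rl {\<sigma>} 0 t)) ((\<lambda>\<tau>. (pp (rl {\<sigma>} 0 t) (\<lambda>\<xi>. \<xi> = \<tau>), {V a b \<tau>})) ` B) (Gr (rl B 0 (rl {\<sigma>} 0 t)))"
    using insert.IH by blast
  have R: "(\<lambda>\<tau>. (pp (rl {\<sigma>} 0 t) (\<lambda>\<xi>. \<xi> = \<tau>), {V a b \<tau>})) ` B = (\<lambda>\<tau>. (pp t (\<lambda>\<xi>. \<xi> = \<tau>), {V a b \<tau>})) ` B"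
    by (rule image_cong) (use insert pp_iso_rl[OF s] in auto)
  have G: "Gr (rl {\<sigma>} 0 t) = S_relabel 1 (Gr t) (V a b ` {\<sigma>})" unfolding S_relabel_Gr by simp
  have "S_subgraph c 1 (Gr t) (V a b ` {\<sigma>})" using S1_iff s by blast
  from S_rule_Suc[OF this *[unfolded R rl_rl G]] show ?case
    using insert(2) unfolding S_polygon_iso[OF s] S_disperse_iso[OF s] by simp
qed

lemma S_rule_one_iff: "S_rule c i 1 H R H' \<longleftrightarrow> (\<exists>A. S_subgraph c i H A \<and> H' = S_relabel i H A \<and>
    R = {(S_polygon c H A, S_disperse c H A)})"
proof
  assume "S_rule c i 1 H R H'"
  then have "S_rule c i (Suc 0) H R H'" by simp
  then show "\<exists>A. S_subgraph c i H A \<and> H' = S_relabel i H A \<and> R = {(S_polygon c H A, S_disperse c H A)}"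
    by (cases rule: S_rule.cases) (auto elim: S_rule.cases)
next
  assume "\<exists>A. S_subgraph c i H A \<and> H' = S_relabel i H A \<and> R = {(S_polygon c H A, S_disperse c H A)}"
  then show "S_rule c i 1 H R H'" using S_rule_Suc[OF _ S_rule_0, of c i H] by auto
qed

lemma S_rule_zero_iff: "S_rule c i 0 H R H' \<longleftrightarrow> R = {} \<and> H' = H"
  by (auto elim: S_rule.cases intro: S_rule_0)

end

text \<open>Either \<open>B\<close> exhausts the isolated nodes and the other disperse nodes remain,
  or all disperse nodes are isolated and exactly one of them remains.\<close>

lemma iso_rest:
  assumes "mixed d" "rows1 d n" "B \<subseteq> {\<sigma>. iso d \<sigma>}" "card B = n"
  shows "\<exists>\<sigma>. src d \<sigma> \<and> (\<lambda>\<tau>. d \<tau> \<and> \<tau> \<notin> B) = res d \<sigma>"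
proof -
  note f = rows1_facts[OF assms(1,2)]
  from f(3) consider "card {\<sigma>. iso d \<sigma>} = n" "n < aD d" | "card {\<sigma>. iso d \<sigma>} = Suc n" "aD d = Suc n"
    unfolding card_iso by blast
  then show ?thesis
  proof cases
    case 1
    then have B: "B = {\<sigma>. iso d \<sigma>}" using card_subset_eq[OF finite_ix assms(3)] assms(4) by simp
    have "{\<sigma>. iso d \<sigma>} \<subset> {\<sigma>. d \<sigma>}" using 1 iso_d card_aD[of d] by (metis (mono_tags, lifting) Collect_mono less_irrefl psubsetI)
    then obtain \<sigma> where "d \<sigma>" "\<not> iso d \<sigma>" by blast
    then show ?thesis using f(1) res_iso(2)[OF f(1,2), of \<sigma>] unfolding B src_def by auto
  next
    case 2
    have "{\<sigma>. iso d \<sigma>} = {\<sigma>. d \<sigma>}" by (rule card_subset_eq) (use 2 iso_d card_aD[of d] in auto)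
    then have D: "iso d \<sigma> \<longleftrightarrow> d \<sigma>" for \<sigma> by blast
    have "card ({\<sigma>. iso d \<sigma>} - B) = 1" using 2 assms(3,4) by (subst card_Diff_subset) auto
    then obtain \<sigma> where s: "{\<sigma>. iso d \<sigma>} - B = {\<sigma>}" by (auto simp: card_1_singleton_iff)
    then have "iso d \<sigma>" by blast
    moreover have "(\<lambda>\<tau>. d \<tau> \<and> \<tau> \<notin> B) = (\<lambda>\<tau>. \<tau> = \<sigma>)" using s D by (intro ext) blast
    ultimately show ?thesis using f(1) res_iso(1)[OF f(1,2), of \<sigma>] D unfolding src_def by auto
  qed
qed

text \<open>When all disperse nodes are isolated, the rule leaves a choice. It is made such that
  \<sigma> is the node left over, so that its triangle arises from the C-rules.\<close>

lemma iso_choose: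
  assumes "mixed d" "rows1 d n" "src d \<sigma>"
  shows "\<exists>B. B \<subseteq> {\<sigma>. iso d \<sigma>} \<and> card B = n \<and> (\<sigma> \<in> B \<and> iso d \<sigma> \<or> (\<lambda>\<tau>. d \<tau> \<and> \<tau> \<notin> B) = res d \<sigma>)"
proof -
  note f = rows1_facts[OF assms(1,2)]
  have ds: "d \<sigma>" using assms(3) f(1) by (simp add: src_def)
  from f(3) consider "card {\<sigma>. iso d \<sigma>} = n" | "card {\<sigma>. iso d \<sigma>} = Suc n" "aD d = Suc n"
    unfolding card_iso by blast
  then show ?thesis
  proof cases
    case 1
    then show ?thesis using res_iso(2)[OF f(1,2), of \<sigma>] by (intro exI[of _ "{\<sigma>. iso d \<sigma>}"]) auto
  next
    case 2
    have "{\<sigma>. iso d \<sigma>} = {\<sigma>. d \<sigma>}" by (rule card_subset_eq) (use 2 iso_d card_aD[of d] in auto)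
    then have D: "iso d \<sigma> \<longleftrightarrow> d \<sigma>" for \<sigma> by blast
    have "card ({\<sigma>. iso d \<sigma>} - {\<sigma>}) = n" using 2 ds D by simp
    moreover have "(\<lambda>\<tau>. d \<tau> \<and> \<tau> \<notin> {\<sigma>. iso d \<sigma>} - {\<sigma>}) = (\<lambda>\<tau>. \<tau> = \<sigma>)" using D ds by (intro ext) auto
    ultimately show ?thesis using res_iso(1)[OF f(1,2), of \<sigma>] D ds by (intro exI[of _ "{\<sigma>. iso d \<sigma>} - {\<sigma>}"]) auto
  qed
qed

context cubc begin

section \<open>Inner iso-paths are the polygons of the residual patterns\<close>

lemma regular_mixed:
  assumes "regular_graph c \<G> (Gr t)"
  shows "mixed (dd t)" "singular_free c (Gr t)"
proof -
  have "\<exists>P\<in>nodes (cbox a b). \<not> disperse c (Gr t) P" "\<exists>P\<in>nodes (cbox a b). \<not> continuous_node c (Gr t) P"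
    using assms unfolding regular_graph_def disperse_graph_def continuous_graph_def by auto
  then show "mixed (dd t)" unfolding mixed_iff nodes_eq by auto
  show "singular_free c (Gr t)" using assms by (simp add: regular_graph_def)
qed

text \<open>For a T1-free graph \<open>coiso\<close> decides whether there is an S3-subgraph. The
  table and the two rules for graphs without L-faces then depend on the pattern alone.\<close>

lemma applicable_iff:
  assumes "singular_free c (Gr t)"
  shows "applicable_rule c (Gr t) i n \<longleftrightarrow> i = 1 \<and> rows1 (dd t) n \<or> i = 2 \<and> n = 1 \<and> s2type (dd t) \<or>
    i = 3 \<and> n = 1 \<and> rows3 (dd t) \<or> n = 0 \<and> nL (dd t) = 0 \<and> (\<forall>m. \<not> rows1 (dd t) m) \<and> \<not> rows3 (dd t)"
proof -
  define e1 e3 where "e1 = (\<exists>\<sigma>. iso (dd t) \<sigma>)" "e3 = (\<exists>\<sigma>. coiso (dd t) \<sigma>)"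
  have S3: "S_subgraph c 3 (Gr t) A \<longleftrightarrow> (\<exists>\<sigma>. A = V a b ` {\<sigma>} \<and> coiso (dd t) \<sigma>)" for A
    by (rule S3_iff) (rule singular_free_T1[OF assms])
  have E: "(\<exists>A. S_subgraph c 1 (Gr t) A) = e1" "(\<exists>A. S_subgraph c 3 (Gr t) A) = e3"
    unfolding S1_iff S3 e1_e3_def by auto
  have R: "list_ex (iso (dd t)) allix = e1" "list_ex (coiso (dd t)) allix = e3" by (simp_all add: e1_e3_def)
  show ?thesis
    unfolding applicable_rule_def L_empty num_disperse_eq S_table_def card_L par_iff E Let_def
      rows1_def rows3_def s2type_def R
    by (cases "nL (dd t) = 0") auto
qed

lemma res_pair:
  assumes "mixed d" "s2type d" "adj \<sigma> \<tau>" "d \<sigma>" "d \<tau>"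
  shows "res d \<sigma> = (\<lambda>\<xi>. \<xi> = \<sigma> \<or> \<xi> = \<tau>)"
proof
  fix \<xi>
  have "res d \<sigma> \<xi> \<longleftrightarrow> d \<xi> \<and> (\<xi> = \<sigma> \<or> adj \<sigma> \<xi>)"
    using s2type_facts(1)[OF assms(1,2)] assms(2) by (simp add: res_def res0_def adj_def)
  then show "res d \<sigma> \<xi> = (\<xi> = \<sigma> \<or> \<xi> = \<tau>)" using s2type_facts(3)[OF assms(1,2,3,4,5), of \<xi>] assms by blast
qed

lemma C_polygon_res0:
  assumes "mixed (dd t)" "src (dd t) \<sigma>" "(\<lambda>\<tau>. dd t \<tau> \<and> \<tau> \<notin> B) = res (dd t) \<sigma>" "\<And>\<tau>. \<tau> \<in> B \<Longrightarrow> dd t \<tau>"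
  shows "C_polygon c (Gr (rl B 0 t)) = pp t (res (dd t) \<sigma>)"
    "disperse_nodes c (Gr (rl B 0 t)) = V a b ` {\<tau>. res (dd t) \<sigma> \<tau>}"
proof -
  show "C_polygon c (Gr (rl B 0 t)) = pp t (res (dd t) \<sigma>)"
    unfolding C_polygon_pp dd_rl0 assms(3)
  proof (rule pp_rl)
    fix \<rho> \<tau> assume h: "cross (res (dd t) \<sigma>) \<rho> \<tau>"
    then have "\<not> dd t \<rho>" using res_cross[OF assms(1,2)] by (auto simp: cross_def)
    moreover have "\<tau> \<notin> B" using h assms(3) by (auto simp: cross_def fun_eq_iff)
    ultimately show "\<rho> \<notin> B \<and> \<tau> \<notin> B" using assms(4) by blast
  qed
  show "disperse_nodes c (Gr (rl B 0 t)) = V a b ` {\<tau>. res (dd t) \<sigma> \<tau>}"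
    unfolding disperse_nodes_eq dd_rl0 assms(3) ..
qed

lemma C_polygon_res1:
  assumes "mixed (dd t)" "src (dd t) \<sigma>" "\<forall>\<xi>. res (dd t) \<sigma> \<xi> \<longleftrightarrow> dd t \<xi> \<or> \<xi> = \<rho>" "coiso (dd t) \<rho>"
  shows "C_polygon c (Gr (rl {\<rho>} 1 t)) = pp t (res (dd t) \<sigma>)"
proof -
  have "dd (rl {\<rho>} 1 t) = res (dd t) \<sigma>" unfolding dd_rl1 using assms(3) by auto
  then have "C_polygon c (Gr (rl {\<rho>} 1 t)) = pp (rl {\<rho>} 1 t) (res (dd t) \<sigma>)" unfolding C_polygon_pp by simp
  also have "\<dots> = pp t (res (dd t) \<sigma>)"
  proof (rule pp_rl)
    fix \<xi> \<tau> assume h: "cross (res (dd t) \<sigma>) \<xi> \<tau>"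
    then have "\<not> dd t \<xi>" "dd t \<tau>" using res_cross[OF assms(1,2)] by (auto simp: cross_def)
    moreover have "\<xi> \<noteq> \<rho>" using h assms(3) by (auto simp: cross_def)
    ultimately show "\<xi> \<notin> {\<rho>} \<and> \<tau> \<notin> {\<rho>}" using assms(4) by (auto simp: coiso_def)
  qed
  finally show ?thesis .
qed

lemma res_coiso: "ctype d \<Longrightarrow> coiso d \<rho> \<Longrightarrow> res d \<rho> = (\<lambda>\<tau>. \<tau> \<noteq> \<rho>)"
  by (simp add: res_def res0_def fun_eq_iff)

lemma coiso_src: "ctype d \<Longrightarrow> coiso d \<rho> \<Longrightarrow> src d \<rho>"
  by (simp add: src_def coiso_def)

lemma S_disperse_pair:
  assumes "adj \<sigma> \<tau>" "dd t \<sigma>" "dd t \<tau>" "\<And>\<rho>. \<rho> \<noteq> \<sigma> \<Longrightarrow> \<rho> \<noteq> \<tau> \<Longrightarrow> adj \<sigma> \<rho> \<or> adj \<tau> \<rho> \<Longrightarrow> \<not> dd t \<rho>"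
  shows "S_disperse c (Gr t) (V a b ` {\<sigma>, \<tau>}) = V a b ` {\<sigma>, \<tau>}"
proof (rule S_disperse_closed)
  fix \<xi> \<rho> assume "\<xi> \<in> {\<sigma>, \<tau>}" "adj \<xi> \<rho>" "dd t \<rho>"
  then show "\<rho> \<in> {\<sigma>, \<tau>}" using assms(4)[of \<rho>] by auto
qed (use assms in auto)

text \<open>The set \<open>K\<close> enters correspondence of nodes and lines on trivial L-faces
  only. These do not occur for S3 patterns (\<open>trivial_not_ctype\<close>), so \<open>K\<close>
  is traced for the other patterns.\<close>

theorem inner_fwd:
  assumes reg: "regular_graph c \<G> (Gr t)" and inn: "inner_iso_path_from c \<G> (Gr t) w K"
  shows "\<exists>\<sigma>. src (dd t) \<sigma> \<and> w = pp t (res (dd t) \<sigma>) \<and> (\<not> ctype (dd t) \<longrightarrow> K = V a b ` {\<tau>. res (dd t) \<sigma> \<tau>})"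
proof -
  define d where "d = dd t"
  note mx = regular_mixed(1)[OF reg, folded d_def] and sf = regular_mixed(2)[OF reg]
  obtain i n R G' where ap: "applicable_rule c (Gr t) i n" and ru: "S_rule c i n (Gr t) R G'"
    and w: "(w, K) \<in> R \<or> w = C_polygon c G' \<and> K = disperse_nodes c G'"
    using inn unfolding inner_iso_path_from_def by blast
  from ap[unfolded applicable_iff[OF sf]] consider "i = 1" "rows1 d n" | "i = 2" "n = 1" "s2type d"
    | "i = 3" "n = 1" "rows3 d" | "n = 0" "nL d = 0" "\<forall>m. \<not> rows1 d m" "\<not> rows3 d"
    unfolding d_def by (elim disjE conjE) auto
  then show ?thesis
  proof cases
    case 1
    note f = rows1_facts[OF mx 1(2)]
    obtain B where B: "B \<subseteq> {\<sigma>. iso d \<sigma>}" "card B = n" "G' = Gr (rl B 0 t)"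
      "R = (\<lambda>\<sigma>. (pp t (\<lambda>\<tau>. \<tau> = \<sigma>), {V a b \<sigma>})) ` B"
      using S1_rule_fwd[OF ru 1(1) refl] unfolding d_def by blast
    from w show ?thesis
    proof
      assume "(w, K) \<in> R"
      then obtain \<sigma> where s: "\<sigma> \<in> B" "w = pp t (\<lambda>\<tau>. \<tau> = \<sigma>)" "K = {V a b \<sigma>}" unfolding B(4) by blast
      then have i: "iso d \<sigma>" using B(1) by blast
      have "src d \<sigma>" using i f(1) by (simp add: src_def iso_d)
      then show ?thesis using s res_iso(1)[OF f(1,2) i] unfolding d_def by (intro exI[of _ \<sigma>]) simp
    next
      assume h: "w = C_polygon c G' \<and> K = disperse_nodes c G'"
      obtain \<sigma> where s: "src d \<sigma>" "(\<lambda>\<tau>. d \<tau> \<and> \<tau> \<notin> B) = res d \<sigma>" using iso_rest[OF mx 1(2) B(1,2)] by blast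
      have "\<tau> \<in> B \<Longrightarrow> dd t \<tau>" for \<tau> using B(1) iso_d[of d \<tau>] unfolding d_def by blast
      then show ?thesis using C_polygon_res0[of t \<sigma> B] mx s h B(3) unfolding d_def by auto
    qed
  next
    case 2
    note f = s2type_facts[OF mx 2(3)]
    obtain A where A: "S_subgraph c 2 (Gr t) A" "G' = S_relabel 2 (Gr t) A" "R = {(S_polygon c (Gr t) A, S_disperse c (Gr t) A)}"
      using ru[unfolded 2(1,2) S_rule_one_iff] by blast
    obtain \<sigma> \<tau> where s: "A = V a b ` {\<sigma>, \<tau>}" "adj \<sigma> \<tau>" "d \<sigma>" "d \<tau>"
      "\<And>\<rho>. \<rho> \<noteq> \<sigma> \<Longrightarrow> \<rho> \<noteq> \<tau> \<Longrightarrow> adj \<sigma> \<rho> \<or> adj \<tau> \<rho> \<Longrightarrow> \<not> d \<rho>"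
      using A(1) unfolding S2_iff d_def by blast
    note s' = s[unfolded d_def]
    from w show ?thesis
    proof
      assume "(w, K) \<in> R"
      then have "w = pp t (\<lambda>\<xi>. \<xi> = \<sigma> \<or> \<xi> = \<tau>)" "K = V a b ` {\<sigma>, \<tau>}"
        unfolding A(3) s(1) using S_polygon_pair[OF s'(2-5)] S_disperse_pair[OF s'(2-5)] by simp_all
      moreover have "src d \<sigma>" using f(1) s(3) by (simp add: src_def)
      moreover have "{\<sigma>, \<tau>} = {\<xi>. \<xi> = \<sigma> \<or> \<xi> = \<tau>}" by auto
      ultimately show ?thesis using res_pair[OF mx 2(3) s(2-4)] unfolding d_def by (intro exI[of _ \<sigma>]) simp
    next
      assume h: "w = C_polygon c G' \<and> K = disperse_nodes c G'"
      obtain \<xi> where x: "src d \<xi>" "\<forall>\<rho>. res d \<xi> \<rho> \<longleftrightarrow> d \<rho> \<and> \<rho> \<noteq> \<sigma> \<and> \<rho> \<noteq> \<tau>" using f(4)[OF s(2-4)] by blast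
      have "(\<lambda>\<rho>. d \<rho> \<and> \<rho> \<notin> {\<sigma>, \<tau>}) = res d \<xi>" using x(2) by auto
      moreover have "G' = Gr (rl {\<sigma>, \<tau>} 0 t)" unfolding A(2) s(1) S_relabel_Gr by simp
      ultimately show ?thesis using C_polygon_res0[of t \<xi> "{\<sigma>, \<tau>}"] mx x(1) h s(3,4) unfolding d_def by auto
    qed
  next
    case 3
    note f = rows3_facts[OF mx 3(3)]
    obtain A where A: "S_subgraph c 3 (Gr t) A" "G' = S_relabel 3 (Gr t) A" "R = {(S_polygon c (Gr t) A, S_disperse c (Gr t) A)}"
      using ru[unfolded 3(1,2) S_rule_one_iff] by blast
    obtain \<rho> where r: "A = V a b ` {\<rho>}" "coiso d \<rho>" using A(1) S3_iff[OF singular_free_T1[OF sf]] unfolding d_def by blast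
    from w show ?thesis
    proof
      assume "(w, K) \<in> R"
      then have "w = pp t (\<lambda>\<tau>. \<tau> \<noteq> \<rho>)" unfolding A(3) r(1) using S_polygon_coiso[OF r(2)[unfolded d_def]] by simp
      then show ?thesis using f(1) r(2) res_coiso[OF f(1) r(2)] coiso_src[OF f(1) r(2)] unfolding d_def by (intro exI[of _ \<rho>]) simp
    next
      assume h: "w = C_polygon c G' \<and> K = disperse_nodes c G'"
      obtain \<xi> where x: "src d \<xi>" "\<forall>\<tau>. res d \<xi> \<tau> \<longleftrightarrow> d \<tau> \<or> \<tau> = \<rho>" using f(3)[OF r(2)] by blast
      have "G' = Gr (rl {\<rho>} 1 t)" unfolding A(2) r(1) S_relabel_Gr by simp
      then show ?thesis using C_polygon_res1[of t \<xi> \<rho>] mx x h r(2) f(1) unfolding d_def by auto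
    qed
  next
    case 4
    have ns: "\<not> s2type d" using 4(2) by (auto simp: s2type_def)
    have n1: "\<And>m. \<not> rows1 d m" using 4(3) by blast
    note f = plain_facts[OF mx n1 4(4) ns]
    \<comment> \<open>Without a rule all disperse nodes share one residual pattern, so any of them
      may represent the path.\<close>
    obtain \<sigma> where "d \<sigma>" using mx unfolding mixed_iff by blast
    then have s: "src d \<sigma>" using f(1) by (simp add: src_def)
    have "R = {}" "G' = Gr t" using ru unfolding 4(1) S_rule_zero_iff by auto
    then have "w = pp t d" "K = V a b ` {\<tau>. d \<tau>}" using w by (simp_all add: C_polygon_pp disperse_nodes_eq d_def)
    then show ?thesis using f(3)[OF s] s unfolding d_def by auto
  qed
qed

theorem inner_bwd:
  assumes reg: "regular_graph c \<G> (Gr t)" and src: "src (dd t) \<sigma>"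
  shows "\<exists>K. inner_iso_path_from c \<G> (Gr t) (pp t (res (dd t) \<sigma>)) K \<and> (\<not> ctype (dd t) \<longrightarrow> K = V a b ` {\<tau>. res (dd t) \<sigma> \<tau>})"
proof -
  define d where "d = dd t"
  note mx = regular_mixed(1)[OF reg, folded d_def] and sf = regular_mixed(2)[OF reg]
  note sr = src[folded d_def]
  have I: "inner_iso_path_from c \<G> (Gr t) w K"
    if "applicable_rule c (Gr t) i n" "S_rule c i n (Gr t) R G'" "(w, K) \<in> R \<or> w = C_polygon c G' \<and> K = disperse_nodes c G'" for i n R G' w K
    unfolding inner_iso_path_from_def using reg that by blast
  consider n where "rows1 d n" | "s2type d" | "rows3 d" | "\<And>m. \<not> rows1 d m" "\<not> rows3 d" "\<not> s2type d" by blast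
  then show ?thesis
  proof cases
    case 1
    note f = rows1_facts[OF mx 1]
    have ap: "applicable_rule c (Gr t) 1 n" using applicable_iff[OF sf] 1 unfolding d_def by blast
    obtain B where B: "B \<subseteq> {\<sigma>. iso d \<sigma>}" "card B = n" "\<sigma> \<in> B \<and> iso d \<sigma> \<or> (\<lambda>\<tau>. d \<tau> \<and> \<tau> \<notin> B) = res d \<sigma>"
      using iso_choose[OF mx 1 sr] by blast
    note ru = S1_rule_bwd[OF B(1)[unfolded d_def], unfolded B(2)]
    from B(3) show ?thesis
    proof
      assume s: "\<sigma> \<in> B \<and> iso d \<sigma>"
      have "inner_iso_path_from c \<G> (Gr t) (pp t (\<lambda>\<tau>. \<tau> = \<sigma>)) {V a b \<sigma>}" by (rule I[OF ap ru]) (use s in blast)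
      then show ?thesis using res_iso(1)[OF f(1,2) s[THEN conjunct2]] unfolding d_def by (intro exI[of _ "{V a b \<sigma>}"]) simp
    next
      assume s: "(\<lambda>\<tau>. d \<tau> \<and> \<tau> \<notin> B) = res d \<sigma>"
      have B': "\<tau> \<in> B \<Longrightarrow> dd t \<tau>" for \<tau> using B(1) iso_d[of d \<tau>] unfolding d_def by blast
      note C = C_polygon_res0[OF mx[unfolded d_def] src s[unfolded d_def] B']
      have "inner_iso_path_from c \<G> (Gr t) (pp t (res (dd t) \<sigma>)) (V a b ` {\<tau>. res (dd t) \<sigma> \<tau>})"
        by (rule I[OF ap ru]) (use C in simp)
      then show ?thesis by blast
    qed
  next
    case 2
    note f = s2type_facts[OF mx 2]
    have ds: "d \<sigma>" using sr f(1) by (simp add: src_def)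
    obtain \<tau> where t: "adj \<sigma> \<tau>" "d \<tau>" using f(2)[OF ds] by blast
    have n: "\<And>\<rho>. \<rho> \<noteq> \<sigma> \<Longrightarrow> \<rho> \<noteq> \<tau> \<Longrightarrow> adj \<sigma> \<rho> \<or> adj \<tau> \<rho> \<Longrightarrow> \<not> dd t \<rho>"
      using f(3)[OF t(1) ds t(2)] f(3)[OF t(1)[unfolded adj_sym[of \<sigma>]] t(2) ds] unfolding d_def by blast
    have ap: "applicable_rule c (Gr t) 2 1" using applicable_iff[OF sf] 2 unfolding d_def by blast
    have S: "S_subgraph c 2 (Gr t) (V a b ` {\<sigma>, \<tau>})" unfolding S2_iff using n t ds unfolding d_def by blast
    have ru: "S_rule c 2 1 (Gr t) {(S_polygon c (Gr t) (V a b ` {\<sigma>, \<tau>}), S_disperse c (Gr t) (V a b ` {\<sigma>, \<tau>}))} (S_relabel 2 (Gr t) (V a b ` {\<sigma>, \<tau>}))"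
      unfolding S_rule_one_iff using S by blast
    have dd: "dd t \<sigma>" "dd t \<tau>" using ds t unfolding d_def by auto
    have "inner_iso_path_from c \<G> (Gr t) (pp t (\<lambda>\<xi>. \<xi> = \<sigma> \<or> \<xi> = \<tau>)) (V a b ` {\<sigma>, \<tau>})"
      by (rule I[OF ap ru]) (use S_polygon_pair[OF t(1) dd n] S_disperse_pair[OF t(1) dd n] in simp)
    moreover have "{\<sigma>, \<tau>} = {\<xi>. \<xi> = \<sigma> \<or> \<xi> = \<tau>}" by auto
    ultimately show ?thesis using res_pair[OF mx 2 t(1) ds t(2)] unfolding d_def by (intro exI[of _ "V a b ` {\<sigma>, \<tau>}"]) simp
  next
    case 3
    note f = rows3_facts[OF mx 3]
    have ap: "applicable_rule c (Gr t) 3 1" using applicable_iff[OF sf] 3 unfolding d_def by blast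
    have ru: "S_rule c 3 1 (Gr t) {(S_polygon c (Gr t) (V a b ` {\<rho>}), S_disperse c (Gr t) (V a b ` {\<rho>}))} (S_relabel 3 (Gr t) (V a b ` {\<rho>}))"
      if "coiso d \<rho>" for \<rho>
      unfolding S_rule_one_iff using that S3_iff[OF singular_free_T1[OF sf]] unfolding d_def by blast
    show ?thesis
    proof (cases "coiso d \<sigma>")
      case True
      have "inner_iso_path_from c \<G> (Gr t) (pp t (\<lambda>\<tau>. \<tau> \<noteq> \<sigma>)) (S_disperse c (Gr t) (V a b ` {\<sigma>}))"
        by (rule I[OF ap ru[OF True]]) (use S_polygon_coiso[OF True[unfolded d_def]] in simp)
      then show ?thesis using f(1) res_coiso[OF f(1) True] unfolding d_def by auto
    next
      case False
      \<comment> \<open>The path of a continuous node that is not isolated is what remains after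
        filling an isolated one, and every choice of \<rho> gives it: the remaining pattern still
        has \<sigma> continuous, so it is the residual pattern of \<sigma>.\<close>
      obtain \<rho> where r: "coiso d \<rho>" using f(2) by blast
      obtain \<xi> where x: "src d \<xi>" "\<forall>\<tau>. res d \<xi> \<tau> \<longleftrightarrow> d \<tau> \<or> \<tau> = \<rho>" using f(3)[OF r] by blast
      have "\<not> res d \<xi> \<sigma>" using x(2) sr f(1) r False by (auto simp: src_def)
      then have e: "res d \<sigma> = res d \<xi>" using res_unique[OF mx x(1) sr] f(1) by simp
      have "S_relabel 3 (Gr t) (V a b ` {\<rho>}) = Gr (rl {\<rho>} 1 t)" unfolding S_relabel_Gr by simp
      then have "C_polygon c (S_relabel 3 (Gr t) (V a b ` {\<rho>})) = pp t (res d \<sigma>)"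
        using C_polygon_res1[of t \<xi> \<rho>] mx x r unfolding e unfolding d_def by simp
      then have "inner_iso_path_from c \<G> (Gr t) (pp t (res d \<sigma>)) (disperse_nodes c (S_relabel 3 (Gr t) (V a b ` {\<rho>})))"
        by (intro I[OF ap ru[OF r]]) simp
      then show ?thesis using f(1) unfolding d_def by blast
    qed
  next
    case 4
    note f = plain_facts[OF mx 4]
    have ap: "applicable_rule c (Gr t) 0 0" using applicable_iff[OF sf] 4 f(2) unfolding d_def by blast
    have ru: "S_rule c 0 0 (Gr t) {} (Gr t)" by (simp add: S_rule_zero_iff)
    have "inner_iso_path_from c \<G> (Gr t) (pp t d) (V a b ` {\<tau>. d \<tau>})"
      by (rule I[OF ap ru]) (simp add: C_polygon_pp disperse_nodes_eq d_def)
    then show ?thesis using f(3)[OF sr] unfolding d_def by auto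
  qed
qed

end

section \<open>Which lines lie on which face, and how many lines a path has\<close>

lemma aL_vals:
  assumes "aL d f"
  shows "d (f (\<not> u) v) = (\<not> d (f u v))" "d (f u (\<not> v)) = (\<not> d (f u v))" "d (f (\<not> u) (\<not> v)) = d (f u v)"
  using assms unfolding aL_def by (cases u; cases v; auto)+

lemma cn_cases: "P (\<not> u) v \<Longrightarrow> P u (\<not> v) \<Longrightarrow> P (\<not> u) (\<not> v) \<Longrightarrow> (p, q) \<noteq> (u, v) \<Longrightarrow> P p (q::bool)"
  by (cases u; cases v; cases p; cases q) auto

lemma fcount_single: "r (f u v) \<Longrightarrow> \<not> r (f (\<not> u) v) \<Longrightarrow> \<not> r (f u (\<not> v)) \<Longrightarrow> \<not> r (f (\<not> u) (\<not> v)) \<Longrightarrow> fcount r f = 1"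
  unfolding fcount_def by (cases u; cases v) simp_all

lemma fcount_co: "\<not> r (f u v) \<Longrightarrow> r (f (\<not> u) v) \<Longrightarrow> r (f u (\<not> v)) \<Longrightarrow> r (f (\<not> u) (\<not> v)) \<Longrightarrow> fcount r f = 3"
  unfolding fcount_def by (cases u; cases v) simp_all

lemma areg_single: 
  assumes "r (f u v)" "\<not> r (f (\<not> u) v)" "\<not> r (f u (\<not> v))" "\<not> r (f (\<not> u) (\<not> v))"
  shows "areg r z f"
  unfolding areg_def fcount_single[OF assms] using assms unfolding aL_def by (cases u; cases v) auto

lemma areg_co: 
  assumes "\<not> r (f u v)" "r (f (\<not> u) v)" "r (f u (\<not> v))" "r (f (\<not> u) (\<not> v))"
  shows "areg r z f \<longleftrightarrow> \<not> z (f u v)"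
proof -
  have "(\<exists>p q. \<not> r (f p q) \<and> z (f p q)) \<longleftrightarrow> z (f u v)"
    using assms cn_cases[of "\<lambda>p q. r (f p q)" u v] by (metis prod.inject)
  moreover have "\<not> aL r f" using assms unfolding aL_def by (cases u; cases v) auto
  ultimately show ?thesis unfolding areg_def fcount_co[OF assms] using assms by blast
qed

lemma ctype_aD: "ctype d \<Longrightarrow> 5 \<le> aD d" by (auto simp: ctype_def)

lemma card_adj: "card {\<tau>. adj \<sigma> \<tau>} = 3"
proof -
  have "{\<tau>. adj \<sigma> \<tau>} = set (nb \<sigma>)" by (auto simp: adj_def)
  moreover have "distinct (nb \<sigma>)" "length (nb \<sigma>) = 3" by (cases \<sigma>; simp add: nb.simps)+
  ultimately show ?thesis using distinct_card[of "nb \<sigma>"] by simp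
qed

lemma aD_le_4:
  assumes "adj \<rho> \<tau>" "\<not> d \<rho>" "\<not> d \<tau>" "\<And>\<xi>. d \<xi> \<Longrightarrow> adj \<rho> \<xi> \<or> adj \<tau> \<xi>"
  shows "aD d \<le> 4"
proof -
  have "{\<xi>. d \<xi>} \<subseteq> ({\<xi>. adj \<rho> \<xi>} - {\<tau>}) \<union> ({\<xi>. adj \<tau> \<xi>} - {\<rho>})" using assms(2-4) by auto
  then have "card {\<xi>. d \<xi>} \<le> card (({\<xi>. adj \<rho> \<xi>} - {\<tau>}) \<union> ({\<xi>. adj \<tau> \<xi>} - {\<rho>}))" by (intro card_mono) simp_all
  also have "\<dots> \<le> card ({\<xi>. adj \<rho> \<xi>} - {\<tau>}) + card ({\<xi>. adj \<tau> \<xi>} - {\<rho>})" by (rule card_Un_le)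
  also have "\<dots> = 4" using assms(1) adj_sym[of \<rho> \<tau>] by (simp add: card_adj)
  finally show ?thesis by (simp add: card_aD)
qed

context cubc begin

text \<open>If a disperse node were incident to neither end of the edge, omitting the other node
  with this property would leave the seven nodes of a T2-subgraph. So the disperse nodes are among
  the four outer neighbors of the edge.\<close>

lemma singular_free_T2:
  assumes "singular_free c (Gr t)" "adj \<rho> \<tau>" "zz t \<rho>" "zz t \<tau>"
    "\<And>\<xi>. adj \<rho> \<xi> \<or> adj \<tau> \<xi> \<Longrightarrow> \<xi> \<noteq> \<rho> \<Longrightarrow> \<xi> \<noteq> \<tau> \<Longrightarrow> dd t \<xi>"
  shows "aD (dd t) \<le> 4" "dd t \<xi> \<Longrightarrow> adj \<rho> \<xi> \<or> adj \<tau> \<xi>"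
proof -
  have *: "adj \<rho> \<xi> \<or> adj \<tau> \<xi>" if x: "dd t \<xi>" for \<xi>
  proof (rule ccontr)
    assume n: "\<not> (adj \<rho> \<xi> \<or> adj \<tau> \<xi>)"
    have ne: "\<xi> \<noteq> \<rho>" "\<xi> \<noteq> \<tau>" using x assms(3,4) zz_not_dd by blast+
    then have far: "t2far \<rho> \<tau> \<xi>" using n by (simp add: t2far_def adj_def)
    obtain \<eta> where e: "\<eta> \<noteq> \<xi>" "t2far \<rho> \<tau> \<eta>" "\<And>\<rho>'. t2far \<rho> \<tau> \<rho>' \<Longrightarrow> \<rho>' = \<xi> \<or> \<rho>' = \<eta>"
      using t2far_two[OF assms(2) far] by blast
    define W where "W = V a b ` (- {\<eta>})"
    have "card (UNIV :: ix set) = 8" using card_aD[of "\<lambda>_. True"] by (simp add: aD_def allix_def)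
    then have W7: "card W = 7" unfolding W_def by (simp add: card_image inj_V card_Diff_subset Compl_eq_Diff_UNIV)
    have inW: "X \<in> W" if X: "incident (cbox a b) (V a b \<rho>) X \<or> incident (cbox a b) (V a b \<tau>) X" for X
    proof -
      obtain \<zeta> where z: "X = V a b \<zeta>" using X unfolding incident_iff by blast
      then have "adj \<rho> \<zeta> \<or> adj \<tau> \<zeta>" using X by simp
      then have "\<zeta> \<noteq> \<eta>" using e(2) by (auto simp: t2far_def adj_def)
      then show ?thesis unfolding W_def z by blast
    qed
    have disp: "disperse c (Gr t) X" if X: "X \<in> W - {V a b \<rho>, V a b \<tau>}" for X
    proof -
      obtain \<zeta> where z: "X = V a b \<zeta>" "\<zeta> \<noteq> \<eta>" "\<zeta> \<noteq> \<rho>" "\<zeta> \<noteq> \<tau>" using X unfolding W_def by auto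
      have "dd t \<zeta>"
      proof (cases "adj \<rho> \<zeta> \<or> adj \<tau> \<zeta>")
        case True then show ?thesis using assms(5) z by blast
      next
        case False
        then have "t2far \<rho> \<tau> \<zeta>" using z by (simp add: t2far_def adj_def)
        then show ?thesis using e(3) z x by blast
      qed
      then show ?thesis using z by simp
    qed
    have sub: "W \<subseteq> nodes (cbox a b)" "V a b \<rho> \<in> W" "V a b \<tau> \<in> W"
      using e(2) unfolding W_def by (auto simp: t2far_def)
    have "T2_pair c (Gr t) (V a b \<rho>) (V a b \<tau>)"
      unfolding T2_pair_def Gr_simps
    proof (intro conjI exI[of _ W] allI impI ballI)
      show "incident (cbox a b) (V a b \<rho>) (V a b \<tau>)" using assms(2) by simp
      show "t (V a b \<rho>) = c" "t (V a b \<tau>) = c" using assms(3,4) by (simp_all add: zz_def)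
    qed (fact W7 sub inW disp)+
    then show False using assms(1) by (auto simp: singular_free_def)
  qed
  show "aD (dd t) \<le> 4"
    by (rule aD_le_4[OF assms(2)]) (use assms(3,4) zz_not_dd * in blast)+
  show "dd t \<xi> \<Longrightarrow> adj \<rho> \<xi> \<or> adj \<tau> \<xi>" by (rule *)
qed

lemma res_crossD: "mixed d \<Longrightarrow> src d \<sigma> \<Longrightarrow> \<forall>\<rho> \<tau>. cross (res d \<sigma>) \<rho> \<tau> \<longrightarrow> cross d \<rho> \<tau>"
  using res_cross unfolding cross_def by blast

lemma line_single:
  assumes "r (cn k s u v)" "\<not> r (cn k s (\<not> u) v)" "\<not> r (cn k s u (\<not> v))" "\<not> r (cn k s (\<not> u) (\<not> v))"
  shows "line t r k s = {ip t (cn k s (\<not> u) v) (cn k s u v), ip t (cn k s u (\<not> v)) (cn k s u v)}"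
proof (intro equalityI subsetI)
  fix x assume "x \<in> line t r k s"
  then obtain \<rho> \<tau> where x: "x = ip t \<rho> \<tau>" "co k \<rho> = s" "co k \<tau> = s" "adj \<rho> \<tau>" "\<not> r \<rho>" "r \<tau>" unfolding line_def by blast
  obtain p q where r: "\<rho> = cn k s p q" using co_iff_cn[THEN iffD1, OF x(2)] by blast
  obtain p' q' where t: "\<tau> = cn k s p' q'" using co_iff_cn[THEN iffD1, OF x(3)] by blast
  have "p' = u \<and> q' = v" using x(6) assms cn_cases[of "\<lambda>p q. \<not> r (cn k s p q)" u v p' q'] unfolding t by blast
  moreover have "p = (\<not> u) \<and> q = v \<or> p = u \<and> q = (\<not> v)" using x(4) calculation unfolding r t by auto
  ultimately show "x \<in> {ip t (cn k s (\<not> u) v) (cn k s u v), ip t (cn k s u (\<not> v)) (cn k s u v)}" unfolding x(1) r t by blast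
next
  fix x assume h: "x \<in> {ip t (cn k s (\<not> u) v) (cn k s u v), ip t (cn k s u (\<not> v)) (cn k s u v)}"
  have A: "adj (cn k s (\<not> u) v) (cn k s u v)" "adj (cn k s u (\<not> v)) (cn k s u v)" by simp_all
  from h consider "x = ip t (cn k s (\<not> u) v) (cn k s u v)" | "x = ip t (cn k s u (\<not> v)) (cn k s u v)" by blast
  then show "x \<in> line t r k s" unfolding line_def using A assms co_cn by cases blast+
qed

lemma line_co:
  assumes "\<not> r (cn k s u v)" "r (cn k s (\<not> u) v)" "r (cn k s u (\<not> v))" "r (cn k s (\<not> u) (\<not> v))"
  shows "line t r k s = {ip t (cn k s u v) (cn k s (\<not> u) v), ip t (cn k s u v) (cn k s u (\<not> v))}"
proof (intro equalityI subsetI)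
  fix x assume "x \<in> line t r k s"
  then obtain \<rho> \<tau> where x: "x = ip t \<rho> \<tau>" "co k \<rho> = s" "co k \<tau> = s" "adj \<rho> \<tau>" "\<not> r \<rho>" "r \<tau>" unfolding line_def by blast
  obtain p q where r: "\<rho> = cn k s p q" using co_iff_cn[THEN iffD1, OF x(2)] by blast
  obtain p' q' where t: "\<tau> = cn k s p' q'" using co_iff_cn[THEN iffD1, OF x(3)] by blast
  have "p = u \<and> q = v" using x(5) assms cn_cases[of "\<lambda>p q. r (cn k s p q)" u v p q] unfolding r by blast
  moreover have "p' = (\<not> u) \<and> q' = v \<or> p' = u \<and> q' = (\<not> v)" using x(4) calculation unfolding r t by auto
  ultimately show "x \<in> {ip t (cn k s u v) (cn k s (\<not> u) v), ip t (cn k s u v) (cn k s u (\<not> v))}" unfolding x(1) r t by blast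
next
  fix x assume h: "x \<in> {ip t (cn k s u v) (cn k s (\<not> u) v), ip t (cn k s u v) (cn k s u (\<not> v))}"
  have A: "adj (cn k s u v) (cn k s (\<not> u) v)" "adj (cn k s u v) (cn k s u (\<not> v))" by simp_all
  from h consider "x = ip t (cn k s u v) (cn k s (\<not> u) v)" | "x = ip t (cn k s u v) (cn k s u (\<not> v))" by blast
  then show "x \<in> line t r k s" unfolding line_def using A assms co_cn by cases blast+
qed

lemma cnE: assumes "co k \<sigma> = s" obtains u v where "\<sigma> = cn k s u v"
  using co_iff_cn[THEN iffD1, OF assms] by blast

lemma line_subset_bface:
  assumes ar: "areg r (zz t) (cn k s)" and cr: "\<forall>\<rho> \<tau>. cross r \<rho> \<tau> \<longrightarrow> cross (dd t) \<rho> \<tau>"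
  shows "line t r k s \<subseteq> bface a b k s"
  using cr unfolding line_cross by (auto simp: ip_bface cross_def)

text \<open>Both continuous ends lie on the common edge of the two faces. If one of them had label
  below c, its crossing edge would be this common edge, which holds a single iso-point, whereas the
  line has two. So both ends of the line are nodes with label c.\<close>

lemma face_unique:
  assumes ar: "areg r (zz t) (cn k s)" and cr: "\<forall>\<rho> \<tau>. cross r \<rho> \<tau> \<longrightarrow> cross (dd t) \<rho> \<tau>"
    and sub: "line t r k s \<subseteq> bface a b k' s'" and ne: "(k', s') \<noteq> (k, s)"
  shows "\<exists>\<rho> \<tau>. adj \<rho> \<tau> \<and> zz t \<rho> \<and> zz t \<tau> \<and> \<not> r \<rho> \<and> \<not> r \<tau> \<and> line t r k s = {V a b \<rho>, V a b \<tau>} \<and>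
    co k \<rho> = s \<and> co k \<tau> = s \<and> co k' \<rho> = s' \<and> co k' \<tau> = s' \<and> k \<noteq> k' \<and> (\<forall>\<xi>. co k \<xi> = s \<longrightarrow> \<xi> \<noteq> \<rho> \<longrightarrow> \<xi> \<noteq> \<tau> \<longrightarrow> r \<xi>)"
proof -
  obtain \<rho>1 \<tau>1 \<rho>2 \<tau>2 where L: "cross r \<rho>1 \<tau>1" "cross r \<rho>2 \<tau>2" "co k \<rho>1 = s" "co k \<tau>1 = s" "co k \<rho>2 = s" "co k \<tau>2 = s"
    "line t r k s = {ip t \<rho>1 \<tau>1, ip t \<rho>2 \<tau>2}" "ip t \<rho>1 \<tau>1 \<noteq> ip t \<rho>2 \<tau>2"
    using line_two_ex[OF ar cr] by (elim exE conjE)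
  note X1 = cr[rule_format, OF L(1)] and X2 = cr[rule_format, OF L(2)]
  have b: "co k' \<rho>1 = s'" "co k' \<tau>1 = s' \<or> zz t \<rho>1" "co k' \<rho>2 = s'" "co k' \<tau>2 = s' \<or> zz t \<rho>2"
    using sub L(7) X1 X2 ip_bface[of t \<rho>1 \<tau>1 k' s'] ip_bface[of t \<rho>2 \<tau>2 k' s'] unfolding cross_def by auto
  have kk: "k \<noteq> k'" using ne b(1) L(3) by auto
  obtain j where j: "j \<noteq> k" "j \<noteq> k'" "\<And>i. i = j \<or> i = k \<or> i = k'"
  proof -
    obtain i j where ij: "i \<noteq> k" "j \<noteq> k" "i \<noteq> j" "UNIV = {i, j, k}" using other_axes[of k] by blast
    then have "k' = i \<or> k' = j" using kk by blast
    then show thesis using that ij by (metis (full_types) UNIV_I insert_iff singletonD)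
  qed
  have eqI: "\<sigma> = \<tau>" if "co j \<sigma> = co j \<tau>" "co k \<sigma> = s" "co k \<tau> = s" "co k' \<sigma> = s'" "co k' \<tau> = s'" for \<sigma> \<tau>
    unfolding ix_eq_iff using that j(3) by metis
  have d1: "\<not> dd t \<rho>1" "dd t \<tau>1" "\<not> dd t \<rho>2" "dd t \<tau>2" using X1 X2 by (auto simp: cross_def)
  have z1: "zz t \<rho>1"
  proof (rule ccontr)
    assume z: "\<not> zz t \<rho>1"
    then have t1: "co k' \<tau>1 = s'" using b by blast
    have "\<rho>1 \<noteq> \<tau>1" using d1 by auto
    then have "co j \<rho>1 \<noteq> co j \<tau>1" using eqI[of \<rho>1 \<tau>1] L b t1 by blast
    then have "co j \<rho>2 = co j \<rho>1 \<or> co j \<rho>2 = co j \<tau>1" by auto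
    then have r2: "\<rho>2 = \<rho>1" using eqI[of \<rho>2 \<rho>1] eqI[of \<rho>2 \<tau>1] L b t1 d1 by blast
    then have t2: "co k' \<tau>2 = s'" using b z by blast
    have "\<rho>2 \<noteq> \<tau>2" using d1 by auto
    then have "co j \<tau>2 \<noteq> co j \<rho>1" using eqI[of \<rho>2 \<tau>2] L b t2 r2 by auto
    then have "co j \<tau>2 = co j \<tau>1" using \<open>co j \<rho>1 \<noteq> co j \<tau>1\<close> by auto
    then have "\<tau>2 = \<tau>1" using eqI[of \<tau>2 \<tau>1] L b t1 t2 by blast
    then show False using L(8) r2 by simp
  qed
  have z2: "zz t \<rho>2"
  proof (rule ccontr)
    assume z: "\<not> zz t \<rho>2"
    then have t1: "co k' \<tau>2 = s'" using b by blast
    have "\<rho>2 \<noteq> \<tau>2" using d1 by auto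
    then have "co j \<rho>2 \<noteq> co j \<tau>2" using eqI[of \<rho>2 \<tau>2] L b t1 by blast
    then have "co j \<rho>1 = co j \<rho>2 \<or> co j \<rho>1 = co j \<tau>2" by auto
    then have "\<rho>1 = \<rho>2" using eqI[of \<rho>1 \<rho>2] eqI[of \<rho>1 \<tau>2] L b t1 d1 by blast
    then show False using z z1 by simp
  qed
  have ip1: "ip t \<rho>1 \<tau>1 = V a b \<rho>1" and ip2: "ip t \<rho>2 \<tau>2 = V a b \<rho>2"
    using z1 z2 by (simp_all add: ip_lam lam_def zz_def)
  have rne: "\<rho>1 \<noteq> \<rho>2" using L(8) ip1 ip2 by auto
  have ad: "adj \<rho>1 \<rho>2" unfolding adj_iff
  proof (intro exI conjI allI impI)
    show "co j \<rho>1 \<noteq> co j \<rho>2" using eqI[of \<rho>1 \<rho>2] L b rne by blast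
    fix i assume "i \<noteq> j"
    then show "co i \<rho>1 = co i \<rho>2" using j(3)[of i] L b by auto
  qed
  have nr: "\<not> r \<rho>1" "\<not> r \<rho>2" using L by (auto simp: cross_def)
  obtain u1 v1 where c1: "\<rho>1 = cn k s u1 v1" using cnE[OF L(3)] by blast
  obtain u2 v2 where c2: "\<rho>2 = cn k s u2 v2" using cnE[OF L(5)] by blast
  \<comment> \<open>A further corner outside \<open>r\<close> would leave at most one corner in
    \<open>r\<close>, incident to both ends of the line; but these are incident to each other and
    the edges of a face form no triangle.\<close>
  have oth: "r \<xi>" if xi: "co k \<xi> = s" "\<xi> \<noteq> \<rho>1" "\<xi> \<noteq> \<rho>2" for \<xi>
  proof (rule ccontr)
    assume nx: "\<not> r \<xi>"
    obtain p q where x: "\<xi> = cn k s p q" using cnE[OF xi(1)] by blast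
    have three: "\<not> r (cn k s u1 v1)" "\<not> r (cn k s u2 v2)" "\<not> r (cn k s p q)" "(u1 = u2) \<noteq> (v1 = v2)"
      "(p, q) \<noteq> (u1, v1)" "(p, q) \<noteq> (u2, v2)"
      using nr nx ad xi unfolding c1 c2 x by auto
    have le: "fcount r (cn k s) \<le> 1" using three unfolding fcount_def
      by (cases u1; cases v1; cases u2; cases v2; cases p; cases q) simp_all
    have "\<tau>1 = \<tau>2"
    proof -
      obtain p1 q1 where "\<tau>1 = cn k s p1 q1" using cnE[OF L(4)] by blast
      moreover obtain p2 q2 where "\<tau>2 = cn k s p2 q2" using cnE[OF L(6)] by blast
      ultimately show ?thesis using fcount_le1[OF le, of p1 q1 p2 q2] L(1,2) by (auto simp: cross_def)
    qed
    then obtain p1 q1 where "\<tau>1 = cn k s p1 q1" "\<tau>2 = cn k s p1 q1" using cnE[OF L(4)] by metis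
    then have "(u1 = p1) \<noteq> (v1 = q1)" "(u2 = p1) \<noteq> (v2 = q1)" using L(1,2) unfolding cross_def c1 c2 by auto
    then show False using three(4) rne unfolding c1 c2 by auto
  qed
  show ?thesis using ad z1 z2 nr L b kk oth unfolding L(7) ip1 ip2 by blast
qed

end

context cubc begin

lemma axis_bface_line: "areg r (zz t) (cn k s) \<Longrightarrow> line t r k s \<in> pp t r"
  unfolding pp_def by blast

lemma line_cong_face:
  assumes "\<And>u v. r (cn k s u v) = r' (cn k s u v)"
  shows "line t r k s = line t r' k s"
proof -
  have *: "r \<xi> = r' \<xi>" if "co k \<xi> = s" for \<xi> using assms cnE[OF that] by metis
  have "(co k \<rho> = s \<and> co k \<tau> = s \<and> adj \<rho> \<tau> \<and> \<not> r \<rho> \<and> r \<tau>) =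
      (co k \<rho> = s \<and> co k \<tau> = s \<and> adj \<rho> \<tau> \<and> \<not> r' \<rho> \<and> r' \<tau>)" for \<rho> \<tau> using *[of \<rho>] *[of \<tau>] by blast
  then show ?thesis unfolding line_def by simp
qed

lemma areg_cong_face: "(\<And>u v. r (cn k s u v) = r' (cn k s u v)) \<Longrightarrow> areg r z (cn k s) = areg r' z (cn k s)"
  unfolding areg_def aL_def fcount_def by simp

text \<open>By \<open>res_not_L\<close> and \<open>res_L\<close> a face that carries a line of the
  path is either untouched by the relabeling, or an L-face of \<open>d\<close> on which the residual
  pattern keeps one corner, which the line cuts off: a disperse corner in general, a continuous one
  for S3 patterns.\<close>

lemma pp_lines:
  assumes mx: "mixed d" and sr: "src d \<sigma>" and ar: "areg (res d \<sigma>) (zz t) (cn k s)"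
  obtains (reg) "\<not> aL d (cn k s)" "\<And>u v. res d \<sigma> (cn k s u v) = d (cn k s u v)" "areg d (zz t) (cn k s)"
      "line t (res d \<sigma>) k s = line t d k s"
  | (disp) u v where "aL d (cn k s)" "\<not> ctype d" "d (cn k s u v)" "res d \<sigma> (cn k s u v)" "\<not> res d \<sigma> (cn k s (\<not> u) (\<not> v))"
      "line t (res d \<sigma>) k s = {ip t (cn k s (\<not> u) v) (cn k s u v), ip t (cn k s u (\<not> v)) (cn k s u v)}"
  | (cont) u v where "aL d (cn k s)" "ctype d" "\<not> d (cn k s u v)" "\<not> res d \<sigma> (cn k s u v)" "\<not> zz t (cn k s u v)"
      "line t (res d \<sigma>) k s = {ip t (cn k s u v) (cn k s (\<not> u) v), ip t (cn k s u v) (cn k s u (\<not> v))}"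
proof (cases "aL d (cn k s)")
  case False
  have "\<exists>u v. res d \<sigma> (cn k s u v)" "\<exists>u v. \<not> res d \<sigma> (cn k s u v)" using ar unfolding areg_def by auto
  then have e: "res d \<sigma> (cn k s u v) = d (cn k s u v)" for u v using res_not_L[OF mx sr False] by blast
  show thesis by (rule reg[OF False e]) (use areg_cong_face[of "res d \<sigma>" k s d, OF e] ar line_cong_face[of "res d \<sigma>" k s d, OF e] in auto)
next
  case True
  show thesis
  proof (cases "ctype d")
    case ct: True
    obtain u v where uv: "\<not> res d \<sigma> (cn k s u v)" using ar unfolding areg_def by auto
    have oth: "res d \<sigma> (cn k s p q)" if "(p, q) \<noteq> (u, v)" for p q
      using res_L[OF mx sr True, of u v p q] uv that ct by auto
    have o: "res d \<sigma> (cn k s (\<not> u) v)" "res d \<sigma> (cn k s u (\<not> v))" "res d \<sigma> (cn k s (\<not> u) (\<not> v))" using oth by auto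
    have "\<not> d (cn k s u v)" using uv res_mono(1)[OF mx sr ct] by blast
    moreover have "\<not> zz t (cn k s u v)" using ar areg_co[OF uv o] by blast
    ultimately show thesis using cont[OF True ct _ uv] line_co[OF uv o] by blast
  next
    case nct: False
    obtain u v where uv: "res d \<sigma> (cn k s u v)" using ar unfolding areg_def by auto
    have oth: "\<not> res d \<sigma> (cn k s p q)" if "(p, q) \<noteq> (u, v)" for p q
      using res_L[OF mx sr True, of u v p q] uv that nct by auto
    have o: "\<not> res d \<sigma> (cn k s (\<not> u) v)" "\<not> res d \<sigma> (cn k s u (\<not> v))" "\<not> res d \<sigma> (cn k s (\<not> u) (\<not> v))" using oth by auto
    have "d (cn k s u v)" using uv res_mono(2)[OF mx sr nct] by blast
    then show thesis using disp[OF True nct _ uv o(3)] line_single[OF uv o] by blast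
  qed
qed

text \<open>Together with \<open>exist_disp\<close> and \<open>exist_cont\<close> the converse of
  \<open>pp_lines\<close>: every line that a face can carry occurs in the path of one of its
  corners. In \<open>exist_cont\<close> the label c is excluded, since the line around such a corner
  degenerates.\<close>

lemma exist_reg:
  assumes mx: "mixed d" and ar: "areg d (zz t) (cn k s)" and sr: "src d (cn k s p q)"
  shows "\<forall>u v. res d (cn k s p q) (cn k s u v) = d (cn k s u v)" "line t d k s \<in> pp t (res d (cn k s p q))"
proof -
  have nl: "\<not> aL d (cn k s)" "\<exists>u v. d (cn k s u v)" "\<exists>u v. \<not> d (cn k s u v)" using ar unfolding areg_def by auto
  have self: "res d (cn k s p q) (cn k s p q) = (\<not> ctype d)" by (rule res_self[OF mx sr])
  show e: "\<forall>u v. res d (cn k s p q) (cn k s u v) = d (cn k s u v)"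
  proof (cases "ctype d")
    case True
    then show ?thesis using res_not_L[OF mx sr nl(1)] self nl(2) res_mono(1)[OF mx sr True] by blast
  next
    case False
    then show ?thesis using res_not_L[OF mx sr nl(1)] self nl(3) res_mono(2)[OF mx sr False] by blast
  qed
  have "areg (res d (cn k s p q)) (zz t) (cn k s)" using areg_cong_face[of "res d (cn k s p q)" k s d] e ar by blast
  from axis_bface_line[OF this] show "line t d k s \<in> pp t (res d (cn k s p q))"
    using line_cong_face[of "res d (cn k s p q)" k s d t] e by simp
qed

lemma exist_disp:
  assumes mx: "mixed d" and L: "aL d (cn k s)" and nct: "\<not> ctype d" and D: "d (cn k s u v)"
  shows "src d (cn k s u v)" "res d (cn k s u v) (cn k s u v)" "\<not> res d (cn k s u v) (cn k s (\<not> u) (\<not> v))"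
    "{ip t (cn k s (\<not> u) v) (cn k s u v), ip t (cn k s u (\<not> v)) (cn k s u v)} \<in> pp t (res d (cn k s u v))"
proof -
  show sr: "src d (cn k s u v)" using nct D by (simp add: src_def)
  show uv: "res d (cn k s u v) (cn k s u v)" using res_self[OF mx sr] nct by simp
  have oth: "\<not> res d (cn k s u v) (cn k s p q)" if "(p, q) \<noteq> (u, v)" for p q
    using res_L[OF mx sr L, of u v p q] uv that nct by auto
  have o: "\<not> res d (cn k s u v) (cn k s (\<not> u) v)" "\<not> res d (cn k s u v) (cn k s u (\<not> v))" "\<not> res d (cn k s u v) (cn k s (\<not> u) (\<not> v))" using oth by auto
  show "\<not> res d (cn k s u v) (cn k s (\<not> u) (\<not> v))" by (rule o)
  show "{ip t (cn k s (\<not> u) v) (cn k s u v), ip t (cn k s u (\<not> v)) (cn k s u v)} \<in> pp t (res d (cn k s u v))"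
    using axis_bface_line[OF areg_single[of "res d (cn k s u v)" "cn k s" u v, OF uv o]] line_single[of "res d (cn k s u v)" k s u v, OF uv o] by simp
qed

lemma exist_cont:
  assumes mx: "mixed d" and L: "aL d (cn k s)" and ct: "ctype d" and D: "\<not> d (cn k s u v)" and nz: "\<not> zz t (cn k s u v)"
  shows "src d (cn k s u v)" 
    "{ip t (cn k s u v) (cn k s (\<not> u) v), ip t (cn k s u v) (cn k s u (\<not> v))} \<in> pp t (res d (cn k s u v))"
proof -
  show sr: "src d (cn k s u v)" using ct D by (simp add: src_def)
  have uv: "\<not> res d (cn k s u v) (cn k s u v)" using res_self[OF mx sr] ct by simp
  have oth: "res d (cn k s u v) (cn k s p q)" if "(p, q) \<noteq> (u, v)" for p q
    using res_L[OF mx sr L, of u v p q] uv that ct by auto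
  have o: "res d (cn k s u v) (cn k s (\<not> u) v)" "res d (cn k s u v) (cn k s u (\<not> v))" "res d (cn k s u v) (cn k s (\<not> u) (\<not> v))" using oth by auto
  have "areg (res d (cn k s u v)) (zz t) (cn k s)" using areg_co[of "res d (cn k s u v)" "cn k s" u v "zz t", OF uv o] nz by blast
  from axis_bface_line[OF this] show "{ip t (cn k s u v) (cn k s (\<not> u) v), ip t (cn k s u v) (cn k s u (\<not> v))} \<in> pp t (res d (cn k s u v))"
    using line_co[of "res d (cn k s u v)" k s u v, OF uv o] by simp
qed

lemma res_meet:
  assumes "mixed d" "src d \<sigma>" "src d \<sigma>'" "res d \<sigma> \<xi> \<noteq> ctype d" "res d \<sigma>' \<xi> \<noteq> ctype d"
  shows "res d \<sigma> = res d \<sigma>'"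
proof -
  have "src d \<xi>" using res_mono[OF assms(1,2), of \<xi>] assms(4) unfolding src_def by auto
  then show ?thesis using res_unique[OF assms(1,2) _ assms(4)] res_unique[OF assms(1,3) _ assms(5)] by metis
qed

definition edgeline :: "(point \<Rightarrow> real) \<Rightarrow> point set \<Rightarrow> bool" where
  "edgeline t l \<longleftrightarrow> (\<exists>\<rho> \<tau>. adj \<rho> \<tau> \<and> zz t \<rho> \<and> zz t \<tau> \<and> l = {V a b \<rho>, V a b \<tau>})"

text \<open>The line determines its face and, on an L-face, the corner that it cuts off, hence a
  node kept by the residual pattern. The hypotheses exclude the two ways in which one graph can have
  a line twice: as an edge of the cuboid, and as the diagonal joining the iso-nodes of a trivial
  L-face.\<close>

lemma unique_path:
  assumes mx: "mixed (dd t)" and s1: "src (dd t) \<sigma>" and s2: "src (dd t) \<sigma>'"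
    and l1: "l \<in> pp t (res (dd t) \<sigma>)" and l2: "l \<in> pp t (res (dd t) \<sigma>')" and ne: "\<not> edgeline t l"
    and nt: "\<And>k s. aL (dd t) (cn k s) \<Longrightarrow> l \<subseteq> bface a b k s \<Longrightarrow> \<exists>u v. \<not> dd t (cn k s u v) \<and> \<not> zz t (cn k s u v)"
  shows "res (dd t) \<sigma> = res (dd t) \<sigma>'"
proof -
  note c1 = res_crossD[OF mx s1] and c2 = res_crossD[OF mx s2]
  obtain k s where f1: "l = line t (res (dd t) \<sigma>) k s" "areg (res (dd t) \<sigma>) (zz t) (cn k s)" using l1 unfolding pp_def by blast
  obtain k' s' where f2: "l = line t (res (dd t) \<sigma>') k' s'" "areg (res (dd t) \<sigma>') (zz t) (cn k' s')" using l2 unfolding pp_def by blast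
  have sub: "l \<subseteq> bface a b k' s'" unfolding f2(1) by (rule line_subset_bface[OF f2(2) c2])
  have sub1: "l \<subseteq> bface a b k s" unfolding f1(1) by (rule line_subset_bface[OF f1(2) c1])
  have "(k', s') = (k, s)"
  proof (rule ccontr)
    assume "(k', s') \<noteq> (k, s)"
    from face_unique[OF f1(2) c1 sub[unfolded f1(1)] this] show False
      using ne unfolding edgeline_def f1(1) by blast
  qed
  then have kk: "k' = k" "s' = s" by auto
  note f2' = f2[unfolded kk]
  have adc: "cross (dd t) (cn k s p q) (cn k s p' q')" if "(p = p') \<noteq> (q = q')" "\<not> dd t (cn k s p q)" "dd t (cn k s p' q')" for p q p' q'
    using that by (simp add: cross_def)
  show ?thesis
    using mx s1 f1(2)
  proof (cases rule: pp_lines)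
    case reg
    then have e2: "res (dd t) \<sigma>' (cn k s u v) = dd t (cn k s u v)" for u v
      using pp_lines[OF mx s2 f2'(2)] by metis
    obtain u v where "dd t (cn k s u v) \<noteq> ctype (dd t)"
      using f1(2) reg(2) unfolding areg_def by metis
    then show ?thesis using res_meet[OF mx s1 s2, of "cn k s u v"] reg(2) e2 by simp
  next
    case (disp u v)
    note vals = aL_vals[OF disp(1), of u v]
    from mx s2 f2'(2) show ?thesis
    proof (cases rule: pp_lines)
      case reg then show ?thesis using disp(1) by blast
    next
      case (cont u' v') then show ?thesis using disp(2) by blast
    next
      case d2: (disp u' v')
      show ?thesis
      proof (cases "(u', v') = (u, v)")
        case True
        then show ?thesis using res_meet[OF mx s1 s2, of "cn k s u v"] disp d2 by auto
      next
        case False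
        then have uv: "u' = (\<not> u)" "v' = (\<not> v)" using d2(3) disp(3) vals by (cases u; cases v; cases u'; cases v'; auto)+
        have d3: "dd t (cn k s (\<not> u) (\<not> v))" "\<not> dd t (cn k s (\<not> u) v)" "\<not> dd t (cn k s u (\<not> v))" using vals disp(3) by auto
        have X: "cross (dd t) (cn k s (\<not> u) v) (cn k s u v)" "cross (dd t) (cn k s u (\<not> v)) (cn k s u v)"
          "cross (dd t) (cn k s (\<not> u) v) (cn k s (\<not> u) (\<not> v))" "cross (dd t) (cn k s u (\<not> v)) (cn k s (\<not> u) (\<not> v))"
          using d3 disp(3) by (auto intro!: adc)
        \<comment> \<open>Equal lines around opposite disperse corners meet each of the two
          continuous corners, so both have label c and the L-face is trivial.\<close>
        have eq: "{ip t (cn k s (\<not> u) v) (cn k s u v), ip t (cn k s u (\<not> v)) (cn k s u v)} =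
          {ip t (cn k s u (\<not> v)) (cn k s (\<not> u) (\<not> v)), ip t (cn k s (\<not> u) v) (cn k s (\<not> u) (\<not> v))}"
          using disp(6) d2(6) f1(1) f2'(1) unfolding uv by simp
        then have "ip t (cn k s (\<not> u) v) (cn k s u v) = ip t (cn k s (\<not> u) v) (cn k s (\<not> u) (\<not> v))"
          "ip t (cn k s u (\<not> v)) (cn k s u v) = ip t (cn k s u (\<not> v)) (cn k s (\<not> u) (\<not> v))"
          using ip_eq[OF X(1) X(4)] ip_eq[OF X(2) X(3)] by (auto simp: doubleton_eq_iff)
        then have zs: "zz t (cn k s (\<not> u) v)" "zz t (cn k s u (\<not> v))" using ip_eq[OF X(1) X(3)] ip_eq[OF X(2) X(4)] by auto
        obtain p q where "\<not> dd t (cn k s p q)" "\<not> zz t (cn k s p q)" using nt[OF disp(1) sub1] by blast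
        then show ?thesis using zs d3 disp(3) by (cases "p = u"; cases "q = v") auto
      qed
    qed
  next
    case (cont u v)
    note vals = aL_vals[OF cont(1), of u v]
    from mx s2 f2'(2) show ?thesis
    proof (cases rule: pp_lines)
      case reg then show ?thesis using cont(1) by blast
    next
      case (disp u' v') then show ?thesis using cont(2) by blast
    next
      case d2: (cont u' v')
      show ?thesis
      proof (cases "(u', v') = (u, v)")
        case True
        then show ?thesis using res_meet[OF mx s1 s2, of "cn k s u v"] cont d2 by auto
      next
        case False
        then have uv: "u' = (\<not> u)" "v' = (\<not> v)" using d2(3) cont(3) vals by (cases u; cases v; cases u'; cases v'; auto)+
        have d3: "\<not> dd t (cn k s (\<not> u) (\<not> v))" "dd t (cn k s (\<not> u) v)" "dd t (cn k s u (\<not> v))" using vals cont(3) by auto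
        have X: "cross (dd t) (cn k s u v) (cn k s (\<not> u) v)" "cross (dd t) (cn k s (\<not> u) (\<not> v)) (cn k s u (\<not> v))"
          "cross (dd t) (cn k s (\<not> u) (\<not> v)) (cn k s (\<not> u) v)"
          using d3 cont(3) by (auto intro!: adc)
        have "ip t (cn k s u v) (cn k s (\<not> u) v) \<in> {ip t (cn k s (\<not> u) (\<not> v)) (cn k s u (\<not> v)), ip t (cn k s (\<not> u) (\<not> v)) (cn k s (\<not> u) v)}"
          using cont(6) d2(6) f1(1) f2'(1) unfolding uv by auto
        then show ?thesis using ip_eq[OF X(1) X(2)] ip_eq[OF X(1) X(3)] by auto
      qed
    qed
  qed
qed

text \<open>A facet that meets the relative interior of a segment of the cuboid contains the whole
  segment; otherwise it meets it in end points only, which are iso-points.\<close>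

lemma points_on_face:
  assumes mx: "mixed (dd t)" and sr: "src (dd t) \<sigma>"
  shows "polygon_points (pp t (res (dd t) \<sigma>)) \<inter> bface a b k s \<subseteq>
    (\<Union>l\<in>{l \<in> pp t (res (dd t) \<sigma>). l \<subseteq> bface a b k s}. convex hull l) \<union> {ip t \<rho> \<tau> | \<rho> \<tau>. cross (dd t) \<rho> \<tau> \<and> ip t \<rho> \<tau> \<in> bface a b k s}"
proof
  fix x assume x: "x \<in> polygon_points (pp t (res (dd t) \<sigma>)) \<inter> bface a b k s"
  note cr = res_crossD[OF mx sr]
  obtain l where l: "l \<in> pp t (res (dd t) \<sigma>)" "x \<in> convex hull l" using x unfolding polygon_points_def by blast
  obtain k' s' where f: "l = line t (res (dd t) \<sigma>) k' s'" "areg (res (dd t) \<sigma>) (zz t) (cn k' s')" using l unfolding pp_def by blast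
  obtain \<rho> \<tau> \<rho>' \<tau>' where L: "cross (res (dd t) \<sigma>) \<rho> \<tau>" "cross (res (dd t) \<sigma>) \<rho>' \<tau>'" "l = {ip t \<rho> \<tau>, ip t \<rho>' \<tau>'}"
    using line_two_ex[OF f(2) cr] f(1) by metis
  define p q where "p = ip t \<rho> \<tau>" "q = ip t \<rho>' \<tau>'"
  have X: "cross (dd t) \<rho> \<tau>" "cross (dd t) \<rho>' \<tau>'" using L cr by blast+
  have pq: "p \<in> cbox a b" "q \<in> cbox a b" using X ip_in unfolding p_q_def cross_def by blast+
  have xs: "x \<in> closed_segment p q" using l(2) unfolding L(3) p_q_def by (simp add: segment_convex_hull)
  show "x \<in> (\<Union>l\<in>{l \<in> pp t (res (dd t) \<sigma>). l \<subseteq> bface a b k s}. convex hull l) \<union> {ip t \<rho> \<tau> | \<rho> \<tau>. cross (dd t) \<rho> \<tau> \<and> ip t \<rho> \<tau> \<in> bface a b k s}"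
  proof (cases "x = p \<or> x = q")
    case True
    then show ?thesis using x X unfolding p_q_def by blast
  next
    case False
    then have "x \<in> open_segment p q" using xs by (simp add: open_segment_def)
    then have "p \<in> bface a b k s \<and> q \<in> bface a b k s"
      using bface_face_of[of a b k s] pq x unfolding face_of_def by blast
    then have "l \<subseteq> bface a b k s" unfolding L(3) p_q_def by blast
    then show ?thesis using l by blast
  qed
qed

text \<open>If neither face at a crossing edge carried a line, both would be singular with \<rho> as
  iso-node. Every neighbor of \<rho> lies on one of these two faces, so \<rho> would be the center
  of a T1-subgraph.\<close>

lemma cross_areg_face:
  assumes mx: "mixed (dd t)" and sr: "src (dd t) \<sigma>" and sf: "singular_free c (Gr t)" and cr: "cross (res (dd t) \<sigma>) \<rho> \<tau>"
  shows "\<exists>k s. areg (res (dd t) \<sigma>) (zz t) (cn k s) \<and> co k \<rho> = s \<and> co k \<tau> = s"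
proof (rule ccontr)
  assume n: "\<not> ?thesis"
  have adj: "adj \<rho> \<tau>" "\<not> res (dd t) \<sigma> \<rho>" "res (dd t) \<sigma> \<tau>" using cr by (auto simp: cross_def)
  then obtain j where j: "co j \<rho> \<noteq> co j \<tau>" "\<And>i. i \<noteq> j \<Longrightarrow> co i \<rho> = co i \<tau>" unfolding adj_iff by blast
  have sing: "zz t \<rho> \<and> (\<forall>\<xi>. co k \<xi> = co k \<rho> \<longrightarrow> \<xi> \<noteq> \<rho> \<longrightarrow> res (dd t) \<sigma> \<xi>)" if kj: "k \<noteq> j" for k
  proof -
    have na: "\<not> areg (res (dd t) \<sigma>) (zz t) (cn k (co k \<rho>))" using n j(2)[OF kj] by metis
    obtain u v where r: "\<rho> = cn k (co k \<rho>) u v" using cnE[OF refl] by metis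
    obtain u' v' where tt: "\<tau> = cn k (co k \<rho>) u' v'" using cnE[OF j(2)[OF kj, symmetric]] by metis
    have "\<not> aL (res (dd t) \<sigma>) (cn k (co k \<rho>))" by (rule res_no_L[OF mx sr])
    then have h: "fcount (res (dd t) \<sigma>) (cn k (co k \<rho>)) = 3" "\<exists>p q. \<not> res (dd t) \<sigma> (cn k (co k \<rho>) p q) \<and> zz t (cn k (co k \<rho>) p q)"
      using na adj r tt unfolding areg_def by metis+
    have le: "3 \<le> fcount (res (dd t) \<sigma>) (cn k (co k \<rho>))" using h(1) by simp
    have only: "\<xi> = \<rho>" if X: "co k \<xi> = co k \<rho>" "\<not> res (dd t) \<sigma> \<xi>" for \<xi>
    proof -
      obtain p q where x: "\<xi> = cn k (co k \<rho>) p q" using cnE[OF X(1)] by metis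
      have "\<not> res (dd t) \<sigma> (cn k (co k \<rho>) u v)" using adj(2) r[symmetric] by simp
      moreover have "\<not> res (dd t) \<sigma> (cn k (co k \<rho>) p q)" using X(2) x[symmetric] by simp
      ultimately have "p = u \<and> q = v" using fcount_ge3[OF le, of p q u v] by blast
      then have "\<xi> = cn k (co k \<rho>) u v" using x by simp
      also have "\<dots> = \<rho>" by (rule r[symmetric])
      finally show ?thesis .
    qed
    obtain p q where "\<not> res (dd t) \<sigma> (cn k (co k \<rho>) p q)" "zz t (cn k (co k \<rho>) p q)" using h(2) by blast
    then have "zz t \<rho>" using only[OF co_cn] by metis
    then show ?thesis using only by blast
  qed
  obtain i where i: "i \<noteq> j" using other_axes[of j] by blast
  have z: "zz t \<rho>" using sing[OF i] by blast
  have "dd t \<xi>" if a: "adj \<rho> \<xi>" for \<xi>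
  proof -
    have ne: "\<xi> \<noteq> \<rho>" using a by auto
    have "res (dd t) \<sigma> \<xi>"
    proof -
      obtain m where m: "\<And>i. i \<noteq> m \<Longrightarrow> co i \<rho> = co i \<xi>" using a unfolding adj_iff by blast
      obtain k where "k \<noteq> j" "k \<noteq> m"
      proof -
        obtain k1 k2 where "k1 \<noteq> j" "k2 \<noteq> j" "k1 \<noteq> k2" using other_axes[of j] by blast
        then show thesis using that by metis
      qed
      then show ?thesis using sing[of k] m[of k] ne by metis
    qed
    then show ?thesis using res_cross[OF mx sr a adj(2)] by blast
  qed
  then have "coiso (dd t) \<rho>" using zz_not_dd[OF z] by (simp add: coiso_def)
  then show False using singular_free_T1[OF sf z] by blast
qed

lemma pp_points:
  assumes mx: "mixed (dd t)" and sr: "src (dd t) \<sigma>" and sf: "singular_free c (Gr t)"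
  shows "\<Union>(pp t (res (dd t) \<sigma>)) = {ip t \<rho> \<tau> | \<rho> \<tau>. cross (res (dd t) \<sigma>) \<rho> \<tau>}"
proof (intro equalityI subsetI)
  fix x assume "x \<in> {ip t \<rho> \<tau> | \<rho> \<tau>. cross (res (dd t) \<sigma>) \<rho> \<tau>}"
  then obtain \<rho> \<tau> where x: "x = ip t \<rho> \<tau>" "cross (res (dd t) \<sigma>) \<rho> \<tau>" by blast
  then obtain k s where "areg (res (dd t) \<sigma>) (zz t) (cn k s)" "co k \<rho> = s" "co k \<tau> = s"
    using cross_areg_face[OF mx sr sf] by blast
  then show "x \<in> \<Union>(pp t (res (dd t) \<sigma>))" using x unfolding pp_def line_cross by blast
qed (auto simp: pp_def line_cross)

text \<open>Different residual patterns have no disperse node in common, so equal polygons share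
  iso-points only where these sit at nodes. Then all boundary nodes of both patterns have label c,
  and the alternatives of \<open>res_bnd\<close> contradict F1- and T1-freeness.\<close>

lemma paths_distinct:
  assumes mx: "mixed (dd t)" and s1: "src (dd t) \<sigma>" and s2: "src (dd t) \<tau>" and sf: "singular_free c (Gr t)"
    and f1: "\<not> F1_graph c (Gr t)" and nct: "\<not> ctype (dd t)" and ne: "res (dd t) \<sigma> \<noteq> res (dd t) \<tau>"
  shows "pp t (res (dd t) \<sigma>) \<noteq> pp t (res (dd t) \<tau>)"
proof
  assume e: "pp t (res (dd t) \<sigma>) = pp t (res (dd t) \<tau>)"
  have pts: "{ip t \<rho> \<xi> | \<rho> \<xi>. cross (res (dd t) \<sigma>) \<rho> \<xi>} = {ip t \<rho> \<xi> | \<rho> \<xi>. cross (res (dd t) \<tau>) \<rho> \<xi>}"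
    using pp_points[OF mx s1 sf] pp_points[OF mx s2 sf] e by simp
  note c1 = res_crossD[OF mx s1] and c2 = res_crossD[OF mx s2]
  have nm: "\<not> (res (dd t) \<sigma> \<xi> \<and> res (dd t) \<tau> \<xi>)" for \<xi> using res_meet[OF mx s1 s2, of \<xi>] ne nct by blast
  have A: "zz t \<rho> \<and> (\<exists>\<xi>'. cross (res (dd t) \<tau>) \<rho> \<xi>')" if "cross (res (dd t) \<sigma>) \<rho> \<xi>" for \<rho> \<xi>
  proof -
    have "ip t \<rho> \<xi> \<in> {ip t \<rho> \<xi> | \<rho> \<xi>. cross (res (dd t) \<tau>) \<rho> \<xi>}" using pts that by blast
    then obtain \<rho>' \<xi>' where h: "ip t \<rho> \<xi> = ip t \<rho>' \<xi>'" "cross (res (dd t) \<tau>) \<rho>' \<xi>'" by blast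
    then have "\<rho> = \<rho>' \<and> (\<xi> = \<xi>' \<or> zz t \<rho>)" using ip_eq c1 c2 that by metis
    then show ?thesis using h(2) nm[of \<xi>] that unfolding cross_def by metis
  qed
  have B: "\<exists>\<xi>'. cross (res (dd t) \<sigma>) \<rho> \<xi>'" if "cross (res (dd t) \<tau>) \<rho> \<xi>" for \<rho> \<xi>
  proof -
    have "ip t \<rho> \<xi> \<in> {ip t \<rho> \<xi> | \<rho> \<xi>. cross (res (dd t) \<sigma>) \<rho> \<xi>}" using pts that by blast
    then obtain \<rho>' \<xi>' where h: "ip t \<rho> \<xi> = ip t \<rho>' \<xi>'" "cross (res (dd t) \<sigma>) \<rho>' \<xi>'" by blast
    then have "\<rho> = \<rho>'" using ip_eq c1 c2 that by metis
    then show ?thesis using h(2) by blast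
  qed
  have bnd: "(\<not> res (dd t) \<sigma> \<rho> \<and> (\<exists>\<tau>'. adj \<rho> \<tau>' \<and> res (dd t) \<sigma> \<tau>')) = (\<not> res (dd t) \<tau> \<rho> \<and> (\<exists>\<tau>'. adj \<rho> \<tau>' \<and> res (dd t) \<tau> \<tau>'))" for \<rho>
    using A[of \<rho>] B[of \<rho>] unfolding cross_def by metis
  have st: "res (dd t) \<sigma> \<tau> = ctype (dd t)" using nm[of \<tau>] res_self[OF mx s2] nct by blast
  from res_bnd[OF mx s1 s2 st nct bnd] show False
  proof
    assume h: "aD (dd t) = 4 \<and> (\<forall>\<rho>. \<not> dd t \<rho> \<longrightarrow> (\<not> res (dd t) \<sigma> \<rho> \<and> (\<exists>\<tau>'. adj \<rho> \<tau>' \<and> res (dd t) \<sigma> \<tau>')) \<and> length (filter (dd t) (nb \<rho>)) = 2)"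
    define W where "W = V a b ` {\<rho>. \<not> dd t \<rho>}"
    have z: "zz t \<rho>" if X: "\<not> dd t \<rho>" for \<rho>
    proof -
      obtain \<tau>' where "cross (res (dd t) \<sigma>) \<rho> \<tau>'" using h X unfolding cross_def by blast
      then show ?thesis using A by blast
    qed
    have "card (UNIV :: ix set) = 8" using card_aD[of "\<lambda>_. True"] by (simp add: aD_def allix_def)
    moreover have "{\<rho>. \<not> dd t \<rho>} = UNIV - {\<rho>. dd t \<rho>}" by auto
    ultimately have "card {\<rho>. \<not> dd t \<rho>} = 4" using h card_aD[of "dd t"] by (simp add: card_Diff_subset)
    then have c4: "card W = 4" unfolding W_def by (simp add: card_image inj_V)
    have two: "card {Q \<in> nodes (cbox a b) - W. incident (cbox a b) P Q} = 2" if P: "P \<in> W" for P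
    proof -
      obtain \<rho> where r: "P = V a b \<rho>" "\<not> dd t \<rho>" using P unfolding W_def by blast
      have "{Q \<in> nodes (cbox a b) - W. incident (cbox a b) P Q} = V a b ` set (filter (dd t) (nb \<rho>))"
        unfolding nodes_eq W_def r by (auto simp: adj_def)
      moreover have "distinct (filter (dd t) (nb \<rho>))" by (cases \<rho>) (simp add: nb.simps)
      ultimately have "card {Q \<in> nodes (cbox a b) - W. incident (cbox a b) P Q} = length (filter (dd t) (nb \<rho>))"
        using card_image[OF inj_V, of "set (filter (dd t) (nb \<rho>))"] distinct_card by metis
      then show ?thesis using h r(2) by simp
    qed
    have "F1_graph c (Gr t)" unfolding F1_graph_def Gr_simps
    proof (intro exI[of _ W] conjI ballI)
      show "W \<subseteq> nodes (cbox a b)" unfolding W_def by auto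
      fix P assume "P \<in> W"
      then show "t P = c" using z unfolding W_def by (auto simp: zz_def)
    next
      fix P assume "P \<in> nodes (cbox a b) - W"
      then show "c < t P" unfolding W_def nodes_eq by (auto simp: dd_def)
    qed (fact c4 two)+
    then show False using f1 by blast
  next
    assume "\<exists>\<rho>. \<not> res (dd t) \<sigma> \<rho> \<and> (\<exists>\<tau>'. adj \<rho> \<tau>' \<and> res (dd t) \<sigma> \<tau>') \<and> coiso (dd t) \<rho>"
    then obtain \<rho> \<xi> where "cross (res (dd t) \<sigma>) \<rho> \<xi>" "coiso (dd t) \<rho>" unfolding cross_def by blast
    then show False using A singular_free_T1[OF sf] by blast
  qed
qed

end

lemma card_3_distinct: "x \<in> S \<Longrightarrow> y \<in> S \<Longrightarrow> w \<in> S \<Longrightarrow> x \<noteq> y \<Longrightarrow> y \<noteq> w \<Longrightarrow> x \<noteq> w \<Longrightarrow> finite S \<Longrightarrow> 3 \<le> card S"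
  using card_mono[of S "{x, y, w}"] by simp

context cubc begin

text \<open>Lines of different faces are different, so it suffices to count regular faces. Those
  with one or two disperse corners always count; in the two exceptional cases of
  \<open>res_faces\<close> the labels decide, and T1- and T2-freeness supply the missing regular
  faces.\<close>

lemma pp_card:
  assumes mx: "mixed (dd t)" and sr: "src (dd t) \<sigma>" and sf: "singular_free c (Gr t)"
  shows "3 \<le> card (pp t (res (dd t) \<sigma>))" "card (pp t (res (dd t) \<sigma>)) \<le> 6"
proof -
  define r where "r = res (dd t) \<sigma>"
  note cr = res_crossD[OF mx sr, folded r_def]
  define S where "S = {(k, s). areg r (zz t) (cn k s)}"
  have SU: "S \<subseteq> set faxes" by auto
  have fin: "finite S" by (rule finite_subset[OF SU]) simp
  have img: "pp t r = (\<lambda>(k, s). line t r k s) ` S" unfolding pp_def S_def by auto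
  have "card S \<le> card (set faxes)" by (rule card_mono) (use SU in auto)
  also have "\<dots> = 6" using distinct_card[OF distinct_faxes] by (simp add: faxes_def)
  finally show "card (pp t (res (dd t) \<sigma>)) \<le> 6"
    using card_image_le[OF fin, of "\<lambda>(k, s). line t r k s"] unfolding r_def[symmetric] img by simp
  have rd: "dd t \<xi>" if "\<not> r \<rho>" "adj \<rho> \<xi>" "r \<xi>" for \<rho> \<xi> using cr that unfolding cross_def by blast
  have sub: "\<not> ctype (dd t) \<Longrightarrow> r \<xi> \<Longrightarrow> dd t \<xi>" for \<xi> using res_mono(2)[OF mx sr] unfolding r_def by blast
  \<comment> \<open>A line common to two faces is an edge with label c at both ends and with
    disperse neighbors otherwise. On the face perpendicular to the edge at \<rho> two neighbors of
    \<rho> are in \<open>r\<close>, hence so is the opposite corner, as \<open>r\<close> has no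
    L-face. That corner is disperse but not incident to the edge, against T2-freeness.\<close>
  have inj: "inj_on (\<lambda>(k, s). line t r k s) S"
  proof (rule inj_onI, rule ccontr)
    fix x y assume xy: "x \<in> S" "y \<in> S" "(case x of (k, s) \<Rightarrow> line t r k s) = (case y of (k, s) \<Rightarrow> line t r k s)" "x \<noteq> y"
    obtain k s k' s' where x: "x = (k, s)" "y = (k', s')" by (cases x; cases y)
    have h: "(k, s) \<in> S" "(k', s') \<in> S" "line t r k s = line t r k' s'" and ne: "(k', s') \<noteq> (k, s)"
      using xy unfolding x by auto
    have ar: "areg r (zz t) (cn k s)" "areg r (zz t) (cn k' s')" using h unfolding S_def by auto
    have s1: "line t r k s \<subseteq> bface a b k' s'" unfolding h(3) by (rule line_subset_bface[OF ar(2) cr])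
    have s2: "line t r k' s' \<subseteq> bface a b k s" unfolding h(3)[symmetric] by (rule line_subset_bface[OF ar(1) cr])
    obtain \<rho> \<tau> where A: "adj \<rho> \<tau>" "zz t \<rho>" "zz t \<tau>" "\<not> r \<rho>" "\<not> r \<tau>" "line t r k s = {V a b \<rho>, V a b \<tau>}"
      "co k \<rho> = s" "co k \<tau> = s" "co k' \<rho> = s'" "co k' \<tau> = s'" "k \<noteq> k'" "\<And>\<xi>. co k \<xi> = s \<Longrightarrow> \<xi> \<noteq> \<rho> \<Longrightarrow> \<xi> \<noteq> \<tau> \<Longrightarrow> r \<xi>"
      using face_unique[OF ar(1) cr s1 ne] by blast
    obtain \<rho>' \<tau>' where B: "line t r k' s' = {V a b \<rho>', V a b \<tau>'}" "\<And>\<xi>. co k' \<xi> = s' \<Longrightarrow> \<xi> \<noteq> \<rho>' \<Longrightarrow> \<xi> \<noteq> \<tau>' \<Longrightarrow> r \<xi>"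
      using face_unique[OF ar(2) cr s2 ne[symmetric]] by blast
    have "{\<rho>', \<tau>'} = {\<rho>, \<tau>}" using h(3) A(6) B(1) by (auto simp: doubleton_eq_iff)
    then have B': "\<And>\<xi>. co k' \<xi> = s' \<Longrightarrow> \<xi> \<noteq> \<rho> \<Longrightarrow> \<xi> \<noteq> \<tau> \<Longrightarrow> r \<xi>" using B(2) by blast
    obtain j where j: "co j \<rho> \<noteq> co j \<tau>" "\<And>i. i \<noteq> j \<Longrightarrow> co i \<rho> = co i \<tau>" using A(1) unfolding adj_iff by blast
    have nbr: "r \<xi>" if x: "adj \<rho> \<xi> \<or> adj \<tau> \<xi>" "\<xi> \<noteq> \<rho>" "\<xi> \<noteq> \<tau>" for \<xi>
    proof -
      have "co k \<xi> = s \<or> co k' \<xi> = s'"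
        using x(1) A(7-11) unfolding adj_iff by metis
      then show ?thesis using A(12) B' x by blast
    qed
    have nd: "dd t \<xi>" if "adj \<rho> \<xi> \<or> adj \<tau> \<xi>" "\<xi> \<noteq> \<rho>" "\<xi> \<noteq> \<tau>" for \<xi>
      using rd[of \<rho> \<xi>] rd[of \<tau> \<xi>] nbr that A(4,5) by blast
    have "aD (dd t) \<le> 4" by (rule singular_free_T2(1)[OF sf A(1-3)]) (rule nd)
    then have nct: "\<not> ctype (dd t)" using ctype_aD by fastforce
    obtain u v where c: "\<rho> = cn j (co j \<rho>) u v" using cnE[OF refl] by metis
    define m where "m = co j \<rho>"
    have c': "\<rho> = cn j m u v" using c m_def by simp
    have "r (cn j m (\<not> u) v)" "r (cn j m u (\<not> v))"
      by (rule nbr; use j(1) in \<open>auto simp: c'\<close>; metis co_cn c')+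
    moreover have "\<not> aL r (cn j m)" unfolding r_def by (rule res_no_L[OF mx sr])
    ultimately have "r (cn j m (\<not> u) (\<not> v))" using A(4) unfolding c' aL_def by (cases u; cases v) auto
    then have D: "dd t (cn j m (\<not> u) (\<not> v))" using sub[OF nct] by blast
    have "adj \<rho> (cn j m (\<not> u) (\<not> v)) \<or> adj \<tau> (cn j m (\<not> u) (\<not> v))"
    proof (rule singular_free_T2(2)[OF sf A(1-3)])
      show "dd t (cn j m (\<not> u) (\<not> v))" by (rule D)
    qed (rule nd)
    then have "adj \<tau> (cn j m (\<not> u) (\<not> v))" unfolding c' by simp
    then obtain i where i: "\<And>l. l \<noteq> i \<Longrightarrow> co l \<tau> = co l (cn j m (\<not> u) (\<not> v))" unfolding adj_iff by blast
    have ij: "i = j" using i[of j] j(1) unfolding c' by auto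
    have "cn j m (\<not> u) (\<not> v) = \<rho>" unfolding ix_eq_iff
    proof
      fix l show "co l (cn j m (\<not> u) (\<not> v)) = co l \<rho>" using i[of l] j(2)[of l] ij unfolding c' by (cases "l = j") auto
    qed
    then show False unfolding c' by simp
  qed
  have "3 \<le> card S"
    using res_faces[OF mx sr]
  proof (elim disjE)
    assume h: "3 \<le> length (filter (\<lambda>f. fcount (res (dd t) \<sigma>) f = 1 \<or> fcount (res (dd t) \<sigma>) f = 2) fcs)"
    define F where "F = filter (\<lambda>(k, s). fcount r (cn k s) = 1 \<or> fcount r (cn k s) = 2) faxes"
    have "length (filter (\<lambda>f. fcount r f = 1 \<or> fcount r f = 2) fcs) = length F"
      unfolding F_def by (simp add: fcs_eq filter_map comp_def case_prod_unfold)
    also have "\<dots> = card (set F)" by (rule distinct_card[symmetric]) (simp add: F_def distinct_faxes)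
    also have "\<dots> \<le> card S"
    proof (rule card_mono[OF fin], rule subsetI)
      fix x assume xF: "x \<in> set F"
      obtain k s where x1: "x = (k, s)" by (cases x)
      have x2: "fcount r (cn k s) = 1 \<or> fcount r (cn k s) = 2" using xF unfolding F_def set_filter x1 by simp
      note x = x1 x2
      have "\<exists>u v. r (cn k s u v)"
      proof (rule ccontr)
        assume "\<not> ?thesis" then have "fcount r (cn k s) = 0" by (simp add: fcount_def)
        then show False using x by simp
      qed
      moreover have "\<exists>u v. \<not> r (cn k s u v)"
      proof (rule ccontr)
        assume "\<not> ?thesis" then have "fcount r (cn k s) = 4" by (simp add: fcount_def)
        then show False using x by simp
      qed
      moreover have "\<not> aL r (cn k s)" unfolding r_def by (rule res_no_L[OF mx sr])
      moreover have "fcount r (cn k s) \<noteq> 3" using x(2) by auto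
      ultimately show "x \<in> S" unfolding S_def x(1) areg_def by simp
    qed
    finally show ?thesis using h unfolding r_def by simp
  next
    \<comment> \<open>A single continuous node is left. Its three faces have three disperse corners
      each, and they are regular because the node does not have label c by T1-freeness.\<close>
    assume h: "aD (res (dd t) \<sigma>) = 7"
    have "card (UNIV :: ix set) = 8" using card_aD[of "\<lambda>_. True"] by (simp add: aD_def allix_def)
    moreover have "{\<rho>. \<not> r \<rho>} = UNIV - {\<rho>. r \<rho>}" by auto
    ultimately have "card {\<rho>. \<not> r \<rho>} = 1" using h card_aD[of r] unfolding r_def[symmetric] by (simp add: card_Diff_subset)
    then obtain X where X: "{\<rho>. \<not> r \<rho>} = {X}" by (auto simp: card_1_singleton_iff)
    then have X': "\<not> r X" "\<And>\<xi>. \<xi> \<noteq> X \<Longrightarrow> r \<xi>" by blast+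
    have nbX: "dd t \<xi>" if "adj X \<xi>" for \<xi> using rd[OF X'(1) that] X'(2)[of \<xi>] that by fastforce
    have nz: "\<not> zz t X"
    proof
      assume z: "zz t X"
      then have "coiso (dd t) X" using nbX zz_not_dd by (simp add: coiso_def)
      then show False using singular_free_T1[OF sf z] by blast
    qed
    have inS: "(k, co k X) \<in> S" for k
    proof -
      obtain u v where c: "X = cn k (co k X) u v" using cnE[OF refl] by metis
      define m where "m = co k X"
      have c': "X = cn k m u v" using c m_def by simp
      have 1: "\<not> r (cn k m u v)" using X'(1) unfolding c' .
      have 2: "r (cn k m (\<not> u) v)" "r (cn k m u (\<not> v))" "r (cn k m (\<not> u) (\<not> v))" by (rule X'(2); simp add: c')+
      have "areg r (zz t) (cn k m)" using areg_co[of r "cn k m" u v "zz t", OF 1 2] nz unfolding c' by blast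
      then show ?thesis unfolding S_def m_def by simp
    qed
    show ?thesis by (rule card_3_distinct[OF inS[of 1] inS[of 2] inS[of 3] _ _ _ fin]) auto
  next
    \<comment> \<open>Two incident continuous nodes are left. The two faces through both have two
      disperse corners; a third line lies on the end face at a node without label c, which exists by
      T2-freeness.\<close>
    assume h: "aD (res (dd t) \<sigma>) = 6 \<and> (\<exists>\<rho> \<tau>. adj \<rho> \<tau> \<and> \<not> res (dd t) \<sigma> \<rho> \<and> \<not> res (dd t) \<sigma> \<tau>)"
    then obtain \<rho> \<tau> where rt: "adj \<rho> \<tau>" "\<not> r \<rho>" "\<not> r \<tau>" unfolding r_def by blast
    have "card (UNIV :: ix set) = 8" using card_aD[of "\<lambda>_. True"] by (simp add: aD_def allix_def)
    moreover have "{\<rho>. \<not> r \<rho>} = UNIV - {\<rho>. r \<rho>}" by auto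
    ultimately have c2: "card {\<rho>. \<not> r \<rho>} = 2" using h card_aD[of r] unfolding r_def[symmetric] by (simp add: card_Diff_subset)
    have "{\<rho>, \<tau>} = {\<rho>. \<not> r \<rho>}"
    proof (rule card_subset_eq)
      have "\<rho> \<noteq> \<tau>" using rt(1) by auto
      then show "card {\<rho>, \<tau>} = card {\<rho>. \<not> r \<rho>}" using c2 by simp
    qed (use rt in auto)
    then have oth: "r \<xi>" if "\<xi> \<noteq> \<rho>" "\<xi> \<noteq> \<tau>" for \<xi> using that by blast
    obtain j where j: "co j \<rho> \<noteq> co j \<tau>" "\<And>i. i \<noteq> j \<Longrightarrow> co i \<rho> = co i \<tau>" using rt(1) unfolding adj_iff by blast
    have nd: "dd t \<xi>" if "adj \<rho> \<xi> \<or> adj \<tau> \<xi>" "\<xi> \<noteq> \<rho>" "\<xi> \<noteq> \<tau>" for \<xi>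
      using rd[of \<rho> \<xi>] rd[of \<tau> \<xi>] oth that rt by blast
    have nz: "\<not> zz t \<rho> \<or> \<not> zz t \<tau>"
    proof (rule ccontr)
      assume "\<not> ?thesis"
      then have zz2: "zz t \<rho>" "zz t \<tau>" by blast+
      have le: "aD (dd t) \<le> 4" by (rule singular_free_T2(1)[OF sf rt(1) zz2]) (rule nd)
      then have nct: "\<not> ctype (dd t)" using ctype_aD by fastforce
      have "card {\<xi>. r \<xi>} \<le> card {\<xi>. dd t \<xi>}" by (rule card_mono) (use sub[OF nct] in auto)
      then show False using le h unfolding card_aD r_def by simp
    qed
    have nzS: "(j, co j X) \<in> S" if "X = \<rho> \<or> X = \<tau>" "\<not> zz t X" for X
    proof -
      obtain u v where c: "X = cn j (co j X) u v" using cnE[OF refl] by metis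
      define m where "m = co j X"
      have c': "X = cn j m u v" using c m_def by simp
      have 1: "\<not> r (cn j m u v)" using that(1) rt unfolding c' by blast
      have rr: "r \<xi>" if "co j \<xi> = m" "\<xi> \<noteq> X" for \<xi>
        by (rule oth) (use that j(1) \<open>X = \<rho> \<or> X = \<tau>\<close> in \<open>auto simp: m_def\<close>)
      have 2: "r (cn j m (\<not> u) v)" "r (cn j m u (\<not> v))" "r (cn j m (\<not> u) (\<not> v))" by (rule rr; simp add: c')+
      have "areg r (zz t) (cn j m)" using areg_co[of r "cn j m" u v "zz t", OF 1 2] that(2) unfolding c' by blast
      then show ?thesis unfolding S_def m_def by simp
    qed
    have sideS: "(k, co k \<rho>) \<in> S" if kj: "k \<noteq> j" for k
    proof -
      obtain u v where c: "\<rho> = cn k (co k \<rho>) u v" using cnE[OF refl] by metis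
      obtain u' v' where d: "\<tau> = cn k (co k \<rho>) u' v'" using cnE[OF j(2)[OF kj, symmetric]] by metis
      define m where "m = co k \<rho>"
      have c': "\<rho> = cn k m u v" "\<tau> = cn k m u' v'" using c d m_def by simp_all
      have un: "(u = u') \<noteq> (v = v')" using rt(1) unfolding c' by simp
      have "fcount r (cn k m) \<noteq> 3"
      proof
        assume "fcount r (cn k m) = 3"
        then have "3 \<le> fcount r (cn k m)" by simp
        from fcount_ge3[OF this, of u v u' v'] show False using rt un unfolding c' by blast
      qed
      moreover have "r (cn k m (\<not> u) (\<not> v))" by (rule oth) (use un in \<open>auto simp: c'\<close>)
      moreover have "\<not> aL r (cn k m)" unfolding r_def by (rule res_no_L[OF mx sr])
      ultimately have "areg r (zz t) (cn k m)" using rt(2) unfolding areg_def c' by blast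
      then show ?thesis unfolding S_def m_def by simp
    qed
    obtain k1 k2 where kk: "k1 \<noteq> j" "k2 \<noteq> j" "k1 \<noteq> k2" using other_axes[of j] by blast
    obtain X where X: "(j, co j X) \<in> S" using nz nzS by blast
    show ?thesis by (rule card_3_distinct[OF sideS[OF kk(1)] sideS[OF kk(2)] X _ _ _ fin]) (use kk in auto)
  qed
  then show "3 \<le> card (pp t (res (dd t) \<sigma>))" unfolding r_def[symmetric] img card_image[OF inj] .
qed

end

section \<open>Exposed segments and the shape of lines on an L-face\<close>

definition supp :: "point set \<Rightarrow> point set \<Rightarrow> bool" where
  "supp S l \<longleftrightarrow> (\<exists>n \<beta>. (\<forall>z\<in>S. n \<bullet> z \<le> \<beta>) \<and> (\<forall>z\<in>S. n \<bullet> z = \<beta> \<longrightarrow> z \<in> l) \<and> (\<forall>z\<in>l. n \<bullet> z = \<beta>))"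

text \<open>\<open>supp S l\<close> says that \<open>l\<close> is the trace on \<open>S\<close> of
  an exposed face of its convex hull. A supporting functional that is maximal inside a segment is
  maximal at both of its ends.\<close>

lemma supp_hull:
  assumes "supp S l" "x \<in> S" "y \<in> S" "z \<in> convex hull l" "z = (1 - u) *\<^sub>R x + u *\<^sub>R y" "0 < u" "u < 1"
  shows "x \<in> l \<and> y \<in> l"
proof -
  obtain n \<beta> where n: "\<forall>z\<in>S. n \<bullet> z \<le> \<beta>" "\<forall>z\<in>S. n \<bullet> z = \<beta> \<longrightarrow> z \<in> l" "\<forall>z\<in>l. n \<bullet> z = \<beta>"
    using assms(1) unfolding supp_def by blast
  have "convex hull l \<subseteq> {z. n \<bullet> z = \<beta>}"
    by (rule hull_minimal) (use n(3) convex_hyperplane in auto)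
  then have "n \<bullet> z = \<beta>" using assms(4) by blast
  then have eq: "(1 - u) * (n \<bullet> x) + u * (n \<bullet> y) = \<beta>" unfolding assms(5) by (simp add: inner_add_right)
  have le: "n \<bullet> x \<le> \<beta>" "n \<bullet> y \<le> \<beta>" using n(1) assms(2,3) by blast+
  have "(1 - u) * (\<beta> - n \<bullet> x) + u * (\<beta> - n \<bullet> y) = 0" using eq by (simp add: algebra_simps)
  moreover have "0 \<le> (1 - u) * (\<beta> - n \<bullet> x)" "0 \<le> u * (\<beta> - n \<bullet> y)" using le assms(6,7) by simp_all
  ultimately have "(1 - u) * (\<beta> - n \<bullet> x) = 0" "u * (\<beta> - n \<bullet> y) = 0" by linarith+
  then show ?thesis using n(2) assms(2,3,6,7) by simp
qed

lemma supp_hull_point: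
  assumes "supp S l" "x \<in> S" "x \<in> convex hull l" shows "x \<in> l"
  using supp_hull[OF assms(1,2,2,3), of "1/2"] by (simp flip: scaleR_left.add)

lemma supp_midpoint:
  assumes "supp S {p, q}" "x \<in> S" "y \<in> S" "x \<noteq> y" "midpoint x y \<in> convex hull {p, q}"
  shows "{p, q} = {x, y}"
proof -
  have "midpoint x y = (1 - 1/2) *\<^sub>R x + (1/2) *\<^sub>R y" by (simp add: midpoint_def scaleR_right_distrib)
  then have "x \<in> {p, q} \<and> y \<in> {p, q}" using supp_hull[OF assms(1-3,5), of "1/2"] by simp
  then show ?thesis using assms(4) by auto
qed

lemma supp_noncross:
  assumes "supp S l" "supp S l'" "l = {p, q}" "l' = {p', q'}" "l \<subseteq> S" "l' \<subseteq> S" "l \<noteq> l'" "p' \<noteq> q'" "p \<noteq> q"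
  shows "convex hull l \<inter> convex hull l' = l \<inter> l'"
proof (intro equalityI subsetI)
  fix x assume x: "x \<in> convex hull l \<inter> convex hull l'"
  then have "x \<in> closed_segment p' q'" unfolding assms(4) by (simp add: segment_convex_hull)
  then obtain u where u: "x = (1 - u) *\<^sub>R p' + u *\<^sub>R q'" "0 \<le> u" "u \<le> 1" unfolding in_segment by blast
  show "x \<in> l \<inter> l'"
  proof (cases "0 < u \<and> u < 1")
    case True
    then have "p' \<in> l \<and> q' \<in> l" using supp_hull[OF assms(1) _ _ _ u(1)] x assms(4,6) by blast
    then have "l = l'" using assms(3,4,8) by auto
    then show ?thesis using assms(7) by blast
  next
    case False
    then have "u = 0 \<or> u = 1" using u by auto
    then have "x \<in> l'" unfolding u(1) assms(4) by auto
    then show ?thesis using supp_hull_point[OF assms(1)] x assms(6) by blast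
  qed
qed (use hull_inc in auto)

text \<open>A non-trivial L-face in coordinates. The corner \<open>X\<close> has label below c, the
  disperse corners are \<open>X + e\<close> and \<open>X + f\<close>. The iso-points next to
  \<open>X\<close> are (p, 0) and (0, q), those next to the opposite corner (1, r) and (s, 1);
  \<open>r = 1\<close> means that the latter two coincide there, which happens for label c.\<close>

locale quad =
  fixes X e f :: point and p q r s :: real
  assumes ef: "e \<bullet> f = 0" "e \<noteq> 0" "f \<noteq> 0"
    and pq: "0 < p" "p < 1" "0 < q" "q < 1" and rs: "0 < r" "r \<le> 1" "0 < s" "s \<le> 1" "r = 1 \<longleftrightarrow> s = 1"
begin

definition \<phi> :: "real \<Rightarrow> real \<Rightarrow> point" where "\<phi> x y = X + x *\<^sub>R e + y *\<^sub>R f"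

abbreviation "XA \<equiv> \<phi> p 0"
abbreviation "XB \<equiv> \<phi> 0 q"
abbreviation "PA \<equiv> \<phi> 1 r"
abbreviation "PB \<equiv> \<phi> s 1"

text \<open>As \<open>e\<close> and \<open>f\<close> are orthogonal and non-zero, every affine form
  in the coordinates comes from an inner product. So exposedness can be verified with explicit
  coefficients.\<close>

lemma functional: "\<exists>n. \<forall>x y. n \<bullet> \<phi> x y = n \<bullet> X + \<alpha> * x + \<beta> * y"
  by (rule exI[of _ "(\<alpha> / (e \<bullet> e)) *\<^sub>R e + (\<beta> / (f \<bullet> f)) *\<^sub>R f"])
    (use ef in \<open>simp add: \<phi>_def inner_add_right inner_add_left inner_commute[of f e]\<close>)

lemma phi_eq[simp]: "\<phi> x y = \<phi> x' y' \<longleftrightarrow> x = x' \<and> y = y'"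
proof
  assume h: "\<phi> x y = \<phi> x' y'"
  obtain n m where "\<forall>x y. n \<bullet> \<phi> x y = n \<bullet> X + 1 * x + 0 * y" "\<forall>x y. m \<bullet> \<phi> x y = m \<bullet> X + 0 * x + 1 * y"
    using functional[of 1 0] functional[of 0 1] by blast
  then show "x = x' \<and> y = y'" using h by (metis add_left_cancel mult_1 mult_zero_left add.right_neutral add.left_neutral)
qed simp

lemma suppI:
  assumes "\<And>z. z \<in> {(p, 0), (0, q), (1, r), (s, 1)} \<Longrightarrow> \<alpha> * fst z + \<beta> * snd z \<le> \<gamma>"
    "\<And>z. z \<in> {(p, 0), (0, q), (1, r), (s, 1)} \<Longrightarrow> \<alpha> * fst z + \<beta> * snd z = \<gamma> \<Longrightarrow> \<phi> (fst z) (snd z) \<in> l"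
    "\<And>z. z \<in> l \<Longrightarrow> \<exists>x y. z = \<phi> x y \<and> \<alpha> * x + \<beta> * y = \<gamma>"
  shows "supp {XA, XB, PA, PB} l"
proof -
  obtain n where n: "\<And>x y. n \<bullet> \<phi> x y = n \<bullet> X + \<alpha> * x + \<beta> * y" using functional by blast
  show ?thesis unfolding supp_def
    by (rule exI[of _ n], rule exI[of _ "n \<bullet> X + \<gamma>"])
      (use assms(1)[of "(p, 0)"] assms(1)[of "(0, q)"] assms(1)[of "(1, r)"] assms(1)[of "(s, 1)"]
        assms(2)[of "(p, 0)"] assms(2)[of "(0, q)"] assms(2)[of "(1, r)"] assms(2)[of "(s, 1)"] assms(3)
        in \<open>fastforce simp: n\<close>)
qed

lemma products: "p * q < q" "p * q < p" "0 < p * r" "0 < q * s" "0 < p * q"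
  using mult_strict_right_mono[of p 1 q] mult_strict_left_mono[of q 1 p] pq rs by simp_all

text \<open>Here and in the next three lemmas the coefficients are those of the line through the two
  iso-points, with signs such that the remaining iso-points do not lie above it.\<close>

lemma supp_lX: "supp {XA, XB, PA, PB} {XA, XB}"
proof (rule suppI[of "- q" "- p" "- (p * q)"])
  have 1: "- q * 1 + - p * r < - (p * q)"
    using products by simp
  have 2: "- q * s + - p * 1 < - (p * q)"
    using products by simp
  fix z assume z: "z \<in> {(p, 0), (0, q), (1, r), (s, 1)}"
  show "- q * fst z + - p * snd z \<le> - (p * q)" using z 1 2 by (auto simp: mult.commute)
  show "- q * fst z + - p * snd z = - (p * q) \<Longrightarrow> \<phi> (fst z) (snd z) \<in> {XA, XB}" using z 1 2 by auto
qed (auto simp: mult.commute)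

lemma supp_lA: "supp {XA, XB, PA, PB} {XA, PA}"
proof (rule suppI[of r "- (1 - p)" "r * p"])
  have 1: "r * 0 + - (1 - p) * q < r * p"
    using products by (simp add: algebra_simps)
  have 2: "r * s + - (1 - p) * 1 \<le> r * p"
  proof -
    have "r * (s - p) \<le> 1 - p"
    proof (cases "s \<le> p")
      case True then have "r * (s - p) \<le> 0" using rs by (simp add: mult_nonneg_nonpos)
      then show ?thesis using pq by linarith
    next
      case False
      have "r * (s - p) \<le> 1 * (s - p)" by (rule mult_right_mono) (use rs False in auto)
      then have "r * (s - p) \<le> s - p" by simp
      also have "\<dots> \<le> 1 - p" using rs by simp
      finally show ?thesis .
    qed
    then show ?thesis by (simp add: algebra_simps)
  qed
  \<comment> \<open>Equality is reached only in the degenerate case, where the point (s, 1) is the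
    same as (1, r) and so belongs to the segment anyway.\<close>
  have 3: "s = 1 \<and> r = 1" if "r * s + - (1 - p) * 1 = r * p"
  proof -
    have e: "r * (s - p) = 1 - p" using that by (simp add: algebra_simps)
    have "s > p"
    proof (rule ccontr)
      assume "\<not> ?thesis" then have "r * (s - p) \<le> 0" using rs by (simp add: mult_nonneg_nonpos)
      then show False using e pq by linarith
    qed
    then have "r * (s - p) \<le> 1 * (s - p)" by (intro mult_right_mono) (use rs in auto)
    then have "1 - p \<le> s - p" unfolding e by simp
    then have "s = 1" using rs by simp
    then show ?thesis using rs by simp
  qed
  fix z assume z: "z \<in> {(p, 0), (0, q), (1, r), (s, 1)}"
  show "r * fst z + - (1 - p) * snd z \<le> r * p" using z 1 2 by (auto simp: algebra_simps)
  show "r * fst z + - (1 - p) * snd z = r * p \<Longrightarrow> \<phi> (fst z) (snd z) \<in> {XA, PA}" using z 1 3 by auto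
next
  fix z assume "z \<in> {XA, PA}"
  then show "\<exists>x y. z = \<phi> x y \<and> r * x + - (1 - p) * y = r * p"
    by (elim insertE emptyE) (rule exI[of _ p], rule exI[of _ 0], simp, rule exI[of _ 1], rule exI[of _ r], simp add: algebra_simps)
qed

lemma supp_lB: "supp {XA, XB, PA, PB} {XB, PB}"
proof (rule suppI[of "- (1 - q)" s "s * q"])
  have 1: "- (1 - q) * p + s * 0 < s * q"
    using products by (simp add: algebra_simps)
  have 2: "- (1 - q) * 1 + s * r \<le> s * q"
  proof -
    have "s * (r - q) \<le> 1 - q"
    proof (cases "r \<le> q")
      case True then have "s * (r - q) \<le> 0" using rs by (simp add: mult_nonneg_nonpos)
      then show ?thesis using pq by linarith
    next
      case False
      have "s * (r - q) \<le> 1 * (r - q)" by (rule mult_right_mono) (use rs False in auto)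
      then have "s * (r - q) \<le> r - q" by simp
      also have "\<dots> \<le> 1 - q" using rs by simp
      finally show ?thesis .
    qed
    then show ?thesis by (simp add: algebra_simps)
  qed
  have 3: "s = 1 \<and> r = 1" if "- (1 - q) * 1 + s * r = s * q"
  proof -
    have e: "s * (r - q) = 1 - q" using that by (simp add: algebra_simps)
    have "r > q"
    proof (rule ccontr)
      assume "\<not> ?thesis" then have "s * (r - q) \<le> 0" using rs by (simp add: mult_nonneg_nonpos)
      then show False using e pq by linarith
    qed
    then have "s * (r - q) \<le> 1 * (r - q)" by (intro mult_right_mono) (use rs in auto)
    then have "1 - q \<le> r - q" unfolding e by simp
    then have "r = 1" using rs by simp
    then show ?thesis using rs by simp
  qed
  fix z assume z: "z \<in> {(p, 0), (0, q), (1, r), (s, 1)}"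
  show "- (1 - q) * fst z + s * snd z \<le> s * q" using z 1 2 by (auto simp: algebra_simps)
  show "- (1 - q) * fst z + s * snd z = s * q \<Longrightarrow> \<phi> (fst z) (snd z) \<in> {XB, PB}" using z 1 3 by auto
next
  fix z assume "z \<in> {XB, PB}"
  then show "\<exists>x y. z = \<phi> x y \<and> - (1 - q) * x + s * y = s * q"
    by (elim insertE emptyE) (rule exI[of _ 0], rule exI[of _ q], simp, rule exI[of _ s], rule exI[of _ 1], simp add: algebra_simps)
qed

lemma supp_lP: assumes "r \<noteq> 1" shows "supp {XA, XB, PA, PB} {PA, PB}"
proof (rule suppI[of "1 - r" "1 - s" "(1 - r) + (1 - s) * r"])
  have rs1: "r < 1" "s < 1" using assms rs by auto
  have 1: "(1 - r) * p + (1 - s) * 0 < (1 - r) + (1 - s) * r"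
  proof -
    have "(1 - r) * p < (1 - r) * 1" by (rule mult_strict_left_mono) (use rs1 pq in auto)
    moreover have "0 < (1 - s) * r" using rs1 rs by simp
    ultimately show ?thesis by simp
  qed
  have 2: "(1 - r) * 0 + (1 - s) * q < (1 - r) + (1 - s) * r"
  proof (cases "q \<le> r")
    case True then have "(1 - s) * q \<le> (1 - s) * r" using rs1 by (intro mult_left_mono) auto
    then show ?thesis using rs1 by linarith
  next
    case False
    then have "(1 - s) * (q - r) \<le> 1 * (q - r)" using rs by (intro mult_right_mono) auto
    then show ?thesis using pq by (simp add: algebra_simps)
  qed
  fix z assume z: "z \<in> {(p, 0), (0, q), (1, r), (s, 1)}"
  show "(1 - r) * fst z + (1 - s) * snd z \<le> (1 - r) + (1 - s) * r" using z 1 2 by (auto simp: algebra_simps)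
  show "(1 - r) * fst z + (1 - s) * snd z = (1 - r) + (1 - s) * r \<Longrightarrow> \<phi> (fst z) (snd z) \<in> {PA, PB}" using z 1 2 by auto
next
  fix z assume "z \<in> {PA, PB}"
  then show "\<exists>x y. z = \<phi> x y \<and> (1 - r) * x + (1 - s) * y = (1 - r) + (1 - s) * r"
    by (elim insertE emptyE) (rule exI[of _ 1], rule exI[of _ r], simp, rule exI[of _ s], rule exI[of _ 1], simp add: algebra_simps)
qed

end

section \<open>The lines of a graph on a non-trivial L-face\<close>

definition ipt :: "real \<Rightarrow> (point \<Rightarrow> real) \<Rightarrow> point \<Rightarrow> point \<Rightarrow> point" where
  "ipt c t P Q = P + ((c - t P) / (t Q - t P)) *\<^sub>R (Q - P)"

lemma iso_point_ipt: "iso_point c G P Q = ipt c (label G) P Q"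
  by (simp add: iso_point_def ipt_def)

definition Lset :: "real \<Rightarrow> lcg set \<Rightarrow> lcg \<Rightarrow> point set \<Rightarrow> point set set" where
  "Lset c \<G> G M = {l. l \<subseteq> M \<and> (\<exists>w. inner_iso_path c \<G> G w \<and> l \<in> w)}"

text \<open>\<open>X\<close> and \<open>P\<close> are the continuous corners of an L-face,
  \<open>A\<close> and \<open>B\<close> the disperse ones. \<open>DISP\<close> cuts off the disperse
  corners, \<open>CONT\<close> the continuous ones; the line around \<open>P\<close> degenerates to
  a point if \<open>P\<close> has label c and is then omitted.\<close>

definition DISP :: "real \<Rightarrow> (point \<Rightarrow> real) \<Rightarrow> point \<Rightarrow> point \<Rightarrow> point \<Rightarrow> point \<Rightarrow> point set set" where
  "DISP c t X A P B = {{ipt c t X A, ipt c t P A}, {ipt c t X B, ipt c t P B}}"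

definition CONT :: "real \<Rightarrow> (point \<Rightarrow> real) \<Rightarrow> point \<Rightarrow> point \<Rightarrow> point \<Rightarrow> point \<Rightarrow> point set set" where
  "CONT c t X A P B = insert {ipt c t X A, ipt c t X B} (if t P < c then {{ipt c t P A, ipt c t P B}} else {})"

text \<open>\<open>t\<close> is the labeling seen from the side of the common face on which \<open>P\<close> is continuous.\<close>

definition face_data ::
  "real \<Rightarrow> lcg set \<Rightarrow> (point \<Rightarrow> real) \<Rightarrow> lcg \<Rightarrow> point set \<Rightarrow> point \<Rightarrow> point \<Rightarrow> point \<Rightarrow> point \<Rightarrow> bool" where
  "face_data c \<G> t G M X A P B \<longleftrightarrow>
     (Lset c \<G> G M = DISP c t X A P B \<or> Lset c \<G> G M = CONT c t X A P B) \<and>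
     (\<forall>w w' l. inner_iso_path c \<G> G w \<longrightarrow> inner_iso_path c \<G> G w' \<longrightarrow> l \<in> w \<longrightarrow> l \<in> w' \<longrightarrow> l \<subseteq> M \<longrightarrow> w = w') \<and>
     (\<forall>l\<in>Lset c \<G> G M. \<forall>F. F facet_of cuboid G \<longrightarrow> l \<subseteq> F \<longrightarrow> F = M) \<and>
     (\<forall>w. inner_iso_path c \<G> G w \<longrightarrow> polygon_points w \<inter> M \<subseteq> (\<Union>l\<in>Lset c \<G> G M. convex hull l) \<union>
        {ipt c t X A, ipt c t X B, ipt c t P A, ipt c t P B}) \<and>
     iso_points c G \<inter> M \<subseteq> {ipt c t X A, ipt c t X B, ipt c t P A, ipt c t P B}"

context cubc begin

lemma iso_points_eq: "iso_points c (Gr t) = {ip t \<rho> \<tau> | \<rho> \<tau>. cross (dd t) \<rho> \<tau>}"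
  unfolding iso_points_def ip_def cross_def by (fastforce simp: incident_iff)

lemma ip_ipt: "ip t \<rho> \<tau> = ipt c t (V a b \<rho>) (V a b \<tau>)"
  by (simp add: ip_def iso_point_ipt)

lemma inner_pp:
  assumes "regular_graph c \<G> (Gr t)"
  shows "inner_iso_path c \<G> (Gr t) w \<longleftrightarrow> (\<exists>\<sigma>. src (dd t) \<sigma> \<and> w = pp t (res (dd t) \<sigma>))"
  unfolding inner_iso_path_def using inner_fwd[OF assms] inner_bwd[OF assms] by blast

text \<open>The labels \<open>t\<close> of this graph may differ from \<open>t0\<close> at
  \<open>P\<close> only, where a label-c node has been removed in this graph. The face is then
  regular with three disperse corners and carries just the line around \<open>X\<close>, which is
  \<open>CONT\<close> for label c at \<open>P\<close>. So the graphs on both sides of the face have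
  data of the same form.\<close>

lemma face_data_Gr:
  fixes k :: 3 and s u v :: bool
  defines "X \<equiv> cn k s u v" and "A \<equiv> cn k s (\<not> u) v" and "B \<equiv> cn k s u (\<not> v)" and "P \<equiv> cn k s (\<not> u) (\<not> v)"
  assumes reg: "regular_graph c \<G> (Gr t)"
    and lab: "t (V a b X) < c" "dd t A" "dd t B"
    and t0: "t0 (V a b X) = t (V a b X)" "t0 (V a b A) = t (V a b A)" "t0 (V a b B) = t (V a b B)"
    and tP: "t0 (V a b P) \<le> c" "t (V a b P) = t0 (V a b P) \<or> t0 (V a b P) = c \<and> dd t P"
  shows "face_data c \<G> t0 (Gr t) (bface a b k s) (V a b X) (V a b A) (V a b P) (V a b B)"
proof -
  define d where "d = dd t"
  note mx = regular_mixed(1)[OF reg] and sf = regular_mixed(2)[OF reg]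
  have X0: "\<not> dd t X" "\<not> zz t X" using lab(1) by (auto simp: dd_def zz_def)
  have nA: "\<not> zz t A" "\<not> zz t B" using lab(2,3) zz_not_dd by blast+
  have neq: "X \<noteq> A" "X \<noteq> B" "X \<noteq> P" "A \<noteq> B" "A \<noteq> P" "B \<noteq> P" unfolding X_def A_def B_def P_def by auto
  have cos: "co k X = s" "co k A = s" "co k B = s" "co k P = s" unfolding X_def A_def B_def P_def by simp_all
  have all: "\<xi> = X \<or> \<xi> = A \<or> \<xi> = B \<or> \<xi> = P" if xk: "co k \<xi> = s" for \<xi>
  proof -
    obtain p q where "\<xi> = cn k s p q" using cnE[OF xk] by blast
    then show ?thesis unfolding X_def A_def B_def P_def by (cases "p = u"; cases "q = v") auto
  qed
  have adjs: "adj X A" "adj X B" "adj P A" "adj P B" "\<not> adj X P" "\<not> adj P X" "\<not> adj A B" "\<not> adj B A"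
    unfolding X_def A_def B_def P_def by simp_all
  have ipX: "ip t X A = ipt c t0 (V a b X) (V a b A)" "ip t X B = ipt c t0 (V a b X) (V a b B)"
    unfolding ip_ipt ipt_def using t0 by simp_all
  have ipP: "ip t P A = ipt c t0 (V a b P) (V a b A)" "ip t P B = ipt c t0 (V a b P) (V a b B)" if "\<not> dd t P"
    unfolding ip_ipt ipt_def using t0 tP that by auto
  have zP: "zz t P \<longleftrightarrow> \<not> t0 (V a b P) < c" if "\<not> dd t P" using tP that by (auto simp: zz_def dd_def)
  have aL: "aL (dd t) (cn k s) \<longleftrightarrow> \<not> dd t P"
    using X0(1) lab(2,3) unfolding aL_def X_def A_def B_def P_def by (cases u; cases v) auto
  \<comment> \<open>At most \<open>P\<close> has label c, so no line on this face is an edge of the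
    cuboid; by \<open>face_unique\<close> such a line lies on no second face.\<close>
  have nozz: "\<not> (adj \<rho> \<tau> \<and> zz t \<rho> \<and> zz t \<tau> \<and> co k \<rho> = s \<and> co k \<tau> = s)" for \<rho> \<tau>
    using all[of \<rho>] all[of \<tau>] X0(2) nA adj_irrefl[of P] by blast
  have onlyface: "k' = k \<and> s' = s"
    if ar: "areg (res (dd t) \<sigma>) (zz t) (cn k1 s1)" and sr: "src (dd t) \<sigma>" and l: "line t (res (dd t) \<sigma>) k1 s1 \<subseteq> bface a b k s"
      "line t (res (dd t) \<sigma>) k1 s1 \<subseteq> bface a b k' s'" for \<sigma> k1 s1 k' s'
  proof -
    note cr = res_crossD[OF mx sr]
    have 1: "(k, s) = (k1, s1)"
    proof (rule ccontr)
      assume n: "(k, s) \<noteq> (k1, s1)"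
      from face_unique[OF ar cr l(1) n] show False using nozz by blast
    qed
    show ?thesis
    proof (rule ccontr)
      assume "\<not> ?thesis"
      then have n: "(k', s') \<noteq> (k1, s1)" using 1 by auto
      from face_unique[OF ar cr l(2) n] show False using nozz 1 by blast
    qed
  qed
  have mem: "\<exists>\<sigma> k1 s1. src (dd t) \<sigma> \<and> w = pp t (res (dd t) \<sigma>) \<and> areg (res (dd t) \<sigma>) (zz t) (cn k1 s1) \<and> l = line t (res (dd t) \<sigma>) k1 s1"
    if "inner_iso_path c \<G> (Gr t) w" "l \<in> w" for w l
    using that unfolding inner_pp[OF reg] pp_def by blast
  have Lmem: "\<exists>\<sigma>. src (dd t) \<sigma> \<and> areg (res (dd t) \<sigma>) (zz t) (cn k s) \<and> l = line t (res (dd t) \<sigma>) k s"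
    if "l \<in> Lset c \<G> (Gr t) (bface a b k s)" for l
  proof -
    obtain w where w: "l \<subseteq> bface a b k s" "inner_iso_path c \<G> (Gr t) w" "l \<in> w" using \<open>l \<in> Lset _ _ _ _\<close> unfolding Lset_def by blast
    obtain \<sigma> k1 s1 where h: "src (dd t) \<sigma>" "areg (res (dd t) \<sigma>) (zz t) (cn k1 s1)" "l = line t (res (dd t) \<sigma>) k1 s1"
      using mem[OF w(2,3)] by blast
    have "l \<subseteq> bface a b k1 s1" unfolding h(3) by (rule line_subset_bface[OF h(2) res_crossD[OF mx h(1)]])
    then have "k1 = k \<and> s1 = s" using onlyface[OF h(2,1) w(1)[unfolded h(3)]] unfolding h(3) by blast
    then show ?thesis using h by blast
  qed
  have LI: "l \<in> Lset c \<G> (Gr t) (bface a b k s)" if "src (dd t) \<sigma>" "l \<in> pp t (res (dd t) \<sigma>)" "l \<subseteq> bface a b k s" for l \<sigma>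
    unfolding Lset_def inner_pp[OF reg] using that by blast
  have ipface: "ip t \<rho> \<tau> \<in> bface a b k s" if "co k \<rho> = s" "co k \<tau> = s" "\<not> dd t \<rho>" "dd t \<tau>" for \<rho> \<tau>
    using ip_bface[OF that(3,4)] that by blast
  have Lset: "Lset c \<G> (Gr t) (bface a b k s) = (if dd t P \<or> ctype (dd t) then CONT c t0 (V a b X) (V a b A) (V a b P) (V a b B)
      else DISP c t0 (V a b X) (V a b A) (V a b P) (V a b B))"
  proof (cases "dd t P")
    case True
    then have tPc: "\<not> t0 (V a b P) < c" using tP by (auto simp: dd_def)
    have co: "\<not> dd t (cn k s u v)" "dd t (cn k s (\<not> u) v)" "dd t (cn k s u (\<not> v))" "dd t (cn k s (\<not> u) (\<not> v))"
      using X0(1) lab(2,3) True unfolding X_def A_def B_def P_def .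
    have ln: "line t (dd t) k s = {ip t X A, ip t X B}" using line_co[of "dd t" k s u v t, OF co] unfolding X_def A_def B_def .
    have ar: "areg (dd t) (zz t) (cn k s)" using areg_co[of "dd t" "cn k s" u v "zz t", OF co] X0(2) unfolding X_def by blast
    have "l = {ip t X A, ip t X B}" if lL: "l \<in> Lset c \<G> (Gr t) (bface a b k s)" for l
    proof -
      obtain \<sigma> where h: "src (dd t) \<sigma>" "areg (res (dd t) \<sigma>) (zz t) (cn k s)" "l = line t (res (dd t) \<sigma>) k s" using Lmem[OF lL] by blast
      from mx h(1,2) show ?thesis by (cases rule: pp_lines) (use h(3) ln aL True in auto)
    qed
    moreover have "{ip t X A, ip t X B} \<in> Lset c \<G> (Gr t) (bface a b k s)"
    proof -
      obtain p q where "src (dd t) (cn k s p q)" unfolding src_def using co by (cases "ctype (dd t)") auto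
      from LI[OF this exist_reg(2)[OF mx ar this]] show ?thesis
        unfolding ln using ipface cos X0 lab(2,3) by blast
    qed
    ultimately have "Lset c \<G> (Gr t) (bface a b k s) = {{ip t X A, ip t X B}}" by blast
    then show ?thesis using True tPc unfolding CONT_def ipX by simp
  next
    case False
    have L: "aL (dd t) (cn k s)" using aL False by blast
    show ?thesis
    proof (cases "ctype (dd t)")
      case ct: True
      have "l = {ip t X A, ip t X B} \<or> \<not> zz t P \<and> l = {ip t P A, ip t P B}" if lL: "l \<in> Lset c \<G> (Gr t) (bface a b k s)" for l
      proof -
        obtain \<sigma> where h: "src (dd t) \<sigma>" "areg (res (dd t) \<sigma>) (zz t) (cn k s)" "l = line t (res (dd t) \<sigma>) k s" using Lmem[OF lL] by blast
        from mx h(1,2) show ?thesis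
        proof (cases rule: pp_lines)
          case (cont u' v')
          have "cn k s u' v' = X \<or> cn k s u' v' = P" using all[of "cn k s u' v'"] cont(3) lab(2,3) by auto
          then show ?thesis
          proof
            assume "cn k s u' v' = X"
            then have "u' = u" "v' = v" unfolding X_def by auto
            then show ?thesis using cont(6) h(3) unfolding X_def A_def B_def by simp
          next
            assume e: "cn k s u' v' = P"
            then have "u' = (\<not> u)" "v' = (\<not> v)" unfolding P_def by auto
            then show ?thesis using cont(5,6) h(3) e unfolding P_def A_def B_def by (auto simp: insert_commute)
          qed
        qed (use L ct in auto)
      qed
      moreover have "{ip t X A, ip t X B} \<in> Lset c \<G> (Gr t) (bface a b k s)"
        using exist_cont[OF mx L ct, of u v] X0 LI[of X "{ip t X A, ip t X B}"] ipface cos lab(2,3) unfolding X_def A_def B_def by blast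
      moreover have "{ip t P A, ip t P B} \<in> Lset c \<G> (Gr t) (bface a b k s)" if "\<not> zz t P"
        using exist_cont[OF mx L ct, of "\<not> u" "\<not> v"] that False LI[of P "{ip t P A, ip t P B}"] ipface cos lab(2,3)
        unfolding P_def A_def B_def by (simp add: insert_commute)
      ultimately have "Lset c \<G> (Gr t) (bface a b k s) = insert {ip t X A, ip t X B} (if \<not> zz t P then {{ip t P A, ip t P B}} else {})"
        by auto
      then show ?thesis using ct zP[OF False] unfolding CONT_def ipX ipP[OF False] by simp
    next
      case nct: False
      have "l = {ip t X A, ip t P A} \<or> l = {ip t X B, ip t P B}" if lL: "l \<in> Lset c \<G> (Gr t) (bface a b k s)" for l
      proof -
        obtain \<sigma> where h: "src (dd t) \<sigma>" "areg (res (dd t) \<sigma>) (zz t) (cn k s)" "l = line t (res (dd t) \<sigma>) k s" using Lmem[OF lL] by blast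
        from mx h(1,2) show ?thesis
        proof (cases rule: pp_lines)
          case (disp u' v')
          have "cn k s u' v' = A \<or> cn k s u' v' = B" using all[of "cn k s u' v'"] disp(3) X0 False by auto
          then show ?thesis
          proof
            assume "cn k s u' v' = A"
            then have "u' = (\<not> u)" "v' = v" unfolding A_def by auto
            then show ?thesis using disp(6) h(3) unfolding X_def A_def P_def by simp
          next
            assume e: "cn k s u' v' = B"
            then have "u' = u" "v' = (\<not> v)" unfolding B_def by auto
            then show ?thesis using disp(6) h(3) e unfolding P_def X_def B_def by (auto simp: insert_commute)
          qed
        qed (use L nct in auto)
      qed
      moreover have "{ip t X A, ip t P A} \<in> Lset c \<G> (Gr t) (bface a b k s)"
        using exist_disp[OF mx L nct, of "\<not> u" v] X0 False LI[of A "{ip t X A, ip t P A}"] ipface cos lab(2,3)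
        unfolding X_def A_def P_def by simp
      moreover have "{ip t X B, ip t P B} \<in> Lset c \<G> (Gr t) (bface a b k s)"
        using exist_disp[OF mx L nct, of u "\<not> v"] X0 False LI[of B "{ip t X B, ip t P B}"] ipface cos lab(2,3)
        unfolding X_def B_def P_def by (simp add: insert_commute)
      ultimately have "Lset c \<G> (Gr t) (bface a b k s) = {{ip t X A, ip t P A}, {ip t X B, ip t P B}}" by blast
      then show ?thesis using nct False unfolding DISP_def ipX ipP[OF False] by simp
    qed
  qed
  \<comment> \<open>Neither exception of \<open>unique_path\<close> occurs: the line is not an edge,
    and an L-face that contains it is this face, whose corner \<open>X\<close> has label below
    c.\<close>
  have uniq: "w = w'" if h: "inner_iso_path c \<G> (Gr t) w" "inner_iso_path c \<G> (Gr t) w'" "l \<in> w" "l \<in> w'" "l \<subseteq> bface a b k s" for w w' l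
  proof -
    obtain \<sigma> where s: "src (dd t) \<sigma>" "w = pp t (res (dd t) \<sigma>)" using h(1) unfolding inner_pp[OF reg] by blast
    obtain \<sigma>' where s': "src (dd t) \<sigma>'" "w' = pp t (res (dd t) \<sigma>')" using h(2) unfolding inner_pp[OF reg] by blast
    obtain k1 s1 where f: "areg (res (dd t) \<sigma>) (zz t) (cn k1 s1)" "l = line t (res (dd t) \<sigma>) k1 s1" using h(3) s(2) unfolding pp_def by blast
    have "\<not> edgeline t l"
    proof
      assume "edgeline t l"
      then obtain \<rho> \<tau> where e: "adj \<rho> \<tau>" "zz t \<rho>" "zz t \<tau>" "l = {V a b \<rho>, V a b \<tau>}" unfolding edgeline_def by blast
      then show False using nozz[of \<rho> \<tau>] h(5) by auto
    qed
    then have "res (dd t) \<sigma> = res (dd t) \<sigma>'"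
    proof (rule unique_path[OF mx s(1) s'(1) h(3)[unfolded s(2)] h(4)[unfolded s'(2)]])
      fix k2 s2 assume "l \<subseteq> bface a b k2 s2"
      then have "k2 = k \<and> s2 = s" using onlyface[OF f(1) s(1)] h(5) f(2) by blast
      then show "\<exists>u v. \<not> dd t (cn k2 s2 u v) \<and> \<not> zz t (cn k2 s2 u v)" using X0 unfolding X_def by blast
    qed
    then show ?thesis using s s' by simp
  qed
  have fac: "F = bface a b k s" if lL: "l \<in> Lset c \<G> (Gr t) (bface a b k s)" and F: "F facet_of cbox a b" "l \<subseteq> F" for l F
  proof -
    obtain k' s' where F': "F = bface a b k' s'" using F(1) facet_iff by blast
    obtain \<sigma> where h: "src (dd t) \<sigma>" "areg (res (dd t) \<sigma>) (zz t) (cn k s)" "l = line t (res (dd t) \<sigma>) k s" using Lmem[OF lL] by blast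
    show ?thesis using onlyface[OF h(2,1) line_subset_bface[OF h(2) res_crossD[OF mx h(1)]]] F(2) unfolding h(3) F' by blast
  qed
  \<comment> \<open>An iso-point on the face belongs to an edge of the face, or it sits at
    \<open>P\<close>, where all crossing edges at \<open>P\<close> give the same point.\<close>
  have 2: "ip t \<rho> \<tau> \<in> {ipt c t0 (V a b X) (V a b A), ipt c t0 (V a b X) (V a b B), ipt c t0 (V a b P) (V a b A), ipt c t0 (V a b P) (V a b B)}"
      if c: "cross (dd t) \<rho> \<tau>" "ip t \<rho> \<tau> \<in> bface a b k s" for \<rho> \<tau>
    proof -
      have d: "\<not> dd t \<rho>" "dd t \<tau>" "adj \<rho> \<tau>" using c(1) by (auto simp: cross_def)
      have b: "co k \<rho> = s" "co k \<tau> = s \<or> zz t \<rho>" using c(2) ip_bface[OF d(1,2)] by blast+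
      consider "\<rho> = X" | "\<rho> = P" using all[OF b(1)] d(1) lab(2,3) by blast
      then show ?thesis
      proof cases
        case 1
        then have "co k \<tau> = s" using b X0 by blast
        then have "\<tau> = A \<or> \<tau> = B" using all[of \<tau>] d 1 adjs X0 by blast
        then show ?thesis using 1 ipX by auto
      next
        case 2
        show ?thesis
        proof (cases "zz t P")
          case True
          have "ip t P \<tau> = ip t P A" using True by (simp add: ip_lam lam_def zz_def)
          then show ?thesis using 2 ipP d(1) by simp
        next
          case False
          then have "co k \<tau> = s" using b 2 by blast
          then have "\<tau> = A \<or> \<tau> = B" using all[of \<tau>] d 2 adjs by blast
          then show ?thesis using 2 ipP d(1) by auto
        qed
      qed
    qed
  have 3: "{ip t \<rho> \<tau> | \<rho> \<tau>. cross (dd t) \<rho> \<tau> \<and> ip t \<rho> \<tau> \<in> bface a b k s} \<subseteq>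
       {ipt c t0 (V a b X) (V a b A), ipt c t0 (V a b X) (V a b B), ipt c t0 (V a b P) (V a b A), ipt c t0 (V a b P) (V a b B)}"
    using 2 by blast
  have pts: "polygon_points w \<inter> bface a b k s \<subseteq> (\<Union>l\<in>Lset c \<G> (Gr t) (bface a b k s). convex hull l) \<union>
        {ipt c t0 (V a b X) (V a b A), ipt c t0 (V a b X) (V a b B), ipt c t0 (V a b P) (V a b A), ipt c t0 (V a b P) (V a b B)}"
    if w: "inner_iso_path c \<G> (Gr t) w" for w
  proof -
    obtain \<sigma> where s: "src (dd t) \<sigma>" "w = pp t (res (dd t) \<sigma>)" using w unfolding inner_pp[OF reg] by blast
    have 1: "(\<Union>l\<in>{l \<in> pp t (res (dd t) \<sigma>). l \<subseteq> bface a b k s}. convex hull l) \<subseteq> (\<Union>l\<in>Lset c \<G> (Gr t) (bface a b k s). convex hull l)"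
      using LI[OF s(1)] by blast
    show ?thesis unfolding s(2) by (rule subset_trans[OF points_on_face[OF mx s(1)] Un_mono[OF 1 3]])
  qed
  have L2: "Lset c \<G> (Gr t) (bface a b k s) = DISP c t0 (V a b X) (V a b A) (V a b P) (V a b B) \<or>
     Lset c \<G> (Gr t) (bface a b k s) = CONT c t0 (V a b X) (V a b A) (V a b P) (V a b B)" using Lset by auto
  show ?thesis unfolding face_data_def Gr_simps
  proof (intro conjI allI impI ballI)
    fix w w' l assume "inner_iso_path c \<G> (Gr t) w" "inner_iso_path c \<G> (Gr t) w'" "l \<in> w" "l \<in> w'" "l \<subseteq> bface a b k s"
    then show "w = w'" by (rule uniq)
  next
    fix l F assume "l \<in> Lset c \<G> (Gr t) (bface a b k s)" "F facet_of cbox a b" "l \<subseteq> F"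
    then show "F = bface a b k s" by (rule fac)
  next
    show "iso_points c (Gr t) \<inter> bface a b k s \<subseteq> {ipt c t0 (V a b X) (V a b A), ipt c t0 (V a b X) (V a b B), ipt c t0 (V a b P) (V a b A), ipt c t0 (V a b P) (V a b B)}"
      using 2 unfolding iso_points_eq by blast
  qed (fact L2, erule pts)
qed

end

section \<open>Recovering the outer polygon from its point set\<close>

lemma simple_polygon_edges:
  assumes "simple_closed_polygon w"
  shows "\<And>l. l \<in> w \<Longrightarrow> \<exists>x y. l = {x, y} \<and> x \<noteq> y"
    "\<exists>l1\<in>w. \<exists>l2\<in>w. \<exists>l3\<in>w. l1 \<noteq> l2 \<and> l2 \<noteq> l3 \<and> l1 \<noteq> l3"
proof -
  obtain ps where ps: "distinct ps" "length ps \<ge> 3" "w = {{ps ! i, ps ! (Suc i mod length ps)} | i. i < length ps}"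
    using assms unfolding simple_closed_polygon_def by blast
  have ne: "ps ! i \<noteq> ps ! j" if "i < length ps" "j < length ps" "i \<noteq> j" for i j
    using that ps(1) nth_eq_iff_index_eq by blast
  show "\<exists>x y. l = {x, y} \<and> x \<noteq> y" if lw: "l \<in> w" for l
  proof -
    obtain i where i: "l = {ps ! i, ps ! (Suc i mod length ps)}" "i < length ps" using lw ps(3) by blast
    have "i \<noteq> Suc i mod length ps"
    proof (cases "Suc i = length ps")
      case True then show ?thesis using ps(2) by auto
    next
      case False then have "Suc i < length ps" using i(2) by simp
      then show ?thesis by simp
    qed
    moreover have "Suc i mod length ps < length ps" using ps(2) by (intro mod_less_divisor) linarith
    ultimately show ?thesis using ne[of i "Suc i mod length ps"] i by blast
  qed
  define n where "n = length ps"
  have n: "n \<ge> 3" using ps(2) by (simp add: n_def)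
  have "{ps ! 0, ps ! 1} \<in> w" using n unfolding ps(3) n_def[symmetric] by (intro CollectI exI[of _ 0]) simp
  moreover have "{ps ! 1, ps ! 2} \<in> w" using n unfolding ps(3) n_def[symmetric]
    by (intro CollectI exI[of _ 1]) (simp add: numeral_2_eq_2)
  moreover have "{ps ! (n - 1), ps ! 0} \<in> w" using n unfolding ps(3) n_def[symmetric] by (intro CollectI exI[of _ "n - 1"]) simp
  moreover have "ps ! 0 \<noteq> ps ! 1" "ps ! 0 \<noteq> ps ! 2" "ps ! 1 \<noteq> ps ! 2" "ps ! (n - 1) \<noteq> ps ! 1" "ps ! (n - 1) \<noteq> ps ! 0"
    using n ne unfolding n_def[symmetric] by auto
  ultimately show "\<exists>l1\<in>w. \<exists>l2\<in>w. \<exists>l3\<in>w. l1 \<noteq> l2 \<and> l2 \<noteq> l3 \<and> l1 \<noteq> l3"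
    by (intro bexI[of _ "{ps ! 0, ps ! 1}"] bexI[of _ "{ps ! 1, ps ! 2}"] bexI[of _ "{ps ! (n - 1), ps ! 0}"]) (auto simp: doubleton_eq_iff)
qed

lemma image_less3: "{f i | i. i < (3::nat)} = {f 0, f 1, f 2}"
proof -
  have "i < 3 \<longleftrightarrow> i = 0 \<or> i = 1 \<or> i = 2" for i :: nat by linarith
  then show ?thesis by auto
qed

lemma image_less4: "{f i | i. i < (4::nat)} = {f 0, f 1, f 2, f 3}"
proof -
  have "i < 4 \<longleftrightarrow> i = 0 \<or> i = 1 \<or> i = 2 \<or> i = 3" for i :: nat by linarith
  then show ?thesis by auto
qed

lemma triangle_edges: "{{[x, y, z] ! i, [x, y, z] ! (Suc i mod length [x, y, z])} | i. i < length [x, y, z]} = {{x, y}, {y, z}, {z, x}}"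
proof -
  have l: "length [x, y, z] = 3" by simp
  have m: "Suc 0 mod 3 = 1" "Suc 1 mod 3 = 2" "Suc 2 mod 3 = 0" by simp_all
  have n: "[x, y, z] ! 0 = x" "[x, y, z] ! 1 = y" "[x, y, z] ! 2 = z" by simp_all
  show ?thesis unfolding l image_less3[of "\<lambda>i. {[x, y, z] ! i, [x, y, z] ! (Suc i mod 3)}"] m n ..
qed

lemma quadrilateral_edges: "{{[x, y, z, v] ! i, [x, y, z, v] ! (Suc i mod length [x, y, z, v])} | i. i < length [x, y, z, v]} =
  {{x, y}, {y, z}, {z, v}, {v, x}}"
proof -
  have l: "length [x, y, z, v] = 4" by simp
  have m: "Suc 0 mod 4 = 1" "Suc 1 mod 4 = 2" "Suc 2 mod 4 = 3" "Suc 3 mod 4 = 0" by simp_all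
  have n: "[x, y, z, v] ! 0 = x" "[x, y, z, v] ! 1 = y" "[x, y, z, v] ! 2 = z" "[x, y, z, v] ! 3 = v" by simp_all
  show ?thesis unfolding l image_less4[of "\<lambda>i. {[x, y, z, v] ! i, [x, y, z, v] ! (Suc i mod 4)}"] m n ..
qed

context quad begin

definition S4 :: "point set" where "S4 = {XA, XB, PA, PB}"
definition DL :: "point set set" where "DL = {{XA, PA}, {XB, PB}}"
definition CL :: "point set set" where "CL = insert {XA, XB} (if r \<noteq> 1 then {{PA, PB}} else {})"

lemma line_supp:
  assumes "l \<in> DL \<union> CL" shows "supp S4 l" "\<exists>x y. l = {x, y} \<and> x \<noteq> y \<and> x \<in> S4 \<and> y \<in> S4"
proof -
  have l: "l = {XA, PA} \<or> l = {XB, PB} \<or> l = {XA, XB} \<or> r \<noteq> 1 \<and> l = {PA, PB}"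
    using assms unfolding DL_def CL_def by (auto split: if_splits)
  then show "supp S4 l" using supp_lA supp_lB supp_lX supp_lP unfolding S4_def by blast
  have "XA \<noteq> PA" "XB \<noteq> PB" "XA \<noteq> XB" "r \<noteq> 1 \<Longrightarrow> PA \<noteq> PB" using pq rs by auto
  then show "\<exists>x y. l = {x, y} \<and> x \<noteq> y \<and> x \<in> S4 \<and> y \<in> S4" using l unfolding S4_def by blast
qed

text \<open>Exposed segments contain the midpoint of two of the four iso-points only if these are
  their end points. So midpoints detect which segments belong to a union.\<close>

lemma midpoint_line:
  assumes "l \<in> DL \<union> CL" "x \<in> S4" "y \<in> S4" "x \<noteq> y" "midpoint x y \<in> convex hull l"
  shows "l = {x, y}"
proof -
  obtain p' q' where "l = {p', q'}" using line_supp(2)[OF assms(1)] by blast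
  then show ?thesis using supp_midpoint[of S4 p' q' x y] line_supp(1)[OF assms(1)] assms by simp
qed

lemma midpoint_not_S4: assumes "x \<in> S4" "y \<in> S4" "x \<noteq> y" shows "midpoint x y \<notin> S4"
proof
  assume m: "midpoint x y \<in> S4"
  obtain l where l: "l \<in> DL \<union> CL" "midpoint x y \<in> l" using m unfolding S4_def DL_def CL_def by auto
  have "midpoint x y \<in> convex hull l" using l(2) hull_inc by metis
  then have "l = {x, y}" by (rule midpoint_line[OF l(1) assms])
  then show False using l(2) assms(3) by (auto simp: midpoint_eq_endpoint)
qed

lemma DL_CL_disjoint: "DL \<inter> CL = {}" and DL_two: "{XA, PA} \<noteq> {XB, PB}"
  using pq rs unfolding DL_def CL_def by (auto simp: doubleton_eq_iff)

text \<open>The point set of \<open>w\<close> is that of \<open>L\<close> up to the four iso-points.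
  Midpoints of edges are not among those four, so each edge of \<open>w\<close> is a line of
  \<open>L\<close> and vice versa. A closed polygon has at least three edges, whereas
  \<open>DL\<close> and \<open>CL\<close> have at most two each; so both kinds must occur.\<close>

lemma outer_unique:
  assumes L: "L \<subseteq> DL \<union> CL" and w: "simple_closed_polygon w" "\<Union>w \<subseteq> S4"
    and U: "(\<Union>l\<in>L. convex hull l) \<subseteq> polygon_points w" "polygon_points w \<subseteq> (\<Union>l\<in>L. convex hull l) \<union> S4"
  shows "w = L" "\<not> L \<subseteq> DL" "\<not> L \<subseteq> CL"
proof -
  have wL: "w \<subseteq> L"
  proof
    fix l assume l: "l \<in> w"
    obtain x y where xy: "l = {x, y}" "x \<noteq> y" using simple_polygon_edges(1)[OF w(1) l] by blast
    have S: "x \<in> S4" "y \<in> S4" using w(2) l xy by auto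
    have "midpoint x y \<in> convex hull l" unfolding xy(1) by (simp add: segment_convex_hull[symmetric])
    then have "midpoint x y \<in> polygon_points w" using l unfolding polygon_points_def by blast
    then obtain l' where l': "l' \<in> L" "midpoint x y \<in> convex hull l'" using U(2) midpoint_not_S4[OF S xy(2)] by blast
    then have "l' = {x, y}" using midpoint_line[OF _ S xy(2)] L by blast
    then show "l \<in> L" using l'(1) xy(1) by simp
  qed
  show "w = L"
  proof (rule equalityI[OF wL], rule subsetI)
    fix l assume l: "l \<in> L"
    then obtain x y where xy: "l = {x, y}" "x \<noteq> y" "x \<in> S4" "y \<in> S4" using line_supp(2) L by blast
    have "midpoint x y \<in> convex hull l" unfolding xy(1) by (simp add: segment_convex_hull[symmetric])
    then have "midpoint x y \<in> polygon_points w" using l U(1) by blast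
    then obtain l' where l': "l' \<in> w" "midpoint x y \<in> convex hull l'" unfolding polygon_points_def by blast
    then have "l' = {x, y}" using midpoint_line[OF _ xy(3,4,2)] L wL by blast
    then show "l \<in> w" using l'(1) xy(1) by simp
  qed
  then show "\<not> L \<subseteq> DL" "\<not> L \<subseteq> CL"
    using simple_polygon_edges(2)[OF w(1)] unfolding DL_def CL_def by (auto split: if_splits)
qed

text \<open>A quadrilateral through the four iso-points, or a triangle if the two at the opposite
  corner coincide. It does not cross itself because its edges are exposed.\<close>

lemma outer_exists: "simple_closed_polygon (DL \<union> CL)" "3 \<le> card (DL \<union> CL)" "card (DL \<union> CL) \<le> 6"
proof -
  have nc: "convex hull l \<inter> convex hull l' = l \<inter> l'" if h: "l \<in> DL \<union> CL" "l' \<in> DL \<union> CL" "l \<noteq> l'" for l l'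
  proof -
    obtain x y where xy: "l = {x, y}" "x \<noteq> y" "x \<in> S4" "y \<in> S4" using line_supp(2)[OF h(1)] by blast
    obtain x' y' where xy': "l' = {x', y'}" "x' \<noteq> y'" "x' \<in> S4" "y' \<in> S4" using line_supp(2)[OF h(2)] by blast
    show ?thesis
      by (rule supp_noncross[OF line_supp(1)[OF h(1)] line_supp(1)[OF h(2)] xy(1) xy'(1) _ _ h(3) xy'(2) xy(2)])
        (use xy xy' in auto)
  qed
  have dist: "{XA, PA} \<noteq> {XB, PB}" "{XA, PA} \<noteq> {XA, XB}" "{XB, PB} \<noteq> {XA, XB}"
    "r \<noteq> 1 \<Longrightarrow> {PA, PB} \<noteq> {XA, PA}" "r \<noteq> 1 \<Longrightarrow> {PA, PB} \<noteq> {XB, PB}" "{PA, PB} \<noteq> {XA, XB}"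
    using pq rs by (auto simp: doubleton_eq_iff)
  have "\<exists>ps. distinct ps \<and> length ps \<ge> 3 \<and> DL \<union> CL = {{ps ! i, ps ! (Suc i mod length ps)} | i. i < length ps}"
  proof (cases "r = 1")
    case True
    then have s1: "s = 1" using rs by simp
    have "DL \<union> CL = {{XA, PA}, {PA, XB}, {XB, XA}}" using True s1 unfolding DL_def CL_def by auto
    then have "DL \<union> CL = {{[XA, PA, XB] ! i, [XA, PA, XB] ! (Suc i mod length [XA, PA, XB])} | i. i < length [XA, PA, XB]}"
      unfolding triangle_edges .
    moreover have "distinct [XA, PA, XB]" using pq rs by auto
    ultimately show ?thesis by (intro exI[of _ "[XA, PA, XB]"]) simp
  next
    case False
    then have s1: "s \<noteq> 1" using rs by simp
    let ?ps = "[XA, PA, PB, XB]"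
    have "DL \<union> CL = {{XA, PA}, {PA, PB}, {PB, XB}, {XB, XA}}" using False s1 unfolding DL_def CL_def by auto
    then have "DL \<union> CL = {{?ps ! i, ?ps ! (Suc i mod length ?ps)} | i. i < length ?ps}"
      unfolding quadrilateral_edges .
    moreover have "distinct ?ps" using pq rs False s1 by auto
    ultimately show ?thesis by (intro exI[of _ "?ps"]) simp
  qed
  then show "simple_closed_polygon (DL \<union> CL)" unfolding simple_closed_polygon_def using nc by blast
  have U: "DL \<union> CL = {{XA, PA}, {XB, PB}, {XA, XB}} \<union> (if r \<noteq> 1 then {{PA, PB}} else {})"
    unfolding DL_def CL_def by auto
  have f: "finite (DL \<union> CL)" unfolding U by simp
  show "3 \<le> card (DL \<union> CL)"
  proof -
    have "card {{XA, PA}, {XB, PB}, {XA, XB}} = 3" using dist by simp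
    then show ?thesis using card_mono[OF f, of "{{XA, PA}, {XB, PB}, {XA, XB}}"] unfolding U by auto
  qed
  have "card (DL \<union> CL) \<le> card {{XA, PA}, {XB, PB}, {XA, XB}, {PA, PB}}" by (rule card_mono) (auto simp: U)
  also have "\<dots> \<le> 4" by (rule order_trans[OF card_insert_le_m1[of 4]]) (simp_all add: card_insert_if)
  finally show "card (DL \<union> CL) \<le> 6" by simp
qed

end

context cubc begin

lemma quad_Gr:
  fixes k :: 3 and s u v :: bool
  defines "X \<equiv> V a b (cn k s u v)" and "A \<equiv> V a b (cn k s (\<not> u) v)" and "B \<equiv> V a b (cn k s u (\<not> v))" and "P \<equiv> V a b (cn k s (\<not> u) (\<not> v))"
  assumes lab: "t X < c" "c < t A" "c < t B" "t P \<le> c"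
  shows "\<exists>p q r s. quad (A - X) (B - X) p q r s \<and> ipt c t X A = quad.\<phi> X (A - X) (B - X) p 0 \<and>
    ipt c t X B = quad.\<phi> X (A - X) (B - X) 0 q \<and> ipt c t P A = quad.\<phi> X (A - X) (B - X) 1 r \<and>
    ipt c t P B = quad.\<phi> X (A - X) (B - X) s 1 \<and> (r = 1 \<longleftrightarrow> \<not> t P < c)"
proof -
  define la where "la P Q = (c - t P) / (t Q - t P)" for P Q
  have la: "0 < la X A" "la X A < 1" "0 < la X B" "la X B < 1" "0 \<le> la P A" "la P A < 1" "0 \<le> la P B" "la P B < 1"
     "la P A = 0 \<longleftrightarrow> \<not> t P < c" "la P B = 0 \<longleftrightarrow> \<not> t P < c"
    using lab by (auto simp: la_def divide_simps)
  have co: "A $ i - X $ i = 0 \<or> B $ i - X $ i = 0" "P $ i = A $ i + B $ i - X $ i" for i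
    using exhaust_3[of k] exhaust_3[of i] unfolding X_def A_def B_def P_def by (auto simp: cn.simps)
  have PE: "P = A + B - X" using co(2) by (simp add: vec_eq_iff)
  have "(A - X) \<bullet> (B - X) = (\<Sum>i\<in>UNIV. (A $ i - X $ i) * (B $ i - X $ i))" by (simp add: inner_vec_def)
  also have "\<dots> = 0" by (rule sum.neutral) (use co(1) in auto)
  finally have ef: "(A - X) \<bullet> (B - X) = 0" .
  have ne: "A - X \<noteq> 0" "B - X \<noteq> 0" unfolding X_def A_def B_def by auto
  have Q: "quad (A - X) (B - X) (la X A) (la X B) (1 - la P B) (1 - la P A)"
    by unfold_locales (use ef ne la in auto)
  have Q': "quad (A - X) (B - X) (la X A) (la X B) (1 - la P A) (1 - la P B)"
    by unfold_locales (use ef ne la in auto)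
  show ?thesis
    by (rule exI[of _ "la X A"], rule exI[of _ "la X B"], rule exI[of _ "1 - la P A"], rule exI[of _ "1 - la P B"])
      (use Q' la in \<open>auto simp: ipt_def quad.\<phi>_def[OF Q'] la_def[symmetric] PE algebra_simps\<close>)
qed

end

section \<open>Geometry of the cuboid partition\<close>

lemma box_of_cuboid: "is_cuboid C \<Longrightarrow> \<exists>a b. cub a b \<and> C = cbox a b"
  unfolding is_cuboid_def cub_def by blast

context cub begin

lemma bface_eq_iff: "bface a b k s = bface a b k' s' \<longleftrightarrow> k = k' \<and> s = s'"
proof -
  interpret cubc a b "1 / 2" by unfold_locales auto
  show ?thesis by (rule bface_inj)
qed

lemma bface_facet: "bface a b k s facet_of cbox a b" unfolding facet_iff by blast

lemma segment_bface: "co k \<rho> = s \<Longrightarrow> co k \<tau> = s \<Longrightarrow> closed_segment (V a b \<rho>) (V a b \<tau>) \<subseteq> bface a b k s"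
  using face_of_imp_convex[OF bface_face_of[of a b k s]] by (intro closed_segment_subset) auto

lemma proper_face_boundary:
  assumes "F face_of cbox a b" "F \<noteq> cbox a b" "x \<in> F"
  shows "\<exists>k. x $ k = a $ k \<or> x $ k = b $ k"
proof -
  obtain I s where F: "F = box_face a b I s" using face_is_box_face[OF assms(1)] assms(3) by blast
  have "I \<noteq> {}" using F assms(2) by (auto simp: box_face_def)
  then obtain k where "k \<in> I" by blast
  then have "x $ k = side a b k (s k)" using assms(3) F by (auto simp: box_face_def)
  then show ?thesis unfolding side_def by (auto split: if_splits)
qed

end

text \<open>A facet is thin in one direction only, so its axis can be read off from the point set;
  its extent along the other axes gives the bounds of either box.\<close>

lemma same_face:
  assumes "cub a b" "cub a' b'" "bface a b k s = bface a' b' k' s'"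
  shows "k' = k" "side a' b' k s' = side a b k s" "j \<noteq> k \<Longrightarrow> a' $ j = a $ j \<and> b' $ j = b $ j"
proof -
  interpret A: cub a b by fact
  interpret B: cub a' b' by fact
  have coord: "x \<in> bface a b k s \<longleftrightarrow> x $ k = side a b k s \<and> (\<forall>j. j \<noteq> k \<longrightarrow> a $ j \<le> x $ j \<and> x $ j \<le> b $ j)" for x
    unfolding bface_def cbox_vec using A.side_le[of k s] by (auto; metis)
  have coord': "x \<in> bface a' b' k' s' \<longleftrightarrow> x $ k' = side a' b' k' s' \<and> (\<forall>j. j \<noteq> k' \<longrightarrow> a' $ j \<le> x $ j \<and> x $ j \<le> b' $ j)" for x
    unfolding bface_def cbox_vec using B.side_le[of k' s'] by (auto; metis)
  have pt: "\<exists>x. x \<in> bface a b k s \<and> (\<forall>j. j \<noteq> k \<longrightarrow> x $ j = side a b j (f j))" for f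
  proof -
    define x :: point where "x = (\<chi> j. if j = k then side a b k s else side a b j (f j))"
    have "x \<in> bface a b k s" unfolding coord by (simp add: x_def A.side_le)
    then show ?thesis by (intro exI[of _ x]) (simp add: x_def)
  qed
  have pt': "\<exists>x. x \<in> bface a' b' k' s' \<and> (\<forall>j. j \<noteq> k' \<longrightarrow> x $ j = side a' b' j (f j))" for f
  proof -
    define x :: point where "x = (\<chi> j. if j = k' then side a' b' k' s' else side a' b' j (f j))"
    have "x \<in> bface a' b' k' s'" unfolding coord' by (simp add: x_def B.side_le)
    then show ?thesis by (intro exI[of _ x]) (simp add: x_def)
  qed
  show k: "k' = k"
  proof (rule ccontr)
    assume n: "k' \<noteq> k"
    obtain x where x: "x \<in> bface a b k s" "x $ k' = a $ k'" using pt[of "\<lambda>_. False"] n by (auto simp: side_def)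
    obtain y where y: "y \<in> bface a b k s" "y $ k' = b $ k'" using pt[of "\<lambda>_. True"] n by (auto simp: side_def)
    show False using x y A.ab[of k'] unfolding assms(3) coord' by auto
  qed
  obtain x where "x \<in> bface a b k s" using pt by blast
  then show "side a' b' k s' = side a b k s" using coord[of x] coord'[of x] unfolding assms(3) k by auto
  assume j: "j \<noteq> k"
  obtain x1 where x1: "x1 \<in> bface a b k s" "x1 $ j = a $ j" using pt[of "\<lambda>_. False"] j by (auto simp: side_def)
  obtain x2 where x2: "x2 \<in> bface a b k s" "x2 $ j = b $ j" using pt[of "\<lambda>_. True"] j by (auto simp: side_def)
  obtain y1 where y1: "y1 \<in> bface a' b' k' s'" "y1 $ j = a' $ j" using pt'[of "\<lambda>_. False"] j k by (auto simp: side_def)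
  obtain y2 where y2: "y2 \<in> bface a' b' k' s'" "y2 $ j = b' $ j" using pt'[of "\<lambda>_. True"] j k by (auto simp: side_def)
  have "a' $ j \<le> a $ j" "b $ j \<le> b' $ j" using x1 x2 j unfolding assms(3) coord' unfolding k by auto
  moreover have "a $ j \<le> a' $ j" "b' $ j \<le> b $ j" using y1 y2 j unfolding assms(3)[symmetric] coord by auto
  ultimately show "a' $ j = a $ j \<and> b' $ j = b $ j" by simp
qed

lemma same_corner:
  assumes "cub a b" "cub a' b'" "bface a b k s = bface a' b' k s'" "co k \<rho> = s" "co k \<rho>' = s'" "\<And>j. j \<noteq> k \<Longrightarrow> co j \<rho> = co j \<rho>'"
  shows "V a b \<rho> = V a' b' \<rho>'"
proof -
  have "side a b j (co j \<rho>) = side a' b' j (co j \<rho>')" for j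
    using same_face[OF assms(1-3)] assms(4-6) by (cases "j = k") (auto simp: side_def)
  then show ?thesis by (simp add: vec_eq_iff)
qed

text \<open>Intervals that share an end on the same side overlap next to it. Doing this in all three
  coordinates shows that two cells which fill the same octant at a common corner are one
  cell.\<close>

lemma anchored_overlap:
  assumes "cub a b" "cub a' b'" "\<And>j. side a b j (co j \<rho>) = side a' b' j (co j \<rho>) \<or> a $ j = a' $ j \<and> b $ j = b' $ j"
  shows "\<exists>x. x \<in> cbox a' b' \<and> (\<forall>j. a $ j < x $ j \<and> x $ j < b $ j)"
proof -
  interpret A: cub a b by fact
  interpret B: cub a' b' by fact
  have "\<exists>y. a' $ j \<le> y \<and> y \<le> b' $ j \<and> a $ j < y \<and> y < b $ j" for j
  proof (cases "a $ j = a' $ j \<or> b $ j = b' $ j")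
    case True
    then show ?thesis
    proof
      assume h: "a $ j = a' $ j"
      show ?thesis by (rule exI[of _ "a $ j + min (b $ j - a $ j) (b' $ j - a' $ j) / 2"])
        (use h A.ab[of j] B.ab[of j] in \<open>auto simp: min_def field_simps\<close>)
    next
      assume h: "b $ j = b' $ j"
      show ?thesis by (rule exI[of _ "b $ j - min (b $ j - a $ j) (b' $ j - a' $ j) / 2"])
        (use h A.ab[of j] B.ab[of j] in \<open>auto simp: min_def field_simps\<close>)
    qed
  next
    case False
    then show ?thesis using assms(3)[of j] by (auto simp: side_def split: if_splits)
  qed
  then obtain f where f: "\<And>j. a' $ j \<le> f j \<and> f j \<le> b' $ j \<and> a $ j < f j \<and> f j < b $ j" by metis
  show ?thesis by (rule exI[of _ "\<chi> j. f j"]) (use f in \<open>simp add: cbox_vec\<close>)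
qed

locale partition =
  fixes \<Omega> :: "point set" and N :: nat and C :: "nat \<Rightarrow> point set"
  assumes op: "open \<Omega>" and cp: "cuboid_partition \<Omega> N C"
begin

lemma cuboid: "i \<in> {1..N} \<Longrightarrow> is_cuboid (C i)"
  using cp unfolding cuboid_partition_def by blast

lemma inter_face:
  assumes "i \<in> {1..N}" "j \<in> {1..N}" "i \<noteq> j" "x \<in> C i" "x \<in> C j"
  shows "(C i \<inter> C j) face_of C i" "(C i \<inter> C j) face_of C j" "aff_dim (C i \<inter> C j) \<le> 2"
    "aff_dim (C i \<inter> C j) = 2 \<Longrightarrow> (C i \<inter> C j) facet_of C i \<and> (C i \<inter> C j) facet_of C j"
proof -
  have d3: "aff_dim (C i) = 3"
    using box_of_cuboid[OF cuboid[OF assms(1)]] cub.aff_dim_cbox by metis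
  have c: "(C i \<inter> C j) facet_of C i \<and> (C i \<inter> C j) facet_of C j \<or>
        (C i \<inter> C j) edge_of C i \<and> (C i \<inter> C j) edge_of C j \<or>
        (\<exists>P \<in> nodes (C i) \<inter> nodes (C j). C i \<inter> C j = {P})"
    using cp assms unfolding cuboid_partition_def by blast
  have v: "(C i \<inter> C j) face_of C i \<and> (C i \<inter> C j) face_of C j \<and> aff_dim (C i \<inter> C j) = 0"
    if "\<exists>P \<in> nodes (C i) \<inter> nodes (C j). C i \<inter> C j = {P}"
    using that by (auto simp: nodes_def face_of_singleton)
  show "(C i \<inter> C j) face_of C i" "(C i \<inter> C j) face_of C j" using c v by (auto simp: facet_of_def edge_of_def)
  show "aff_dim (C i \<inter> C j) \<le> 2" using c v d3 by (auto simp: facet_of_def edge_of_def)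
  show "(C i \<inter> C j) facet_of C i \<and> (C i \<inter> C j) facet_of C j" if "aff_dim (C i \<inter> C j) = 2"
    using c v that by (auto simp: edge_of_def)
qed

text \<open>Two different cells meet in a face of dimension at most two, and such a face contains no
  point of the open box.\<close>

lemma interior_unique:
  assumes i: "i \<in> {1..N}" "j \<in> {1..N}" and box: "cub a b" "C i = cbox a b" and x: "x \<in> C j" "\<And>k. a $ k < x $ k \<and> x $ k < b $ k"
  shows "i = j"
proof (rule ccontr)
  assume n: "i \<noteq> j"
  interpret cub a b by fact
  have xi: "x \<in> C i" using x(2) unfolding box(2) cbox_vec by (simp add: less_imp_le)
  note f = inter_face[OF i n xi x(1)]
  have "C i \<inter> C j \<noteq> cbox a b" using f(3) aff_dim_cbox by auto
  then obtain k where "x $ k = a $ k \<or> x $ k = b $ k" using proper_face_boundary[of "C i \<inter> C j" x] f(1) xi x(1) box(2) by auto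
  then show False using x(2)[of k] by auto
qed

lemma C_inj: assumes "i \<in> {1..N}" "j \<in> {1..N}" "C i = C j" shows "i = j"
proof -
  obtain a b where box: "cub a b" "C i = cbox a b" using box_of_cuboid[OF cuboid[OF assms(1)]] by blast
  interpret cub a b by fact
  have "(\<chi> k. (a $ k + b $ k) / 2) \<in> C i" using ab unfolding box(2) by (simp add: cbox_vec less_imp_le)
  then have "(\<chi> k. (a $ k + b $ k) / 2) \<in> C j" unfolding assms(3) .
  then show ?thesis by (rule interior_unique[OF assms(1,2) box]) (use ab in simp)
qed

text \<open>The cells that miss \<open>x\<close> are closed and finitely many and \<Omega> is open,
  so a short step in any direction ends in a cell that contains \<open>x\<close>.\<close>

lemma direction:
  assumes x: "x \<in> \<Omega>"
  shows "\<exists>i\<in>{1..N}. \<exists>\<epsilon>>0. x \<in> C i \<and> x + \<epsilon> *\<^sub>R v \<in> C i"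
proof -
  have cl: "closed (C i)" if "i \<in> {1..N}" for i using box_of_cuboid[OF cuboid[OF that]] by auto
  define U where "U = \<Omega> \<inter> (\<Inter>i\<in>{i\<in>{1..N}. x \<notin> C i}. - C i)"
  have "open U" unfolding U_def by (intro open_Int op open_INT) (use cl in auto)
  moreover have "x \<in> U" using x unfolding U_def by auto
  moreover have "((\<lambda>e. x + e *\<^sub>R v) \<longlongrightarrow> x + 0 *\<^sub>R v) (at_right 0)" by (intro tendsto_intros)
  ultimately have "\<forall>\<^sub>F e in at_right 0. x + e *\<^sub>R v \<in> U" using topological_tendstoD by fastforce
  moreover have "\<forall>\<^sub>F e in at_right (0::real). 0 < e" by (rule eventually_at_right_less)
  ultimately have "\<forall>\<^sub>F e in at_right 0. x + e *\<^sub>R v \<in> U \<and> 0 < e" by (rule eventually_conj)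
  then obtain e where e: "x + e *\<^sub>R v \<in> U" "0 < e" using eventually_happens by (metis (no_types, lifting) trivial_limit_at_right_real)
  have "x + e *\<^sub>R v \<in> closure \<Omega>" using e(1) closure_subset unfolding U_def by blast
  then obtain i where i: "i \<in> {1..N}" "x + e *\<^sub>R v \<in> C i" using cp unfolding cuboid_partition_def by blast
  then have "x \<in> C i" using e(1) unfolding U_def by blast
  then show ?thesis using i e by blast
qed

lemma rel_interior_meets:
  assumes "convex M" "M \<inter> \<Omega> \<noteq> {}" shows "\<exists>x\<in>\<Omega>. x \<in> rel_interior M"
proof -
  have "\<Omega> \<inter> closure (rel_interior M) \<noteq> {}"
    unfolding convex_closure_rel_interior[OF assms(1)] using assms(2) closure_subset[of M] by blast
  then show ?thesis using open_Int_closure_eq_empty[OF op] by blast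
qed

text \<open>From a relatively interior point of \<open>M\<close> inside \<Omega> a short step leaves
  \<open>C i\<close> across \<open>M\<close> and enters another cell. The two cells meet in a face
  that contains this point, hence all of \<open>M\<close>; the dimension then forces
  equality.\<close>

lemma neighbor:
  assumes i: "i \<in> {1..N}" and M: "M facet_of C i" "M \<inter> \<Omega> \<noteq> {}"
  shows "\<exists>j\<in>{1..N}. j \<noteq> i \<and> C i \<inter> C j = M \<and> M facet_of C j"
proof -
  obtain a b where box: "cub a b" "C i = cbox a b" using box_of_cuboid[OF cuboid[OF i]] by blast
  interpret cub a b by fact
  obtain k s where ks: "M = bface a b k s" using M(1) facet_iff unfolding box(2) by blast
  have fM: "M face_of C i" using M(1) by (simp add: facet_of_def)
  obtain x where x: "x \<in> \<Omega>" "x \<in> rel_interior M" using rel_interior_meets[OF face_of_imp_convex[OF fM] M(2)] by blast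
  have xM: "x \<in> M" using x(2) rel_interior_subset by blast
  obtain j \<epsilon> where j: "j \<in> {1..N}" "\<epsilon> > 0" "x \<in> C j" "x + \<epsilon> *\<^sub>R ((if s then 1 else -1) *\<^sub>R axis k 1) \<in> C j"
    using direction[OF x(1), of "(if s then 1 else -1) *\<^sub>R axis k 1"] by blast
  define y where "y = x + \<epsilon> *\<^sub>R ((if s then 1 else -1) *\<^sub>R axis k 1)"
  have "y $ k = side a b k s + \<epsilon> * (if s then 1 else -1)"
    using xM unfolding ks bface_def y_def by (simp add: axis_def)
  then have "\<not> (a $ k \<le> y $ k \<and> y $ k \<le> b $ k)" using j(2) by (cases s) (simp_all add: side_def)
  then have "x + \<epsilon> *\<^sub>R ((if s then 1 else -1) *\<^sub>R axis k 1) \<notin> C i"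
    unfolding box(2) cbox_vec y_def by blast
  then have ji: "j \<noteq> i" using j(4) by blast
  have xi: "x \<in> C i" using xM fM face_of_imp_subset by blast
  note f = inter_face[OF i j(1) ji[symmetric] xi j(3)]
  have sub: "M \<subseteq> C i \<inter> C j"
    by (rule subset_of_face_of[OF f(1)]) (use fM face_of_imp_subset x(2) xi j(3) in auto)
  have dM: "aff_dim M = 2" using M(1) aff_dim_cbox unfolding box(2) facet_of_def by simp
  have "aff_dim (C i \<inter> C j) = 2" using aff_dim_subset[OF sub] dM f(3) by simp
  then have fc: "(C i \<inter> C j) facet_of C i" "(C i \<inter> C j) facet_of C j" using f(4) by auto
  have "M face_of C i \<inter> C j" using face_of_subset[OF fM sub] by simp
  moreover have "convex (C i \<inter> C j)" using f(1) face_of_imp_convex by blast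
  ultimately have "C i \<inter> C j = M" using face_of_aff_dim_lt dM \<open>aff_dim (C i \<inter> C j) = 2\<close> by (metis less_irrefl)
  then show ?thesis using j(1) ji fc by auto
qed

text \<open>Two cells on the same side of a common facet would overlap near it.\<close>

lemma opposite_side:
  assumes i: "i \<in> {1..N}" "j \<in> {1..N}" "i \<noteq> j" and box: "cub a b" "C i = cbox a b" "cub a' b'" "C j = cbox a' b'"
    and M: "bface a b k s = bface a' b' k' s'"
  shows "k' = k" "s' = (\<not> s)"
proof -
  note sf = same_face[OF box(1,3) M]
  show k: "k' = k" by (rule sf(1))
  show "s' = (\<not> s)"
  proof (rule ccontr)
    assume "s' \<noteq> (\<not> s)"
    then have s: "s' = s" by auto
    obtain \<rho> where \<rho>: "\<forall>j. co j \<rho> = s" using ix_of_fun[of "\<lambda>_. s"] by blast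
    have "\<exists>x. x \<in> cbox a' b' \<and> (\<forall>j. a $ j < x $ j \<and> x $ j < b $ j)"
    proof (rule anchored_overlap[OF box(1,3)])
      fix j show "side a b j (co j \<rho>) = side a' b' j (co j \<rho>) \<or> a $ j = a' $ j \<and> b $ j = b' $ j"
        using sf(2,3) \<rho> s by (cases "j = k") auto
    qed
    then show False using interior_unique[OF i(1,2) box(1,2)] i(3) box(4) by blast
  qed
qed

text \<open>Of three cells at one facet any two lie on opposite sides, but a facet has only two
  sides.\<close>

lemma neighbor_unique:
  assumes i: "i \<in> {1..N}" "j \<in> {1..N}" "l \<in> {1..N}" "i \<noteq> j" "i \<noteq> l" and M: "M facet_of C i" "M facet_of C j" "M facet_of C l"
  shows "j = l"
proof (rule ccontr)
  assume n: "j \<noteq> l"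
  obtain a b where A: "cub a b" "C i = cbox a b" using box_of_cuboid[OF cuboid[OF i(1)]] by blast
  obtain a' b' where B: "cub a' b'" "C j = cbox a' b'" using box_of_cuboid[OF cuboid[OF i(2)]] by blast
  obtain a2 b2 where D: "cub a2 b2" "C l = cbox a2 b2" using box_of_cuboid[OF cuboid[OF i(3)]] by blast
  obtain k s where 1: "M = bface a b k s" using M(1) cub.facet_iff[OF A(1)] unfolding A(2) by blast
  obtain k' s' where 2: "M = bface a' b' k' s'" using M(2) cub.facet_iff[OF B(1)] unfolding B(2) by blast
  obtain k2 s2 where 3: "M = bface a2 b2 k2 s2" using M(3) cub.facet_iff[OF D(1)] unfolding D(2) by blast
  show False
    using opposite_side(2)[OF i(1,2,4) A B 1[symmetric, THEN trans, OF 2]] opposite_side(2)[OF i(1,3,5) A D 1[symmetric, THEN trans, OF 3]]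
      opposite_side(2)[OF i(2,3) n B D 2[symmetric, THEN trans, OF 3]] by auto
qed

text \<open>Facets across \<open>k\<close>, \<open>j\<close>, \<open>k\<close>, \<open>j\<close> are
  crossed in turn, all containing the edge. Both bits of the edge are flipped twice, so the fifth
  cell has the edge in the same position as \<open>C i\<close>; it overlaps \<open>C i\<close> and
  therefore equals it.\<close>

lemma around_edge:
  assumes i: "i \<in> {1..N}" and box: "cub a b" "C i = cbox a b" and kj: "k \<noteq> j"
    and om: "closed_segment (V a b \<rho>) (V a b \<tau>) \<inter> \<Omega> \<noteq> {}" and rt: "co k \<rho> = co k \<tau>" "co j \<rho> = co j \<tau>"
  shows "\<exists>i2 i3 i4 M2 M3. i2 \<in> {1..N} \<and> i3 \<in> {1..N} \<and> i4 \<in> {1..N} \<and> i2 \<noteq> i \<and> i3 \<noteq> i2 \<and> i4 \<noteq> i3 \<and> i4 \<noteq> i \<and>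
    C i \<inter> C i2 = bface a b k (co k \<rho>) \<and> bface a b k (co k \<rho>) facet_of C i2 \<and>
    C i2 \<inter> C i3 = M2 \<and> M2 facet_of C i2 \<and> M2 facet_of C i3 \<and> closed_segment (V a b \<rho>) (V a b \<tau>) \<subseteq> M2 \<and> M2 \<noteq> bface a b k (co k \<rho>) \<and>
    C i3 \<inter> C i4 = M3 \<and> M3 facet_of C i3 \<and> M3 facet_of C i4 \<and> closed_segment (V a b \<rho>) (V a b \<tau>) \<subseteq> M3 \<and> M3 \<noteq> M2 \<and>
    C i4 \<inter> C i = bface a b j (co j \<rho>) \<and> bface a b j (co j \<rho>) facet_of C i4 \<and> M3 \<noteq> bface a b j (co j \<rho>)"
proof -
  define e where "e = closed_segment (V a b \<rho>) (V a b \<tau>)"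
  have step: "\<exists>i' a' b' \<rho>' \<tau>'. i' \<in> {1..N} \<and> i' \<noteq> i \<and> cub a' b' \<and> C i' = cbox a' b' \<and> C i \<inter> C i' = bface a b k (co k \<rho>) \<and>
      bface a b k (co k \<rho>) facet_of C i' \<and> bface a b k (co k \<rho>) = bface a' b' k (co k \<rho>') \<and>
      V a b \<rho> = V a' b' \<rho>' \<and> V a b \<tau> = V a' b' \<tau>' \<and> co k \<rho>' = co k \<tau>' \<and> co j \<rho>' = co j \<tau>' \<and>
      co k \<rho>' = (\<not> co k \<rho>) \<and> co j \<rho>' = co j \<rho> \<and> side a' b' k (co k \<rho>') = side a b k (co k \<rho>) \<and>
      (\<forall>l. l \<noteq> k \<longrightarrow> a' $ l = a $ l \<and> b' $ l = b $ l)"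
    if i: "i \<in> {1..N}" and box: "cub a b" "C i = cbox a b" and kj: "k \<noteq> j" and
      om: "closed_segment (V a b \<rho>) (V a b \<tau>) \<inter> \<Omega> \<noteq> {}" and rt: "co k \<rho> = co k \<tau>" "co j \<rho> = co j \<tau>"
    for i a b k j \<rho> \<tau>
  proof -
    interpret cub a b by fact
    let ?M = "bface a b k (co k \<rho>)"
    have fM: "?M facet_of C i" unfolding box(2) facet_iff by blast
    have "V a b \<rho> \<in> ?M" "V a b \<tau> \<in> ?M" using rt by auto
    moreover have "convex ?M" using bface_face_of face_of_imp_convex by blast
    ultimately have "closed_segment (V a b \<rho>) (V a b \<tau>) \<subseteq> ?M" by (simp add: closed_segment_subset)
    then have "?M \<inter> \<Omega> \<noteq> {}" using om by blast
    then obtain i' where i': "i' \<in> {1..N}" "i' \<noteq> i" "C i \<inter> C i' = ?M" "?M facet_of C i'" using neighbor[OF i fM] by blast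
    obtain a' b' where B: "cub a' b'" "C i' = cbox a' b'" using box_of_cuboid[OF cuboid[OF i'(1)]] by blast
    obtain k' s' where f: "?M = bface a' b' k' s'" using i'(4) cub.facet_iff[OF B(1)] unfolding B(2) by blast
    note o = opposite_side[OF i i'(1) i'(2)[symmetric] box B f]
    note f' = f[unfolded o]
    obtain \<rho>' where r: "\<forall>l. co l \<rho>' = (if l = k then \<not> co k \<rho> else co l \<rho>)" using ix_of_fun[of "\<lambda>l. if l = k then \<not> co k \<rho> else co l \<rho>"] by blast
    obtain \<tau>' where t: "\<forall>l. co l \<tau>' = (if l = k then \<not> co k \<rho> else co l \<tau>)" using ix_of_fun[of "\<lambda>l. if l = k then \<not> co k \<rho> else co l \<tau>"] by blast
    have 1: "V a b \<rho> = V a' b' \<rho>'" by (rule same_corner[OF box(1) B(1) f']) (use r in auto)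
    have 2: "V a b \<tau> = V a' b' \<tau>'" by (rule same_corner[OF box(1) B(1) f']) (use t rt in auto)
    have 3: "co k \<rho>' = (\<not> co k \<rho>)" "co k \<tau>' = (\<not> co k \<rho>)" "co j \<rho>' = co j \<rho>" "co j \<tau>' = co j \<tau>" using r t kj by auto
    note sf = same_face(2,3)[OF box(1) B(1) f']
    show ?thesis
      by (rule exI[of _ i'], rule exI[of _ a'], rule exI[of _ b'], rule exI[of _ \<rho>'], rule exI[of _ \<tau>'])
        (use i' B f' 1 2 3 rt sf in auto)
  qed
  obtain i2 a2 b2 \<rho>2 \<tau>2 where s2: "i2 \<in> {1..N}" "i2 \<noteq> i" "cub a2 b2" "C i2 = cbox a2 b2" "C i \<inter> C i2 = bface a b k (co k \<rho>)"
      "bface a b k (co k \<rho>) facet_of C i2" "bface a b k (co k \<rho>) = bface a2 b2 k (co k \<rho>2)"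
      "V a b \<rho> = V a2 b2 \<rho>2" "V a b \<tau> = V a2 b2 \<tau>2" "co k \<rho>2 = co k \<tau>2" "co j \<rho>2 = co j \<tau>2"
      "co k \<rho>2 = (\<not> co k \<rho>)" "co j \<rho>2 = co j \<rho>" "side a2 b2 k (co k \<rho>2) = side a b k (co k \<rho>)"
      "\<forall>l. l \<noteq> k \<longrightarrow> a2 $ l = a $ l \<and> b2 $ l = b $ l"
    using step[OF i box kj om rt] by (elim exE conjE)
  obtain i3 a3 b3 \<rho>3 \<tau>3 where s3: "i3 \<in> {1..N}" "i3 \<noteq> i2" "cub a3 b3" "C i3 = cbox a3 b3" "C i2 \<inter> C i3 = bface a2 b2 j (co j \<rho>2)"
      "bface a2 b2 j (co j \<rho>2) facet_of C i3" "bface a2 b2 j (co j \<rho>2) = bface a3 b3 j (co j \<rho>3)"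
      "V a2 b2 \<rho>2 = V a3 b3 \<rho>3" "V a2 b2 \<tau>2 = V a3 b3 \<tau>3" "co j \<rho>3 = co j \<tau>3" "co k \<rho>3 = co k \<tau>3"
      "co j \<rho>3 = (\<not> co j \<rho>2)" "co k \<rho>3 = co k \<rho>2" "side a3 b3 j (co j \<rho>3) = side a2 b2 j (co j \<rho>2)"
      "\<forall>l. l \<noteq> j \<longrightarrow> a3 $ l = a2 $ l \<and> b3 $ l = b2 $ l"
    using step[OF s2(1,3,4) kj[symmetric] om[unfolded s2(8,9)] s2(11,10)] by (elim exE conjE)
  obtain i4 a4 b4 \<rho>4 \<tau>4 where s4: "i4 \<in> {1..N}" "i4 \<noteq> i3" "cub a4 b4" "C i4 = cbox a4 b4" "C i3 \<inter> C i4 = bface a3 b3 k (co k \<rho>3)"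
      "bface a3 b3 k (co k \<rho>3) facet_of C i4" "bface a3 b3 k (co k \<rho>3) = bface a4 b4 k (co k \<rho>4)"
      "V a3 b3 \<rho>3 = V a4 b4 \<rho>4" "V a3 b3 \<tau>3 = V a4 b4 \<tau>4" "co k \<rho>4 = co k \<tau>4" "co j \<rho>4 = co j \<tau>4"
      "co k \<rho>4 = (\<not> co k \<rho>3)" "co j \<rho>4 = co j \<rho>3" "side a4 b4 k (co k \<rho>4) = side a3 b3 k (co k \<rho>3)"
      "\<forall>l. l \<noteq> k \<longrightarrow> a4 $ l = a3 $ l \<and> b4 $ l = b3 $ l"
    using step[OF s3(1,3,4) kj om[unfolded s2(8,9) s3(8,9)] s3(11,10)] by (elim exE conjE)
  obtain i5 a5 b5 \<rho>5 \<tau>5 where s5: "i5 \<in> {1..N}" "i5 \<noteq> i4" "cub a5 b5" "C i5 = cbox a5 b5" "C i4 \<inter> C i5 = bface a4 b4 j (co j \<rho>4)"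
      "bface a4 b4 j (co j \<rho>4) facet_of C i5" "bface a4 b4 j (co j \<rho>4) = bface a5 b5 j (co j \<rho>5)"
      "V a4 b4 \<rho>4 = V a5 b5 \<rho>5" "V a4 b4 \<tau>4 = V a5 b5 \<tau>5" "co j \<rho>5 = co j \<tau>5" "co k \<rho>5 = co k \<tau>5"
      "co j \<rho>5 = (\<not> co j \<rho>4)" "co k \<rho>5 = co k \<rho>4" "side a5 b5 j (co j \<rho>5) = side a4 b4 j (co j \<rho>4)"
      "\<forall>l. l \<noteq> j \<longrightarrow> a5 $ l = a4 $ l \<and> b5 $ l = b4 $ l"
    using step[OF s4(1,3,4) kj[symmetric] om[unfolded s2(8,9) s3(8,9) s4(8,9)] s4(11,10)] by (elim exE conjE)
  have r5: "co k \<rho>5 = co k \<rho>" "co j \<rho>5 = co j \<rho>" using s2 s3 s4 s5 by auto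
  have Veq: "V a b \<rho> = V a5 b5 \<rho>5" using s2(8) s3(8) s4(8) s5(8) by simp
  have i5: "i = i5"
  proof -
    have "\<exists>x. x \<in> cbox a5 b5 \<and> (\<forall>j. a $ j < x $ j \<and> x $ j < b $ j)"
    proof (rule anchored_overlap[OF box(1) s5(3)])
      fix l
      show "side a b l (co l \<rho>) = side a5 b5 l (co l \<rho>) \<or> a $ l = a5 $ l \<and> b $ l = b5 $ l"
      proof (cases "l = k \<or> l = j")
        case True
        have "V a b \<rho> $ l = V a5 b5 \<rho>5 $ l" using Veq by simp
        then show ?thesis using True r5 by auto
      next
        case False
        then show ?thesis using s2(15) s3(15) s4(15) s5(15) by auto
      qed
    qed
    then show ?thesis using interior_unique[OF i s5(1) box] s5(4) by blast
  qed
  interpret A: cub a b by fact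
  interpret A2: cub a2 b2 by (rule s2(3))
  interpret A3: cub a3 b3 by (rule s3(3))
  interpret A4: cub a4 b4 by (rule s4(3))
  have ab5: "a5 = a" "b5 = b"
  proof -
    have "cbox a b = cbox a5 b5" using box(2) s5(4) i5 by simp
    moreover have "cbox a b \<noteq> {}" using A.V_in by blast
    ultimately show "a5 = a" "b5 = b" using eq_cbox[of a b a5 b5] by auto
  qed
  have m5: "bface a4 b4 j (co j \<rho>4) = bface a b j (co j \<rho>)" using s5(7) ab5 r5 by simp
  have seg: "closed_segment (V a b \<rho>) (V a b \<tau>) \<subseteq> bface a2 b2 j (co j \<rho>2)"
    unfolding s2(8,9) by (rule A2.segment_bface) (use s2 in auto)
  have seg3: "closed_segment (V a b \<rho>) (V a b \<tau>) \<subseteq> bface a3 b3 k (co k \<rho>3)"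
    unfolding s2(8,9) s3(8,9) by (rule A3.segment_bface) (use s3 in auto)
  have n2: "bface a2 b2 j (co j \<rho>2) \<noteq> bface a b k (co k \<rho>)" unfolding s2(7) A2.bface_eq_iff using kj by auto
  have n3: "bface a3 b3 k (co k \<rho>3) \<noteq> bface a2 b2 j (co j \<rho>2)" unfolding s3(7) A3.bface_eq_iff using kj by auto
  have n4: "bface a3 b3 k (co k \<rho>3) \<noteq> bface a b j (co j \<rho>)" unfolding s4(7) m5[symmetric] A4.bface_eq_iff using kj by auto
  have f2: "bface a2 b2 j (co j \<rho>2) facet_of C i2" unfolding s2(4) by (rule A2.bface_facet)
  have f3: "bface a3 b3 k (co k \<rho>3) facet_of C i3" unfolding s3(4) by (rule A3.bface_facet)
  have f4: "bface a b j (co j \<rho>) facet_of C i4" unfolding s4(4) m5[symmetric] by (rule A4.bface_facet)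
  have i4i: "i4 \<noteq> i" using s5(2) i5 by blast
  have c4: "C i4 \<inter> C i = bface a b j (co j \<rho>)" using s5(5) i5 m5 by simp
  show ?thesis
    by (rule exI[of _ i2], rule exI[of _ i3], rule exI[of _ i4], rule exI[of _ "bface a2 b2 j (co j \<rho>2)"], rule exI[of _ "bface a3 b3 k (co k \<rho>3)"],
      intro conjI) (fact s2 s3 s4 i4i c4 seg seg3 n2 n3 n4 f2 f3 f4)+
qed

end

lemma polygon_points_union: "polygon_points (L \<union> L') = polygon_points L \<union> polygon_points L'"
  by (auto simp: polygon_points_def)

context quad begin

text \<open>Each of the two graphs draws \<open>DL\<close> or \<open>CL\<close>. If both draw the
  same, no closed polygon is possible; if not, the union is the full polygon.\<close>

lemma outer_polygon:
  assumes L: "L1 = DL \<or> L1 = CL" "L2 = DL \<or> L2 = CL"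
    and lo: "polygon_points (L1 \<union> L2) \<subseteq> J" and up: "J \<subseteq> polygon_points (L1 \<union> L2) \<union> S4"
  shows "\<And>w. simple_closed_polygon w \<Longrightarrow> \<Union>w \<subseteq> S4 \<Longrightarrow> polygon_points w = J \<Longrightarrow> w = L1 \<union> L2 \<and> L1 \<noteq> L2"
    and "L1 \<noteq> L2 \<Longrightarrow> L1 \<inter> L2 = {} \<and> simple_closed_polygon (L1 \<union> L2) \<and> 3 \<le> card (L1 \<union> L2) \<and> card (L1 \<union> L2) \<le> 6 \<and>
      \<Union>(L1 \<union> L2) \<subseteq> S4 \<and> polygon_points (L1 \<union> L2) = J"
proof -
  fix w assume w: "simple_closed_polygon w" "\<Union>w \<subseteq> S4" "polygon_points w = J"
  have sub: "L1 \<union> L2 \<subseteq> DL \<union> CL" using L by auto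
  note o = outer_unique[OF sub w(1,2), folded polygon_points_def, unfolded w(3), OF lo up]
  show "w = L1 \<union> L2 \<and> L1 \<noteq> L2" using o L by auto
next
  assume ne: "L1 \<noteq> L2"
  have U: "L1 \<union> L2 = DL \<union> CL" using L ne by blast
  have i: "L1 \<inter> L2 = {}" using L ne DL_CL_disjoint by auto
  have UD: "\<Union>(DL \<union> CL) \<subseteq> S4" unfolding DL_def CL_def S4_def by auto
  have "S4 \<subseteq> \<Union>(DL \<union> CL)" unfolding DL_def CL_def S4_def by auto
  also have "\<dots> \<subseteq> polygon_points (DL \<union> CL)" unfolding polygon_points_def using hull_subset by fastforce
  finally have "polygon_points (DL \<union> CL) = J" using lo up unfolding U by blast
  then show "L1 \<inter> L2 = {} \<and> simple_closed_polygon (L1 \<union> L2) \<and> 3 \<le> card (L1 \<union> L2) \<and> card (L1 \<union> L2) \<le> 6 \<and>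
      \<Union>(L1 \<union> L2) \<subseteq> S4 \<and> polygon_points (L1 \<union> L2) = J"
    using i UD outer_exists unfolding U by blast
qed

end

context cubc begin

lemma nontrivial_face_polygon:
  fixes k :: 3 and s u v :: bool
  defines "X \<equiv> V a b (cn k s u v)" and "A \<equiv> V a b (cn k s (\<not> u) v)" and "B \<equiv> V a b (cn k s u (\<not> v))" and "P \<equiv> V a b (cn k s (\<not> u) (\<not> v))"
    and "M \<equiv> bface a b k s"
  assumes lab: "t X < c" "c < t A" "c < t B" "t P \<le> c"
    and f1: "face_data c \<G> t G1 M X A P B" and f2: "face_data c \<G> t G2 M X A P B"
  shows "\<And>w. simple_closed_polygon w \<Longrightarrow> \<Union>w \<subseteq> iso_points c G1 \<Longrightarrow>
      polygon_points w = (\<Union>J\<in>{J. inner_iso_path c \<G> G1 J \<or> inner_iso_path c \<G> G2 J}. polygon_points J) \<inter> M \<Longrightarrow>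
      w = Lset c \<G> G1 M \<union> Lset c \<G> G2 M \<and> Lset c \<G> G1 M \<noteq> Lset c \<G> G2 M"
    and "Lset c \<G> G1 M \<noteq> Lset c \<G> G2 M \<Longrightarrow> Lset c \<G> G1 M \<inter> Lset c \<G> G2 M = {} \<and>
      simple_closed_polygon (Lset c \<G> G1 M \<union> Lset c \<G> G2 M) \<and>
      3 \<le> card (Lset c \<G> G1 M \<union> Lset c \<G> G2 M) \<and> card (Lset c \<G> G1 M \<union> Lset c \<G> G2 M) \<le> 6 \<and>
      \<Union>(Lset c \<G> G1 M \<union> Lset c \<G> G2 M) \<subseteq> {ipt c t X A, ipt c t X B, ipt c t P A, ipt c t P B} \<and>
      polygon_points (Lset c \<G> G1 M \<union> Lset c \<G> G2 M) = (\<Union>J\<in>{J. inner_iso_path c \<G> G1 J \<or> inner_iso_path c \<G> G2 J}. polygon_points J) \<inter> M"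
proof -
  obtain p q r s' where Q: "quad (A - X) (B - X) p q r s'" and ip: "ipt c t X A = quad.\<phi> X (A - X) (B - X) p 0"
    "ipt c t X B = quad.\<phi> X (A - X) (B - X) 0 q" "ipt c t P A = quad.\<phi> X (A - X) (B - X) 1 r"
    "ipt c t P B = quad.\<phi> X (A - X) (B - X) s' 1" and r: "r = 1 \<longleftrightarrow> \<not> t P < c"
    using quad_Gr[of t k s u v] lab unfolding X_def A_def B_def P_def by blast
  interpret quad X "A - X" "B - X" p q r s' by fact
  have S4': "S4 = {ipt c t X A, ipt c t X B, ipt c t P A, ipt c t P B}" unfolding S4_def ip ..
  have D: "DISP c t X A P B = DL" unfolding DISP_def DL_def ip ..
  have Cc: "CONT c t X A P B = CL" unfolding CONT_def CL_def ip using r by auto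
  let ?L1 = "Lset c \<G> G1 M" and ?L2 = "Lset c \<G> G2 M"
  let ?J = "\<Union>J\<in>{J. inner_iso_path c \<G> G1 J \<or> inner_iso_path c \<G> G2 J}. polygon_points J"
  have cv: "convex M" unfolding M_def by (rule face_of_imp_convex[OF bface_face_of])
  have L: "?L1 = DL \<or> ?L1 = CL" by (rule f1[unfolded face_data_def D Cc, THEN conjunct1])
  have L2: "?L2 = DL \<or> ?L2 = CL" by (rule f2[unfolded face_data_def D Cc, THEN conjunct1])
  note L = L L2
  have pts: "polygon_points w \<inter> M \<subseteq> (\<Union>l\<in>?L1. convex hull l) \<union> S4" if "inner_iso_path c \<G> G1 w" for w
    using f1[unfolded face_data_def, THEN conjunct2, THEN conjunct2, THEN conjunct2, THEN conjunct1, rule_format, OF that] unfolding S4' .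
  have pts2: "polygon_points w \<inter> M \<subseteq> (\<Union>l\<in>?L2. convex hull l) \<union> S4" if "inner_iso_path c \<G> G2 w" for w
    using f2[unfolded face_data_def, THEN conjunct2, THEN conjunct2, THEN conjunct2, THEN conjunct1, rule_format, OF that] unfolding S4' .
  have isoM: "iso_points c G1 \<inter> M \<subseteq> S4"
    using f1[unfolded face_data_def, THEN conjunct2, THEN conjunct2, THEN conjunct2, THEN conjunct2] unfolding S4' .
  have lo: "polygon_points (?L1 \<union> ?L2) \<subseteq> ?J \<inter> M"
  proof
    fix x assume "x \<in> polygon_points (?L1 \<union> ?L2)"
    then obtain l where l: "l \<in> ?L1 \<union> ?L2" "x \<in> convex hull l" unfolding polygon_points_def by blast
    have "l \<subseteq> M" using l(1) unfolding Lset_def by blast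
    then have "x \<in> M" using l(2) cv hull_minimal[of l M convex] by blast
    moreover have "\<exists>w. (inner_iso_path c \<G> G1 w \<or> inner_iso_path c \<G> G2 w) \<and> l \<in> w" using l(1) unfolding Lset_def by blast
    then have "x \<in> ?J" using l(2) unfolding polygon_points_def by blast
    ultimately show "x \<in> ?J \<inter> M" by blast
  qed
  have up: "?J \<inter> M \<subseteq> polygon_points (?L1 \<union> ?L2) \<union> S4"
  proof
    fix x assume "x \<in> ?J \<inter> M"
    then obtain w where w: "inner_iso_path c \<G> G1 w \<or> inner_iso_path c \<G> G2 w" "x \<in> polygon_points w \<inter> M" by blast
    then have "x \<in> (\<Union>l\<in>?L1 \<union> ?L2. convex hull l) \<union> S4"
      using pts[of w] pts2[of w] by blast
    then show "x \<in> polygon_points (?L1 \<union> ?L2) \<union> S4" unfolding polygon_points_def by blast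
  qed
  note o = outer_polygon[OF L lo up]
  show "w = ?L1 \<union> ?L2 \<and> ?L1 \<noteq> ?L2" if w: "simple_closed_polygon w" "\<Union>w \<subseteq> iso_points c G1" "polygon_points w = ?J \<inter> M" for w
  proof -
    have "\<Union>w \<subseteq> polygon_points w" unfolding polygon_points_def using hull_subset by fastforce
    then have "\<Union>w \<subseteq> M" using w(3) by (metis Int_lower2 order_trans)
    then have "\<Union>w \<subseteq> iso_points c G1 \<inter> M" using w(2) by (rule Int_greatest[rotated])
    then have S: "\<Union>w \<subseteq> S4" using isoM by (rule subset_trans)
    show ?thesis by (rule o(1)[OF w(1) S w(3)])
  qed
  show "?L1 \<inter> ?L2 = {} \<and> simple_closed_polygon (?L1 \<union> ?L2) \<and> 3 \<le> card (?L1 \<union> ?L2) \<and> card (?L1 \<union> ?L2) \<le> 6 \<and>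
      \<Union>(?L1 \<union> ?L2) \<subseteq> {ipt c t X A, ipt c t X B, ipt c t P A, ipt c t P B} \<and> polygon_points (?L1 \<union> ?L2) = ?J \<inter> M"
    if "?L1 \<noteq> ?L2" using o(2)[OF that] unfolding S4' .
qed

lemma inner_line_facet:
  assumes reg: "regular_graph c \<G> (Gr t)" and w: "inner_iso_path c \<G> (Gr t) w" "l \<in> w"
  obtains k s \<sigma> where "src (dd t) \<sigma>" "w = pp t (res (dd t) \<sigma>)" "areg (res (dd t) \<sigma>) (zz t) (cn k s)"
    "l = line t (res (dd t) \<sigma>) k s" "l \<subseteq> bface a b k s"
proof -
  obtain \<sigma> where s: "src (dd t) \<sigma>" "w = pp t (res (dd t) \<sigma>)" using w(1) unfolding inner_pp[OF reg] by blast
  obtain k s where h: "areg (res (dd t) \<sigma>) (zz t) (cn k s)" "l = line t (res (dd t) \<sigma>) k s" using w(2) unfolding s(2) pp_def by blast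
  have "l \<subseteq> bface a b k s" unfolding h(2) by (rule line_subset_bface[OF h(1) res_crossD[OF regular_mixed(1)[OF reg] s(1)]])
  then show ?thesis using that s h by blast
qed

end

section \<open>The removal step\<close>

locale labeling = partition \<Omega> N C for \<Omega> N C +
  fixes c :: real and f :: "point \<Rightarrow> real" and G :: "nat \<Rightarrow> lcg" and \<G> :: "lcg set"
  assumes c01: "0 < c" "c < 1"
    and step: "\<And>i. i \<in> {1..N} \<Longrightarrow> removal_step c ((\<lambda>j. \<lparr>cuboid = C j, label = f\<rparr>) ` {1..N}) \<lparr>cuboid = C i, label = f\<rparr> (G i)"
    and GG: "\<G> = G ` {1..N}"
    and free: "\<And>i. i \<in> {1..N} \<Longrightarrow> singular_free c (G i) \<and> isolated_free c \<G> (G i)"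
    and bd: "\<Union>(iso_elements c \<G>) \<inter> frontier \<Omega> = {}"
begin

abbreviation "I \<equiv> {1..N}"
abbreviation "lb i \<equiv> label (G i)"

definition removed :: "nat \<Rightarrow> point \<Rightarrow> bool" where
  "removed i P \<longleftrightarrow> P \<in> nodes (C i) \<and> f P = c \<and> lb i P \<noteq> c"

text \<open>The trace that an F2-pair leaves after the removal: the common nodes had label c and are
  disperse in both graphs now, all other nodes were disperse from the start. Both cuboids are
  treated alike, so the relation is symmetric.\<close>

definition F2alt :: "nat \<Rightarrow> nat \<Rightarrow> bool" where
  "F2alt i i' \<longleftrightarrow> i' \<in> I \<and> i' \<noteq> i \<and> (C i \<inter> C i') facet_of C i \<and> (C i \<inter> C i') facet_of C i' \<and>
     (\<forall>h\<in>{i, i'}. \<forall>R\<in>nodes (C h). if R \<in> C i \<inter> C i' then f R = c \<and> c < lb h R else c < f R)"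

lemma F2altD: "F2alt i i' \<Longrightarrow> R \<in> nodes (C i) \<Longrightarrow> if R \<in> C i \<inter> C i' then f R = c \<and> c < lb i R else c < f R"
  unfolding F2alt_def by blast

lemma F2alt_sym: "F2alt i i' \<Longrightarrow> i \<in> I \<Longrightarrow> F2alt i' i"
  unfolding F2alt_def by (auto simp: Int_commute insert_commute)

lemma cuboid_G[simp]: "i \<in> I \<Longrightarrow> cuboid (G i) = C i"
  using step[of i] unfolding removal_step_def Let_def by (auto split: if_splits)

lemma incident_nodes: "i \<in> I \<Longrightarrow> incident (C i) P Q \<Longrightarrow> P \<in> nodes (C i) \<and> Q \<in> nodes (C i) \<and> P \<noteq> Q"
proof -
  assume i: "i \<in> I" and e: "incident (C i) P Q"
  obtain a b where ab2: "cub a b" "C i = cbox a b" using box_of_cuboid[OF cuboid[OF i]] by blast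
  interpret cub a b by fact
  show ?thesis using e unfolding ab2(2) incident_iff nodes_eq by auto
qed

lemma label_cases:
  assumes i: "i \<in> I" shows "lb i P = f P \<or> f P = c \<and> lb i P = 1 \<and> P \<in> nodes (C i)"
proof (cases "F1_graph c \<lparr>cuboid = C i, label = f\<rparr> \<or> F2_graph c ((\<lambda>j. \<lparr>cuboid = C j, label = f\<rparr>) ` I) \<lparr>cuboid = C i, label = f\<rparr>")
  case True
  then show ?thesis using step[OF i] unfolding removal_step_def by auto
next
  case False
  define H where "H = \<lparr>cuboid = C i, label = f\<rparr>\<lparr>label := \<lambda>P. if T1_node c \<lparr>cuboid = C i, label = f\<rparr> P then 1 else f P\<rparr>"
  have st: "if \<exists>P Q. T2_pair c H P Q then \<exists>P Q. T2_pair c H P Q \<and> G i = H\<lparr>label := (label H)(P := 1, Q := 1)\<rparr> else G i = H"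
    using step[OF i] False unfolding removal_step_def Let_def H_def by (simp cong: if_cong)
  have H: "label H P = f P \<or> f P = c \<and> label H P = 1 \<and> P \<in> nodes (C i)" for P by (auto simp: H_def T1_node_def)
  show ?thesis
  proof (cases "\<exists>S T. T2_pair c H S T")
    case True
    then obtain S T where T: "T2_pair c H S T" "G i = H\<lparr>label := (label H)(S := 1, T := 1)\<rparr>" using st by metis
    have "incident (C i) S T" "label H S = c" "label H T = c" using T(1) by (auto simp: T2_pair_def H_def)
    then have "S \<in> nodes (C i)" "T \<in> nodes (C i)" "f S = c" "f T = c" using incident_nodes[OF i] H[of S] H[of T] c01 by auto
    then show ?thesis using T(2) H[of P] by auto
  next
    case False then show ?thesis using st H[of P] by simp
  qed
qed

lemma box:
  assumes "i \<in> I"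
  obtains a b where "cubc a b c" "C i = cbox a b" "G i = cubc.Gr a b (lb i)"
proof -
  obtain a b where ab2: "cub a b" "C i = cbox a b" using box_of_cuboid[OF cuboid[OF assms]] by blast
  interpret cubc a b c using ab2(1) c01 by (simp add: cubc_def cubc_axioms_def)
  have "G i = Gr (lb i)" unfolding Gr_def using assms ab2(2) by (simp flip: cuboid_G)
  then show ?thesis using that ab2 cubc_axioms by blast
qed

lemma common_nodes:
  assumes "i \<in> I" "j \<in> I" "i \<noteq> j" "P \<in> nodes (C i)" "P \<in> C j" shows "P \<in> nodes (C j)"
proof -
  have Pi: "P \<in> C i" using assms(4) by (simp add: nodes_def extreme_point_of_def)
  note f = inter_face[OF assms(1-3) Pi assms(5)]
  have "P extreme_point_of (C i \<inter> C j)"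
    using assms(4,5) Pi unfolding nodes_def extreme_point_of_def by blast
  then show ?thesis using f(2) extreme_point_of_face unfolding nodes_def by blast
qed

lemma F2_graphs:
  assumes i: "i \<in> I" and F2: "F2_graph c ((\<lambda>j. \<lparr>cuboid = C j, label = f\<rparr>) ` I) \<lparr>cuboid = C i, label = f\<rparr>"
  shows "\<exists>i'. F2alt i i'"
proof -
  let ?H = "\<lambda>j. \<lparr>cuboid = C j, label = f\<rparr>"
  let ?K = "\<lambda>i'. nodes (C i) \<inter> nodes (C i')"
  have "\<exists>i'\<in>I. face_neighbors (?H i) (?H i') \<and> (\<forall>P\<in>?K i'. f P = c) \<and>
      (\<forall>P\<in>nodes (C i) - ?K i'. disperse c (?H i) P) \<and> (\<forall>P\<in>nodes (C i') - ?K i'. disperse c (?H i') P)"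
    using F2 unfolding F2_graph_def Let_def bex_simps(7) lcg.simps by simp
  then obtain i' where i': "i' \<in> I" "face_neighbors (?H i) (?H i')"
    and l: "\<forall>P\<in>?K i'. f P = c" "\<forall>P\<in>nodes (C i) - ?K i'. disperse c (?H i) P"
      "\<forall>P\<in>nodes (C i') - ?K i'. disperse c (?H i') P" by (elim bexE conjE)
  have ft: "(C i \<inter> C i') facet_of C i" "(C i \<inter> C i') facet_of C i'" using i'(2) by (auto simp: face_neighbors_def)
  have ne: "i' \<noteq> i" using ft(1) by auto
  have "face_neighbors (?H i') (?H i)" using i'(2) by (auto simp: face_neighbors_def Int_commute)
  then have "\<exists>h\<in>I. face_neighbors (?H i') (?H h) \<and> (\<forall>P\<in>nodes (C i') \<inter> nodes (C h). f P = c) \<and>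
      (\<forall>P\<in>nodes (C i') - nodes (C i') \<inter> nodes (C h). disperse c (?H i') P) \<and> (\<forall>P\<in>nodes (C h) - nodes (C i') \<inter> nodes (C h). disperse c (?H h) P)"
    by (intro bexI[OF _ i] conjI) (use l in \<open>simp_all add: Int_commute\<close>)
  \<comment> \<open>The F2-condition is symmetric, so the same rule has relabeled the common nodes
    in the neighbor.\<close>
  then have F2': "F2_graph c (?H ` I) (?H i')" unfolding F2_graph_def Let_def bex_simps(7) lcg.simps by simp
  have lb: "c < lb h R" if h: "h \<in> {i, i'}" "R \<in> nodes (C h)" "f R = c" for h R
  proof -
    have "h \<in> I" using h i i' by auto
    moreover have "F2_graph c (?H ` I) (?H h)" using F2 F2' h(1) by auto
    ultimately have "G h = (?H h)\<lparr>label := \<lambda>P. if P \<in> nodes (C h) \<and> f P = c then 1 else f P\<rparr>"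
      using step[of h] unfolding removal_step_def by (simp del: lcg.update_convs cong: if_cong)
    then show ?thesis using h(2,3) c01 by simp
  qed
  have "\<forall>R\<in>nodes (C h). if R \<in> C i \<inter> C i' then f R = c \<and> c < lb h R else c < f R" if h: "h \<in> {i, i'}" for h
  proof
    fix R assume R: "R \<in> nodes (C h)"
    have eq: "R \<in> C i \<inter> C i' \<longleftrightarrow> R \<in> nodes (C i) \<inter> nodes (C i')"
    proof
      assume "R \<in> C i \<inter> C i'"
      then show "R \<in> nodes (C i) \<inter> nodes (C i')"
        using h R common_nodes[OF i i'(1) ne[symmetric]] common_nodes[OF i'(1) i ne] by auto
    qed (auto simp: nodes_def extreme_point_of_def)
    show "if R \<in> C i \<inter> C i' then f R = c \<and> c < lb h R else c < f R"
      unfolding eq using l R h lb[OF h R] by (auto simp: disperse_def)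
  qed
  then show ?thesis unfolding F2alt_def using i' ne ft by blast
qed

text \<open>The F1-case is absorbed by the pair: of the three neighbors of a node of the
  four-element set two lie outside, so exactly one lies inside. The set splits into two edges, each
  with disperse neighbors otherwise, as for a T2-subgraph.\<close>

lemma removed_cases:
  assumes i: "i \<in> I" and P: "removed i P"
  obtains (F2) i' where "F2alt i i'" "P \<in> C i'"
  | (T1) "\<And>Q. incident (C i) P Q \<Longrightarrow> c < f Q"
  | (pair) Q where "incident (C i) P Q" "f Q = c" "c < lb i Q"
      "\<And>R. incident (C i) P R \<or> incident (C i) Q R \<Longrightarrow> R \<noteq> P \<Longrightarrow> R \<noteq> Q \<Longrightarrow> c < f R"
proof -
  let ?H = "\<lparr>cuboid = C i, label = f\<rparr>" and ?GG = "(\<lambda>j. \<lparr>cuboid = C j, label = f\<rparr>) ` I"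
  have P': "P \<in> nodes (C i)" "f P = c" "lb i P \<noteq> c" using P by (auto simp: removed_def)
  obtain a b where box: "cubc a b c" "C i = cbox a b" "G i = cubc.Gr a b (lb i)" using box[OF i] by blast
  interpret cubc a b c by fact
  note inci = incident_iff[folded box(2)]
  have nd: "nodes (C i) = range (V a b)" using nodes_eq box(2) by simp
  have sym: "incident (C i) R S \<longleftrightarrow> incident (C i) S R" for R S by (simp add: incident_def closed_segment_commute)
  have nodesI: "R \<in> nodes (C i)" "S \<in> nodes (C i)" "R \<noteq> S" if "incident (C i) R S" for R S
    using incident_nodes[OF i that] by blast+
  have c3: "card {R. incident (C i) S R} = 3" if Sn: "S \<in> nodes (C i)" for S
  proof -
    obtain \<sigma> where S: "S = V a b \<sigma>" using Sn unfolding nd by (rule rangeE)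
    have "{R. incident (cbox a b) (V a b \<sigma>) R} = V a b ` {\<tau>. adj \<sigma> \<tau>}"
    proof (intro equalityI subsetI)
      fix R assume "R \<in> {R. incident (cbox a b) (V a b \<sigma>) R}"
      then obtain \<sigma>' \<tau> where "V a b \<sigma> = V a b \<sigma>'" "R = V a b \<tau>" "adj \<sigma>' \<tau>" unfolding mem_Collect_eq incident_iff by blast
      then show "R \<in> V a b ` {\<tau>. adj \<sigma> \<tau>}" by simp
    qed auto
    then show ?thesis unfolding S box(2) by (simp only: card_image[OF inj_V] card_adj)
  qed
  consider "F2_graph c ?GG ?H" | "F1_graph c ?H" | "\<not> F1_graph c ?H" "\<not> F2_graph c ?GG ?H" by blast
  then show ?thesis
  proof cases
    case 1
    then obtain i' where "F2alt i i'" using F2_graphs[OF i] by blast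
    moreover from this have "P \<in> C i'" using F2altD[of i i' P] P' by (auto split: if_splits)
    ultimately show ?thesis by (rule F2)
  next
    case 2
    then obtain V' where V': "V' \<subseteq> nodes (C i)" "\<forall>P\<in>V'. card {Q \<in> nodes (C i) - V'. incident (C i) P Q} = 2"
      "\<forall>P\<in>V'. f P = c" "\<forall>P\<in>nodes (C i) - V'. c < f P" unfolding F1_graph_def by auto
    have lab: "c < lb i R" if "R \<in> nodes (C i)" "f R = c" for R
    proof -
      have "G i = ?H\<lparr>label := \<lambda>P. if P \<in> nodes (C i) \<and> f P = c then 1 else f P\<rparr>"
        using step[OF i] 2 unfolding removal_step_def by (simp del: lcg.update_convs cong: if_cong)
      then show ?thesis using that c01 by simp
    qed
    have one: "\<exists>Q\<in>V'. incident (C i) R Q \<and> (\<forall>S\<in>V'. incident (C i) R S \<longrightarrow> S = Q)" if R: "R \<in> V'" for R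
    proof -
      let ?o = "{Q \<in> nodes (C i) - V'. incident (C i) R Q}" and ?n = "{Q \<in> V'. incident (C i) R Q}"
      have Rn: "R \<in> nodes (C i)" using R V'(1) by blast
      have fin: "finite {Q. incident (C i) R Q}" by (rule card_ge_0_finite) (simp add: c3[OF Rn])
      have e: "{Q. incident (C i) R Q} = ?o \<union> ?n" using nodesI(2) V'(1) by blast
      have "card (?o \<union> ?n) = card ?o + card ?n" 
      proof (rule card_Un_disjoint)
        show "finite ?o" by (rule finite_subset[OF _ fin]) blast
        show "finite ?n" by (rule finite_subset[OF _ fin]) blast
      qed blast
      then have "3 = card ?o + card ?n" using arg_cong[OF e, of card] unfolding c3[OF Rn] by (rule trans[rotated])
      then have "card ?n = 1" using V'(2) R by simp
      then obtain Q where "?n = {Q}" using card_1_singletonE by blast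
      then show ?thesis by blast
    qed
    have PV: "P \<in> V'" using P' V'(4) by force
    obtain Q where Q: "Q \<in> V'" "incident (C i) P Q" "\<forall>S\<in>V'. incident (C i) P S \<longrightarrow> S = Q" using one[OF PV] by blast
    obtain Q' where Q': "\<forall>S\<in>V'. incident (C i) Q S \<longrightarrow> S = Q'" using one[OF Q(1)] by blast
    have "Q' = P" using Q' PV Q(2) sym by blast
    show ?thesis
    proof (rule pair)
      show "incident (C i) P Q" by fact
      show "f Q = c" using Q V' by blast
      then show "c < lb i Q" using lab Q V' by blast
      fix R assume R: "incident (C i) P R \<or> incident (C i) Q R" "R \<noteq> P" "R \<noteq> Q"
      then have "R \<in> nodes (C i)" "R \<notin> V'" using nodesI(2) Q(3) Q' \<open>Q' = P\<close> by blast+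
      then show "c < f R" using V'(4) by blast
    qed
  next
    case 3
    define H where "H = ?H\<lparr>label := \<lambda>P. if T1_node c ?H P then 1 else f P\<rparr>"
    have st: "if \<exists>P Q. T2_pair c H P Q then \<exists>P Q. T2_pair c H P Q \<and> G i = H\<lparr>label := (label H)(P := 1, Q := 1)\<rparr> else G i = H"
      using step[OF i] 3 unfolding removal_step_def Let_def H_def by (simp cong: if_cong)
    have cH: "cuboid H = C i" by (simp add: H_def)
    show ?thesis
    proof (cases "T1_node c ?H P")
      case True
      show ?thesis by (rule T1) (use True in \<open>simp add: T1_node_def disperse_def\<close>)
    next
      case False
      then have lP: "label H P = c" using P' by (simp add: H_def)
      have "G i \<noteq> H" using P'(3) lP by auto
      then obtain S T where T: "T2_pair c H S T" "G i = H\<lparr>label := (label H)(S := 1, T := 1)\<rparr>" using st by (auto split: if_splits)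
      have PST: "P = S \<or> P = T" using P'(3) lP T(2) by (auto split: if_splits)
      have inc: "incident (C i) S T" "label H S = c" "label H T = c" using T(1) cH unfolding T2_pair_def by auto
      obtain W where W: "\<And>X. incident (C i) S X \<or> incident (C i) T X \<Longrightarrow> X \<in> W" "\<And>X. X \<in> W - {S, T} \<Longrightarrow> disperse c H X"
        using T(1) unfolding T2_pair_def cH by blast
      have W': "\<And>X. incident (C i) S X \<or> incident (C i) T X \<Longrightarrow> X \<noteq> S \<Longrightarrow> X \<noteq> T \<Longrightarrow> c < label H X"
        using W unfolding disperse_def by blast
      have nT: "\<not> T1_node c ?H S" "\<not> T1_node c ?H T" using inc c01 by (auto simp: H_def split: if_splits)
      then have fST: "f S = c" "f T = c" using inc by (auto simp: H_def)
      \<comment> \<open>A node relabeled earlier as a T1-node has disperse neighbors only, so it is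
        not incident to \<open>S\<close> or \<open>T\<close>. Hence the labels around the pair are
        still the original ones.\<close>
      have fX: "c < f X" if X: "incident (C i) S X \<or> incident (C i) T X" "X \<noteq> S" "X \<noteq> T" for X
      proof (cases "T1_node c ?H X")
        case True
        then have "\<And>Y. incident (C i) X Y \<Longrightarrow> c < f Y" by (simp add: T1_node_def disperse_def)
        then show ?thesis using X(1) sym fST less_irrefl by metis
      next
        case False then show ?thesis using W'[OF X] by (simp add: H_def)
      qed
      have lST: "c < lb i S" "c < lb i T" using T(2) c01 by auto
      from PST show ?thesis
      proof
        assume e: "P = S"
        show ?thesis by (rule pair[of T]) (use e inc fST lST fX in auto)
      next
        assume e: "P = T"
        show ?thesis by (rule pair[of S]) (use e inc fST lST fX sym in auto)
      qed
    qed
  qed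
qed

text \<open>In each of the three situations a neighbor of a removed node was disperse before or is
  removed as well. So a node whose label is still at most c is incident to no removed node of its
  graph.\<close>

lemma removed_incident:
  assumes i: "i \<in> I" and P: "removed i P" and Q: "incident (C i) P Q"
  shows "c < lb i Q"
  using i P
proof (cases rule: removed_cases)
  case (F2 i')
  obtain a b where box: "cubc a b c" "C i = cbox a b" using box[OF i] by blast
  interpret cubc a b c by fact
  have "Q \<in> nodes (C i)" using Q unfolding box(2) incident_iff nodes_eq by auto
  then show ?thesis using F2altD[OF F2(1), of Q] label_cases[OF i, of Q] c01 by (auto split: if_splits)
next
  case T1
  show ?thesis using T1[OF Q] label_cases[OF i, of Q] c01 by auto
next
  case (pair R)
  show ?thesis
  proof (cases "Q = R")
    case True then show ?thesis using pair(3) by simp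
  next
    case False
    have "Q \<noteq> P" using incident_nodes[OF i Q] by blast
    then have "c < f Q" by (rule pair(4)[OF disjI1[OF Q] _ False])
    then show ?thesis using label_cases[OF i, of Q] c01 by auto
  qed
qed

lemma removed_label: "i \<in> I \<Longrightarrow> removed i P \<longleftrightarrow> P \<in> nodes (C i) \<and> f P = c \<and> lb i P = 1"
  using label_cases[of i P] c01 by (auto simp: removed_def)

lemma not_removed_label: "i \<in> I \<Longrightarrow> \<not> removed i P \<Longrightarrow> lb i P = f P"
  using label_cases[of i P] by (auto simp: removed_def)

end

section \<open>Non-trivial L-faces between two graphs\<close>

lemma co_cn_other: "j \<noteq> k \<Longrightarrow> co j (cn k s u v) = co j (cn k s' u v)"
  using exhaust_3[of j] exhaust_3[of k] by (auto simp: cn.simps)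

context cubc begin

text \<open>A continuous corner of an L-face has disperse neighbors, so it fails to be an iso-node
  exactly when its label is below c. This corner is put at (u, v), the opposite one is only known to
  be continuous.\<close>

lemma nontrivial_iff: "nontrivial_L_face c (Gr t) (bface a b k s) \<longleftrightarrow> (\<exists>u v. t (V a b (cn k s u v)) < c \<and>
    c < t (V a b (cn k s (\<not> u) v)) \<and> c < t (V a b (cn k s u (\<not> v))) \<and> t (V a b (cn k s (\<not> u) (\<not> v))) \<le> c)"
proof
  assume "nontrivial_L_face c (Gr t) (bface a b k s)"
  then have L: "aL (dd t) (cn k s)" and "\<exists>P\<in>bface a b k s. continuous_node c (Gr t) P \<and> \<not> iso_node c (Gr t) P"
    unfolding nontrivial_L_face_def trivial_L_face_def L_face_iff by blast+
  then obtain \<sigma> where s: "co k \<sigma> = s" "\<not> dd t \<sigma>" "\<not> iso_node c (Gr t) (V a b \<sigma>)" unfolding continuous_iff by auto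
  obtain u v where e: "\<sigma> = cn k s u v" using cnE[OF s(1)] by blast
  note al = aL_vals[OF L, of u v]
  have "adj \<sigma> (cn k s (\<not> u) v)" unfolding e by simp
  then have "\<not> zz t \<sigma>" using s(2,3) al(1) unfolding iso_node_V e by blast
  then show "\<exists>u v. t (V a b (cn k s u v)) < c \<and>
    c < t (V a b (cn k s (\<not> u) v)) \<and> c < t (V a b (cn k s u (\<not> v))) \<and> t (V a b (cn k s (\<not> u) (\<not> v))) \<le> c"
    using al s(2) unfolding e dd_def zz_def by (intro exI[of _ u] exI[of _ v]) auto
next
  assume "\<exists>u v. t (V a b (cn k s u v)) < c \<and>
    c < t (V a b (cn k s (\<not> u) v)) \<and> c < t (V a b (cn k s u (\<not> v))) \<and> t (V a b (cn k s (\<not> u) (\<not> v))) \<le> c"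
  then obtain u v where h: "t (V a b (cn k s u v)) < c" "c < t (V a b (cn k s (\<not> u) v))" "c < t (V a b (cn k s u (\<not> v)))"
    "t (V a b (cn k s (\<not> u) (\<not> v))) \<le> c" by (elim exE conjE)
  then have "aL (dd t) (cn k s)" unfolding aL_def dd_def by (cases u; cases v) auto
  moreover have "continuous_node c (Gr t) (V a b (cn k s u v))" "\<not> iso_node c (Gr t) (V a b (cn k s u v))"
    using h(1) by (auto simp: dd_def iso_node_V zz_def)
  moreover have "V a b (cn k s u v) \<in> bface a b k s" by simp
  ultimately show "nontrivial_L_face c (Gr t) (bface a b k s)" unfolding nontrivial_L_face_def trivial_L_face_def L_face_iff by blast
qed

end

context labeling begin

lemma regularI:
  assumes "i \<in> I" "P \<in> nodes (C i)" "Q \<in> nodes (C i)" "lb i P \<le> c" "c < lb i Q"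
  shows "regular_graph c \<G> (G i)"
  unfolding regular_graph_def disperse_graph_def continuous_graph_def disperse_def continuous_node_def
  using assms free[OF assms(1)] by (simp; force)

text \<open>Both cells can be described with the same axis \<open>k\<close> and the same two bits
  for the corners of the common facet; only the side along \<open>k\<close> is reversed.\<close>

lemma frame:
  assumes i: "i \<in> I" and ab: "cubc a b c" "C i = cbox a b" and j: "j \<in> I" "j \<noteq> i" "bface a b k s facet_of C j"
  shows "\<exists>a' b'. cubc a' b' c \<and> C j = cbox a' b' \<and> G j = cubc.Gr a' b' (lb j) \<and> bface a b k s = bface a' b' k (\<not> s) \<and>
    (\<forall>u v. V a' b' (cn k (\<not> s) u v) = V a b (cn k s u v))"
proof -
  obtain a' b' where b: "cubc a' b' c" "C j = cbox a' b'" "G j = cubc.Gr a' b' (lb j)" using box[OF j(1)] by blast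
  have A: "cub a b" "cub a' b'" using ab(1) b(1) by (simp_all add: cubc_def)
  obtain k' s' where f: "bface a b k s = bface a' b' k' s'" using j(3) cub.facet_iff[OF A(2)] unfolding b(2) by blast
  note o = opposite_side[OF i j(1) j(2)[symmetric] A(1) ab(2) A(2) b(2) f]
  have "V a' b' (cn k (\<not> s) u v) = V a b (cn k s u v)" for u v
    by (rule same_corner[OF A f[unfolded o], symmetric]) (simp_all add: co_cn_other[of _ k s u v "\<not> s"])
  then show ?thesis by (intro exI[of _ a'] exI[of _ b'] conjI allI) (use b f o in simp_all)
qed

lemma graph_systemI: "i \<in> I \<Longrightarrow> j \<in> I \<Longrightarrow> e edge_of C i \<Longrightarrow> e edge_of C j \<Longrightarrow> G j \<in> graph_system \<G> (G i)"
  unfolding graph_system_def edge_system_def using GG by auto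

lemma graph_system_self: "i \<in> I \<Longrightarrow> G i \<in> graph_system \<G> (G i)"
proof -
  assume i: "i \<in> I"
  obtain a b where ab2: "cubc a b c" "C i = cbox a b" using box[OF i] by blast
  interpret cubc a b c by fact
  have "closed_segment (V a b (cn 1 True True True)) (V a b (cn 1 True True False)) edge_of C i"
    unfolding ab2(2) edge_iff using adj_cn[of 1 True True True True False] by blast
  then show ?thesis using graph_systemI[OF i i] by blast
qed

lemma graph_system_neighbor:
  assumes i: "i \<in> I" "j \<in> I" "j \<noteq> i" and M: "M facet_of C i" "M facet_of C j"
  shows "G j \<in> graph_system \<G> (G i)"
proof -
  obtain a b where ab2: "cubc a b c" "C i = cbox a b" using box[OF i(1)] by blast
  interpret cubc a b c by fact
  obtain k s where ks: "M = bface a b k s" using M(1) unfolding ab2(2) facet_iff by blast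
  obtain a' b' where F: "cubc a' b' c" "C j = cbox a' b'" "G j = cubc.Gr a' b' (lb j)" "bface a b k s = bface a' b' k (\<not> s)"
     "\<forall>u v. V a' b' (cn k (\<not> s) u v) = V a b (cn k s u v)"
    using frame[OF i(1) ab2 i(2,3) M(2)[unfolded ks]] by (elim exE conjE)
  note F5 = F(5)[rule_format]
  interpret B: cubc a' b' c by fact
  have "closed_segment (V a b (cn k s True True)) (V a b (cn k s True False)) edge_of C i"
    unfolding ab2(2) edge_iff using adj_cn[of k s True True True False] by blast
  moreover have "closed_segment (V a b (cn k s True True)) (V a b (cn k s True False)) edge_of C j"
    unfolding F(2) B.edge_iff F5[symmetric] using adj_cn[of k "\<not> s" True True True False] by blast
  ultimately show ?thesis by (rule graph_systemI[OF i(1,2)])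
qed

text \<open>The consequences of \<open>face_data\<close> and \<open>nontrivial_face_polygon\<close>
  for one of the two graphs, stated without coordinates of the corners.\<close>

definition carrier :: "nat \<Rightarrow> nat \<Rightarrow> point set \<Rightarrow> nat \<Rightarrow> bool" where
  "carrier i j M g \<longleftrightarrow>
     (\<forall>l\<in>Lset c \<G> (G g) M. \<forall>F. F facet_of C g \<longrightarrow> l \<subseteq> F \<longrightarrow> F = M) \<and>
     (\<forall>w w' l. inner_iso_path c \<G> (G g) w \<longrightarrow> inner_iso_path c \<G> (G g) w' \<longrightarrow> l \<in> w \<longrightarrow> l \<in> w' \<longrightarrow> l \<subseteq> M \<longrightarrow> w = w') \<and>
     (\<forall>w. simple_closed_polygon w \<longrightarrow> \<Union>w \<subseteq> iso_points c (G g) \<longrightarrow>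
       polygon_points w = (\<Union>J\<in>{J. inner_iso_path c \<G> (G i) J \<or> inner_iso_path c \<G> (G j) J}. polygon_points J) \<inter> M \<longrightarrow>
       w = Lset c \<G> (G i) M \<union> Lset c \<G> (G j) M \<and> Lset c \<G> (G i) M \<noteq> Lset c \<G> (G j) M)"

text \<open>Only the graph of \<open>i\<close> is required to have an L-face here: seen from
  \<open>j\<close> the face may be regular, because the continuous corner with label c may have been
  removed there.\<close>

definition linked :: "nat \<Rightarrow> nat \<Rightarrow> point set \<Rightarrow> bool" where
  "linked i j M \<longleftrightarrow> i \<in> I \<and> j \<in> I \<and> i \<noteq> j \<and> C i \<inter> C j = M \<and> M facet_of C i \<and> M facet_of C j \<and>
     regular_graph c \<G> (G i) \<and> regular_graph c \<G> (G j) \<and> nontrivial_L_face c (G i) M \<and>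
     carrier i j M i \<and> carrier i j M j \<and>
     (Lset c \<G> (G i) M \<noteq> Lset c \<G> (G j) M \<longrightarrow> Lset c \<G> (G i) M \<inter> Lset c \<G> (G j) M = {} \<and>
        3 \<le> card (Lset c \<G> (G i) M \<union> Lset c \<G> (G j) M) \<and> card (Lset c \<G> (G i) M \<union> Lset c \<G> (G j) M) \<le> 6 \<and>
        outer_iso_path c \<G> (G i) M (Lset c \<G> (G i) M \<union> Lset c \<G> (G j) M))"

lemma linkedD:
  assumes "linked i j M"
  shows "i \<in> I" "j \<in> I" "i \<noteq> j" "C i \<inter> C j = M" "M facet_of C i" "M facet_of C j" "regular_graph c \<G> (G i)" "regular_graph c \<G> (G j)"
    "nontrivial_L_face c (G i) M" "carrier i j M i" "carrier i j M j"
  using assms unfolding linked_def by simp_all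

lemma linked_mismatch:
  assumes "linked i j M" "Lset c \<G> (G i) M \<noteq> Lset c \<G> (G j) M"
  shows "Lset c \<G> (G i) M \<inter> Lset c \<G> (G j) M = {}" "3 \<le> card (Lset c \<G> (G i) M \<union> Lset c \<G> (G j) M)"
    "card (Lset c \<G> (G i) M \<union> Lset c \<G> (G j) M) \<le> 6" "outer_iso_path c \<G> (G i) M (Lset c \<G> (G i) M \<union> Lset c \<G> (G j) M)"
  using assms unfolding linked_def by simp_all

lemma face_data_carrier:
  assumes "g \<in> I" and fd: "face_data c \<G> t (G g) M X A P B"
    and o: "\<And>w. simple_closed_polygon w \<Longrightarrow> \<Union>w \<subseteq> iso_points c (G g) \<Longrightarrow>
       polygon_points w = (\<Union>J\<in>{J. inner_iso_path c \<G> (G i) J \<or> inner_iso_path c \<G> (G j) J}. polygon_points J) \<inter> M \<Longrightarrow>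
       w = Lset c \<G> (G i) M \<union> Lset c \<G> (G j) M \<and> Lset c \<G> (G i) M \<noteq> Lset c \<G> (G j) M"
  shows "carrier i j M g"
  unfolding carrier_def
  apply (rule conjI)
   apply (rule fd[unfolded face_data_def cuboid_G[OF assms(1)], THEN conjunct2, THEN conjunct2, THEN conjunct1])
  apply (rule conjI)
   apply (rule fd[unfolded face_data_def, THEN conjunct2, THEN conjunct1])
  apply (intro allI impI)
  apply (rule o)
    apply assumption+
  done

text \<open>The corner \<open>X\<close> has label below c, so by \<open>removed_incident\<close> its
  neighbors \<open>A\<close> and \<open>B\<close> are not removed in \<open>i\<close>: they are
  disperse before the removal, and at \<open>X\<close>, \<open>A\<close> and \<open>B\<close> both
  graphs have the same labels. They can disagree at \<open>P\<close> only, with label c in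
  \<open>i\<close> and a larger one in \<open>j\<close>.\<close>

lemma nontrivial_linked:
  assumes i: "i \<in> I" "j \<in> I" "j \<noteq> i" and M: "C i \<inter> C j = M" "M facet_of C i" "M facet_of C j"
    and reg: "regular_graph c \<G> (G i)" and nt: "nontrivial_L_face c (G i) M"
  shows "linked i j M"
proof -
  obtain a b where ab2: "cubc a b c" "C i = cbox a b" "G i = cubc.Gr a b (lb i)" using box[OF i(1)] by blast
  interpret cubc a b c by fact
  obtain k s where ks: "M = bface a b k s" using M(2) unfolding ab2(2) facet_iff by blast
  obtain a' b' where F: "cubc a' b' c" "C j = cbox a' b'" "G j = cubc.Gr a' b' (lb j)" "bface a b k s = bface a' b' k (\<not> s)"
     "\<forall>u v. V a' b' (cn k (\<not> s) u v) = V a b (cn k s u v)"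
    using frame[OF i(1) ab2(1,2) i(2,3) M(3)[unfolded ks]] by (elim exE conjE)
  note F5 = F(5)[rule_format]
  interpret B: cubc a' b' c by fact
  define ti tj where "ti = lb i" and tj_def: "tj = lb j"
  note ti_def = this(1)
  have Gi: "G i = Gr ti" and Gj: "G j = B.Gr tj" unfolding ti_def tj_def by (fact ab2(3), fact F(3))
  obtain u v where c: "lb i (V a b (cn k s u v)) < c" "c < lb i (V a b (cn k s (\<not> u) v))" "c < lb i (V a b (cn k s u (\<not> v)))"
    "lb i (V a b (cn k s (\<not> u) (\<not> v))) \<le> c" using nt[unfolded Gi ks nontrivial_iff] unfolding ti_def by (elim exE conjE)
  define X A B P where XABP: "X = V a b (cn k s u v)" "A = V a b (cn k s (\<not> u) v)" "B = V a b (cn k s u (\<not> v))" "P = V a b (cn k s (\<not> u) (\<not> v))"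
  note c' = c[folded XABP]
  have nX: "X \<in> nodes (C i)" "A \<in> nodes (C i)" "X \<in> nodes (C j)" "A \<in> nodes (C j)"
    unfolding XABP(1,2) ab2(2) using F(2) B.V_nodes F5 by (metis V_nodes)+
  have inc: "incident (C i) A X" "incident (C i) B X" unfolding XABP ab2(2) by auto
  have l1: "f X = lb i X" using label_cases[OF i(1), of X] c'(1) c01 by auto
  then have X: "lb j X = lb i X" using label_cases[OF i(2), of X] c'(1) by auto
  have nr: "\<not> removed i A" "\<not> removed i B" using removed_incident[OF i(1) _ inc(1)] removed_incident[OF i(1) _ inc(2)] c'(1) by auto
  then have "f A = lb i A" "f B = lb i B" using not_removed_label[OF i(1)] by auto
  then have AB: "lb j A = lb i A" "lb j B = lb i B" using label_cases[OF i(2), of A] label_cases[OF i(2), of B] c' by auto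
  have "f P = lb i P" using label_cases[OF i(1), of P] c'(4) c01 by auto
  then have P: "lb j P = lb i P \<or> lb i P = c \<and> c < lb j P" using label_cases[OF i(2), of P] c01 by auto
  have rj: "regular_graph c \<G> (G j)"
    by (rule regularI[OF i(2) nX(3,4)]) (use X AB c' in auto)
  have fi: "face_data c \<G> (lb i) (G i) M X A P B"
    unfolding XABP ks
    unfolding Gi by (rule face_data_Gr) (use reg c in \<open>auto simp: dd_def ti_def[symmetric] Gi[symmetric]\<close>)
  have fj: "face_data c \<G> (lb i) (G j) M X A P B"
    unfolding XABP ks F5[symmetric] F(4)
    unfolding Gj by (rule B.face_data_Gr) (use rj c' X AB P in \<open>auto simp: B.dd_def F5 XABP tj_def[symmetric] Gj[symmetric]\<close>)
  note ci = c'[unfolded XABP]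
  note o1 = nontrivial_face_polygon(1)[of "lb i" k s u v, folded XABP ks, OF c' fi fj]
    and o2 = nontrivial_face_polygon(1)[of "lb i" k s u v, folded XABP ks, OF c' fj fi]
    and o3 = nontrivial_face_polygon(2)[of "lb i" k s u v, folded XABP ks, OF c' fi fj]
  have isoi: "{ipt c (lb i) X A, ipt c (lb i) X B, ipt c (lb i) P A, ipt c (lb i) P B} \<subseteq> iso_points c (G i)"
  proof -
    have "ip (lb i) (cn k s p q) (cn k s p' q') \<in> iso_points c (G i)"
      if "lb i (V a b (cn k s p q)) \<le> c" "c < lb i (V a b (cn k s p' q'))" "(p = p') \<noteq> (q = q')" for p q p' q'
    proof -
      have "cross (dd ti) (cn k s p q) (cn k s p' q')" using that unfolding cross_def dd_def ti_def by simp
      then have "ip ti (cn k s p q) (cn k s p' q') \<in> iso_points c (Gr ti)" unfolding iso_points_eq by blast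
      then show ?thesis by (simp add: Gi)
    qed
    then show ?thesis using c unfolding XABP ip_ipt[symmetric] by simp
  qed
  have fn: "face_neighbors (G i) (G j)" using M i by (simp add: face_neighbors_def)
  have outer: "outer_iso_path c \<G> (G i) M (Lset c \<G> (G i) M \<union> Lset c \<G> (G j) M)" if ne: "Lset c \<G> (G i) M \<noteq> Lset c \<G> (G j) M"
    unfolding outer_iso_path_def
  proof (intro conjI)
    show "regular_graph c \<G> (G i)" "nontrivial_L_face c (G i) M" by fact+
    note o = o3[OF ne]
    show "simple_closed_polygon (Lset c \<G> (G i) M \<union> Lset c \<G> (G j) M)" using o by (elim conjE)
    have "\<Union>(Lset c \<G> (G i) M \<union> Lset c \<G> (G j) M) \<subseteq> {ipt c (lb i) X A, ipt c (lb i) X B, ipt c (lb i) P A, ipt c (lb i) P B}"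
      using o by (elim conjE)
    then show "\<Union>(Lset c \<G> (G i) M \<union> Lset c \<G> (G j) M) \<subseteq> iso_points c (G i)" using isoi by (rule subset_trans)
    have "polygon_points (Lset c \<G> (G i) M \<union> Lset c \<G> (G j) M) =
          (\<Union>J\<in>{J. inner_iso_path c \<G> (G i) J \<or> inner_iso_path c \<G> (G j) J}. polygon_points J) \<inter> M" using o by (elim conjE)
    then show "\<exists>G'\<in>\<G>. face_neighbors (G i) G' \<and> M = cuboid (G i) \<inter> cuboid G' \<and>
        polygon_points (Lset c \<G> (G i) M \<union> Lset c \<G> (G j) M) =
          (\<Union>J\<in>{J. inner_iso_path c \<G> (G i) J \<or> inner_iso_path c \<G> G' J}. polygon_points J) \<inter> M"
      using fn M(1) i GG by (intro bexI[of _ "G j"]) auto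
  qed
  have sw: "{J. inner_iso_path c \<G> (G j) J \<or> inner_iso_path c \<G> (G i) J} = {J. inner_iso_path c \<G> (G i) J \<or> inner_iso_path c \<G> (G j) J}" by blast
  have ci: "carrier i j M i" by (rule face_data_carrier[OF i(1) fi]) (rule o1)
  have cj: "carrier i j M j"
  proof (rule face_data_carrier[OF i(2) fj])
    fix w assume "simple_closed_polygon w" "\<Union>w \<subseteq> iso_points c (G j)"
      "polygon_points w = (\<Union>J\<in>{J. inner_iso_path c \<G> (G i) J \<or> inner_iso_path c \<G> (G j) J}. polygon_points J) \<inter> M"
    from o2[of w, unfolded sw, OF this]
    show "w = Lset c \<G> (G i) M \<union> Lset c \<G> (G j) M \<and> Lset c \<G> (G i) M \<noteq> Lset c \<G> (G j) M" by (metis Un_commute)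
  qed
  show ?thesis unfolding linked_def
  proof (intro conjI impI)
    assume ne: "Lset c \<G> (G i) M \<noteq> Lset c \<G> (G j) M"
    note o = o3[OF ne]
    show "Lset c \<G> (G i) M \<inter> Lset c \<G> (G j) M = {}" "3 \<le> card (Lset c \<G> (G i) M \<union> Lset c \<G> (G j) M)"
      "card (Lset c \<G> (G i) M \<union> Lset c \<G> (G j) M) \<le> 6" using o by simp_all
    show "outer_iso_path c \<G> (G i) M (Lset c \<G> (G i) M \<union> Lset c \<G> (G j) M)" by (rule outer[OF ne])
  next
    show "i \<noteq> j" by (rule i(3)[symmetric])
  qed (fact i(1), fact i(2), fact M(1), fact M(2), fact M(3), fact reg, fact rj, fact nt, fact ci, fact cj)
qed

end

context labeling begin

definition continued :: "iso_path \<Rightarrow> iso_line \<Rightarrow> bool" where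
  "continued p l \<longleftrightarrow> (\<exists>q. q \<noteq> p \<and> l \<in> snd q \<and> (\<exists>g\<in>I. iso_path_of c \<G> (G g) q) \<and>
     (\<exists>i\<in>I. disperse_connected_paths c \<G> (G i) p q l \<or> disperse_connected_paths c \<G> (G i) q p l))"

lemma inner_regular: "inner_iso_path c \<G> H w \<Longrightarrow> regular_graph c \<G> H"
  by (auto simp: inner_iso_path_def inner_iso_path_from_def)

lemma inner_line:
  assumes h: "h \<in> I" and w: "inner_iso_path c \<G> (G h) w" "l \<in> w"
  shows "l \<subseteq> C h" "l \<noteq> {}"
proof -
  obtain a b where ab2: "cubc a b c" "C h = cbox a b" "G h = cubc.Gr a b (lb h)" using box[OF h] by blast
  interpret cubc a b c by fact
  define t where "t = lb h"
  have Gh: "G h = Gr t" unfolding t_def by (fact ab2(3))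
  have reg: "regular_graph c \<G> (Gr t)" using inner_regular[OF w(1)] unfolding Gh .
  have w1: "inner_iso_path c \<G> (Gr t) w" using w(1) unfolding Gh .
  obtain k s \<sigma> where z: "src (dd t) \<sigma>" "areg (res (dd t) \<sigma>) (zz t) (cn k s)"
    "l = line t (res (dd t) \<sigma>) k s" "l \<subseteq> bface a b k s" using inner_line_facet[OF reg w1 w(2)] by metis
  show "l \<subseteq> C h" using z(4) unfolding ab2(2) bface_def by blast
  have "\<forall>\<rho> \<tau>. cross (res (dd t) \<sigma>) \<rho> \<tau> \<longrightarrow> cross (dd t) \<rho> \<tau>" by (rule res_crossD[OF regular_mixed(1)[OF reg] z(1)])
  then show "l \<noteq> {}" using line_two[OF z(2)] unfolding z(3) by (metis insert_not_empty)
qed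

text \<open>\<open>M\<close> is the only facet of \<open>C g\<close> that contains the line. A third
  cell with the line meets \<open>C g\<close> in a face containing it: either this face lies in two
  different facets, which is impossible, or it is \<open>M\<close> itself, and then three cells
  share a facet.\<close>

lemma linked_cuboids:
  assumes L: "linked i j M" and g: "g \<in> {i, j}" and l: "l \<in> Lset c \<G> (G g) M" and h: "h \<in> I" "l \<subseteq> C h"
  shows "h \<in> {i, j}"
proof (rule ccontr)
  assume n: "h \<notin> {i, j}"
  note lk = linkedD[OF L]
  have gI: "g \<in> I" using g lk by auto
  have car: "\<And>F. F facet_of C g \<Longrightarrow> l \<subseteq> F \<Longrightarrow> F = M" using g lk(10,11) l unfolding carrier_def by auto
  obtain w where w: "inner_iso_path c \<G> (G g) w" "l \<in> w" using l unfolding Lset_def by blast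
  note il = inner_line[OF gI w]
  obtain x where x: "x \<in> l" using il(2) by blast
  have ng: "g \<noteq> h" using n g by auto
  have lK: "l \<subseteq> C g \<inter> C h" using il h(2) by blast
  then have xK: "x \<in> C g" "x \<in> C h" using x by auto
  note f = inter_face[OF gI h(1) ng xK]
  obtain a b where ab2: "cubc a b c" "C g = cbox a b" using box[OF gI] by blast
  interpret cubc a b c by fact
  obtain J s where J: "C g \<inter> C h = box_face a b J s" using face_is_box_face[of "C g \<inter> C h" a b] f(1) xK unfolding ab2(2) by blast
  show False
  proof (cases "\<exists>k k'. k \<in> J \<and> k' \<in> J \<and> k \<noteq> k'")
    case True
    then obtain k k' where k: "k \<in> J" "k' \<in> J" "k \<noteq> k'" by blast
    have "C g \<inter> C h \<subseteq> bface a b k (s k)" "C g \<inter> C h \<subseteq> bface a b k' (s k')" unfolding J box_face_def bface_def using k by auto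
    then have "bface a b k (s k) = M" "bface a b k' (s k') = M" using car bface_facet lK unfolding ab2(2) by blast+
    then show False using k(3) bface_inj by metis
  next
    case False
    then consider "J = {}" | k where "J = {k}" by blast
    then show False
    proof cases
      case 1
      then have "C g \<inter> C h = cbox a b" unfolding J by (simp add: box_face_def)
      then show False using f(3) aff_dim_cbox by simp
    next
      case (2 k)
      then have e: "C g \<inter> C h = bface a b k (s k)" unfolding J by (simp add: box_face_single)
      have "(C g \<inter> C h) facet_of C g" using bface_facet[of k "s k"] unfolding e[symmetric] ab2(2)[symmetric] .
      then have M: "C g \<inter> C h = M" using car lK by blast
      have "aff_dim (C g \<inter> C h) = 2" using lk(5) \<open>(C g \<inter> C h) facet_of C g\<close> aff_dim_cbox unfolding facet_of_def ab2(2) by simp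
      then have Mh: "M facet_of C h" using f(4) M by auto
      have "h = i \<or> h = j"
        using g neighbor_unique[OF lk(1,2) h(1) lk(3) _ lk(5,6) Mh] neighbor_unique[OF lk(2,1) h(1) lk(3)[symmetric] _ lk(6,5) Mh] n by auto
      then show False using n by blast
    qed
  qed
qed

text \<open>Every cell that contributes a path through the line contains the line, so it is one of
  the two cells at \<open>M\<close>. For an outer iso-path both of its cells are concerned, hence
  its face is \<open>M\<close> as well.\<close>

lemma linked_paths:
  assumes L: "linked i j M" and l: "l \<in> Lset c \<G> (G i) M \<union> Lset c \<G> (G j) M" and h: "h \<in> I" and q: "iso_path_of c \<G> (G h) q" "l \<in> snd q"
  shows "(\<exists>g\<in>{i, j}. fst q = C g \<and> inner_iso_path c \<G> (G g) (snd q) \<and> l \<in> Lset c \<G> (G g) M) \<or>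
    q = (M, Lset c \<G> (G i) M \<union> Lset c \<G> (G j) M) \<and> Lset c \<G> (G i) M \<noteq> Lset c \<G> (G j) M"
proof -
  note lk = linkedD[OF L]
  have lM: "l \<subseteq> M" using l unfolding Lset_def by blast
  obtain g where g: "g \<in> {i, j}" "l \<in> Lset c \<G> (G g) M" using l by blast
  note lc = linked_cuboids[OF L g]
  consider "inner_path_of c \<G> (G h) q" | "outer_iso_path c \<G> (G h) (fst q) (snd q)" using q(1) unfolding iso_path_of_def by blast
  then show ?thesis
  proof cases
    case 1
    then have w: "inner_iso_path c \<G> (G h) (snd q)" "fst q = C h" using h unfolding inner_path_of_def by auto
    have "h \<in> {i, j}" by (rule lc[OF h inner_line(1)[OF h w(1) q(2)]])
    then show ?thesis using w lM q(2) unfolding Lset_def by blast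
  next
    case 2
    then obtain G' where G': "G' \<in> \<G>" "face_neighbors (G h) G'" "fst q = cuboid (G h) \<inter> cuboid G'"
        "polygon_points (snd q) = (\<Union>J\<in>{J. inner_iso_path c \<G> (G h) J \<or> inner_iso_path c \<G> G' J}. polygon_points J) \<inter> fst q"
      and s: "simple_closed_polygon (snd q)" "\<Union>(snd q) \<subseteq> iso_points c (G h)" unfolding outer_iso_path_def by blast
    obtain h' where h': "h' \<in> I" "G' = G h'" using G'(1) GG by blast
    have F: "fst q = C h \<inter> C h'" "(C h \<inter> C h') facet_of C h" using G'(2,3) h h' by (auto simp: face_neighbors_def)
    have "l \<subseteq> polygon_points (snd q)" unfolding polygon_points_def using q(2) hull_subset[of l convex] by blast
    then have "l \<subseteq> C h \<inter> C h'" using G'(4) F(1) by blast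
    then have hh: "h \<in> {i, j}" "h' \<in> {i, j}" using lc[OF h] lc[OF h'(1)] by blast+
    have "h \<noteq> h'" using F(2) by auto
    then have hh': "h = i \<and> h' = j \<or> h = j \<and> h' = i" using hh by auto
    then have M: "fst q = M" using F(1) lk(4) by (auto simp: Int_commute)
    have sw: "{J. inner_iso_path c \<G> (G j) J \<or> inner_iso_path c \<G> (G i) J} = {J. inner_iso_path c \<G> (G i) J \<or> inner_iso_path c \<G> (G j) J}" by blast
    have pq: "polygon_points (snd q) = (\<Union>J\<in>{J. inner_iso_path c \<G> (G i) J \<or> inner_iso_path c \<G> (G j) J}. polygon_points J) \<inter> M"
      using G'(4) hh' unfolding h'(2) M using sw by auto
    have "carrier i j M h" using hh' lk by auto
    then have "snd q = Lset c \<G> (G i) M \<union> Lset c \<G> (G j) M \<and> Lset c \<G> (G i) M \<noteq> Lset c \<G> (G j) M"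
      unfolding carrier_def using s pq by blast
    then show ?thesis using M by (metis prod.collapse)
  qed
qed

lemma disperse_connected_only:
  assumes i: "i \<in> I" "regular_graph c \<G> (G i)" "iso_path_of c \<G> (G i) p1" and j: "G j \<in> graph_system \<G> (G i)" "iso_path_of c \<G> (G j) p2"
    and ne: "p2 \<noteq> p1" and l: "l \<in> snd p1" "l \<in> snd p2"
    and only: "\<And>h q. h \<in> I \<Longrightarrow> iso_path_of c \<G> (G h) q \<Longrightarrow> l \<in> snd q \<Longrightarrow> q = p1 \<or> q = p2"
  shows "disperse_connected_paths c \<G> (G i) p1 p2 l"
proof -
  have "\<forall>H\<in>graph_system \<G> (G i). \<forall>q. iso_path_of c \<G> H q \<and> l \<in> snd q \<longrightarrow> q = p1 \<or> q = p2"
    using only unfolding graph_system_def edge_system_def GG by blast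
  then show ?thesis unfolding disperse_connected_paths_def using assms(2-8) by blast
qed

lemma carrier_unique:
  assumes "carrier i j M g" "inner_iso_path c \<G> (G g) w" "inner_iso_path c \<G> (G g) w'" "l \<in> w" "l \<in> w'" "l \<subseteq> M"
  shows "w = w'"
  using assms(1)[unfolded carrier_def, THEN conjunct2, THEN conjunct1, rule_format, OF assms(2-6)] .

text \<open>Since only two iso-paths contain the line, clause (1) of disperse connectedness applies,
  and no corresponding nodes have to be compared.\<close>

lemma linked_continued:
  assumes L: "linked i j M" and l: "l \<in> Lset c \<G> (G i) M \<union> Lset c \<G> (G j) M" and h: "h \<in> I" and p: "iso_path_of c \<G> (G h) p" "l \<in> snd p"
  shows "continued p l"
proof -
  note lk = linkedD[OF L]
  note sys = graph_system_self[OF lk(1)] graph_system_neighbor[OF lk(1,2) lk(3)[symmetric] lk(5,6)]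
  have lM: "l \<subseteq> M" using l unfolding Lset_def by blast
  have uniq: "w = w'" if "g \<in> {i, j}" "inner_iso_path c \<G> (G g) w" "inner_iso_path c \<G> (G g) w'" "l \<in> w" "l \<in> w'" for g w w'
    by (rule carrier_unique[OF _ that(2-5) lM]) (use that(1) lk(10,11) in auto)
  have ip: "iso_path_of c \<G> (G g) (C g, w)" if "g \<in> {i, j}" "inner_iso_path c \<G> (G g) w" for g w
    unfolding iso_path_of_def inner_path_of_def using that lk(1,2) by auto
  have fin: "continued p l" if d: "disperse_connected_paths c \<G> (G i) p1 p2 l"
    and i1: "g1 \<in> I" "iso_path_of c \<G> (G g1) p1" "l \<in> snd p1" and i2: "g2 \<in> I" "iso_path_of c \<G> (G g2) p2" "l \<in> snd p2"
    and ne: "p2 \<noteq> p1" and pp: "p = p1 \<or> p = p2" for p1 p2 g1 g2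
    using pp
  proof
    assume e: "p = p1"
    show ?thesis unfolding continued_def e by (rule exI[of _ p2]) (use d i2 ne lk(1) in blast)
  next
    assume e: "p = p2"
    show ?thesis unfolding continued_def e by (rule exI[of _ p1]) (use d i1 ne lk(1) in blast)
  qed
  show ?thesis
  proof (cases "Lset c \<G> (G i) M = Lset c \<G> (G j) M")
    case True
    obtain wi where wi: "inner_iso_path c \<G> (G i) wi" "l \<in> wi" using l True unfolding Lset_def by blast
    obtain wj where wj: "inner_iso_path c \<G> (G j) wj" "l \<in> wj" using l True unfolding Lset_def by blast
    have ne: "(C j, wj) \<noteq> (C i, wi)" using C_inj[OF lk(2,1)] lk(3) by auto
    have only: "q = (C i, wi) \<or> q = (C j, wj)" if hq: "h' \<in> I" "iso_path_of c \<G> (G h') q" "l \<in> snd q" for h' q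
    proof -
      obtain g where g: "g \<in> {i, j}" "fst q = C g" "inner_iso_path c \<G> (G g) (snd q)"
        using linked_paths[OF L l hq] True by blast
      have "g = i \<or> g = j" using g(1) by simp
      then show ?thesis
      proof
        assume e: "g = i"
        have "snd q = wi" by (rule uniq[OF g(1,3)]) (use wi hq(3) e in auto)
        then show ?thesis using g(2) e by (metis prod.collapse)
      next
        assume e: "g = j"
        have "snd q = wj" by (rule uniq[OF g(1,3)]) (use wj hq(3) e in auto)
        then show ?thesis using g(2) e by (metis prod.collapse)
      qed
    qed
    have "disperse_connected_paths c \<G> (G i) (C i, wi) (C j, wj) l"
      by (rule disperse_connected_only[OF lk(1,7) ip[OF _ wi(1)] sys(2) ip[OF _ wj(1)] ne _ _ only]) (use wi wj in simp_all)
    from fin[OF this lk(1) ip[OF _ wi(1)] _ lk(2) ip[OF _ wj(1)] _ ne only[OF h p]] show ?thesis using wi wj by simp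
  next
    case False
    note mm = linked_mismatch[OF L False]
    obtain g where g: "g \<in> {i, j}" "l \<in> Lset c \<G> (G g) M" using l by blast
    obtain w where w: "inner_iso_path c \<G> (G g) w" "l \<in> w" using g(2) unfolding Lset_def by blast
    have gI: "g \<in> I" "M facet_of C g" using g lk by auto
    let ?o = "(M, Lset c \<G> (G i) M \<union> Lset c \<G> (G j) M)"
    have o: "iso_path_of c \<G> (G i) ?o" unfolding iso_path_of_def using mm(4) by simp
    have ne: "(C g, w) \<noteq> ?o" using gI(2) by auto
    have only: "q = ?o \<or> q = (C g, w)" if hq: "h' \<in> I" "iso_path_of c \<G> (G h') q" "l \<in> snd q" for h' q
    proof (rule ccontr)
      assume n: "\<not> ?thesis"
      obtain g' where g': "g' \<in> {i, j}" "fst q = C g'" "inner_iso_path c \<G> (G g') (snd q)" "l \<in> Lset c \<G> (G g') M"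
        using linked_paths[OF L l hq] n by blast
      have e: "g' = g" using g g'(1,4) mm(1) by blast
      have "snd q = w" by (rule uniq[OF g'(1,3)]) (use w hq(3) e in auto)
      then show False using n g'(2) e by (metis prod.collapse)
    qed
    have sg: "G g \<in> graph_system \<G> (G i)" using g(1) sys by auto
    have "disperse_connected_paths c \<G> (G i) ?o (C g, w) l"
      by (rule disperse_connected_only[OF lk(1,7) o sg ip[OF g(1) w(1)] ne _ _ only]) (use l w in simp_all)
    from fin[OF this lk(1) o _ gI(1) ip[OF g(1) w(1)] _ ne only[OF h p]] show ?thesis using l w by simp
  qed
qed

end

section \<open>Lines that are edges of a cuboid\<close>

lemma third_axis: "\<exists>k :: 3. k \<noteq> m \<and> k \<noteq> n"
proof (rule ccontr)
  assume "\<not> ?thesis"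
  then have "UNIV \<subseteq> {m, n}" by blast
  then have "CARD(3) \<le> card {m, n}" by (intro card_mono) simp_all
  then show False using card_insert_le_m1[of 2 "{n}" m] by simp
qed

lemma axes:
  assumes "k \<noteq> m" "k' \<noteq> m" "k \<noteq> (k' :: 3)"
  shows "l = m \<or> l = k \<or> l = k'"
  using assms exhaust_3[of l] exhaust_3[of m] exhaust_3[of k] exhaust_3[of k'] by auto

lemma adj_axis:
  assumes "adj \<rho> \<tau>" "co k \<tau> = co k \<rho>" "co k' \<tau> = co k' \<rho>" "k \<noteq> k'"
  obtains m where "k \<noteq> m" "k' \<noteq> m" "co m \<tau> = (\<not> co m \<rho>)" "\<And>l. l = m \<or> l = k \<or> l = k'"
proof -
  obtain m where m: "co m \<rho> \<noteq> co m \<tau>" "\<forall>j. j \<noteq> m \<longrightarrow> co j \<rho> = co j \<tau>" using assms(1) unfolding adj_iff by blast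
  have n: "k \<noteq> m" "k' \<noteq> m" using m(1) assms(2,3) by auto
  show ?thesis by (rule that[OF n _ axes[OF n assms(4)]]) (use m(1) in auto)
qed

lemma edge_axes:
  assumes e: "adj \<rho> \<tau>" "co k \<tau> = co k \<rho>" "co k' \<tau> = co k' \<rho>" "k \<noteq> k'"
  shows "co l \<tau> = co l \<rho> \<Longrightarrow> l = k \<or> l = k'"
    "co k \<xi> = co k \<rho> \<Longrightarrow> co k' \<xi> = co k' \<rho> \<Longrightarrow> \<xi> = \<rho> \<or> \<xi> = \<tau>"
    "co k \<xi> = co k \<rho> \<Longrightarrow> \<xi> = \<rho> \<or> \<xi> = \<tau> \<or> adj \<rho> \<xi> \<or> adj \<tau> \<xi>"
    "\<exists>\<xi>. co k \<xi> = co k \<rho> \<and> adj \<rho> \<xi> \<and> \<xi> \<noteq> \<tau>"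
    "adj \<rho> \<xi> \<Longrightarrow> \<xi> = \<tau> \<or> co k \<xi> = co k \<rho> \<or> co k' \<xi> = co k' \<rho>"
proof -
  obtain m where m: "k \<noteq> m" "k' \<noteq> m" "co m \<tau> = (\<not> co m \<rho>)" "\<And>l. l = m \<or> l = k \<or> l = k'" using adj_axis[OF e] by blast
  have all: "(\<forall>l. Q l) \<longleftrightarrow> Q m \<and> Q k \<and> Q k'" for Q using m(4) by metis
  show "l = k \<or> l = k'" if "co l \<tau> = co l \<rho>" using m(4)[of l] that m(3) by auto
  show "\<xi> = \<rho> \<or> \<xi> = \<tau>" if "co k \<xi> = co k \<rho>" "co k' \<xi> = co k' \<rho>"
    unfolding ix_eq_iff all using that e m(3) by auto
  show "\<xi> = \<rho> \<or> \<xi> = \<tau> \<or> adj \<rho> \<xi> \<or> adj \<tau> \<xi>" if h: "co k \<xi> = co k \<rho>"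
  proof (cases "co k' \<xi> = co k' \<rho>")
    case True then show ?thesis unfolding ix_eq_iff all using h e m(3) by auto
  next
    case False
    show ?thesis
    proof (cases "co m \<xi> = co m \<rho>")
      case True
      have "\<forall>j. j \<noteq> k' \<longrightarrow> co j \<rho> = co j \<xi>" unfolding all using True h by simp
      then show ?thesis unfolding adj_iff using False by metis
    next
      case mf: False
      have "\<forall>j. j \<noteq> k' \<longrightarrow> co j \<tau> = co j \<xi>" unfolding all using mf h e m(3) by simp
      then show ?thesis unfolding adj_iff using False e(3) by metis
    qed
  qed
  show "\<exists>\<xi>. co k \<xi> = co k \<rho> \<and> adj \<rho> \<xi> \<and> \<xi> \<noteq> \<tau>"
  proof -
    obtain \<xi> where x: "\<And>l. co l \<xi> = (if l = k' then \<not> co k' \<rho> else co l \<rho>)" using ix_of_fun[of "\<lambda>l. if l = k' then \<not> co k' \<rho> else co l \<rho>"] by blast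
    have "co k \<xi> = co k \<rho>" "\<xi> \<noteq> \<tau>" using x[of k] x[of k'] e(3,4) by auto
    moreover have "adj \<rho> \<xi>" unfolding adj_iff by (rule exI[of _ k']) (simp add: x)
    ultimately show ?thesis by blast
  qed
  show "\<xi> = \<tau> \<or> co k \<xi> = co k \<rho> \<or> co k' \<xi> = co k' \<rho>" if "adj \<rho> \<xi>"
  proof -
    obtain n where n: "co n \<rho> \<noteq> co n \<xi>" "\<forall>j. j \<noteq> n \<longrightarrow> co j \<rho> = co j \<xi>" using \<open>adj \<rho> \<xi>\<close> unfolding adj_iff by blast
    show ?thesis using n(2) e(4) by metis
  qed
qed

context cubc begin

lemma ip_zz: "zz t \<rho> \<Longrightarrow> ip t \<rho> \<tau> = V a b \<rho>"
  by (simp add: ip_lam lam_def zz_def)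

lemma edge_face:
  assumes "adj \<rho> \<tau>" "zz t \<rho>" "zz t \<tau>" "co k \<rho> = s" "co k \<tau> = s"
    and oth: "\<And>\<xi>. co k \<xi> = s \<Longrightarrow> \<xi> \<noteq> \<rho> \<Longrightarrow> \<xi> \<noteq> \<tau> \<Longrightarrow> dd t \<xi>"
  shows "areg (dd t) (zz t) (cn k s)" "line t (dd t) k s = {V a b \<rho>, V a b \<tau>}"
proof -
  obtain u v where r: "\<rho> = cn k s u v" using cnE[OF assms(4)] by blast
  obtain u' v' where t: "\<tau> = cn k s u' v'" using cnE[OF assms(5)] by blast
  have a: "(u = u') \<noteq> (v = v')" using assms(1) unfolding r t by simp
  have d: "dd t (cn k s p q) \<longleftrightarrow> (p, q) \<noteq> (u, v) \<and> (p, q) \<noteq> (u', v')" for p q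
    using oth[of "cn k s p q"] zz_not_dd[OF assms(2)] zz_not_dd[OF assms(3)] unfolding r t
    by (cases "(p, q) = (u, v)"; cases "(p, q) = (u', v')") auto
  show "areg (dd t) (zz t) (cn k s)"
    unfolding areg_def aL_def fcount_def d using a by (cases u; cases v; cases u'; cases v') auto
  have n: "\<exists>\<xi>. co k \<xi> = s \<and> adj \<eta> \<xi> \<and> dd t \<xi>" if h: "\<eta> = \<rho> \<or> \<eta> = \<tau>" for \<eta>
  proof -
    obtain p q where e: "\<eta> = cn k s p q" "(p, q) = (u, v) \<or> (p, q) = (u', v')" using h r t by auto
    have "dd t (cn k s (\<not> p) q) \<or> dd t (cn k s p (\<not> q))" unfolding d using e(2) a by auto
    then show ?thesis unfolding e(1) using adj_cn[of k s p q "\<not> p" q] adj_cn[of k s p q p "\<not> q"] co_cn by metis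
  qed
  show "line t (dd t) k s = {V a b \<rho>, V a b \<tau>}"
  proof (intro equalityI subsetI)
    fix x assume "x \<in> line t (dd t) k s"
    then obtain \<eta> \<xi> where h: "x = ip t \<eta> \<xi>" "co k \<eta> = s" "\<not> dd t \<eta>" unfolding line_def by blast
    have e: "\<eta> = \<rho> \<or> \<eta> = \<tau>" using oth[OF h(2)] h(3) by blast
    then show "x \<in> {V a b \<rho>, V a b \<tau>}" unfolding h(1) using ip_zz assms(2,3) by auto
  next
    fix x assume "x \<in> {V a b \<rho>, V a b \<tau>}"
    then obtain \<eta> where e: "\<eta> = \<rho> \<or> \<eta> = \<tau>" "x = V a b \<eta>" by blast
    have z: "zz t \<eta>" "co k \<eta> = s" using e(1) assms(2-5) by auto
    obtain \<xi> where x: "co k \<xi> = s" "adj \<eta> \<xi>" "dd t \<xi>" using n[OF e(1)] by blast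
    have "x = ip t \<eta> \<xi>" using ip_zz[OF z(1)] e(2) by simp
    then show "x \<in> line t (dd t) k s" unfolding line_def using z x zz_not_dd by blast
  qed
qed

lemma regular_line_path:
  assumes reg: "regular_graph c \<G> (Gr t)" and ar: "areg (dd t) (zz t) (cn k s)"
  shows "\<exists>w. inner_iso_path c \<G> (Gr t) w \<and> line t (dd t) k s \<in> w"
proof -
  have "\<exists>u v. dd t (cn k s u v)" "\<exists>u v. \<not> dd t (cn k s u v)" using ar unfolding areg_def by auto
  then obtain p q where "src (dd t) (cn k s p q)" unfolding src_def by (cases "ctype (dd t)") auto
  then show ?thesis using exist_reg(2)[OF regular_mixed(1)[OF reg] ar] inner_pp[OF reg] by blast
qed

lemma regular_corresponds:
  assumes "inner_iso_path c \<G> (Gr t) w" "areg (dd t) (zz t) (cn k s)" "line t (dd t) k s \<in> w" "dd t \<xi>" "co k \<xi> = s"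
  shows "corresponds c \<G> (Gr t) (cbox a b, w) (line t (dd t) k s) (V a b \<xi>)"
  unfolding corresponds_def inner_path_of_def
  using assms regular_face_iff[of t k s] face_iso_points_eq[of t k s] by (intro conjI exI[of _ "bface a b k s"]) auto

text \<open>On the face perpendicular to the edge at \<rho> the two neighbors of \<rho> are
  disperse, and T2-freeness makes the opposite corner continuous. So it is an L-face, its two
  disperse corners own different paths, and each of these contains the edge, one through each of the
  two faces at the edge.\<close>

lemma double_edge:
  assumes reg: "regular_graph c \<G> (Gr t)" and e: "adj \<rho> \<tau>" "zz t \<rho>" "zz t \<tau>"
    and oth: "\<And>\<xi>. adj \<rho> \<xi> \<or> adj \<tau> \<xi> \<Longrightarrow> \<xi> \<noteq> \<rho> \<Longrightarrow> \<xi> \<noteq> \<tau> \<Longrightarrow> dd t \<xi>"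
  shows "\<exists>w1 w2. w1 \<noteq> w2 \<and> inner_iso_path c \<G> (Gr t) w1 \<and> inner_iso_path c \<G> (Gr t) w2 \<and> {V a b \<rho>, V a b \<tau>} \<in> w1 \<and> {V a b \<rho>, V a b \<tau>} \<in> w2"
proof -
  note mx = regular_mixed(1)[OF reg] and sf = regular_mixed(2)[OF reg]
  have f1: "\<not> F1_graph c (Gr t)" using reg unfolding regular_graph_def isolated_free_def by blast
  note T2 = singular_free_T2[OF sf e oth]
  have nct: "\<not> ctype (dd t)" using ctype_aD T2(1) by fastforce
  obtain m where m: "co m \<rho> \<noteq> co m \<tau>" "\<forall>j. j \<noteq> m \<longrightarrow> co j \<rho> = co j \<tau>" using e(1) unfolding adj_iff by blast
  define s where "s = co m \<rho>"
  obtain p q where r: "\<rho> = cn m s p q" using cnE[of m \<rho> s] s_def by blast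
  let ?A = "cn m s (\<not> p) q" and ?B = "cn m s p (\<not> q)" and ?D = "cn m s (\<not> p) (\<not> q)"
  have nt: "cn m s x y \<noteq> \<tau>" for x y using m(1) s_def by (metis co_cn)
  have rd: "\<not> dd t \<rho>" using zz_not_dd e(2) by blast
  have A: "dd t ?A" "adj \<rho> ?A" by (rule oth) (use nt in \<open>auto simp: r\<close>)
  have B: "dd t ?B" "adj \<rho> ?B" by (rule oth) (use nt in \<open>auto simp: r\<close>)
  have D: "\<not> dd t ?D"
  proof
    assume "dd t ?D"
    then have "adj \<rho> ?D \<or> adj \<tau> ?D" using T2(2) by blast
    then have "adj \<tau> ?D" unfolding r by simp
    then obtain n where n: "co n \<tau> \<noteq> co n ?D" "\<forall>j. j \<noteq> n \<longrightarrow> co j \<tau> = co j ?D" unfolding adj_iff by blast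
    have "n = m" using n(2) m(1) s_def by (metis co_cn)
    then have "co j ?D = co j \<rho>" for j using n(2) m(2) s_def by (cases "j = m") (metis co_cn)+
    then have "?D = \<rho>" unfolding ix_eq_iff by blast
    then show False unfolding r by simp
  qed
  have L: "aL (dd t) (cn m s)" using A(1) B(1) D rd unfolding aL_def r by (cases p; cases q) auto
  note xA = exist_disp[OF mx L nct A(1)] and xB = exist_disp[OF mx L nct B(1)]
  have "res (dd t) ?A \<noteq> res (dd t) ?B" using xA(3) xB(2) by auto
  then have ne: "pp t (res (dd t) ?A) \<noteq> pp t (res (dd t) ?B)" by (rule paths_distinct[OF mx xA(1) xB(1) sf f1 nct])
  have ln: "{V a b \<rho>, V a b \<tau>} \<in> pp t (res (dd t) X)" if X: "adj \<rho> X" "src (dd t) X" for X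
  proof -
    obtain n where n: "co n \<rho> \<noteq> co n X" "\<forall>j. j \<noteq> n \<longrightarrow> co j \<rho> = co j X" using X(1) unfolding adj_iff by blast
    \<comment> \<open>The face through \<rho>, \<tau> and \<open>X\<close>; its line is the edge,
      and \<open>X\<close> is one of its disperse corners.\<close>
    obtain k where k: "k \<noteq> m" "k \<noteq> n" using third_axis by blast
    have kt: "co k \<tau> = co k \<rho>" "co k X = co k \<rho>" using m(2) n(2) k by auto
    obtain k' where k': "k' \<noteq> m" "k' \<noteq> k" using third_axis by blast
    note ea = edge_axes(3)[OF e(1) kt(1) _ k'(2)[symmetric]]
    have o: "dd t \<xi>" if "co k \<xi> = co k \<rho>" "\<xi> \<noteq> \<rho>" "\<xi> \<noteq> \<tau>" for \<xi>
      using ea[of \<xi>] m(2) k'(1) that oth by auto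
    note ef = edge_face[OF e refl kt(1) o]
    obtain x y where Xc: "X = cn k (co k \<rho>) x y" using cnE[OF kt(2)] by blast
    show ?thesis using exist_reg(2)[OF mx ef(1), of x y] X(2) ef(2) unfolding Xc by simp
  qed
  have "inner_iso_path c \<G> (Gr t) (pp t (res (dd t) ?A))" "inner_iso_path c \<G> (Gr t) (pp t (res (dd t) ?B))"
    unfolding inner_pp[OF reg] using xA(1) xB(1) by blast+
  then show ?thesis using ne ln[OF A(2) xA(1)] ln[OF B(2) xB(1)] by blast
qed

end

text \<open>All disperse paths of the proof have two edges that meet in a removed node. The two
  edges may belong to different graphs, in both of which the node is disperse.\<close>

lemma disperse_path3:
  assumes "distinct [A, P, B]" "H \<in> \<H>" "incident (cuboid H) A P" "disperse c H A" "disperse c H P"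
    "H' \<in> \<H>" "incident (cuboid H') P B" "disperse c H' P" "disperse c H' B"
  shows "disperse_path c \<H> A B"
  unfolding disperse_path_def
proof (intro exI[of _ "[A, P, B]"] conjI allI impI)
  fix m assume "Suc m < length [A, P, B]"
  then consider "m = 0" | "m = 1" by fastforce
  then show "\<exists>H\<in>\<H>. incident (cuboid H) ([A, P, B] ! m) ([A, P, B] ! Suc m) \<and>
              disperse c H ([A, P, B] ! m) \<and> disperse c H ([A, P, B] ! Suc m)"
  proof cases
    case 1 then show ?thesis using assms by (intro bexI[of _ H]) auto
  next
    case 2 then show ?thesis using assms by (intro bexI[of _ H']) auto
  qed
qed (use assms(1) in auto)

context labeling begin

lemma continued_by_node:
  assumes i: "i \<in> I" "j \<in> I" "G j \<in> graph_system \<G> (G i)"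
    and w: "inner_iso_path c \<G> (G i) w" "inner_iso_path c \<G> (G j) w'" "l \<in> w" "l \<in> w'" "(C j, w') \<noteq> (C i, w)"
    and P: "corresponds c \<G> (G i) (C i, w) l P" "corresponds c \<G> (G j) (C j, w') l P'" "P = P' \<or> disperse_path c (graph_system \<G> (G i)) P P'"
  shows "continued (C i, w) l"
proof -
  have ip: "inner_path_of c \<G> (G i) (C i, w)" "inner_path_of c \<G> (G j) (C j, w')" using w(1,2) i by (simp_all add: inner_path_of_def)
  have "disperse_connected_paths c \<G> (G i) (C i, w) (C j, w') l"
    unfolding disperse_connected_paths_def iso_path_of_def
    using inner_regular[OF w(1)] ip i(3) w(3-5) P by (cases "P = P'") auto
  then show ?thesis unfolding continued_def using w ip i unfolding iso_path_of_def by (intro exI[of _ "(C j, w')"]) auto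
qed

lemma incident_sym: "incident (C h) P Q \<longleftrightarrow> incident (C h) Q P" by (simp add: incident_def closed_segment_commute)

lemma incident_transfer:
  assumes i: "i \<in> I" "j \<in> I" "j \<noteq> i" and M: "M facet_of C i" "M facet_of C j" and PQ: "P \<in> M" "Q \<in> M" "incident (C i) P Q"
  shows "incident (C j) P Q"
proof -
  obtain a b where ab2: "cubc a b c" "C i = cbox a b" using box[OF i(1)] by blast
  interpret cubc a b c by fact
  obtain k s where ks: "M = bface a b k s" using M(1) unfolding ab2(2) facet_iff by blast
  obtain a' b' where F: "cubc a' b' c" "C j = cbox a' b'" "G j = cubc.Gr a' b' (lb j)" "bface a b k s = bface a' b' k (\<not> s)"
     "\<forall>u v. V a' b' (cn k (\<not> s) u v) = V a b (cn k s u v)"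
    using frame[OF i(1) ab2 i(2,3) M(2)[unfolded ks]] by (elim exE conjE)
  interpret B: cubc a' b' c by fact
  obtain \<rho> \<tau> where r: "P = V a b \<rho>" "Q = V a b \<tau>" "adj \<rho> \<tau>" using PQ(3) unfolding ab2(2) incident_iff by blast
  have co: "co k \<rho> = s" "co k \<tau> = s" using PQ(1,2) unfolding r ks by simp_all
  obtain u v where u: "\<rho> = cn k s u v" using cnE[OF co(1)] by blast
  obtain u' v' where u': "\<tau> = cn k s u' v'" using cnE[OF co(2)] by blast
  have "adj (cn k (\<not> s) u v) (cn k (\<not> s) u' v')" using r(3) unfolding u u' by simp
  then show ?thesis unfolding r(1,2) u u' F(2) F(5)[rule_format, symmetric] by simp
qed

text \<open>The facts of \<open>edge_axes\<close> without coordinates, so that they can be applied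
  in each of the cells around an edge.\<close>

lemma edge_faces:
  assumes h: "h \<in> I" and e: "incident (C h) P Q" and F: "F facet_of C h" "F' facet_of C h" "F \<noteq> F'" "P \<in> F" "Q \<in> F" "P \<in> F'" "Q \<in> F'"
  shows "K facet_of C h \<Longrightarrow> P \<in> K \<Longrightarrow> Q \<in> K \<Longrightarrow> K = F \<or> K = F'"
    "X \<in> nodes (C h) \<Longrightarrow> X \<in> F \<Longrightarrow> X \<in> F' \<Longrightarrow> X = P \<or> X = Q"
    "X \<in> nodes (C h) \<Longrightarrow> X \<in> F \<Longrightarrow> X = P \<or> X = Q \<or> incident (C h) P X \<or> incident (C h) Q X"
    "\<exists>A\<in>F. incident (C h) P A \<and> A \<noteq> Q"
    "incident (C h) P X \<Longrightarrow> X = Q \<or> X \<in> F \<or> X \<in> F'"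
proof -
  obtain a b where ab2: "cubc a b c" "C h = cbox a b" using box[OF h] by blast
  interpret cubc a b c by fact
  obtain \<rho> \<tau> where r: "P = V a b \<rho>" "Q = V a b \<tau>" "adj \<rho> \<tau>" using e unfolding ab2(2) incident_iff by blast
  obtain k s where k: "F = bface a b k s" using F(1) unfolding ab2(2) facet_iff by blast
  obtain k' s' where k': "F' = bface a b k' s'" using F(2) unfolding ab2(2) facet_iff by blast
  have s: "s = co k \<rho>" "co k \<tau> = co k \<rho>" "s' = co k' \<rho>" "co k' \<tau> = co k' \<rho>" using F(4-7) unfolding k k' r by auto
  have kk: "k \<noteq> k'" using F(3) s unfolding k k' by auto
  note ea = edge_axes[OF r(3) s(2,4) kk]
  show "K = F \<or> K = F'" if K: "K facet_of C h" "P \<in> K" "Q \<in> K"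
  proof -
    obtain l q where l: "K = bface a b l q" using K(1) unfolding ab2(2) facet_iff by blast
    have "q = co l \<rho>" "co l \<tau> = co l \<rho>" using K(2,3) unfolding l r by auto
    then show ?thesis using ea(1)[of l] s unfolding l k k' by auto
  qed
  have node: "\<exists>\<xi>. X = V a b \<xi>" if "X \<in> nodes (C h)" for X using that unfolding ab2(2) nodes_eq by blast
  show "X = P \<or> X = Q" if X: "X \<in> nodes (C h)" "X \<in> F" "X \<in> F'"
  proof -
    obtain \<xi> where x: "X = V a b \<xi>" using node[OF X(1)] by blast
    have "co k \<xi> = co k \<rho>" "co k' \<xi> = co k' \<rho>" using X(2,3) s(1,3) unfolding x k k' by simp_all
    from ea(2)[OF this] show ?thesis unfolding x r(1,2) by auto
  qed
  show "X = P \<or> X = Q \<or> incident (C h) P X \<or> incident (C h) Q X" if X: "X \<in> nodes (C h)" "X \<in> F"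
  proof -
    obtain \<xi> where x: "X = V a b \<xi>" using node[OF X(1)] by blast
    have "co k \<xi> = co k \<rho>" using X(2) s(1) unfolding x k by simp
    from ea(3)[OF this] show ?thesis unfolding x r(1,2) ab2(2) by auto
  qed
  obtain \<xi> where "co k \<xi> = co k \<rho>" "adj \<rho> \<xi>" "\<xi> \<noteq> \<tau>" using ea(4) by blast
  then show "\<exists>A\<in>F. incident (C h) P A \<and> A \<noteq> Q" unfolding k r s ab2(2) by (intro bexI[of _ "V a b \<xi>"]) auto
  show "X = Q \<or> X \<in> F \<or> X \<in> F'" if X: "incident (C h) P X"
  proof -
    obtain \<rho>' \<xi> where x: "P = V a b \<rho>'" "X = V a b \<xi>" "adj \<rho>' \<xi>" using X unfolding ab2(2) incident_iff by blast
    then have "adj \<rho> \<xi>" using r(1) by simp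
    then show ?thesis using ea(5)[of \<xi>] unfolding x(2) r k k' s by auto
  qed
qed

end

context labeling begin

text \<open>Stated with the labels \<open>f\<close> before the removal, which all cells share;
  therefore the property passes to the cell on the other side of the face.\<close>

definition Dface :: "nat \<Rightarrow> point set \<Rightarrow> point \<Rightarrow> point \<Rightarrow> bool" where
  "Dface h F P Q \<longleftrightarrow> F facet_of C h \<and> P \<in> F \<and> Q \<in> F \<and> incident (C h) P Q \<and>
     (\<forall>X\<in>nodes (C h). X \<in> F \<longrightarrow> X \<noteq> P \<longrightarrow> X \<noteq> Q \<longrightarrow> c < f X)"

lemma DfaceD:
  assumes "Dface h F P Q"
  shows "F facet_of C h" "P \<in> F" "Q \<in> F" "incident (C h) P Q"
    "X \<in> nodes (C h) \<Longrightarrow> X \<in> F \<Longrightarrow> X \<noteq> P \<Longrightarrow> X \<noteq> Q \<Longrightarrow> c < f X"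
  using assms unfolding Dface_def by blast+

lemma label_disperse: "h \<in> I \<Longrightarrow> c < f X \<Longrightarrow> c < lb h X"
  using label_cases[of h X] by auto

lemma Dface_transfer:
  assumes D: "Dface i F P Q" and i: "i \<in> I" "j \<in> I" "j \<noteq> i" "F facet_of C j"
  shows "Dface j F P Q"
  unfolding Dface_def
proof (intro conjI ballI impI)
  note d = DfaceD[OF D]
  show "F facet_of C j" "P \<in> F" "Q \<in> F" by fact+
  show "incident (C j) P Q" by (rule incident_transfer[OF i(1-3) d(1) i(4) d(2,3,4)])
  fix X assume X: "X \<in> nodes (C j)" "X \<in> F" "X \<noteq> P" "X \<noteq> Q"
  have "X \<in> C i" using X(2) d(1) facet_of_imp_subset by blast
  then have "X \<in> nodes (C i)" by (rule common_nodes[OF i(2,1,3) X(1)])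
  then show "c < f X" using d(5) X by blast
qed

lemma Dface_path:
  assumes h: "h \<in> I" and D: "Dface h F P Q" and PQ: "lb h P = c" "lb h Q = c"
  shows "regular_graph c \<G> (G h)" "\<exists>w. inner_iso_path c \<G> (G h) w \<and> {P, Q} \<in> w"
    "inner_iso_path c \<G> (G h) w \<Longrightarrow> {P, Q} \<in> w \<Longrightarrow> A \<in> F \<Longrightarrow> A \<in> nodes (C h) \<Longrightarrow> A \<noteq> P \<Longrightarrow> A \<noteq> Q \<Longrightarrow> corresponds c \<G> (G h) (C h, w) {P, Q} A"
proof -
  note d = DfaceD[OF D]
  obtain a b where ab2: "cubc a b c" "C h = cbox a b" "G h = cubc.Gr a b (lb h)" using box[OF h] by blast
  interpret cubc a b c by fact
  define t where "t = lb h"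
  have Gh: "G h = Gr t" unfolding t_def by (fact ab2(3))
  obtain k s where k: "F = bface a b k s" using d(1) unfolding ab2(2) facet_iff by blast
  obtain \<rho> \<tau> where r: "P = V a b \<rho>" "Q = V a b \<tau>" "adj \<rho> \<tau>" using d(4) unfolding ab2(2) incident_iff by blast
  have co: "co k \<rho> = s" "co k \<tau> = s" using d(2,3) unfolding r k by simp_all
  have z: "zz t \<rho>" "zz t \<tau>" using PQ unfolding zz_def t_def r .
  have o: "dd t \<xi>" if "co k \<xi> = s" "\<xi> \<noteq> \<rho>" "\<xi> \<noteq> \<tau>" for \<xi>
  proof -
    have "c < f (V a b \<xi>)" by (rule d(5)) (use that in \<open>simp_all add: ab2(2) k r\<close>)
    then show ?thesis unfolding dd_def t_def by (rule label_disperse[OF h])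
  qed
  have ef: "areg (dd t) (zz t) (cn k s)" "line t (dd t) k s = {V a b \<rho>, V a b \<tau>}"
    by (rule edge_face(1)[OF r(3) z co], rule o, assumption+) (rule edge_face(2)[OF r(3) z co], rule o, assumption+)
  obtain u v where uv: "dd t (cn k s u v)" using ef(1) unfolding areg_def by blast
  show reg: "regular_graph c \<G> (G h)"
    by (rule regularI[OF h, of P "V a b (cn k s u v)"]) (use uv PQ in \<open>simp_all add: ab2(2) r dd_def t_def\<close>)
  have reg': "regular_graph c \<G> (Gr t)" using reg unfolding Gh .
  show "\<exists>w. inner_iso_path c \<G> (G h) w \<and> {P, Q} \<in> w"
    using regular_line_path[OF reg' ef(1)] unfolding ef(2) Gh r .
  show "corresponds c \<G> (G h) (C h, w) {P, Q} A"
    if w: "inner_iso_path c \<G> (G h) w" "{P, Q} \<in> w" and A: "A \<in> F" "A \<in> nodes (C h)" "A \<noteq> P" "A \<noteq> Q"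
  proof -
    obtain \<xi> where x: "A = V a b \<xi>" using A(2) unfolding ab2(2) nodes_eq by blast
    have ck: "co k \<xi> = s" using A(1) unfolding x k by simp
    have dx: "dd t \<xi>" by (rule o[OF ck]) (use A(3,4) x r in auto)
    have w': "inner_iso_path c \<G> (Gr t) w" "line t (dd t) k s \<in> w" unfolding ef(2) by (fact w(1)[unfolded Gh], fact w(2)[unfolded r])
    show ?thesis using regular_corresponds[OF w'(1) ef(1) w'(2) dx ck] unfolding ef(2) Gh ab2(2) x r .
  qed
qed

lemma removed_both:
  assumes h: "h \<in> I" and e: "incident (C h) P Q" and f: "f P = c" "f Q = c"
  shows "removed h P \<longleftrightarrow> removed h Q"
proof
  have e': "incident (C h) Q P" using e incident_sym by blast
  show "removed h Q" if "removed h P" using removed_incident[OF h that e] incident_nodes[OF h e] f unfolding removed_def by simp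
  show "removed h P" if "removed h Q" using removed_incident[OF h that e'] incident_nodes[OF h e] f unfolding removed_def by simp
qed

text \<open>Passing a cell in which the edge is removed: it is entered through \<open>F\<close>,
  whose other corners are disperse. T1 is impossible because \<open>Q\<close> has label c. If the
  edge is a removed pair, all its neighbors are disperse, so the exit face \<open>F'\<close> has the
  property of \<open>F\<close>; otherwise \<open>F'\<close> is the common face of an
  F2-pair.\<close>

lemma removed_step:
  assumes h: "h \<in> I" and D: "Dface h F P Q" and rP: "removed h P" and fQ: "f Q = c"
    and F': "F' facet_of C h" "F \<noteq> F'" "P \<in> F'" "Q \<in> F'"
    and h': "h' \<in> I" "h' \<noteq> h" "F' facet_of C h'"
  shows "Dface h F' P Q \<or> F2alt h h'"
proof -
  note d = DfaceD[OF D]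
  have PQn: "P \<in> nodes (C h)" "Q \<in> nodes (C h)" "P \<noteq> Q" using incident_nodes[OF h d(4)] by blast+
  note ef = edge_faces[OF h d(4,1) F'(1,2) d(2,3) F'(3,4)]
  note ef' = edge_faces[OF h d(4) F'(1) d(1) F'(2)[symmetric] F'(3,4) d(2,3)]
  from h rP show ?thesis
  proof (cases rule: removed_cases)
    case (F2 h2)
    have h2: "h2 \<in> I" "h2 \<noteq> h" "(C h \<inter> C h2) facet_of C h" "(C h \<inter> C h2) facet_of C h2" using F2(1) unfolding F2alt_def by blast+
    have iff: "R \<in> C h2 \<longleftrightarrow> f R = c" if R: "R \<in> nodes (C h)" for R
    proof -
      have "R \<in> C h" using R unfolding nodes_def extreme_point_of_def by blast
      then show ?thesis using F2altD[OF F2(1) R] by (auto split: if_splits)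
    qed
    have PQ: "P \<in> C h \<inter> C h2" "Q \<in> C h \<inter> C h2" using F2(2) iff PQn fQ unfolding nodes_def extreme_point_of_def by auto
    \<comment> \<open>All nodes of the common face of an F2-pair had label c, whereas
      \<open>F\<close> has a disperse corner.\<close>
    have "C h \<inter> C h2 \<noteq> F"
    proof
      assume e: "C h \<inter> C h2 = F"
      obtain A where A: "A \<in> F" "incident (C h) P A" "A \<noteq> Q" using ef(4) by blast
      have An: "A \<in> nodes (C h)" "A \<noteq> P" using incident_nodes[OF h A(2)] by auto
      have "c < f A" by (rule d(5)[OF An(1) A(1) An(2) A(3)])
      moreover have "f A = c" using iff[OF An(1)] A(1) e by auto
      ultimately show False by simp
    qed
    then have e: "C h \<inter> C h2 = F'" using ef(1)[OF h2(3) PQ] by blast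
    have "h2 = h'" by (rule neighbor_unique[OF h h2(1) h'(1) h2(2)[symmetric] h'(2)[symmetric] F'(1) h2(4)[unfolded e] h'(3)])
    then show ?thesis using F2(1) by blast
  next
    case T1
    then show ?thesis using T1[OF d(4)] fQ by simp
  next
    case (pair Q')
    have "Q = Q'"
    proof (rule ccontr)
      assume "Q \<noteq> Q'"
      then have "c < f Q" by (intro pair(4)) (use d(4) PQn in auto)
      then show False using fQ by simp
    qed
    then have "c < f X" if "X \<in> nodes (C h)" "X \<in> F'" "X \<noteq> P" "X \<noteq> Q" for X
      using ef'(3)[OF that(1,2)] that(3,4) pair(4)[of X] by blast
    then show ?thesis unfolding Dface_def using F' d(4) by blast
  qed
qed

text \<open>Beyond the common face of an F2-pair every node was disperse, so the walk can go on
  through the next face at the edge.\<close>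

lemma F2_exit:
  assumes h: "h \<in> I" and F2: "F2alt h h'" and F: "C h \<inter> C h' = F" "F' facet_of C h'" "F \<noteq> F'"
    and e: "incident (C h') P Q" "P \<in> F" "Q \<in> F" "P \<in> F'" "Q \<in> F'"
  shows "Dface h' F' P Q"
proof -
  have h': "h' \<in> I" "F facet_of C h'" using F2 F(1) unfolding F2alt_def by blast+
  note ef = edge_faces[OF h'(1) e(1) h'(2) F(2,3) e(2-5)]
  have "c < f X" if X: "X \<in> nodes (C h')" "X \<in> F'" "X \<noteq> P" "X \<noteq> Q" for X
  proof -
    have "X \<notin> F" using ef(2)[OF X(1)] X by blast
    then show ?thesis using F2altD[OF F2alt_sym[OF F2 h] X(1)] F(1) by (auto split: if_splits)
  qed
  then show ?thesis unfolding Dface_def using F e by blast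
qed

lemma F2_removed: "F2alt h h' \<Longrightarrow> h \<in> I \<Longrightarrow> P \<in> nodes (C h) \<Longrightarrow> f P = c \<Longrightarrow> P \<in> C h' \<and> c < lb h P"
  using F2altD[of h h' P] by (auto split: if_splits)

lemma Dface_neighbor:
  assumes h: "h \<in> I" and D: "Dface h F P Q" "F' facet_of C h" "F \<noteq> F'" "P \<in> F'" "Q \<in> F'"
  obtains A where "A \<in> F" "A \<in> nodes (C h)" "A \<noteq> P" "A \<noteq> Q" "incident (C h) P A" "c < f A"
proof -
  note d = DfaceD[OF D(1)]
  obtain A where A: "A \<in> F" "incident (C h) P A" "A \<noteq> Q" using edge_faces(4)[OF h d(4,1) D(2,3) d(2,3) D(4,5)] by blast
  then show ?thesis using that incident_nodes[OF h A(2)] d(5) by blast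
qed

text \<open>If the other corners of \<open>F'\<close> are disperse too, \<open>C i\<close> itself
  has two paths through the edge, and both correspond to the node \<open>A\<close>. Otherwise the
  walk leads through cells in which the edge is removed until it reaches one that still has the edge
  as a line. It stops before it returns to \<open>i\<close>, since an arrival through
  \<open>F'\<close> would show that the other corners of \<open>F'\<close> are disperse, or that
  \<open>P\<close> is removed in \<open>i\<close>.\<close>

lemma edge_line_continued:
  assumes i: "i \<in> I" and D: "Dface i F P Q" and F': "F' facet_of C i" "F \<noteq> F'" "P \<in> F'" "Q \<in> F'"
    and lab: "lb i P = c" "lb i Q = c" and w: "inner_iso_path c \<G> (G i) w" "{P, Q} \<in> w" and om: "P \<in> \<Omega>"
    and r: "r \<in> I" "r \<noteq> i" "F facet_of C r" "removed r P"
  shows "continued (C i, w) {P, Q}"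
proof -
  note d = DfaceD[OF D]
  have ff: "f P = c" "f Q = c" using label_cases[OF i, of P] label_cases[OF i, of Q] lab c01 by auto
  have PQn: "P \<in> nodes (C i)" "Q \<in> nodes (C i)" "P \<noteq> Q" using incident_nodes[OF i d(4)] by blast+
  obtain A where A: "A \<in> F" "A \<in> nodes (C i)" "A \<noteq> P" "A \<noteq> Q" "incident (C i) P A" "c < f A"
    using Dface_neighbor[OF i D F'] by blast
  note corA = Dface_path(3)[OF i D lab w A(1-4)]
  show ?thesis
  proof (cases "Dface i F' P Q")
    case D': True
    obtain a b where ab2: "cubc a b c" "C i = cbox a b" "G i = cubc.Gr a b (lb i)" using box[OF i] by blast
    interpret cubc a b c by fact
    define t where "t = lb i"
    have Gi: "G i = Gr t" unfolding t_def by (fact ab2(3))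
    obtain \<rho> \<tau> where rt: "P = V a b \<rho>" "Q = V a b \<tau>" "adj \<rho> \<tau>" using d(4) unfolding ab2(2) incident_iff by blast
    have z: "zz t \<rho>" "zz t \<tau>" using lab unfolding zz_def t_def rt .
    note eP = edge_faces(5)[OF i d(4,1) F'(1,2) d(2,3) F'(3,4)]
    have sym: "incident (C i) Q P" using d(4) incident_sym by blast
    note eQ = edge_faces(5)[OF i sym d(1) F'(1,2) d(3,2) F'(4,3)]
    have o: "dd t \<xi>" if x: "adj \<rho> \<xi> \<or> adj \<tau> \<xi>" "\<xi> \<noteq> \<rho>" "\<xi> \<noteq> \<tau>" for \<xi>
    proof -
      have n: "V a b \<xi> \<noteq> P" "V a b \<xi> \<noteq> Q" using x(2,3) unfolding rt by simp_all
      have "V a b \<xi> \<in> F \<or> V a b \<xi> \<in> F'" using x(1) eP[of "V a b \<xi>"] eQ[of "V a b \<xi>"] n unfolding ab2(2) rt by auto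
      then have "c < f (V a b \<xi>)" using d(5) DfaceD(5)[OF D'] n unfolding ab2(2) by auto
      then show ?thesis unfolding dd_def t_def by (rule label_disperse[OF i])
    qed
    have rg: "regular_graph c \<G> (Gr t)" using inner_regular[OF w(1)] unfolding Gi .
    have "\<exists>w1 w2. w1 \<noteq> w2 \<and> inner_iso_path c \<G> (Gr t) w1 \<and> inner_iso_path c \<G> (Gr t) w2 \<and> {V a b \<rho>, V a b \<tau>} \<in> w1 \<and> {V a b \<rho>, V a b \<tau>} \<in> w2"
      by (rule double_edge[OF rg rt(3) z]) (rule o)
    then obtain w1 w2 where "w1 \<noteq> w2" "inner_iso_path c \<G> (G i) w1" "inner_iso_path c \<G> (G i) w2" "{P, Q} \<in> w1" "{P, Q} \<in> w2"
      unfolding Gi rt by blast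
    then obtain w' where w': "w' \<noteq> w" "inner_iso_path c \<G> (G i) w'" "{P, Q} \<in> w'" by metis
    show ?thesis
      by (rule continued_by_node[OF i i graph_system_self[OF i] w(1) w'(2) w(2) w'(3) _ corA Dface_path(3)[OF i D lab w'(2,3) A(1-4)]])
        (use w'(1) in simp_all)
  next
    case nD': False
    obtain a b where ab2: "cubc a b c" "C i = cbox a b" "G i = cubc.Gr a b (lb i)" using box[OF i] by blast
    interpret cubc a b c by fact
    obtain \<rho> \<tau> where rt: "P = V a b \<rho>" "Q = V a b \<tau>" "adj \<rho> \<tau>" using d(4) unfolding ab2(2) incident_iff by blast
    obtain k s where k: "F = bface a b k s" using d(1) unfolding ab2(2) facet_iff by blast
    obtain k' s' where k': "F' = bface a b k' s'" using F'(1) unfolding ab2(2) facet_iff by blast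
    have co: "co k \<rho> = s" "co k \<tau> = s" "co k' \<rho> = s'" "co k' \<tau> = s'" using d(2,3) F'(3,4) unfolding rt k k' by simp_all
    have kk: "k \<noteq> k'" using F'(2) co unfolding k k' by auto
    have "closed_segment (V a b \<rho>) (V a b \<tau>) \<inter> \<Omega> \<noteq> {}" using om unfolding rt by auto
    from around_edge[OF i cub_axioms ab2(2) kk this, unfolded co, folded k k' rt(1,2), OF refl refl]
    obtain i2 i3 i4 M2 M3 where I: "i2 \<in> I" "i3 \<in> I" "i4 \<in> I" "i2 \<noteq> i" "i3 \<noteq> i2" "i4 \<noteq> i3" "i4 \<noteq> i"
      and f12: "C i \<inter> C i2 = F" "F facet_of C i2"
      and f23: "C i2 \<inter> C i3 = M2" "M2 facet_of C i2" "M2 facet_of C i3" "closed_segment P Q \<subseteq> M2" "M2 \<noteq> F"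
      and f34: "C i3 \<inter> C i4 = M3" "M3 facet_of C i3" "M3 facet_of C i4" "closed_segment P Q \<subseteq> M3" "M3 \<noteq> M2"
      and f41: "C i4 \<inter> C i = F'" "F' facet_of C i4" "M3 \<noteq> F'" by (elim exE conjE)
    have PM: "P \<in> M2" "Q \<in> M2" "P \<in> M3" "Q \<in> M3" using f23(4) f34(4) by auto
    have "r = i2" by (rule neighbor_unique[OF i r(1) I(1) r(2)[symmetric] I(4)[symmetric] d(1) r(3) f12(2)])
    then have r2: "removed i2 P" using r(4) by simp
    have inc2: "incident (C i2) P Q" by (rule incident_transfer[OF i I(1,4) d(1) f12(2) d(2,3,4)])
    have inc3: "incident (C i3) P Q" by (rule incident_transfer[OF I(1,2,5) f23(2,3) PM(1,2) inc2])
    have inc4: "incident (C i4) P Q" by (rule incident_transfer[OF I(2,3,6) f34(2,3) PM(3,4) inc3])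
    have A2: "incident (C i2) P A" by (rule incident_transfer[OF i I(1,4) d(1) f12(2) d(2) A(1,5)])
    have node: "P \<in> nodes (C h) \<and> closed_segment P Q edge_of C h" if "h \<in> I" "incident (C h) P Q" for h
      using incident_nodes[OF that] that(2) unfolding incident_def by blast
    have sys: "G h \<in> graph_system \<G> (G i)" if "h \<in> I" "incident (C h) P Q" for h
      by (rule graph_systemI[OF i that(1)]) (use d(4) that in \<open>auto simp: incident_def\<close>)
    have dP: "disperse c (G h) P" if h: "h \<in> I" "incident (C h) P Q" "removed h P" for h
    proof -
      have "lb h P = 1" using h removed_label by blast
      then show ?thesis using node[OF h(1,2)] h(1) c01 unfolding disperse_def by simp
    qed
    \<comment> \<open>\<open>h\<close> is the cell where the walk stops, \<open>g\<close> the
      removed cell just before it. \<open>P\<close> is disperse in \<open>i2\<close> and in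
      \<open>g\<close>, so it connects the corner \<open>A\<close> of \<open>F\<close> with the
      corner \<open>B\<close> of \<open>K\<close>, unless these are the same node.\<close>
    have fin: "continued (C i, w) {P, Q}"
      if h: "h \<in> I" "h \<noteq> i" "Dface h K P Q" "\<not> removed h P" and K': "K' facet_of C h" "K \<noteq> K'" "P \<in> K'" "Q \<in> K'"
        and g: "g \<in> I" "g \<noteq> h" "K facet_of C g" "removed g P" for h g K K'
    proof -
      note dh = DfaceD[OF h(3)]
      have nr: "\<not> removed h P" "\<not> removed h Q" using h(4) removed_both[OF h(1) dh(4) ff] by blast+
      have lh: "lb h P = c" "lb h Q = c" using not_removed_label[OF h(1)] nr ff by auto
      obtain B where B: "B \<in> K" "B \<in> nodes (C h)" "B \<noteq> P" "B \<noteq> Q" "incident (C h) P B" "c < f B"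
        using Dface_neighbor[OF h(1,3) K'] by blast
      obtain w' where w': "inner_iso_path c \<G> (G h) w'" "{P, Q} \<in> w'" using Dface_path(2)[OF h(1,3) lh] by blast
      have ginc: "incident (C g) P Q" "incident (C g) P B"
        by (rule incident_transfer[OF h(1) g(1,2) dh(1) g(3) dh(2,3,4)], rule incident_transfer[OF h(1) g(1,2) dh(1) g(3) dh(2) B(1,5)])
      have dn: "disperse c (G g') Y" if "g' \<in> I" "c < f Y" "incident (C g') P Y" for g' Y
        using label_disperse[OF that(1,2)] incident_nodes[OF that(1,3)] that(1) unfolding disperse_def by simp
      have "A = B \<or> disperse_path c (graph_system \<G> (G i)) A B"
      proof (cases "A = B")
        case False
        have "disperse_path c (graph_system \<G> (G i)) A B"
        proof (rule disperse_path3[of A P B "G i2" _ _ "G g"])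
          show "distinct [A, P, B]" using False A(3) B(3) by auto
          show "G i2 \<in> graph_system \<G> (G i)" "G g \<in> graph_system \<G> (G i)" using sys I(1) inc2 g(1) ginc(1) by blast+
          show "incident (cuboid (G i2)) A P" using A2 incident_sym I(1) by simp
          show "incident (cuboid (G g)) P B" using ginc(2) g(1) by simp
          show "disperse c (G i2) A" by (rule dn[OF I(1) A(6) A2])
          show "disperse c (G i2) P" by (rule dP[OF I(1) inc2 r2])
          show "disperse c (G g) P" by (rule dP[OF g(1) ginc(1) g(4)])
          show "disperse c (G g) B" by (rule dn[OF g(1) B(6) ginc(2)])
        qed
        then show ?thesis by blast
      qed simp
      from continued_by_node[OF i h(1) sys[OF h(1) dh(4)] w(1) w'(1) w(2) w'(2) _ corA Dface_path(3)[OF h(1,3) lh w' B(1-4)] this]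
      show ?thesis using C_inj[OF h(1) i] h(2) by auto
    qed
    have D2: "Dface i2 F P Q" by (rule Dface_transfer[OF D i I(1,4) f12(2)])
    \<comment> \<open>The walk has to stop in the fourth cell: if \<open>P\<close> were removed
      there as well, it would reach \<open>i\<close> through \<open>F'\<close> or remove
      \<open>P\<close> in \<open>i\<close>.\<close>
    have X4: "continued (C i, w) {P, Q}" if D3: "Dface i3 M3 P Q" and r3: "removed i3 P"
    proof (cases "removed i4 P")
      case False
      have D4: "Dface i4 M3 P Q" by (rule Dface_transfer[OF D3 I(2,3,6) f34(3)])
      show ?thesis by (rule fin[OF I(3,7) D4 False f41(2,3) F'(3,4) I(2) I(6)[symmetric] f34(2) r3])
    next
      case True
      have D4: "Dface i4 M3 P Q" by (rule Dface_transfer[OF D3 I(2,3,6) f34(3)])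
      from removed_step[OF I(3) D4 True ff(2) f41(2,3) F'(3,4) i I(7)[symmetric] F'(1)]
      have False
      proof
        assume "Dface i4 F' P Q"
        then show False using Dface_transfer[OF _ I(3) i I(7)[symmetric] F'(1)] nD' by blast
      next
        assume "F2alt i4 i"
        from F2_removed[OF F2alt_sym[OF this I(3)] i PQn(1) ff(1)] show False using lab(1) by simp
      qed
      then show ?thesis ..
    qed
    from removed_step[OF I(1) D2 r2 ff(2) f23(2) f23(5)[symmetric] PM(1,2) I(2,5) f23(3)]
    show ?thesis
    proof
      assume "Dface i2 M2 P Q"
      then have D3: "Dface i3 M2 P Q" by (rule Dface_transfer[OF _ I(1,2,5) f23(3)])
      show ?thesis
      proof (cases "removed i3 P")
        case False
        show ?thesis
        proof (cases "i3 = i")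
          case True
          have "M2 facet_of C i" using f23(3) True by simp
          have "C i2 \<inter> C i3 = F" using f12(1) True by blast
          then show ?thesis using f23(1,5) by simp
        next
          case ne: False
          show ?thesis by (rule fin[OF I(2) ne D3 False f34(2) f34(5)[symmetric] PM(3,4) I(1) I(5)[symmetric] f23(2) r2])
        qed
      next
        case True
        from removed_step[OF I(2) D3 True ff(2) f34(2) f34(5)[symmetric] PM(3,4) I(3,6) f34(3)]
        show ?thesis
        proof
          assume "Dface i3 M3 P Q" then show ?thesis using X4 True by blast
        next
          assume F2: "F2alt i3 i4"
          have "Dface i4 F' P Q" by (rule F2_exit[OF I(2) F2 f34(1) f41(2,3) inc4 PM(3,4) F'(3,4)])
          then show ?thesis using Dface_transfer[OF _ I(3) i I(7)[symmetric] F'(1)] nD' by blast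
        qed
      qed
    next
      \<comment> \<open>An F2-pair covers two cells at once: the edge is removed in the third cell
        too, and the walk leaves that cell through \<open>M3\<close>.\<close>
      assume F2: "F2alt i2 i3"
      have "c < lb i3 P" using F2_removed[OF F2alt_sym[OF F2 I(1)] I(2) _ ff(1)] node[OF I(2) inc3] by blast
      then have "removed i3 P" unfolding removed_def using node[OF I(2) inc3] ff by auto
      moreover have "Dface i3 M3 P Q" by (rule F2_exit[OF I(1) F2 f23(1) f34(2) f34(5)[symmetric] inc3 PM(1,2) PM(3,4)])
      ultimately show ?thesis using X4 by blast
    qed
  qed
qed

end

section \<open>Every line of every iso-path is continued\<close>

lemma cn_axis: "k2 \<noteq> k \<Longrightarrow> (\<forall>s u v. co k2 (cn k s u v) = u) \<or> (\<forall>s u v. co k2 (cn k s u v) = v)"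
  using exhaust_3[of k2] exhaust_3[of k] by (auto simp: cn.simps)

context cubc begin

lemma line_eq: "line t (dd t) k s = {ipt c t (V a b (cn k s p q)) (V a b (cn k s p' q')) | p q p' q'.
    (p = p') \<noteq> (q = q') \<and> \<not> c < t (V a b (cn k s p q)) \<and> c < t (V a b (cn k s p' q'))}"
proof (intro equalityI subsetI)
  fix x assume "x \<in> line t (dd t) k s"
  then obtain \<rho> \<tau> where h: "x = ip t \<rho> \<tau>" "co k \<rho> = s" "co k \<tau> = s" "adj \<rho> \<tau>" "\<not> dd t \<rho>" "dd t \<tau>" unfolding line_def by blast
  obtain p q where r: "\<rho> = cn k s p q" using cnE[OF h(2)] by blast
  obtain p' q' where t: "\<tau> = cn k s p' q'" using cnE[OF h(3)] by blast
  show "x \<in> {ipt c t (V a b (cn k s p q)) (V a b (cn k s p' q')) | p q p' q'.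
    (p = p') \<noteq> (q = q') \<and> \<not> c < t (V a b (cn k s p q)) \<and> c < t (V a b (cn k s p' q'))}"
    unfolding mem_Collect_eq
    by (rule exI[of _ p], rule exI[of _ q], rule exI[of _ p'], rule exI[of _ q'])
      (use h(1,4-6) in \<open>simp add: r t ip_ipt dd_def\<close>)
next
  fix x assume "x \<in> {ipt c t (V a b (cn k s p q)) (V a b (cn k s p' q')) | p q p' q'.
    (p = p') \<noteq> (q = q') \<and> \<not> c < t (V a b (cn k s p q)) \<and> c < t (V a b (cn k s p' q'))}"
  then obtain p q p' q' where h: "x = ipt c t (V a b (cn k s p q)) (V a b (cn k s p' q'))" "(p = p') \<noteq> (q = q')"
    "\<not> c < t (V a b (cn k s p q))" "c < t (V a b (cn k s p' q'))" unfolding mem_Collect_eq by (elim exE conjE)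
  show "x \<in> line t (dd t) k s" unfolding line_def mem_Collect_eq
    by (rule exI[of _ "cn k s p q"], rule exI[of _ "cn k s p' q'"])
      (use h in \<open>simp add: ip_ipt dd_def\<close>)
qed

lemma inner_card:
  assumes reg: "regular_graph c \<G> (Gr t)" and w: "inner_iso_path c \<G> (Gr t) w"
  shows "3 \<le> card w" "card w \<le> 6"
proof -
  obtain \<sigma> where s: "src (dd t) \<sigma>" "w = pp t (res (dd t) \<sigma>)" using w unfolding inner_pp[OF reg] by blast
  show "3 \<le> card w" "card w \<le> 6" unfolding s(2) using pp_card[OF regular_mixed(1)[OF reg] s(1) regular_mixed(2)[OF reg]] by blast+
qed

text \<open>Both continuous corners have label c and are not isolated by T1-freeness. In an S3
  pattern they would own the same residual pattern, but on an L-face this keeps at most one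
  continuous corner.\<close>

lemma trivial_not_ctype:
  assumes reg: "regular_graph c \<G> (Gr t)" and L: "aL (dd t) (cn k s)" and z: "zz t (cn k s (\<not> u) v)" "zz t (cn k s u (\<not> v))"
  shows "\<not> ctype (dd t)"
proof
  assume ct: "ctype (dd t)"
  let ?d = "dd t" let ?R = "cn k s (\<not> u) v" and ?S = "cn k s u (\<not> v)"
  note mx = regular_mixed(1)[OF reg] and sf = regular_mixed(2)[OF reg]
  have nd: "\<not> ?d ?R" "\<not> ?d ?S" using zz_not_dd z by blast+
  have nco: "\<not> coiso ?d X" if "zz t X" for X
  proof
    assume co: "coiso ?d X"
    have "T1_node c (Gr t) (V a b X)" unfolding T1_node_def Gr_simps
    proof (intro conjI allI impI)
      show "t (V a b X) = c" using that unfolding zz_def .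
      fix Q assume "incident (cbox a b) (V a b X) Q"
      then obtain \<rho> \<tau> where "V a b X = V a b \<rho>" "Q = V a b \<tau>" "adj \<rho> \<tau>" unfolding incident_iff by blast
      then show "disperse c (Gr t) Q" using co unfolding coiso_def by simp
    qed simp
    then show False using sf unfolding singular_free_def by blast
  qed
  have sr: "src ?d ?R" "src ?d ?S" using ct nd unfolding src_def by simp_all
  have e: "res ?d ?R = res ?d ?S" unfolding res_def res0_def using ct nco[OF z(1)] nco[OF z(2)] by simp
  have "\<not> res ?d ?R ?R" "\<not> res ?d ?S ?S" using res_self[OF mx sr(1)] res_self[OF mx sr(2)] ct by simp_all
  then have "\<not> res ?d ?R ?R" "\<not> res ?d ?R ?S" using e by simp_all
  then show False using res_L[OF mx sr(1) L, of "\<not> u" v u "\<not> v"] ct by simp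
qed

text \<open>The line is the diagonal between the two iso-nodes and looks the same from both disperse
  corners. Which of them it corresponds to is decided by the set \<open>K\<close> of the
  path.\<close>

lemma trivial_corresponds:
  assumes reg: "regular_graph c \<G> (Gr t)" and L: "aL (dd t) (cn k s)" and nct: "\<not> ctype (dd t)"
    and D: "dd t (cn k s u v)" and z: "zz t (cn k s (\<not> u) v)" "zz t (cn k s u (\<not> v))"
  shows "inner_iso_path c \<G> (Gr t) (pp t (res (dd t) (cn k s u v)))"
    "{V a b (cn k s (\<not> u) v), V a b (cn k s u (\<not> v))} \<in> pp t (res (dd t) (cn k s u v))"
    "corresponds c \<G> (Gr t) (cbox a b, pp t (res (dd t) (cn k s u v))) {V a b (cn k s (\<not> u) v), V a b (cn k s u (\<not> v))} (V a b (cn k s u v))"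
proof -
  let ?w = "pp t (res (dd t) (cn k s u v))" and ?l = "{V a b (cn k s (\<not> u) v), V a b (cn k s u (\<not> v))}"
  note mx = regular_mixed(1)[OF reg]
  note x = exist_disp[OF mx L nct D]
  show w: "inner_iso_path c \<G> (Gr t) ?w" unfolding inner_pp[OF reg] using x(1) by blast
  show l: "?l \<in> ?w" using x(4)[where t = t] unfolding ip_zz[OF z(1)] ip_zz[OF z(2)] .
  have D': "dd t (cn k s (\<not> u) (\<not> v))" using aL_vals(3)[OF L, of u v] D by simp
  have nd: "\<not> dd t (cn k s (\<not> u) v)" "\<not> dd t (cn k s u (\<not> v))" using zz_not_dd z by blast+
  have two: "(p, q) = (\<not> u, v) \<or> (p, q) = (u, \<not> v)" if n: "\<not> dd t (cn k s p q)" for p q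
  proof (rule ccontr)
    assume "\<not> ?thesis"
    then have "(p, q) = (u, v) \<or> (p, q) = (\<not> u, \<not> v)" by auto
    then show False using n D D' by auto
  qed
  have iso: "iso_node c (Gr t) P" if P: "P \<in> bface a b k s" "continuous_node c (Gr t) P" for P
  proof -
    obtain \<xi> where xi: "P = V a b \<xi>" "\<not> dd t \<xi>" using P(2) unfolding continuous_iff by blast
    have "co k \<xi> = s" using P(1) unfolding xi(1) by simp
    then obtain p q where pq: "\<xi> = cn k s p q" using cnE by blast
    have o: "(p, q) = (\<not> u, v) \<or> (p, q) = (u, \<not> v)" using two xi(2) unfolding pq by blast
    have "adj \<xi> (cn k s u v)" "zz t \<xi>" using o z unfolding pq by auto
    then show ?thesis unfolding xi(1) iso_node_V using D by blast
  qed
  have tr: "trivial_L_face c (Gr t) (bface a b k s)"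
    unfolding trivial_L_face_def L_face_iff using L iso by blast
  have ln: "line t (dd t) k s = ?l"
  proof (intro equalityI subsetI)
    fix y assume "y \<in> line t (dd t) k s"
    then obtain \<rho> \<tau> where h: "y = ip t \<rho> \<tau>" "co k \<rho> = s" "\<not> dd t \<rho>" unfolding line_def by blast
    obtain p q where pq: "\<rho> = cn k s p q" using cnE[OF h(2)] by blast
    have "\<rho> = cn k s (\<not> u) v \<or> \<rho> = cn k s u (\<not> v)" using two[of p q] h(3) unfolding pq by auto
    then show "y \<in> ?l" using ip_zz z unfolding h(1) by auto
  next
    fix y assume "y \<in> ?l"
    then consider "y = V a b (cn k s (\<not> u) v)" | "y = V a b (cn k s u (\<not> v))" by blast
    then show "y \<in> line t (dd t) k s"
    proof cases
      case 1
      have "y = ip t (cn k s (\<not> u) v) (cn k s u v)" using 1 ip_zz[OF z(1)] by simp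
      then show ?thesis unfolding line_def mem_Collect_eq
        by (intro exI[of _ "cn k s (\<not> u) v"] exI[of _ "cn k s u v"]) (simp add: nd D)
    next
      case 2
      have "y = ip t (cn k s u (\<not> v)) (cn k s u v)" using 2 ip_zz[OF z(2)] by simp
      then show ?thesis unfolding line_def mem_Collect_eq
        by (intro exI[of _ "cn k s u (\<not> v)"] exI[of _ "cn k s u v"]) (simp add: nd D)
    qed
  qed
  obtain K where K: "inner_iso_path_from c \<G> (Gr t) ?w K" "\<not> ctype (dd t) \<longrightarrow> K = V a b ` {\<tau>. res (dd t) (cn k s u v) \<tau>}"
    using inner_bwd[OF reg x(1)] by blast
  have PK: "V a b (cn k s u v) \<in> K" using K(2) nct x(2) by blast
  have fl: "?l = face_iso_points c (Gr t) (bface a b k s)" unfolding face_iso_points_eq ln ..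
  have ex: "\<exists>K. inner_iso_path_from c \<G> (Gr t) (snd (cbox a b, ?w)) K \<and> V a b (cn k s u v) \<in> K"
    by (rule exI[of _ K]) (use K(1) PK in simp)
  note third = conjI[OF tr conjI[OF fl ex]]
  have M: "V a b (cn k s u v) \<in> bface a b k s" by simp
  show "corresponds c \<G> (Gr t) (cbox a b, ?w) ?l (V a b (cn k s u v))"
    unfolding corresponds_def inner_path_of_def
    by (intro conjI, simp, simp add: w, simp add: l, simp add: D, rule exI[of _ "bface a b k s"], rule conjI, rule M, rule disjI2, rule disjI2, rule third)
qed

end

context labeling begin

lemma line_in_domain:
  assumes h: "h \<in> I" "iso_path_of c \<G> (G h) p" "l \<in> snd p" "l \<subseteq> C h"
  shows "l \<subseteq> \<Omega>"
proof
  fix x assume x: "x \<in> l"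
  define Pc where "Pc = (1 / real (card (\<Union>(snd p)))) *\<^sub>R (\<Sum>P\<in>\<Union>(snd p). P)"
  have "x \<in> convex hull (insert Pc l)" using x by (intro hull_inc) blast
  then have "x \<in> iso_element p" unfolding iso_element_def Let_def Pc_def using h(3) by blast
  moreover have "iso_element p \<in> iso_elements c \<G>" unfolding iso_elements_def using h(1,2) GG by blast
  ultimately have "x \<notin> frontier \<Omega>" using bd by blast
  moreover have "x \<in> closure \<Omega>" using x h(1,4) cp unfolding cuboid_partition_def by blast
  ultimately show "x \<in> \<Omega>" using op by (simp add: frontier_def interior_open)
qed

lemma inner_continued:
  assumes i: "i \<in> I" and w: "inner_iso_path c \<G> (G i) w" "l \<in> w"
  shows "continued (C i, w) l"
proof -
  obtain a b where ab2: "cubc a b c" "C i = cbox a b" "G i = cubc.Gr a b (lb i)" using box[OF i] by blast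
  interpret cubc a b c by fact
  define t where "t = lb i"
  have Gi: "G i = Gr t" unfolding t_def by (fact ab2(3))
  have reg0: "regular_graph c \<G> (G i)" by (rule inner_regular[OF w(1)])
  have reg: "regular_graph c \<G> (Gr t)" using reg0 unfolding Gi .
  have w1: "inner_iso_path c \<G> (Gr t) w" using w(1) unfolding Gi .
  note mx = regular_mixed(1)[OF reg] and sf = regular_mixed(2)[OF reg]
  obtain k s \<sigma> where z: "src (dd t) \<sigma>" "w = pp t (res (dd t) \<sigma>)" "areg (res (dd t) \<sigma>) (zz t) (cn k s)"
    "l = line t (res (dd t) \<sigma>) k s" "l \<subseteq> bface a b k s" using inner_line_facet[OF reg w1 w(2)] by metis
  define M where "M = bface a b k s"
  have lM: "l \<subseteq> M" unfolding M_def by (fact z(5))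
  have ip: "iso_path_of c \<G> (G i) (C i, w)" unfolding iso_path_of_def inner_path_of_def using w(1) i by simp
  note il = inner_line[OF i w]
  have lO: "l \<subseteq> \<Omega>" by (rule line_in_domain[OF i ip _ il(1)]) (use w(2) in simp)
  have Mf: "M facet_of C i" using bface_facet[of k s] unfolding M_def ab2(2) .
  have "M \<inter> \<Omega> \<noteq> {}" using lM lO il(2) by blast
  from neighbor[OF i Mf this] obtain j where j: "j \<in> I" "j \<noteq> i" "C i \<inter> C j = M" "M facet_of C j" by blast
  obtain a' b' where F: "cubc a' b' c" "C j = cbox a' b'" "G j = cubc.Gr a' b' (lb j)" "bface a b k s = bface a' b' k (\<not> s)"
     "\<forall>u v. V a' b' (cn k (\<not> s) u v) = V a b (cn k s u v)"
    using frame[OF i ab2(1,2) j(1,2) j(4)[unfolded M_def]] by (elim exE conjE)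
  note F5 = F(5)[rule_format]
  interpret B: cubc a' b' c by fact
  define tj where "tj = lb j"
  have Gj: "G j = B.Gr tj" unfolding tj_def by (fact F(3))
  \<comment> \<open>The corners of \<open>M\<close> under the addresses valid in both cells; the
    labels of \<open>i\<close> and \<open>j\<close> are compared through them.\<close>
  define R where "R u v = V a b (cn k s u v)" for u v
  have Rn: "R u v \<in> nodes (C i)" "R u v \<in> nodes (C j)" "R u v \<in> M" for u v
  proof -
    show "R u v \<in> nodes (C i)" unfolding R_def ab2(2) by (rule V_nodes)
    have "V a' b' (cn k (\<not> s) u v) \<in> nodes (C j)" unfolding F(2) by (rule B.V_nodes)
    then show "R u v \<in> nodes (C j)" unfolding R_def F5 .
    show "R u v \<in> M" unfolding R_def M_def by simp
  qed
  have Req: "R u v = R u' v' \<longleftrightarrow> u = u' \<and> v = v'" for u v u' v' unfolding R_def by simp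
  have inci: "incident (C i) (R u v) (R u' v')" if "(u = u') \<noteq> (v = v')" for u v u' v'
    unfolding R_def ab2(2) using that by simp
  have incj: "incident (C j) (R u v) (R u' v')" if "(u = u') \<noteq> (v = v')" for u v u' v'
    by (rule incident_transfer[OF i j(1,2) Mf j(4) Rn(3) Rn(3) inci[OF that]])
  have ddR: "dd t (cn k s u v) \<longleftrightarrow> c < t (R u v)" for u v unfolding dd_def R_def ..
  have zzR: "zz t (cn k s u v) \<longleftrightarrow> t (R u v) = c" for u v unfolding zz_def R_def ..
  have ddj: "B.dd tj (cn k (\<not> s) u v) \<longleftrightarrow> c < tj (R u v)" for u v unfolding B.dd_def F5 R_def ..
  have zzj: "B.zz tj (cn k (\<not> s) u v) \<longleftrightarrow> tj (R u v) = c" for u v unfolding B.zz_def F5 R_def ..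
  have corner: "\<exists>p q. X = R p q" if X: "X \<in> nodes (C i)" "X \<in> M" for X
  proof -
    obtain \<xi> where x: "X = V a b \<xi>" using X(1) unfolding ab2(2) nodes_eq by blast
    have "co k \<xi> = s" using X(2) unfolding x M_def by simp
    then obtain p q where "\<xi> = cn k s p q" using cnE by blast
    then show ?thesis unfolding x R_def by blast
  qed
  have ti: "t P = f P \<or> f P = c \<and> t P = 1" for P using label_cases[OF i, of P] unfolding t_def by blast
  have tjc: "tj P = f P \<or> f P = c \<and> tj P = 1" for P using label_cases[OF j(1), of P] unfolding tj_def by blast
  have remi: "removed i (R u v)" if "f (R u v) = c" "t (R u v) \<noteq> c" for u v
    using that Rn(1) unfolding removed_def t_def by blast
  have remj: "removed j (R u v)" if "f (R u v) = c" "tj (R u v) \<noteq> c" for u v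
    using that Rn(2) unfolding removed_def tj_def by blast
  have ri: "c < t (R u' v')" if "removed i (R u v)" "(u = u') \<noteq> (v = v')" for u v u' v'
    unfolding t_def by (rule removed_incident[OF i that(1) inci[OF that(2)]])
  have rj: "c < tj (R u' v')" if "removed j (R u v)" "(u = u') \<noteq> (v = v')" for u v u' v'
    unfolding tj_def by (rule removed_incident[OF j(1) that(1) incj[OF that(2)]])
  have regj: "regular_graph c \<G> (G j)" if "tj (R u v) \<le> c" "c < tj (R u' v')" for u v u' v'
    by (rule regularI[OF j(1) Rn(2) Rn(2)]) (use that in \<open>simp_all add: tj_def\<close>)
  have lL: "l \<in> Lset c \<G> (G i) M" unfolding Lset_def using lM w by blast
  have sysj: "G j \<in> graph_system \<G> (G i)" by (rule graph_system_neighbor[OF i j(1,2) Mf j(4)])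
  have nej: "(C j, w') \<noteq> (C i, w)" for w' using C_inj[OF j(1) i] j(2) by auto
  show ?thesis
  proof (cases "nontrivial_L_face c (G i) M")
    case True
    have "linked i j M" by (rule nontrivial_linked[OF i j(1,2,3) Mf j(4) reg0 True])
    from linked_continued[OF this _ i ip] show ?thesis using lL w(2) by simp
  next
    case triv: False
    have notnt: "\<not> (t (R u v) < c \<and> c < t (R (\<not> u) v) \<and> c < t (R u (\<not> v)) \<and> t (R (\<not> u) (\<not> v)) \<le> c)" for u v
      using triv unfolding Gi M_def nontrivial_iff R_def by blast
    from mx z(1,3) show ?thesis
    proof (cases rule: pp_lines)
      case reg
      have ln: "l = line t (dd t) k s" using reg(4) z(4) by simp
      have nL: "\<not> aL (dd t) (cn k s)" by (fact reg(1))
      show ?thesis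
      proof (cases "\<forall>u v. tj (R u v) = t (R u v)")
        \<comment> \<open>With equal labels at the four corners the neighbor draws the same line,
          and any disperse corner of the face corresponds to it on both sides.\<close>
        case eq: True
        have ddE: "B.dd tj (cn k (\<not> s) u v) = dd t (cn k s u v)" for u v unfolding ddj ddR using eq by simp
        have zzE: "B.zz tj (cn k (\<not> s) u v) = zz t (cn k s u v)" for u v unfolding zzj zzR using eq by simp
        have arE: "areg (B.dd tj) (B.zz tj) (cn k (\<not> s))"
          using reg(3) unfolding areg_def aL_def fcount_def ddE zzE .
        have lnE: "B.line tj (B.dd tj) k (\<not> s) = l"
          unfolding ln B.line_eq line_eq F5 R_def[symmetric] using eq by (simp add: ipt_def)
        obtain u v where uv: "dd t (cn k s u v)" using reg(3) unfolding areg_def by blast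
        obtain u' v' where uv': "\<not> dd t (cn k s u' v')" using reg(3) unfolding areg_def by blast
        have rgj: "regular_graph c \<G> (G j)" by (rule regj[of u' v' u v]) (use uv uv' eq in \<open>simp_all add: ddR\<close>)
        have rgj': "regular_graph c \<G> (B.Gr tj)" using rgj unfolding Gj .
        obtain w' where w': "inner_iso_path c \<G> (B.Gr tj) w'" "l \<in> w'" using B.regular_line_path[OF rgj' arE] unfolding lnE by blast
        have c1: "corresponds c \<G> (G i) (C i, w) l (R u v)"
          using regular_corresponds[OF w1 reg(3) _ uv co_cn] w(2) unfolding ln Gi ab2(2) R_def by blast
        have "B.dd tj (cn k (\<not> s) u v)" using uv unfolding ddE .
        from B.regular_corresponds[OF w'(1) arE _ this co_cn]
        have c2: "corresponds c \<G> (G j) (C j, w') l (R u v)" using w'(2) unfolding lnE F(2) Gj F5 R_def by blast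
        have w'': "inner_iso_path c \<G> (G j) w'" using w'(1) unfolding Gj .
        show ?thesis by (rule continued_by_node[OF i j(1) sysj w(1) w'' w(2) w'(2) nej c1 c2 disjI1[OF refl]])
      next
        case False
        then obtain u v where uv: "tj (R u v) \<noteq> t (R u v)" by blast
        have fR: "f (R u v) = c" using ti[of "R u v"] tjc[of "R u v"] uv by auto
        show ?thesis
        proof (cases "t (R u v) = c")
          case False
          \<comment> \<open>Removed in \<open>i\<close> but not in \<open>j\<close>: the corner and
            its two neighbors on the face are disperse in \<open>i\<close>. The fourth corner has
            label below c, or else the face would be disperse or singular. Seen from
            \<open>j\<close> the face is a non-trivial L-face.\<close>
          have rem: "removed i (R u v)" by (rule remi[OF fR False])
          have tj0: "tj (R u v) = c" using ti[of "R u v"] tjc[of "R u v"] uv fR False by auto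
          have t1: "c < t (R u v)" using ti[of "R u v"] fR False c01 by auto
          have AB: "c < t (R (\<not> u) v)" "c < t (R u (\<not> v))" by (rule ri[OF rem], simp)+
          have X: "t (R (\<not> u) (\<not> v)) < c"
          proof (rule ccontr)
            assume n: "\<not> ?thesis"
            show False
            proof (cases "c < t (R (\<not> u) (\<not> v))")
              case True
              have "dd t (cn k s p q)" for p q using AB t1 True unfolding ddR by (cases "p = u"; cases "q = v") auto
              then show False using reg(3) unfolding areg_def by blast
            next
              case F': False
              then have "zz t (cn k s (\<not> u) (\<not> v))" using n unfolding zzR by simp
              moreover have "\<not> dd t (cn k s (\<not> u) (\<not> v))" using F' unfolding ddR .
              moreover have "dd t (cn k s (\<not> \<not> u) (\<not> v))" "dd t (cn k s (\<not> u) (\<not> \<not> v))" "dd t (cn k s (\<not> \<not> u) (\<not> \<not> v))"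
                using AB t1 unfolding ddR by simp_all
              ultimately show False using areg_co[of "dd t" "cn k s" "\<not> u" "\<not> v" "zz t"] reg(3) by blast
            qed
          qed
          have fX: "f (R (\<not> u) (\<not> v)) < c" using ti[of "R (\<not> u) (\<not> v)"] X c01 by auto
          \<comment> \<open>The fourth corner, of label below c, excludes an F2-pair and also that
            one of its neighbors was removed together with the corner. So these neighbors are
            disperse before the removal and in \<open>j\<close> as well.\<close>
          have fAB: "c < f (R (\<not> u) v) \<and> c < f (R u (\<not> v))"
            using i rem
          proof (cases rule: removed_cases)
            case (F2 i')
            then show ?thesis using F2altD[OF F2(1) Rn(1)[of "\<not> u" "\<not> v"]] fX by (auto split: if_splits)
          next
            case T1
            show ?thesis using T1[OF inci[of u "\<not> u" v v]] T1[OF inci[of u u v "\<not> v"]] by simp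
          next
            case (pair Q)
            have qa: "Q \<noteq> R (\<not> u) v"
            proof
              assume e: "Q = R (\<not> u) v"
              have "c < f (R (\<not> u) (\<not> v))" by (rule pair(4)) (use inci[of "\<not> u" "\<not> u" v "\<not> v"] e Req in auto)
              then show False using fX by simp
            qed
            have qb: "Q \<noteq> R u (\<not> v)"
            proof
              assume e: "Q = R u (\<not> v)"
              have "c < f (R (\<not> u) (\<not> v))" by (rule pair(4)) (use inci[of u "\<not> u" "\<not> v" "\<not> v"] e Req in auto)
              then show False using fX by simp
            qed
            have "c < f (R (\<not> u) v)" by (rule pair(4)) (use inci[of u "\<not> u" v v] qa Req in auto)
            moreover have "c < f (R u (\<not> v))" by (rule pair(4)) (use inci[of u u v "\<not> v"] qb Req in auto)
            ultimately show ?thesis by blast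
          qed
          have tjA: "c < tj (R (\<not> u) v)" "c < tj (R u (\<not> v))"
            using fAB label_disperse[OF j(1)] unfolding tj_def by blast+
          have tjX: "tj (R (\<not> u) (\<not> v)) < c" using tjc[of "R (\<not> u) (\<not> v)"] fX by auto
          have rgj: "regular_graph c \<G> (G j)" by (rule regj[of u v "\<not> u" v]) (use tj0 tjA in simp_all)
          have "\<exists>p q. tj (V a' b' (cn k (\<not> s) p q)) < c \<and> c < tj (V a' b' (cn k (\<not> s) (\<not> p) q)) \<and>
              c < tj (V a' b' (cn k (\<not> s) p (\<not> q))) \<and> tj (V a' b' (cn k (\<not> s) (\<not> p) (\<not> q))) \<le> c"
            unfolding F5 R_def[symmetric]
            by (rule exI[of _ "\<not> u"], rule exI[of _ "\<not> v"]) (use tjA tjX tj0 in simp)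
          then have "nontrivial_L_face c (B.Gr tj) (bface a' b' k (\<not> s))" unfolding B.nontrivial_iff .
          then have nt: "nontrivial_L_face c (G j) M" unfolding Gj M_def F(4) .
          have ji: "C j \<inter> C i = M" using j(3) by blast
          have "linked j i M" by (rule nontrivial_linked[OF j(1) i j(2)[symmetric] ji j(4) Mf rgj nt])
          from linked_continued[OF this _ i ip] show ?thesis using lL w(2) by simp
        next
          case tR: True
          \<comment> \<open>Removed in \<open>j\<close> but not in \<open>i\<close>: the corner has
            label c in \<open>i\<close>. Two disperse neighbors on the face would make it singular
            or an L-face, so another corner is removed along with it, and the line is the edge
            between the two.\<close>
          then have rem: "removed j (R u v)" using remj[OF fR] uv by simp
          have edgecase: "continued (C i, w) l" if adj': "(u = u') \<noteq> (v = v')" and fq: "f (R u' v') = c"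
              and oth: "\<And>p q. (p, q) \<noteq> (u, v) \<Longrightarrow> (p, q) \<noteq> (u', v') \<Longrightarrow> c < f (R p q)" for u' v'
          proof -
            have tq: "t (R u' v') = c"
            proof (rule ccontr)
              assume n: "t (R u' v') \<noteq> c"
              have "(u' = u) \<noteq> (v' = v)" using adj' by auto
              from ri[OF remi[OF fq n] this] show False using tR by simp
            qed
            have D: "Dface i M (R u v) (R u' v')"
              unfolding Dface_def
            proof (intro conjI ballI impI)
              show "incident (C i) (R u v) (R u' v')" by (rule inci[OF adj'])
              fix X assume X: "X \<in> nodes (C i)" "X \<in> M" "X \<noteq> R u v" "X \<noteq> R u' v'"
              obtain p q where x: "X = R p q" using corner[OF X(1,2)] by blast
              have n: "\<not> (p = u \<and> q = v)" "\<not> (p = u' \<and> q = v')" by (fact X(3)[unfolded x Req], fact X(4)[unfolded x Req])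
              show "c < f X" unfolding x by (rule oth; unfold prod.inject; fact n)
            qed (fact Mf, fact Rn(3), fact Rn(3))
            have za: "zz t (cn k s u v)" "zz t (cn k s u' v')" using tR tq unfolding zzR by simp_all
            have od: "dd t \<xi>" if x: "co k \<xi> = s" "\<xi> \<noteq> cn k s u v" "\<xi> \<noteq> cn k s u' v'" for \<xi>
            proof -
              obtain p q where pq: "\<xi> = cn k s p q" using cnE[OF x(1)] by blast
              have n: "\<not> (p = u \<and> q = v)" "\<not> (p = u' \<and> q = v')" using x(2,3) unfolding pq by blast+
              have "c < f (R p q)" by (rule oth; unfold prod.inject; fact n)
              then have "c < t (R p q)" unfolding t_def by (rule label_disperse[OF i])
              then show ?thesis unfolding pq ddR .
            qed
            have aa: "adj (cn k s u v) (cn k s u' v')" using adj' by simp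
            have "line t (dd t) k s = {V a b (cn k s u v), V a b (cn k s u' v')}"
              by (rule edge_face(2)[OF aa za co_cn co_cn]) (rule od, assumption+)
            then have le: "l = {R u v, R u' v'}" unfolding ln R_def .
            obtain m where m: "co m (cn k s u v) \<noteq> co m (cn k s u' v')" "\<forall>n. n \<noteq> m \<longrightarrow> co n (cn k s u v) = co n (cn k s u' v')"
              using aa unfolding adj_iff by blast
            obtain k2 where k2: "k2 \<noteq> k" "k2 \<noteq> m" using third_axis by blast
            define F' where "F' = bface a b k2 (co k2 (cn k s u v))"
            have F': "F' facet_of C i" "M \<noteq> F'" "R u v \<in> F'" "R u' v' \<in> F'"
            proof -
              show "F' facet_of C i" using bface_facet unfolding F'_def ab2(2) .
              show "M \<noteq> F'" unfolding M_def F'_def using k2(1) by simp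
              show "R u v \<in> F'" "R u' v' \<in> F'" unfolding F'_def R_def using m(2) k2(2) by simp_all
            qed
            have tl: "lb i (R u v) = c" "lb i (R u' v') = c" using tR tq unfolding t_def by simp_all
            have RO: "R u v \<in> \<Omega>" using lO le by blast
            have wl: "{R u v, R u' v'} \<in> w" using w(2) le by simp
            show ?thesis unfolding le
              by (rule edge_line_continued[OF i D F' tl w(1) wl RO j(1,2,4) rem])
          qed
          have both: False if AB: "c < f (R (\<not> u) v)" "c < f (R u (\<not> v))"
          proof -
            have tAB: "c < t (R (\<not> u) v)" "c < t (R u (\<not> v))" using AB label_disperse[OF i] unfolding t_def by blast+
            have d: "\<not> dd t (cn k s u v)" "dd t (cn k s (\<not> u) v)" "dd t (cn k s u (\<not> v))" using tAB tR unfolding ddR by simp_all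
            have zR: "zz t (cn k s u v)" using tR unfolding zzR .
            show False
            proof (cases "dd t (cn k s (\<not> u) (\<not> v))")
              case True
              then show False using areg_co[of "dd t" "cn k s" u v "zz t", OF d True] zR reg(3) by blast
            next
              case n: False
              have "aL (dd t) (cn k s)" using d n unfolding aL_def by (cases u; cases v) auto
              then show False using nL by blast
            qed
          qed
          from j(1) rem show ?thesis
          proof (cases rule: removed_cases)
            case (F2 j')
            have j': "j' \<in> I" "j' \<noteq> j" "(C j \<inter> C j') facet_of C j" "(C j \<inter> C j') facet_of C j'" using F2(1) unfolding F2alt_def by blast+
            have inC: "R p q \<in> C j" for p q using Rn(2)[of p q] unfolding nodes_def extreme_point_of_def by blast
            have fK: "if R p q \<in> C j' then f (R p q) = c else c < f (R p q)" for p q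
              using F2altD[OF F2(1) Rn(2)[of p q]] inC[of p q] by (auto split: if_splits)
            \<comment> \<open>If \<open>M\<close> were the common face of the F2-pair, the corner
              would be removed in \<open>i\<close> too. So that face meets \<open>M\<close> in an
              edge, whose ends are the two label-c corners of \<open>M\<close>.\<close>
            have neM: "C j \<inter> C j' \<noteq> M"
            proof
              assume e: "C j \<inter> C j' = M"
              have "i = j'" by (rule neighbor_unique[OF j(1) i j'(1) j(2) j'(2)[symmetric] j(4) Mf j'(4)[unfolded e]])
              then have "F2alt i j" using F2alt_sym[OF F2(1) j(1)] by simp
              from F2_removed[OF this i Rn(1) fR] show False using tR unfolding t_def by simp
            qed
            obtain k2 s2 where k2: "C j \<inter> C j' = bface a' b' k2 s2" using j'(3) unfolding F(2) B.facet_iff by blast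
            have memK: "R p q \<in> C j' \<longleftrightarrow> co k2 (cn k (\<not> s) p q) = s2" for p q
            proof -
              have "R p q \<in> C j' \<longleftrightarrow> R p q \<in> C j \<inter> C j'" using inC by blast
              also have "\<dots> \<longleftrightarrow> co k2 (cn k (\<not> s) p q) = s2" unfolding k2 R_def F5[symmetric] by simp
              finally show ?thesis .
            qed
            have kk: "k2 \<noteq> k"
            proof
              assume e: "k2 = k"
              have "s2 = (\<not> s)" using memK[of u v] F2(2) unfolding e by simp
              then show False using neM k2 e unfolding M_def F(4) by simp
            qed
            from cn_axis[OF kk] show ?thesis
            proof
              assume e: "\<forall>s u v. co k2 (cn k s u v) = u"
              have su: "s2 = u" using memK[of u v] F2(2) e by simp
              show ?thesis
              proof (rule edgecase[of u "\<not> v"])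
                show "f (R u (\<not> v)) = c" using fK[of u "\<not> v"] memK[of u "\<not> v"] e su by simp
                fix p q assume "(p, q) \<noteq> (u, v)" "(p, q) \<noteq> (u, \<not> v)"
                then have "p \<noteq> u" by auto
                then show "c < f (R p q)" using fK[of p q] memK[of p q] e su by simp
              qed simp
            next
              assume e: "\<forall>s u v. co k2 (cn k s u v) = v"
              have su: "s2 = v" using memK[of u v] F2(2) e by simp
              show ?thesis
              proof (rule edgecase[of "\<not> u" v])
                show "f (R (\<not> u) v) = c" using fK[of "\<not> u" v] memK[of "\<not> u" v] e su by simp
                fix p q assume "(p, q) \<noteq> (u, v)" "(p, q) \<noteq> (\<not> u, v)"
                then have "q \<noteq> v" by auto
                then show "c < f (R p q)" using fK[of p q] memK[of p q] e su by simp
              qed simp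
            qed
          next
            case T1
            have "c < f (R (\<not> u) v)" by (rule T1, rule incj) simp
            moreover have "c < f (R u (\<not> v))" by (rule T1, rule incj) simp
            ultimately show ?thesis using both by blast
          next
            case (pair Q)
            show ?thesis
            proof (cases "Q = R (\<not> u) v \<or> Q = R u (\<not> v)")
              case True
              then have "\<exists>u' v'. Q = R u' v' \<and> (u = u') \<noteq> (v = v')"
              proof
                assume "Q = R (\<not> u) v"
                then show ?thesis by (intro exI[of _ "\<not> u"] exI[of _ v]) simp
              next
                assume "Q = R u (\<not> v)"
                then show ?thesis by (intro exI[of _ u] exI[of _ "\<not> v"]) simp
              qed
              then obtain u' v' where q: "Q = R u' v'" "(u = u') \<noteq> (v = v')" by blast
              show ?thesis
              proof (rule edgecase[OF q(2)])
                show "f (R u' v') = c" using pair(2) q(1) by simp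
                fix p q' assume n: "(p, q') \<noteq> (u, v)" "(p, q') \<noteq> (u', v')"
                then have "(u = p) \<noteq> (v = q') \<or> (u' = p) \<noteq> (v' = q')" using q(2) by auto
                then have "incident (C j) (R u v) (R p q') \<or> incident (C j) Q (R p q')" unfolding q(1) using incj by metis
                moreover have "R p q' \<noteq> R u v" "R p q' \<noteq> Q" using n unfolding q(1) Req prod.inject by blast+
                ultimately show "c < f (R p q')" by (rule pair(4))
              qed
            next
              case False
              have "c < f (R (\<not> u) v)" by (rule pair(4)) (use incj[of u "\<not> u" v v] False Req in auto)
              moreover have "c < f (R u (\<not> v))" by (rule pair(4)) (use incj[of u u v "\<not> v"] False Req in auto)
              ultimately show ?thesis using both by blast
            qed
          qed
        qed
      qed
    next
      case (disp u v)
      note al = aL_vals[OF disp(1), of u v]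
      have tA: "c < t (R u v)" "c < t (R (\<not> u) (\<not> v))" "\<not> c < t (R (\<not> u) v)" "\<not> c < t (R u (\<not> v))"
        using disp(3) al unfolding ddR by simp_all
      have t0: "t (R (\<not> u) v) = c" "t (R u (\<not> v)) = c"
        using notnt[of "\<not> u" v] notnt[of u "\<not> v"] tA by auto
      have zA: "zz t (cn k s (\<not> u) v)" "zz t (cn k s u (\<not> v))" using t0 unfolding zzR by simp_all
      have f0: "f (R (\<not> u) v) = c" "f (R u (\<not> v)) = c" using ti[of "R (\<not> u) v"] ti[of "R u (\<not> v)"] t0 c01 by auto
      have nrm: "\<not> removed i (R u v)" "\<not> removed i (R (\<not> u) (\<not> v))"
        using ri[of u v "\<not> u" v] ri[of "\<not> u" "\<not> v" "\<not> u" v] t0 by auto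
      have fA: "f (R u v) = t (R u v)" "f (R (\<not> u) (\<not> v)) = t (R (\<not> u) (\<not> v))"
        using nrm not_removed_label[OF i] unfolding t_def by metis+
      have fA': "c < f (R u v)" "c < f (R (\<not> u) (\<not> v))" using fA tA by simp_all
      have tjA: "c < tj (R u v)" "c < tj (R (\<not> u) (\<not> v))" using fA' label_disperse[OF j(1)] unfolding tj_def by blast+
      have le: "l = {R (\<not> u) v, R u (\<not> v)}" unfolding z(4) disp(6) ip_zz[OF zA(1)] ip_zz[OF zA(2)] R_def ..
      note xd = exist_disp[OF mx disp(1,2,3)]
      have "res (dd t) \<sigma> = res (dd t) (cn k s u v)"
        by (rule res_meet[OF mx z(1) xd(1), of "cn k s u v"]) (use disp(2,4) xd(2) in simp_all)
      then have wA: "w = pp t (res (dd t) (cn k s u v))" using z(2) by simp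
      note tc = trivial_corresponds[OF reg disp(1,2,3) zA]
      have c1: "corresponds c \<G> (G i) (C i, w) l (R u v)" using tc(3) unfolding wA le Gi ab2(2) R_def .
      show ?thesis
      proof (cases "tj (R (\<not> u) v) = c \<and> tj (R u (\<not> v)) = c")
        case True
        have Lj: "aL (B.dd tj) (cn k (\<not> s))"
        proof -
          have "c < tj (R p q) \<longleftrightarrow> (p = u) = (q = v)" for p q
            using True tjA by (cases "p = u"; cases "q = v") auto
          then show ?thesis unfolding aL_def ddj by auto
        qed
        have zj: "B.zz tj (cn k (\<not> s) (\<not> u) v)" "B.zz tj (cn k (\<not> s) u (\<not> v))" using True unfolding zzj by simp_all
        have dj: "B.dd tj (cn k (\<not> s) u v)" using tjA(1) unfolding ddj .
        have rgj: "regular_graph c \<G> (G j)" by (rule regj[of "\<not> u" v u v]) (use True tjA in simp_all)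
        have rgj': "regular_graph c \<G> (B.Gr tj)" using rgj unfolding Gj .
        note nct = B.trivial_not_ctype[OF rgj' Lj zj]
        note tcj = B.trivial_corresponds[OF rgj' Lj nct dj zj]
        define w' where "w' = B.pp tj (res (B.dd tj) (cn k (\<not> s) u v))"
        have c2: "corresponds c \<G> (G j) (C j, w') l (R u v)" using tcj(3) unfolding w'_def[symmetric] le Gj F(2) R_def F5 .
        have w'': "inner_iso_path c \<G> (G j) w'" using tcj(1) unfolding w'_def[symmetric] Gj .
        have lw': "l \<in> w'" using tcj(2) unfolding w'_def[symmetric] le R_def F5 .
        show ?thesis by (rule continued_by_node[OF i j(1) sysj w(1) w'' w(2) lw' nej c1 c2 disjI1[OF refl]])
      next
        case False
        \<comment> \<open>One of the two iso-nodes is removed in \<open>j\<close>, hence disperse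
          there, and it is incident to both disperse corners of \<open>M\<close>. Through it they
          are joined by a disperse path, which connects the paths that \<open>G i\<close> itself has
          at these corners.\<close>
        then obtain p q where pq: "(p, q) = (\<not> u, v) \<or> (p, q) = (u, \<not> v)" "tj (R p q) \<noteq> c" by blast
        have fp: "f (R p q) = c" using pq(1) f0 by auto
        have rem: "removed j (R p q)" by (rule remj[OF fp pq(2)])
        have tjp: "c < tj (R p q)" using tjc[of "R p q"] fp pq(2) c01 by auto
        have D': "dd t (cn k s (\<not> u) (\<not> v))" using tA(2) unfolding ddR .
        have zA': "zz t (cn k s (\<not> \<not> u) (\<not> v))" "zz t (cn k s (\<not> u) (\<not> \<not> v))" using zA by simp_all
        note tcB = trivial_corresponds[OF reg disp(1,2) D' zA']
        define w' where "w' = pp t (res (dd t) (cn k s (\<not> u) (\<not> v)))"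
        have le': "l = {V a b (cn k s (\<not> \<not> u) (\<not> v)), V a b (cn k s (\<not> u) (\<not> \<not> v))}" unfolding le R_def by auto
        have c2: "corresponds c \<G> (G i) (C i, w') l (R (\<not> u) (\<not> v))" using tcB(3) unfolding w'_def[symmetric] le'[symmetric] Gi ab2(2) R_def .
        have w'': "inner_iso_path c \<G> (G i) w'" using tcB(1) unfolding w'_def[symmetric] Gi .
        have lw': "l \<in> w'" using tcB(2) unfolding w'_def[symmetric] le'[symmetric] .
        have f1: "\<not> F1_graph c (Gr t)" using reg unfolding regular_graph_def isolated_free_def by blast
        note xB = exist_disp[OF mx disp(1,2) D']
        have "res (dd t) (cn k s u v) \<noteq> res (dd t) (cn k s (\<not> u) (\<not> v))" using xd(3) xB(2) by auto
        then have "w \<noteq> w'" unfolding wA w'_def by (rule paths_distinct[OF mx xd(1) xB(1) sf f1 disp(2)])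
        then have ne: "(C i, w') \<noteq> (C i, w)" by auto
        have dj: "disperse c (G j) (R x y)" if "c < tj (R x y)" for x y
          using that Rn(2)[of x y] j(1) unfolding disperse_def tj_def by simp
        have cj: "cuboid (G j) = C j" using j(1) by simp
        have "disperse_path c (graph_system \<G> (G i)) (R u v) (R (\<not> u) (\<not> v))"
        proof (rule disperse_path3[of _ "R p q" _ "G j" _ _ "G j"])
          show "distinct [R u v, R p q, R (\<not> u) (\<not> v)]" using pq(1) by (auto simp: Req)
          show "incident (cuboid (G j)) (R u v) (R p q)" unfolding cj by (rule incj) (use pq(1) in auto)
          show "incident (cuboid (G j)) (R p q) (R (\<not> u) (\<not> v))" unfolding cj by (rule incj) (use pq(1) in auto)
        qed (rule sysj, rule dj[OF tjA(1)], rule dj[OF tjp], rule sysj, rule dj[OF tjp], rule dj[OF tjA(2)])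
        from continued_by_node[OF i i graph_system_self[OF i] w(1) w'' w(2) lw' ne c1 c2 disjI2[OF this]] show ?thesis .
      qed
    next
      \<comment> \<open>A line around a continuous corner needs a label below c there, which would
        make the L-face non-trivial.\<close>
      case (cont u v)
      note al = aL_vals[OF cont(1), of u v]
      have "t (R u v) < c" using cont(3,5) unfolding ddR zzR by simp
      then show ?thesis using notnt[of u v] al cont(3) unfolding ddR by auto
    qed
  qed
qed

lemma outer_linked:
  assumes h: "h \<in> I" and o: "outer_iso_path c \<G> (G h) M w"
  shows "\<exists>j. linked h j M \<and> w = Lset c \<G> (G h) M \<union> Lset c \<G> (G j) M \<and> Lset c \<G> (G h) M \<noteq> Lset c \<G> (G j) M"
proof -
  obtain G' where G': "G' \<in> \<G>" "face_neighbors (G h) G'" "M = cuboid (G h) \<inter> cuboid G'"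
      "polygon_points w = (\<Union>J\<in>{J. inner_iso_path c \<G> (G h) J \<or> inner_iso_path c \<G> G' J}. polygon_points J) \<inter> M"
    and s: "regular_graph c \<G> (G h)" "nontrivial_L_face c (G h) M" "simple_closed_polygon w" "\<Union>w \<subseteq> iso_points c (G h)"
    using o unfolding outer_iso_path_def by blast
  obtain j where j: "j \<in> I" "G' = G j" using G'(1) GG by blast
  have M: "C h \<inter> C j = M" "M facet_of C h" "M facet_of C j" using G'(2,3) h j by (auto simp: face_neighbors_def)
  have "j \<noteq> h" using M by auto
  then have L: "linked h j M" by (rule nontrivial_linked[OF h j(1) _ M s(1,2)])
  have "w = Lset c \<G> (G h) M \<union> Lset c \<G> (G j) M \<and> Lset c \<G> (G h) M \<noteq> Lset c \<G> (G j) M"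
    by (rule linkedD(10)[OF L, unfolded carrier_def, THEN conjunct2, THEN conjunct2, rule_format, OF s(3,4) G'(4)[unfolded j(2)]])
  then show ?thesis using L by blast
qed

lemma iso_path_continued:
  assumes h: "h \<in> I" and p: "iso_path_of c \<G> (G h) p"
  shows "3 \<le> card (snd p) \<and> card (snd p) \<le> 6 \<and> (\<forall>l\<in>snd p. continued p l)"
proof -
  consider "inner_path_of c \<G> (G h) p" | "outer_iso_path c \<G> (G h) (fst p) (snd p)" using p unfolding iso_path_of_def by blast
  then show ?thesis
  proof cases
    case 1
    then have w: "inner_iso_path c \<G> (G h) (snd p)" "p = (C h, snd p)" using h unfolding inner_path_of_def by (auto simp: prod_eq_iff)
    obtain a b where ab2: "cubc a b c" "G h = cubc.Gr a b (lb h)" using box[OF h] by blast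
    interpret cubc a b c by fact
    define t where "t = lb h"
    have Gh: "G h = Gr t" unfolding t_def by (fact ab2(2))
    have "3 \<le> card (snd p) \<and> card (snd p) \<le> 6"
      using inner_card[of \<G> t "snd p"] inner_regular[OF w(1)] w(1) unfolding Gh by blast
    moreover have "continued p l" if "l \<in> snd p" for l using inner_continued[OF h w(1) that] w(2) by simp
    ultimately show ?thesis by blast
  next
    case 2
    obtain j where L: "linked h j (fst p)" and s: "snd p = Lset c \<G> (G h) (fst p) \<union> Lset c \<G> (G j) (fst p)"
      and ne: "Lset c \<G> (G h) (fst p) \<noteq> Lset c \<G> (G j) (fst p)" using outer_linked[OF h 2] by blast
    have "continued p l" if l: "l \<in> snd p" for l by (rule linked_continued[OF L l[unfolded s] h p l])
    then show ?thesis using linked_mismatch(2,3)[OF L ne] unfolding s[symmetric] by blast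
  qed
qed

end

section \<open>Components as equivalence classes\<close>

definition neighbor_step :: "real \<Rightarrow> lcg set \<Rightarrow> point set \<Rightarrow> point set \<Rightarrow> bool" where
  "neighbor_step c \<G> Z Z' \<longleftrightarrow> Z \<in> iso_elements c \<G> \<and> Z' \<in> iso_elements c \<G> \<and> neighbored c \<G> Z Z'"

lemma neighbor_step_sym: "neighbor_step c \<G> Z Z' \<Longrightarrow> neighbor_step c \<G> Z' Z"
  unfolding neighbor_step_def neighbored_def by (simp add: insert_commute) metis

lemma disperse_connected_iff: "disperse_connected c \<G> Z Z' \<longleftrightarrow> (neighbor_step c \<G>)\<^sup>+\<^sup>+ Z Z'"
proof
  assume "disperse_connected c \<G> Z Z'"
  then obtain r :: nat and Y :: "nat \<Rightarrow> point set" where Y: "1 \<le> r" "Y 0 = Z" "Y r = Z'" "\<forall>i\<le>r. Y i \<in> iso_elements c \<G>" "\<forall>i\<in>{1..r}. neighbored c \<G> (Y (i - 1)) (Y i)"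
    unfolding disperse_connected_def by (elim exE conjE)
  have st: "neighbor_step c \<G> (Y m) (Y (Suc m))" if "Suc m \<le> r" for m
    unfolding neighbor_step_def using Y(4) that bspec[OF Y(5), of "Suc m"] by simp
  have "(neighbor_step c \<G>)\<^sup>+\<^sup>+ (Y 0) (Y (Suc m))" if "Suc m \<le> r" for m
    using that
  proof (induction m)
    case 0 then show ?case using st[of 0] by (simp add: tranclp.r_into_trancl)
  next
    case (Suc m)
    have "(neighbor_step c \<G>)\<^sup>+\<^sup>+ (Y 0) (Y (Suc m))" by (rule Suc.IH) (use Suc.prems in simp)
    then show ?case by (rule tranclp.trancl_into_trancl) (rule st[OF Suc.prems])
  qed
  from this[of "r - 1"] show "(neighbor_step c \<G>)\<^sup>+\<^sup>+ Z Z'" using Y(1-3) by simp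
next
  assume "(neighbor_step c \<G>)\<^sup>+\<^sup>+ Z Z'"
  then show "disperse_connected c \<G> Z Z'"
  proof (induction rule: tranclp_induct)
    case (base y)
    then have b: "Z \<in> iso_elements c \<G>" "y \<in> iso_elements c \<G>" "neighbored c \<G> Z y" unfolding neighbor_step_def by blast+
    show ?case unfolding disperse_connected_def
      by (rule exI[of _ "1::nat"], intro conjI, simp, rule exI[of _ "\<lambda>n::nat. if n = 0 then Z else y"]) (use b in auto)
  next
    case (step y z)
    obtain r :: nat and Y :: "nat \<Rightarrow> point set" where Y: "1 \<le> r" "Y 0 = Z" "Y r = y" "\<forall>i\<le>r. Y i \<in> iso_elements c \<G>" "\<forall>i\<in>{1..r}. neighbored c \<G> (Y (i - 1)) (Y i)"
      using step.IH unfolding disperse_connected_def by (elim exE conjE)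
    have n: "z \<in> iso_elements c \<G>" "neighbored c \<G> y z" using step.hyps(2) unfolding neighbor_step_def by blast+
    define Y' where "Y' = Y(Suc r := z)"
    have 1: "Y' 0 = Z" "Y' (Suc r) = z" unfolding Y'_def using Y(2) by simp_all
    have 2: "\<forall>i\<le>Suc r. Y' i \<in> iso_elements c \<G>" unfolding Y'_def using Y(4) n(1) by (auto simp: le_Suc_eq)
    have 3: "neighbored c \<G> (Y' (i - 1)) (Y' i)" if i: "i \<in> {1..Suc r}" for i
    proof (cases "i = Suc r")
      case True then show ?thesis unfolding Y'_def using Y(3) n(2) by simp
    next
      case False
      then have "i \<in> {1..r}" "i - 1 \<noteq> Suc r" using i by auto
      then show ?thesis unfolding Y'_def using Y(5) False by simp
    qed
    have s: "1 \<le> Suc r" by simp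
    show ?case unfolding disperse_connected_def
      by (rule exI[of _ "Suc r"], intro conjI, fact s, rule exI[of _ Y'], intro conjI ballI, fact 1(1), fact 1(2), fact 2, rule 3)
  qed
qed

text \<open>Inserting \<open>Z\<close> turns the transitive closure, given by chains with at least
  one step, into the reflexive one; symmetry of the steps then makes components equivalence
  classes.\<close>

lemma component_eq:
  assumes "Z \<in> iso_elements c \<G>"
  shows "component c \<G> Z = {Z'. (neighbor_step c \<G>)\<^sup>*\<^sup>* Z Z'}"
proof -
  have t: "Z' \<in> iso_elements c \<G>" if "(neighbor_step c \<G>)\<^sup>+\<^sup>+ Z Z'" for Z'
    using that by (induction rule: tranclp_induct) (simp_all add: neighbor_step_def)
  show ?thesis unfolding component_def disperse_connected_iff
  proof (intro equalityI subsetI)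
    fix x assume "x \<in> insert Z {Z' \<in> iso_elements c \<G>. (neighbor_step c \<G>)\<^sup>+\<^sup>+ Z Z'}"
    then show "x \<in> {Z'. (neighbor_step c \<G>)\<^sup>*\<^sup>* Z Z'}" using tranclp_into_rtranclp by fastforce
  next
    fix x assume "x \<in> {Z'. (neighbor_step c \<G>)\<^sup>*\<^sup>* Z Z'}"
    then have "x = Z \<or> (neighbor_step c \<G>)\<^sup>+\<^sup>+ Z x" using rtranclpD by (metis mem_Collect_eq)
    then show "x \<in> insert Z {Z' \<in> iso_elements c \<G>. (neighbor_step c \<G>)\<^sup>+\<^sup>+ Z Z'}" using t by blast
  qed
qed

lemma neighbor_closure_sym: "(neighbor_step c \<G>)\<^sup>*\<^sup>* Z Z' \<Longrightarrow> (neighbor_step c \<G>)\<^sup>*\<^sup>* Z' Z"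
  by (induction rule: rtranclp_induct) (auto intro: neighbor_step_sym converse_rtranclp_into_rtranclp)

lemma component_class:
  assumes "Z \<in> iso_elements c \<G>" "Z' \<in> iso_elements c \<G>" "Z' \<in> component c \<G> Z"
  shows "component c \<G> Z' = component c \<G> Z"
proof -
  have "(neighbor_step c \<G>)\<^sup>*\<^sup>* Z Z'" using assms(3) unfolding component_eq[OF assms(1)] by simp
  then have e: "(neighbor_step c \<G>)\<^sup>*\<^sup>* Z' x \<longleftrightarrow> (neighbor_step c \<G>)\<^sup>*\<^sup>* Z x" for x
    using neighbor_closure_sym rtranclp_trans by metis
  show ?thesis unfolding component_eq[OF assms(1)] component_eq[OF assms(2)] by (rule Collect_cong) (rule e)
qed

lemma component_subset: "Z \<in> iso_elements c \<G> \<Longrightarrow> component c \<G> Z \<subseteq> iso_elements c \<G>"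
  by (auto simp: component_def)

context labeling begin

lemma component_connected:
  assumes Z: "Z \<in> iso_elements c \<G>"
  shows "iso_surface_connected c \<G> \<Omega> (component c \<G> Z)"
  unfolding iso_surface_connected_def
proof (intro ballI allI impI)
  fix H p assume H: "H \<in> \<G>" and p0: "iso_path_of c \<G> H p \<and> iso_element p \<in> component c \<G> Z \<and> \<not> (\<exists>l\<in>snd p. convex hull l \<subseteq> frontier \<Omega>)"
  obtain h where h: "h \<in> I" "H = G h" using H GG by blast
  have p: "iso_path_of c \<G> (G h) p" "iso_element p \<in> component c \<G> Z" using p0 h by simp_all
  note cont = iso_path_continued[OF h(1) p(1)]
  have "\<exists>G\<in>\<G>. \<exists>q. iso_path_of c \<G> G q \<and> iso_element q \<in> component c \<G> Z \<and> q \<noteq> p \<and> convex hull l \<subseteq> polygon_points (snd q)"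
    if l: "l \<in> snd p" for l
  proof -
    have "continued p l" using cont l by blast
    then obtain q g g' where q: "q \<noteq> p" "l \<in> snd q" "g \<in> I" "iso_path_of c \<G> (G g) q" "g' \<in> I"
      "disperse_connected_paths c \<G> (G g') p q l \<or> disperse_connected_paths c \<G> (G g') q p l" unfolding continued_def by blast
    have el: "iso_element p \<in> iso_elements c \<G>" "iso_element q \<in> iso_elements c \<G>"
      unfolding iso_elements_def using p(1) q(3,4) h(1) GG by blast+
    have "iso_element q \<in> component c \<G> Z"
    \<comment> \<open>Different iso-paths may span the same point set, for instance the same
      triangle in the common face of two cuboids. Neighbored elements are distinct by definition,
      but in this case the element of \<open>q\<close> lies in the component anyway.\<close>
    proof (cases "iso_element p = iso_element q")
      case True then show ?thesis using p(2) by simp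
    next
      case False
      have gG: "G g' \<in> \<G>" using q(5) GG by blast
      have "neighbored c \<G> (iso_element p) (iso_element q)"
        using q(6)
      proof
        assume d: "disperse_connected_paths c \<G> (G g') p q l"
        show ?thesis unfolding neighbored_def
          by (rule conjI[OF False], rule bexI[OF _ gG], rule exI[of _ p], rule exI[of _ q], rule exI[of _ l]) (use d in simp)
      next
        assume d: "disperse_connected_paths c \<G> (G g') q p l"
        show ?thesis unfolding neighbored_def
          by (rule conjI[OF False], rule bexI[OF _ gG], rule exI[of _ q], rule exI[of _ p], rule exI[of _ l]) (use d in \<open>simp add: insert_commute\<close>)
      qed
      then have "neighbor_step c \<G> (iso_element p) (iso_element q)" unfolding neighbor_step_def using el by blast
      then show ?thesis using p(2) unfolding component_eq[OF Z] by (simp add: rtranclp.rtrancl_into_rtrancl)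
    qed
    moreover have "convex hull l \<subseteq> polygon_points (snd q)" unfolding polygon_points_def using q(2) by blast
    ultimately show ?thesis using q(1,3,4) GG by blast
  qed
  then show "iso_path_connected c \<G> (component c \<G> Z) p" unfolding iso_path_connected_def using cont by blast
qed

end

theorem theorem7p7:
  fixes \<Omega> :: "(real ^ 3) set" and N :: nat and C :: "nat \<Rightarrow> (real ^ 3) set"
    and c :: real and f :: "real ^ 3 \<Rightarrow> real" and G :: "nat \<Rightarrow> lcg" and \<G> :: "lcg set"
  assumes "polygonal_domain \<Omega>" and "cuboid_partition \<Omega> N C"
    and "0 < c" and "c < 1"
    and "\<And>i P. i \<in> {1..N} \<Longrightarrow> P \<in> nodes (C i) \<Longrightarrow> f P \<in> {0..1}"
    and "\<And>i. i \<in> {1..N} \<Longrightarrow>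
           removal_step c ((\<lambda>j. \<lparr>cuboid = C j, label = f\<rparr>) ` {1..N}) \<lparr>cuboid = C i, label = f\<rparr> (G i)"
    and "\<G> = G ` {1..N}"
    and "\<And>i. i \<in> {1..N} \<Longrightarrow> singular_free c (G i) \<and> isolated_free c \<G> (G i)"
    and "\<Union>(iso_elements c \<G>) \<inter> frontier \<Omega> = {}"
  shows "(\<forall>Z\<in>iso_elements c \<G>. iso_surface_connected c \<G> \<Omega> (component c \<G> Z)) \<and>
    (\<forall>Z1\<in>iso_elements c \<G>. \<forall>Z2\<in>iso_elements c \<G>. Z1 \<noteq> Z2 \<longrightarrow>
       component c \<G> Z1 = component c \<G> Z2 \<or> component c \<G> Z1 \<inter> component c \<G> Z2 = {}) \<and>
    (\<forall>Z\<in>iso_elements c \<G>. \<exists>!K. K \<in> component c \<G> ` iso_elements c \<G> \<and> Z \<in> K)"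
proof -
  have opn: "open \<Omega>" using assms(1) unfolding polygonal_domain_def by blast
  have L: "labeling \<Omega> N C c f G \<G>"
    by unfold_locales (fact opn assms | erule assms | rule assms)+
  have self: "Z \<in> component c \<G> Z" for Z unfolding component_def by simp
  have cl: "component c \<G> Z = component c \<G> Z'" if "Z \<in> iso_elements c \<G>" "Z' \<in> iso_elements c \<G>" "X \<in> component c \<G> Z" "X \<in> component c \<G> Z'" for Z Z' X
  proof -
    have X: "X \<in> iso_elements c \<G>" using component_subset[OF that(1)] that(3) by blast
    show ?thesis using component_class[OF that(1) X that(3)] component_class[OF that(2) X that(4)] by simp
  qed
  show ?thesis
  proof (intro conjI ballI impI)
    fix Z assume Z: "Z \<in> iso_elements c \<G>"
    show "iso_surface_connected c \<G> \<Omega> (component c \<G> Z)" by (rule labeling.component_connected[OF L Z])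
    show "\<exists>!K. K \<in> component c \<G> ` iso_elements c \<G> \<and> Z \<in> K"
    proof (rule ex1I[of _ "component c \<G> Z"])
      show "component c \<G> Z \<in> component c \<G> ` iso_elements c \<G> \<and> Z \<in> component c \<G> Z" using Z self by blast
      fix K assume "K \<in> component c \<G> ` iso_elements c \<G> \<and> Z \<in> K"
      then obtain Z' where "Z' \<in> iso_elements c \<G>" "K = component c \<G> Z'" "Z \<in> component c \<G> Z'" by blast
      then show "K = component c \<G> Z" using cl[OF _ Z _ self] by blast
    qed
  next
    fix Z1 Z2 assume Z: "Z1 \<in> iso_elements c \<G>" "Z2 \<in> iso_elements c \<G>"
    show "component c \<G> Z1 = component c \<G> Z2 \<or> component c \<G> Z1 \<inter> component c \<G> Z2 = {}"
      using cl[OF Z] by blast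
  qed
qed

end
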